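(* Let $T\in(0,\infty)$, $\theta,\sigma,\mu\in\mathbf{R}$ with $\mu\ne0$, and let $V_1,V_2$ be the independent noise processes with parameters $(p_1,q_1)$, $(p_2,q_2)$ defined in the context, with associated processes $\alpha_1,\alpha_2$. Let $X_0$ be a centered Gaussian random variable independent of $(V_1,V_2)$, and let $(X(t),Y(t))_{0\le t\le T}$ satisfy $$dX(t)=\theta X(t)\,dt+\sigma\,dV_1(t),\quad X(0)=X_0,\qquad dY(t)=\mu X(t)\,dt+dV_2(t),\quad Y(0)=0.$$ Put $Z(t)=(X(t),\alpha_1(t),\alpha_2(t))^{*}$, $\widehat Z(t)=\mathbb{E}[Z(t)\,|\,\mathcal{F}^Y(t)]$, and $P(t)=\mathbb{E}[Z(t)(Z(t)-\widehat Z(t))^{*}]\in\mathbf{R}^{3\times3}$ for $0\le t\le T$. With $r_j=p_j+q_j$ and $$l_j(t)=p_j\left\{1-\frac{2p_jq_j}{(2q_j+p_j)^2e^{2q_jt}-p_j^2}\right\}\qquad(j=1,2),$$ let $$F=\begin{pmatrix}-\theta&\sigma&0\\0&r_1&0\\0&0&r_2\end{pmatrix},\quad D(t)=\begin{pmatrix}0&0&0\\0&0&0\\ \mu^{-1}l_2(t)&0&0\end{pmatrix},\quad a=\begin{pmatrix}\mu\\0\\-1\end{pmatrix},$$ $$G(t)=\begin{pmatrix}\sigma^2&\sigma l_1(t)&0\\ \sigma l_1(t)&l_1(t)^2&0\\0&0&0\end{pmatrix},\quad H(t)=\begin{pmatrix}-\theta&\sigma&0\\0&r_1&0\\ \mu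 l_2(t)&0&r_2-l_2(t)\end{pmatrix}.$$ Then the filter $\widehat Z$ satisfies the stochastic differential equation $$d\widehat Z(t)=-\{F+(P(t)+D(t))aa^{*}\}\widehat Z(t)\,dt+(P(t)+D(t))a\,dY(t)\qquad(0\le t\le T)$$ with $\widehat Z(0)=(\mathbb{E}[X_0],0,0)^{*}$, and $P$ follows the matrix Riccati equation $$\frac{dP(t)}{dt}=G(t)-H(t)P(t)-P(t)H(t)^{*}-P(t)aa^{*}P(t)\qquad(0\le t\le T)$$ with $P_{ij}(0)=\delta_{i1}\delta_{j1}\mathbb{E}[(X_0)^2]$ for $i,j=1,2,3$.
   Context: $*$ denotes transposition and $\delta_{ij}$ is the Kronecker delta. For $j=1,2$ let $p_j,q_j$ be real constants with $0<q_j<\infty$, $-q_j<p_j<\infty$, let $W_1,W_2$ be independent one-dimensional two-sided Brownian motions on $\mathbf{R}$ with $W_j(0)=0$, and set $$V_j(t)=W_j(t)-\int_0^t\left(\int_{-\infty}^s p_je^{-(q_j+p_j)(s-u)}\,dW_j(u)\right)ds .$$ For a process $(A(t))_{0\le t\le T}$, $\mathcal{F}^A(t)$ denotes the $\mathbb{P}$-augmentation (by null sets) of $\sigma(A(s):0\le s\le t)$. For $j=1,2$, $(B_j(t))_{0\le t\le T}$ denotes the innovation process of $V_j$: the one-dimensional Brownian motion with $\mathcal{F}^{B_j}(t)=\mathcal{F}^{V_j}(t)$ for $0\le t\le T$ and $$V_j(t)=B_j(t)-\int_0^t\alpha_j(s)\,ds,\qquad \alpha_j(t)=\int_0^t l_j(t,s)\,dB_j(s)\qquad(0\le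 t\le T),$$ $$l_j(t,s)=p_je^{-(p_j+q_j)(t-s)}\left\{1-\frac{2p_jq_j}{(2q_j+p_j)^2e^{2q_js}-p_j^2}\right\}=e^{-(p_j+q_j)(t-s)}l_j(s)\qquad(0\le s\le t\le T).$$ $B_1$ and $B_2$ are independent. *)

theory Defs
  imports "HOL-Probability.Probability"
begin

text \<open>
  A process is a function of type \<open>real \<Rightarrow> 'w \<Rightarrow> real\<close> (time first). Sample-path properties are
  required almost surely, and no completeness of the probability space is assumed.
\<close>

text \<open>With \<open>I = UNIV\<close> this is a two-sided Brownian motion vanishing at time 0, with \<open>I = {0..T}\<close> a
  Brownian motion on \<open>[0,T]\<close>.\<close>

definition brownian_motion_on :: "'w measure \<Rightarrow> real set \<Rightarrow> (real \<Rightarrow> 'w \<Rightarrow> real) \<Rightarrow> bool" where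
  "brownian_motion_on M I W \<longleftrightarrow>
     (\<forall>t\<in>I. W t \<in> borel_measurable M) \<and>
     (AE \<omega> in M. W 0 \<omega> = 0) \<and>
     (AE \<omega> in M. continuous_on I (\<lambda>t. W t \<omega>)) \<and>
     (\<forall>s\<in>I. \<forall>t\<in>I. s < t \<longrightarrow>
        distributed M lborel (\<lambda>\<omega>. W t \<omega> - W s \<omega>) (normal_density 0 (sqrt (t - s)))) \<and>
     (\<forall>(n::nat) \<tau>. (\<forall>k\<le>n. \<tau> k \<in> I) \<and> (\<forall>k<n. \<tau> k < \<tau> (Suc k)) \<longrightarrow>
        prob_space.indep_vars M (\<lambda>_. borel) (\<lambda>k \<omega>. W (\<tau> (Suc k)) \<omega> - W (\<tau> k) \<omega>) {..<n})"

text \<open>The degenerate case of variance 0 is included.\<close>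

definition centered_gaussian :: "'w measure \<Rightarrow> ('w \<Rightarrow> real) \<Rightarrow> bool" where
  "centered_gaussian M \<xi> \<longleftrightarrow> \<xi> \<in> borel_measurable M \<and>
     ((AE \<omega> in M. \<xi> \<omega> = 0) \<or> (\<exists>s>0. distributed M lborel \<xi> (normal_density 0 s)))"

text \<open>The triple \<open>(c, a, b)\<close> stands for \<open>c\<close> times the indicator of \<open>(a,b]\<close>.\<close>

definition step_fun :: "(real \<times> real \<times> real) list \<Rightarrow> real \<Rightarrow> real" where
  "step_fun xs u = (\<Sum>(c, a, b)\<leftarrow>xs. c * indicator {a<..b} u)"

definition step_integral ::
    "(real \<Rightarrow> 'w \<Rightarrow> real) \<Rightarrow> (real \<times> real \<times> real) list \<Rightarrow> 'w \<Rightarrow> real" where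
  "step_integral S xs \<omega> = (\<Sum>(c, a, b)\<leftarrow>xs. c * (S b \<omega> - S a \<omega>))"

text \<open>
  \<open>has_wiener_integral M S A f I\<close>: the random variable \<open>I\<close> is (a version of) the stochastic integral
  over \<open>A\<close> of the deterministic function \<open>f\<close> against \<open>S\<close>, obtained as usual as the mean-square
  limit of the integrals of step functions converging to \<open>f\<close> in \<open>L\<^sup>2(A)\<close>. It determines \<open>I\<close> almost
  surely when the elementary integral is continuous from \<open>L\<^sup>2(A)\<close> to \<open>L\<^sup>2(M)\<close>. That is the case
  if \<open>S\<close> is a Brownian motion (isometry), and also, for bounded \<open>A\<close>, if \<open>S\<close> is the sum of a
  Brownian motion and a drift \<open>\<integral> \<beta> ds\<close> whose density \<open>\<beta>\<close> is bounded in mean square on \<open>A\<close>; then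
  \<open>I\<close> is the Ito integral of \<open>f\<close> against the semimartingale \<open>S\<close>.
\<close>

definition has_wiener_integral ::
    "'w measure \<Rightarrow> (real \<Rightarrow> 'w \<Rightarrow> real) \<Rightarrow> real set \<Rightarrow> (real \<Rightarrow> real) \<Rightarrow> ('w \<Rightarrow> real) \<Rightarrow> bool" where
  "has_wiener_integral M S A f I \<longleftrightarrow>
     I \<in> borel_measurable M \<and> set_borel_measurable lborel A f \<and>
     (\<exists>\<xi>. (\<forall>n. \<forall>(c, a, b)\<in>set (\<xi> n). a < b \<and> {a<..b} \<subseteq> A) \<and>
          ((\<lambda>n. \<integral>\<^sup>+u\<in>A. ennreal ((step_fun (\<xi> n) u - f u)\<^sup>2) \<partial>lborel) \<longlonglongrightarrow> 0) \<and>
          ((\<lambda>n. \<integral>\<^sup>+\<omega>. ennreal ((step_integral S (\<xi> n) \<omega> - I \<omega>)\<^sup>2) \<partial>M) \<longlonglongrightarrow> 0))"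

text \<open>\<open>\<F>\<^sup>A(t)\<close>: the \<open>\<sigma>\<close>-algebra generated by \<open>A(s)\<close>, \<open>0 \<le> s \<le> t\<close>, and the null sets.\<close>

definition aug_filtration :: "'w measure \<Rightarrow> (real \<Rightarrow> 'w \<Rightarrow> real) \<Rightarrow> real \<Rightarrow> 'w measure" where
  "aug_filtration M A t =
     sigma (space M)
       ({A s -` E \<inter> space M | s E. s \<in> {0..t} \<and> E \<in> sets borel} \<union> null_sets M)"

text \<open>
  \<open>V(t) = W(t) - \<integral>\<^sub>0\<^sup>t U(s) ds\<close>, where \<open>U(s) = \<integral>\<^bsub>(-\<infinity>,s]\<^esub> p exp(-(q+p)(s-u)) dW(u)\<close>. The inner
  integral is only defined up to a null set for each \<open>s\<close>; \<open>U\<close> is its continuous version.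
\<close>

definition noise_process ::
    "'w measure \<Rightarrow> real \<Rightarrow> real \<Rightarrow> (real \<Rightarrow> 'w \<Rightarrow> real) \<Rightarrow> (real \<Rightarrow> 'w \<Rightarrow> real) \<Rightarrow> bool" where
  "noise_process M p q W V \<longleftrightarrow>
     (\<forall>t. V t \<in> borel_measurable M) \<and>
     (\<exists>U. (\<forall>s. has_wiener_integral M W {..s} (\<lambda>u. p * exp (- (q + p) * (s - u))) (U s)) \<and>
          (AE \<omega> in M. continuous_on UNIV (\<lambda>s. U s \<omega>)) \<and>
          (AE \<omega> in M. \<forall>t. V t \<omega> = W t \<omega> - (LBINT s=0..t. U s \<omega>)))"

definition lfun :: "real \<Rightarrow> real \<Rightarrow> real \<Rightarrow> real" where
  "lfun p q s = p * (1 - 2 * p * q / ((2 * q + p)\<^sup>2 * exp (2 * q * s) - p\<^sup>2))"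

definition lker :: "real \<Rightarrow> real \<Rightarrow> real \<Rightarrow> real \<Rightarrow> real" where
  "lker p q t s = exp (- (p + q) * (t - s)) * lfun p q s"

text \<open>
  \<open>B\<close> is the innovation process of \<open>V\<close> on \<open>[0,T]\<close>, and \<open>\<alpha>\<close> is the continuous version of
  \<open>\<integral>\<^sub>0\<^sup>t l(t,s) dB(s)\<close>.
\<close>

definition innovation_process ::
    "'w measure \<Rightarrow> real \<Rightarrow> real \<Rightarrow> real \<Rightarrow>
      (real \<Rightarrow> 'w \<Rightarrow> real) \<Rightarrow> (real \<Rightarrow> 'w \<Rightarrow> real) \<Rightarrow> (real \<Rightarrow> 'w \<Rightarrow> real) \<Rightarrow> bool" where
  "innovation_process M T p q V B \<alpha> \<longleftrightarrow>
     brownian_motion_on M {0..T} B \<and>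
     (\<forall>t\<in>{0..T}. sets (aug_filtration M B t) = sets (aug_filtration M V t)) \<and>
     (\<forall>t\<in>{0..T}. has_wiener_integral M B {0<..t} (lker p q t) (\<alpha> t)) \<and>
     (AE \<omega> in M. continuous_on {0..T} (\<lambda>t. \<alpha> t \<omega>)) \<and>
     (AE \<omega> in M. \<forall>t\<in>{0..T}. V t \<omega> = B t \<omega> - (LBINT s=0..t. \<alpha> s \<omega>))"

definition cond_exp_vec ::
    "'w measure \<Rightarrow> 'w measure \<Rightarrow> ('w \<Rightarrow> real ^ 'n) \<Rightarrow> 'w \<Rightarrow> real ^ 'n" where
  "cond_exp_vec M G Z \<omega> = (\<chi> i. real_cond_exp M G (\<lambda>\<omega>. Z \<omega> $ i) \<omega>)"

text \<open>\<open>E[Z(t) (Z(t) - Zh(t))\<^sup>*]\<close> with \<open>Zh(t) = E[Z(t) | \<F>\<^sup>Y(t)]\<close>\<close>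

definition error_matrix ::
    "'w measure \<Rightarrow> (real \<Rightarrow> 'w \<Rightarrow> real) \<Rightarrow> (real \<Rightarrow> 'w \<Rightarrow> real ^ 'n) \<Rightarrow> real \<Rightarrow> real ^ 'n ^ 'n" where
  "error_matrix M Y Z t =
     (\<chi> i j. \<integral>\<omega>. Z t \<omega> $ i * (Z t \<omega> $ j - cond_exp_vec M (aug_filtration M Y t) (Z t) \<omega> $ j) \<partial>M)"

text \<open>
  The conditional expectations \<open>E[Z(t) | \<F>\<^sup>Y(t)]\<close> are only determined almost surely for each \<open>t\<close>.
  The filter, as the process entering a stochastic differential equation, is an adapted
  continuous version of this family.
\<close>

definition filter_process ::
    "'w measure \<Rightarrow> real \<Rightarrow> (real \<Rightarrow> 'w \<Rightarrow> real) \<Rightarrow> (real \<Rightarrow> 'w \<Rightarrow> real ^ 'n) \<Rightarrow>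
      (real \<Rightarrow> 'w \<Rightarrow> real ^ 'n) \<Rightarrow> bool" where
  "filter_process M T Y Z Zh \<longleftrightarrow>
     (\<forall>t\<in>{0..T}. Zh t \<in> borel_measurable (aug_filtration M Y t) \<and>
        (AE \<omega> in M. Zh t \<omega> = cond_exp_vec M (aug_filtration M Y t) (Z t) \<omega>)) \<and>
     (AE \<omega> in M. continuous_on {0..T} (\<lambda>t. Zh t \<omega>))"

text \<open>
  \<open>d\<zeta>(t) = A(t) \<zeta>(t) dt + b(t) dY(t)\<close> on \<open>[0,T]\<close> in integrated form, with deterministic
  coefficients; \<open>J(t)\<close> is the stochastic integral \<open>\<integral>\<^sub>0\<^sup>t b(s) dY(s)\<close>.
\<close>

definition solves_linear_sde ::
    "'w measure \<Rightarrow> real \<Rightarrow> (real \<Rightarrow> real ^ 'n ^ 'n) \<Rightarrow> (real \<Rightarrow> real ^ 'n) \<Rightarrow>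
      (real \<Rightarrow> 'w \<Rightarrow> real) \<Rightarrow> (real \<Rightarrow> 'w \<Rightarrow> real ^ 'n) \<Rightarrow> bool" where
  "solves_linear_sde M T A b Y \<zeta> \<longleftrightarrow>
     (AE \<omega> in M. continuous_on {0..T} (\<lambda>t. \<zeta> t \<omega>)) \<and>
     (\<exists>J. (\<forall>t\<in>{0..T}. \<forall>i. has_wiener_integral M Y {0<..t} (\<lambda>s. b s $ i) (\<lambda>\<omega>. J t \<omega> $ i)) \<and>
          (AE \<omega> in M. \<forall>t\<in>{0..T}.
             interval_lebesgue_integrable lborel 0 t (\<lambda>s. A s *v \<zeta> s \<omega>) \<and>
             \<zeta> t \<omega> = \<zeta> 0 \<omega> + (LBINT s=0..t. A s *v \<zeta> s \<omega>) + J t \<omega>))"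

end

theory Submission
  imports Defs
begin

text \<open>
  The pair \<open>(Z, Y)\<close> solves a linear system driven by the innovations \<open>B\<^sub>1\<close>, \<open>B\<^sub>2\<close>:
  \<open>dZ = - F Z dt + b\<^sub>1 dB\<^sub>1 + b\<^sub>2 dB\<^sub>2\<close> and \<open>dY = a\<cdot>Z dt + dB\<^sub>2\<close>, where \<open>b\<^sub>1 = (\<sigma>, l\<^sub>1, 0)\<close> and
  \<open>b\<^sub>2 = (0, 0, l\<^sub>2)\<close>. Let \<open>Q\<close> solve the Riccati equation and put \<open>k = Q a + b\<^sub>2\<close>. The process
  \<open>\<zeta>\<close> with \<open>d\<zeta> = - (F + k a\<^sup>*) \<zeta> dt + k dY\<close> is a pathwise functional of \<open>Y\<close>, because \<open>k\<close> is smooth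
  and the stochastic integral can be integrated by parts. The error \<open>e = Z - \<zeta>\<close> solves
  \<open>de = - (F + k a\<^sup>*) e dt + b\<^sub>1 dB\<^sub>1 + (b\<^sub>2 - k) dB\<^sub>2\<close>. Hence \<open>E[e Z\<^sup>*]\<close> and \<open>Q\<close> satisfy the same linear
  equation, so they agree; then \<open>E[e(t) Y(t)]\<close> satisfies a homogeneous linear equation, so it vanishes,
  and so does \<open>E[e(t) Y(s)]\<close> for \<open>s \<le> t\<close>. All variables are jointly Gaussian, so \<open>e(t)\<close> has
  conditional mean 0 given \<open>Y\<close> up to time \<open>t\<close>. Therefore \<open>\<zeta>\<close> is the filter and \<open>Q = E[Z e\<^sup>*]\<close> is
  the error matrix.
\<close>

section \<open>Linear differential equations and the Riccati equation\<close>

text \<open>Solving the Riccati equation first turns the problem into a verification: once Q is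
  fixed, the equations of all covariances involved are linear and have unique solutions, although
  the equation of Q itself is quadratic. The summand b_2 of the gain accounts for the correlation of
  signal and observation, which share the noise B_2. Since all coefficients are deterministic and
  smooth, every stochastic integral is replaced by its integration by parts, and Ito calculus
  shrinks to a product rule for second moments. Adaptedness is encoded as orthogonality to the later
  increments of B_1 and B_2, joint Gaussianity as membership in one closed linear span; both are
  closed linear conditions, hence survive limits and time integrals. Exceptional null sets are
  removed once, by setting the processes to 0 there, which is harmless because the zero path solves
  the linear equations.\<close>

lemma picard_exists:
  fixes f :: "real \<Rightarrow> 'a::euclidean_space \<Rightarrow> 'a"
  assumes T: "0 \<le> T" and L: "0 < L"
    and cont: "\<And>x. continuous_on {0..T} x \<Longrightarrow> continuous_on {0..T} (\<lambda>t. f t (x t))"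
    and lip: "\<And>t x y. t \<in> {0..T} \<Longrightarrow> norm (f t x - f t y) \<le> L * norm (x - y)"
  obtains x where "x 0 = x0"
    "\<And>t. t \<in> {0..T} \<Longrightarrow> (x has_vector_derivative f t (x t)) (at t within {0..T})"
proof -
  define X where "X n = ((\<lambda>y t. x0 + integral {0..t} (\<lambda>s. f s (y s))) ^^ n) (\<lambda>t. x0)" for n
  have X0: "X 0 = (\<lambda>t. x0)" and XS: "X (Suc n) = (\<lambda>t. x0 + integral {0..t} (\<lambda>s. f s (X n s)))" for n
    by (simp_all add: X_def)
  have Xc: "continuous_on {0..T} (X n)" for n
  proof (induction n)
    case 0 show ?case by (simp add: X0)
  next
    case (Suc n)
    show ?case unfolding XS
      by (intro continuous_intros indefinite_integral_continuous_1 integrable_continuous_real cont Suc)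
  qed
  have fi: "(\<lambda>s. f s (x s)) integrable_on {0..t}" if "t \<in> {0..T}" "continuous_on {0..T} x" for t x
    using that by (intro integrable_continuous_real continuous_on_subset[OF cont]) auto
  have "compact ((\<lambda>s. norm (f s x0)) ` {0..T})"
    by (intro compact_continuous_image continuous_intros cont) auto
  then have "bdd_above ((\<lambda>s. norm (f s x0)) ` {0..T})"
    by (intro bounded_imp_bdd_above compact_imp_bounded)
  then obtain C where C: "\<And>s. s \<in> {0..T} \<Longrightarrow> norm (f s x0) \<le> C"
    unfolding bdd_above_def by blast
  have C0: "0 \<le> C" using order_trans[OF norm_ge_zero C[of 0]] T by simp
  \<comment> \<open>The weight \<open>exp (2 * L * t)\<close> makes Picard iteration contract:
    integrating \<open>L * exp (2 * L * s)\<close> up to t gives at most half of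
    \<open>exp (2 * L * t)\<close>. Each step gains a factor 1/2 on the whole interval, however
    large L T may be.\<close>
  have bound: "norm (X (Suc n) t - X n t) \<le> T * C * exp (2 * L * t) * (1/2)^n" if "t \<in> {0..T}" for n t
    using that
  proof (induction n arbitrary: t)
    case 0
    have "norm (X (Suc 0) t - X 0 t) = norm (integral {0..t} (\<lambda>s. f s x0))"
      by (simp add: X0 XS)
    also have "\<dots> \<le> integral {0..t} (\<lambda>s. C)"
      using 0 by (intro integral_norm_bound_integral fi) (auto intro: C)
    also have "\<dots> = t * C" using 0 by simp
    also have "\<dots> \<le> T * C" using 0 C0 by (intro mult_right_mono) auto
    also have "\<dots> \<le> T * C * exp (2 * L * t)"
      using 0 L T C0 mult_left_mono[of 1 "exp (2 * L * t)" "T * C"] by simp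
    finally show ?case by simp
  next
    case (Suc n)
    have hi: "((\<lambda>s. L * (T * C * exp (2 * L * s) * (1/2)^n)) has_integral
        (T * C * exp (2 * L * t) * (1/2)^Suc n - T * C * exp (2 * L * 0) * (1/2)^Suc n)) {0..t}"
      using Suc.prems
      by (intro fundamental_theorem_of_calculus)
        (auto intro!: derivative_eq_intros simp flip: has_real_derivative_iff_has_vector_derivative)
    have "X (Suc (Suc n)) t - X (Suc n) t =
        integral {0..t} (\<lambda>s. f s (X (Suc n) s)) - integral {0..t} (\<lambda>s. f s (X n s))"
      by (simp add: XS[of "Suc n"] XS[of n])
    also have "\<dots> = integral {0..t} (\<lambda>s. f s (X (Suc n) s) - f s (X n s))"
      using Suc.prems Xc by (intro integral_diff[symmetric] fi)
    also have "norm \<dots> \<le> integral {0..t} (\<lambda>s. L * (T * C * exp (2 * L * s) * (1/2)^n))"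
    proof (rule integral_norm_bound_integral)
      show "(\<lambda>s. f s (X (Suc n) s) - f s (X n s)) integrable_on {0..t}"
        using Suc.prems Xc by (intro integrable_diff fi)
      show "(\<lambda>s. L * (T * C * exp (2 * L * s) * (1/2)^n)) integrable_on {0..t}"
        using hi by blast
      fix s assume "s \<in> {0..t}"
      then have s: "s \<in> {0..T}" using Suc.prems by auto
      have "norm (f s (X (Suc n) s) - f s (X n s)) \<le> L * norm (X (Suc n) s - X n s)"
        by (rule lip[OF s])
      also have "\<dots> \<le> L * (T * C * exp (2 * L * s) * (1/2)^n)"
        using L by (intro mult_left_mono Suc.IH s) auto
      finally show "norm (f s (X (Suc n) s) - f s (X n s)) \<le> L * (T * C * exp (2 * L * s) * (1/2)^n)" .
    qed
    also have "\<dots> = T * C * exp (2 * L * t) * (1/2)^Suc n - T * C * exp (2 * L * 0) * (1/2)^Suc n"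
      using hi by (rule integral_unique)
    also have "\<dots> \<le> T * C * exp (2 * L * t) * (1/2)^Suc n"
      using T C0 by simp
    finally show ?case .
  qed
  define x where "x t = x0 + (\<Sum>n. X (Suc n) t - X n t)" for t
  have "uniform_limit {0..T} (\<lambda>n t. \<Sum>i<n. X (Suc i) t - X i t) (\<lambda>t. \<Sum>n. X (Suc n) t - X n t) sequentially"
  proof (rule Weierstrass_m_test)
    fix n t assume t: "t \<in> {0..T}"
    have "T * C * exp (2 * L * t) * (1/2)^n \<le> T * C * exp (2 * L * T) * (1/2)^n"
      using t T C0 L by (intro mult_right_mono mult_left_mono) auto
    with bound[OF t, of n] show "norm (X (Suc n) t - X n t) \<le> T * C * exp (2 * L * T) * (1/2)^n"
      by linarith
  qed (auto intro!: summable_mult summable_geometric)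
  then have "uniform_limit {0..T} (\<lambda>n t. x0 + (\<Sum>i<n. X (Suc i) t - X i t)) x sequentially"
    unfolding x_def by (intro uniform_limit_intros)
  then have ul: "uniform_limit {0..T} X x sequentially"
    using sum_lessThan_telescope[of "\<lambda>i. X i _"] by (simp add: X0)
  have xc: "continuous_on {0..T} x"
    by (rule uniform_limit_theorem[OF _ ul]) (auto simp: Xc)
  have ulf: "uniform_limit {0..T} (\<lambda>n s. f s (X n s)) (\<lambda>s. f s (x s)) sequentially"
  proof (rule uniform_limitI)
    fix e :: real assume "0 < e"
    then have "\<forall>\<^sub>F n in sequentially. \<forall>s\<in>{0..T}. dist (X n s) (x s) < e / L"
      using L by (intro uniform_limitD[OF ul]) auto
    then show "\<forall>\<^sub>F n in sequentially. \<forall>s\<in>{0..T}. dist (f s (X n s)) (f s (x s)) < e"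
    proof eventually_elim
      case (elim n)
      show ?case
      proof
        fix s assume s: "s \<in> {0..T}"
        have "dist (f s (X n s)) (f s (x s)) \<le> L * dist (X n s) (x s)"
          unfolding dist_norm by (rule lip[OF s])
        also have "\<dots> < L * (e / L)"
          using elim s L by (intro mult_strict_left_mono) auto
        finally show "dist (f s (X n s)) (f s (x s)) < e" using L by simp
      qed
    qed
  qed
  have eq: "x t = x0 + integral {0..t} (\<lambda>s. f s (x s))" if t: "t \<in> {0..T}" for t
  proof -
    have "(\<lambda>n. integral {0..t} (\<lambda>s. f s (X n s))) \<longlonglongrightarrow> integral {0..t} (\<lambda>s. f s (x s))"
    proof -
      have "uniform_limit (cbox 0 t) (\<lambda>n s. f s (X n s)) (\<lambda>s. f s (x s)) sequentially"
        using t by (intro uniform_limit_on_subset[OF ulf]) auto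
      then obtain I J where IJ: "\<And>n. ((\<lambda>s. f s (X n s)) has_integral I n) (cbox 0 t)"
          "((\<lambda>s. f s (x s)) has_integral J) (cbox 0 t)" "I \<longlonglongrightarrow> J"
        using t Xc by (elim uniform_limit_integral_cbox)
          (auto intro!: continuous_on_subset[OF cont])
      have "I n = integral {0..t} (\<lambda>s. f s (X n s))" for n
        using IJ(1)[of n] by (simp add: integral_unique)
      moreover have "J = integral {0..t} (\<lambda>s. f s (x s))"
        using IJ(2) by (simp add: integral_unique)
      ultimately show ?thesis using IJ(3) by presburger
    qed
    then have "(\<lambda>n. X (Suc n) t) \<longlonglongrightarrow> x0 + integral {0..t} (\<lambda>s. f s (x s))"
      unfolding XS by (intro tendsto_intros)
    moreover have "(\<lambda>n. X (Suc n) t) \<longlonglongrightarrow> x t"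
      using tendsto_uniform_limitI[OF ul t] by (rule LIMSEQ_Suc)
    ultimately show ?thesis using LIMSEQ_unique by blast
  qed
  show thesis
  proof (rule that)
    show "x 0 = x0" using eq[of 0] T by simp
    fix t assume t: "t \<in> {0..T}"
    have "((\<lambda>t. x0 + integral {0..t} (\<lambda>s. f s (x s))) has_vector_derivative f t (x t)) (at t within {0..T})"
      using integral_has_vector_derivative[OF cont[OF xc] t]
      by (auto intro!: derivative_eq_intros)
    then show "(x has_vector_derivative f t (x t)) (at t within {0..T})"
      by (rule has_vector_derivative_transform[OF t eq, rotated])
  qed
qed

text \<open>Gronwall for the squared norm: it changes at most at relative rate 2L, so a suitable
  exponential factor makes it monotone in either time direction. The zero may lie anywhere in the
  interval; \<open>riccati_exists\<close> also runs this backwards from the right endpoint.\<close>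

lemma ode_zero:
  fixes y :: "real \<Rightarrow> 'a::real_inner"
  assumes der: "\<And>t. t \<in> {c..d} \<Longrightarrow> (y has_vector_derivative g t) (at t within {c..d})"
    and bd: "\<And>t. t \<in> {c..d} \<Longrightarrow> norm (g t) \<le> L * norm (y t)"
    and t0: "t0 \<in> {c..d}" "y t0 = 0" and t: "t \<in> {c..d}"
  shows "y t = 0"
proof -
  have yc: "continuous_on {c..d} y"
    using der by (meson continuous_on_eq_continuous_within has_vector_derivative_continuous)
  have dphi: "((\<lambda>s. y s \<bullet> y s) has_real_derivative 2 * (y s \<bullet> g s)) (at s)" if "c < s" "s < d" for s
  proof -
    have "(y has_vector_derivative g s) (at s)"
      using der[of s] that by (simp add: at_within_Icc_at)
    from bounded_bilinear.has_vector_derivative[OF bounded_bilinear_inner this this]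
    show ?thesis by (simp add: has_real_derivative_iff_has_vector_derivative inner_commute)
  qed
  have ab: "\<bar>2 * (y s \<bullet> g s)\<bar> \<le> 2 * L * (y s \<bullet> y s)" if "s \<in> {c..d}" for s
  proof -
    have "\<bar>y s \<bullet> g s\<bar> \<le> norm (y s) * norm (g s)" by (rule Cauchy_Schwarz_ineq2)
    also have "\<dots> \<le> norm (y s) * (L * norm (y s))" by (intro mult_left_mono bd that) auto
    also have "\<dots> = L * (y s \<bullet> y s)" by (simp add: dot_square_norm power2_eq_square)
    finally show ?thesis by simp
  qed
  have "y t \<bullet> y t \<le> 0"
  proof (cases "t0 \<le> t")
    case True
    have "exp (- 2 * L * t0) * (y t0 \<bullet> y t0) \<ge> exp (- 2 * L * t) * (y t \<bullet> y t)"
    proof (rule DERIV_nonpos_imp_decreasing_open[OF True])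
      fix s assume s: "t0 < s" "s < t"
      have "((\<lambda>s. exp (- 2 * L * s) * (y s \<bullet> y s)) has_real_derivative
          exp (- 2 * L * s) * (2 * (y s \<bullet> g s) - 2 * L * (y s \<bullet> y s))) (at s)"
        using s t0 t by (auto intro!: derivative_eq_intros dphi simp: algebra_simps)
      moreover have "exp (- 2 * L * s) * (2 * (y s \<bullet> g s) - 2 * L * (y s \<bullet> y s)) \<le> 0"
        using ab[of s] s t0 t by (intro mult_nonneg_nonpos) auto
      ultimately show "\<exists>y'. ((\<lambda>s. exp (- 2 * L * s) * (y s \<bullet> y s)) has_real_derivative y') (at s) \<and> y' \<le> 0"
        by blast
    qed (use t0 t in \<open>auto intro!: continuous_intros continuous_on_subset[OF yc]\<close>)
    then show ?thesis using t0 by (simp add: mult_le_0_iff)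
  next
    case False
    have "exp (2 * L * t) * (y t \<bullet> y t) \<le> exp (2 * L * t0) * (y t0 \<bullet> y t0)"
    proof (rule DERIV_nonneg_imp_increasing_open[of t t0 "\<lambda>s. exp (2 * L * s) * (y s \<bullet> y s)"])
      fix s assume s: "t < s" "s < t0"
      have "((\<lambda>s. exp (2 * L * s) * (y s \<bullet> y s)) has_real_derivative
          exp (2 * L * s) * (2 * (y s \<bullet> g s) + 2 * L * (y s \<bullet> y s))) (at s)"
        using s t0 t by (auto intro!: derivative_eq_intros dphi simp: algebra_simps)
      moreover have "exp (2 * L * s) * (2 * (y s \<bullet> g s) + 2 * L * (y s \<bullet> y s)) \<ge> 0"
        using ab[of s] s t0 t by (intro mult_nonneg_nonneg) auto
      ultimately show "\<exists>y'. ((\<lambda>s. exp (2 * L * s) * (y s \<bullet> y s)) has_real_derivative y') (at s) \<and> 0 \<le> y'"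
        by blast
    qed (use False t0 t in \<open>auto intro!: continuous_intros continuous_on_subset[OF yc]\<close>)
    then show ?thesis using t0 by (simp add: mult_le_0_iff)
  qed
  then show ?thesis by (metis inner_gt_zero_iff not_less)
qed

section \<open>Calculus of matrix functions and linear differential equations\<close>

lemma bounded_bilinear_matrix_mult:
  "bounded_bilinear ((**) :: real^'n^'m \<Rightarrow> real^'p^'n \<Rightarrow> real^'p^'m)"
  unfolding bilinear_conv_bounded_bilinear[symmetric] bilinear_def
  by (auto intro!: linearI simp: vec_eq_iff matrix_matrix_mult_def sum.distrib algebra_simps sum_distrib_left)

lemma bounded_bilinear_matrix_vector:
  "bounded_bilinear ((*v) :: real^'n^'m \<Rightarrow> real^'n \<Rightarrow> real^'m)"
  unfolding bilinear_conv_bounded_bilinear[symmetric] bilinear_def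
  by (auto intro!: linearI simp: vec_eq_iff matrix_vector_mult_def sum.distrib algebra_simps sum_distrib_left)

lemma bounded_linear_transpose: "bounded_linear (transpose :: real^'n^'m \<Rightarrow> real^'m^'n)"
  unfolding linear_conv_bounded_linear[symmetric]
  by (auto intro!: linearI simp: vec_eq_iff transpose_def)

lemmas continuous_on_matrix_mult [continuous_intros] =
  bounded_bilinear.continuous_on[OF bounded_bilinear_matrix_mult]
lemmas continuous_on_matrix_vector [continuous_intros] =
  bounded_bilinear.continuous_on[OF bounded_bilinear_matrix_vector]
lemmas continuous_on_transpose [continuous_intros] =
  bounded_linear.continuous_on[OF bounded_linear_transpose]
lemmas has_vector_derivative_matrix_mult =
  bounded_bilinear.has_vector_derivative[OF bounded_bilinear_matrix_mult]
lemmas has_vector_derivative_matrix_vector =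
  bounded_bilinear.has_vector_derivative[OF bounded_bilinear_matrix_vector]
lemmas has_vector_derivative_transpose =
  bounded_linear.has_vector_derivative[OF bounded_linear_transpose]

lemma linear_ode_exists:
  fixes f :: "real \<Rightarrow> 'a::euclidean_space \<Rightarrow> 'a"
  assumes T: "0 \<le> T"
    and cont: "\<And>x. continuous_on {0..T} x \<Longrightarrow> continuous_on {0..T} (\<lambda>t. f t (x t))"
    and bd: "\<And>t. t \<in> {0..T} \<Longrightarrow> linear (f t)"
    and L: "\<And>t x. t \<in> {0..T} \<Longrightarrow> norm (f t x) \<le> L * norm x"
  obtains x where "x 0 = x0"
    "\<And>t. t \<in> {0..T} \<Longrightarrow> (x has_vector_derivative f t (x t)) (at t within {0..T})"
\<comment> \<open>\<open>max L 1\<close> because Picard iteration asks for a positive Lipschitz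
  constant.\<close>
proof (rule picard_exists[of T "max L 1" f x0])
  fix t x y assume t: "t \<in> {0..T}"
  have "norm (f t x - f t y) = norm (f t (x - y))" using bd[OF t] by (simp add: linear_diff)
  also have "\<dots> \<le> L * norm (x - y)" by (rule L[OF t])
  also have "\<dots> \<le> max L 1 * norm (x - y)" by (intro mult_right_mono) auto
  finally show "norm (f t x - f t y) \<le> max L 1 * norm (x - y)" .
qed (use T cont that in auto)

lemma continuous_on_Icc_bounded:
  fixes f :: "real \<Rightarrow> 'a::real_normed_vector"
  assumes "continuous_on {c..d} f"
  obtains C where "0 < C" "\<And>t. t \<in> {c..d} \<Longrightarrow> norm (f t) \<le> C"
proof -
  have "bounded (f ` {c..d})"
    using assms by (intro compact_imp_bounded compact_continuous_image) auto
  then show thesis using that by (auto simp: bounded_pos)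
qed

lemma matrix_mult_norm_bound:
  obtains K where "0 < K" "\<And>(A::real^'n^'m) (B::real^'p^'n). norm (A ** B) \<le> norm A * norm B * K"
  using bounded_bilinear.pos_bounded[OF bounded_bilinear_matrix_mult] by blast

lemma matrix_vector_norm_bound:
  obtains K where "0 < K" "\<And>(A::real^'n^'m) (x::real^'n). norm (A *v x) \<le> norm A * norm x * K"
  using bounded_bilinear.pos_bounded[OF bounded_bilinear_matrix_vector] by blast

lemma linear_ode_matrix_exists:
  fixes A :: "real \<Rightarrow> real^'n^'n" and X0 :: "real^'m^'n"
  assumes T: "0 \<le> T" and A: "continuous_on {0..T} A"
  obtains X where "X 0 = X0"
    "\<And>t. t \<in> {0..T} \<Longrightarrow> (X has_vector_derivative A t ** X t) (at t within {0..T})"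
proof -
  obtain K where K: "0 < K" "\<And>(A::real^'n^'n) (B::real^'m^'n). norm (A ** B) \<le> norm A * norm B * K"
    using matrix_mult_norm_bound by blast
  obtain C where C: "0 < C" "\<And>t. t \<in> {0..T} \<Longrightarrow> norm (A t) \<le> C"
    using continuous_on_Icc_bounded[OF A] by blast
  show thesis
  proof (rule linear_ode_exists[of T "\<lambda>t X. A t ** X" "C * K" X0])
    fix t and x :: "real^'m^'n" assume t: "t \<in> {0..T}"
    have "norm (A t ** x) \<le> norm (A t) * norm x * K" by (rule K)
    also have "\<dots> \<le> C * norm x * K" using K C(2)[OF t] by (intro mult_right_mono) auto
    finally show "norm (A t ** x) \<le> C * K * norm x" by (simp add: mult_ac)
    show "linear ((**) (A t) :: real^'m^'n \<Rightarrow> _)"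
      using bounded_bilinear.bounded_linear_right[OF bounded_bilinear_matrix_mult]
      by (rule bounded_linear.linear)
  qed (use T that A in \<open>auto intro!: continuous_intros\<close>)
qed

lemma constant_of_zero_derivative:
  fixes y :: "real \<Rightarrow> 'a::real_inner"
  assumes "\<And>t. t \<in> {c..d} \<Longrightarrow> (y has_vector_derivative 0) (at t within {c..d})"
    and "t \<in> {c..d}" "s \<in> {c..d}"
  shows "y t = y s"
proof -
  have "y t - y s = 0"
    by (rule ode_zero[of c d "\<lambda>t. y t - y s" "\<lambda>_. 0" 0 s])
      (use assms in \<open>auto intro!: derivative_eq_intros\<close>)
  then show ?thesis by simp
qed

text \<open>The inverse comes from the adjoint equation: if R' = - A^* R and \<open>\<Psi>\<close>
  is the transpose of R, then the product of \<open>\<Psi>\<close> and \<open>\<Phi>\<close> has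
  derivative 0 and keeps its initial value. This yields invertibility and the differentiability of
  the inverse at once.\<close>

lemma fundamental_solution:
  fixes A :: "real \<Rightarrow> real^'n^'n"
  assumes T: "0 \<le> T" and A: "continuous_on {0..T} A"
  obtains \<Phi> \<Psi> :: "real \<Rightarrow> real^'n^'n" where "\<Phi> 0 = mat 1" "\<Psi> 0 = mat 1"
    "\<And>t. t \<in> {0..T} \<Longrightarrow> (\<Phi> has_vector_derivative A t ** \<Phi> t) (at t within {0..T})"
    "\<And>t. t \<in> {0..T} \<Longrightarrow> (\<Psi> has_vector_derivative - (\<Psi> t ** A t)) (at t within {0..T})"
    "\<And>t. t \<in> {0..T} \<Longrightarrow> \<Psi> t ** \<Phi> t = mat 1" "\<And>t. t \<in> {0..T} \<Longrightarrow> \<Phi> t ** \<Psi> t = mat 1"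
proof -
  obtain \<Phi> where \<Phi>: "\<Phi> 0 = (mat 1 :: real^'n^'n)"
    "\<And>t. t \<in> {0..T} \<Longrightarrow> (\<Phi> has_vector_derivative A t ** \<Phi> t) (at t within {0..T})"
    using linear_ode_matrix_exists[OF T A] by blast
  have "continuous_on {0..T} (\<lambda>t. - transpose (A t))" by (intro continuous_intros A)
  then obtain R where R: "R 0 = (mat 1 :: real^'n^'n)"
    "\<And>t. t \<in> {0..T} \<Longrightarrow> (R has_vector_derivative - transpose (A t) ** R t) (at t within {0..T})"
    using linear_ode_matrix_exists[OF T] by blast
  define \<Psi> where "\<Psi> t = transpose (R t)" for t
  have \<Psi>: "(\<Psi> has_vector_derivative - (\<Psi> t ** A t)) (at t within {0..T})" if "t \<in> {0..T}" for t
  proof -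
    have "transpose (- transpose (A t) ** R t) = - (\<Psi> t ** A t)"
      by (simp add: \<Psi>_def vec_eq_iff transpose_def matrix_matrix_mult_def sum_negf mult_ac)
    then show ?thesis
      using has_vector_derivative_transpose[OF R(2)[OF that]] unfolding \<Psi>_def by simp
  qed
  have "((\<lambda>t. \<Psi> t ** \<Phi> t) has_vector_derivative 0) (at t within {0..T})" if "t \<in> {0..T}" for t
  proof -
    have "- (\<Psi> t ** A t) ** \<Phi> t = - (\<Psi> t ** (A t ** \<Phi> t))"
      by (simp add: matrix_mul_assoc bounded_bilinear.minus_left[OF bounded_bilinear_matrix_mult])
    then show ?thesis
      using has_vector_derivative_matrix_mult[OF \<Psi>[OF that] \<Phi>(2)[OF that]] by simp
  qed
  then have "\<Psi> t ** \<Phi> t = \<Psi> 0 ** \<Phi> 0" if "t \<in> {0..T}" for t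
    using that T by (intro constant_of_zero_derivative[of 0 T "\<lambda>t. \<Psi> t ** \<Phi> t"]) auto
  then have 1: "\<Psi> t ** \<Phi> t = mat 1" if "t \<in> {0..T}" for t
    using that by (simp add: \<Phi> R \<Psi>_def)
  show thesis
    by (rule that[of \<Phi> \<Psi>]) (use \<Phi> \<Psi> R 1 in \<open>auto simp: \<Psi>_def matrix_left_right_inverse\<close>)
qed

text \<open>Difference quotients can be treated component by component
  (\<open>has_vector_derivative_vecI\<close>) and through the resolvent identity of inverse
  matrices.\<close>

lemma has_vector_derivative_iff_quotient:
  "(f has_vector_derivative D) (at x within S) \<longleftrightarrow>
    ((\<lambda>y. (1 / (y - x)) *\<^sub>R (f y - f x)) \<longlongrightarrow> D) (at x within S)"
proof -
  have "norm ((1 / (y - x)) *\<^sub>R (f y - f x) - D) = norm (f y - f x - (y - x) *\<^sub>R D) / norm (y - x)"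
    if "y \<noteq> x" for y
  proof -
    have "(1 / (y - x)) *\<^sub>R (f y - f x) - D = (1 / (y - x)) *\<^sub>R (f y - f x - (y - x) *\<^sub>R D)"
      using that by (simp add: scaleR_right_diff_distrib)
    then show ?thesis by (simp add: divide_inverse)
  qed
  then have "((\<lambda>y. norm ((1 / (y - x)) *\<^sub>R (f y - f x) - D)) \<longlongrightarrow> 0) (at x within S) \<longleftrightarrow>
      ((\<lambda>y. norm (f y - f x - (y - x) *\<^sub>R D) / norm (y - x)) \<longlongrightarrow> 0) (at x within S)"
    by (intro filterlim_cong refl) (simp add: eventually_at_filter)
  then show ?thesis
    by (simp add: has_vector_derivative_def has_derivative_iff_norm bounded_linear_scaleR_left
        tendsto_norm_zero_iff LIM_zero_iff)
qed

text \<open>Everything follows from the resolvent identity V(s) - V(t) = - V(s) (U(s) - U(t)) V(t):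
  it first gives continuity of V at t, and then the difference quotient converges factor by
  factor.\<close>

lemma matrix_inverse_has_vector_derivative:
  fixes U V :: "real \<Rightarrow> real^'n^'n"
  assumes inv: "\<And>t. t \<in> S \<Longrightarrow> U t ** V t = mat 1" and t: "t \<in> S"
    and dU: "(U has_vector_derivative U') (at t within S)"
  shows "(V has_vector_derivative - (V t ** U' ** V t)) (at t within S)"
proof -
  obtain K where K: "0 < K" "\<And>(A::real^'n^'n) (B::real^'n^'n). norm (A ** B) \<le> norm A * norm B * K"
    using matrix_mult_norm_bound by blast
  have inv': "V t ** U t = mat 1" if "t \<in> S" for t
    using inv[OF that] by (simp add: matrix_left_right_inverse)
  note bb = bounded_bilinear_matrix_mult
  have resolvent: "V s - V t = - (V s ** (U s - U t) ** V t)" if "s \<in> S" for s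
  proof -
    have "V s ** (U s - U t) ** V t = (V s ** U s) ** V t - V s ** (U t ** V t)"
      by (simp add: bounded_bilinear.diff_right[OF bb] bounded_bilinear.diff_left[OF bb] matrix_mul_assoc)
    then show ?thesis by (simp add: inv inv' that t)
  qed
  have Ut: "(U \<longlongrightarrow> U t) (at t within S)"
    using has_vector_derivative_continuous[OF dU] by (simp add: continuous_within)
  define c where "c = K * K * norm (V t)"
  have c: "0 \<le> c" unfolding c_def using K by auto
  have VV: "norm (V s - V t) \<le> norm (V s) * (c * norm (U s - U t))" if "s \<in> S" for s
  proof -
    have "norm (V s - V t) \<le> norm (V s ** (U s - U t)) * norm (V t) * K"
      using resolvent[OF that] K(2)[of "V s ** (U s - U t)" "V t"] by simp
    also have "\<dots> \<le> (norm (V s) * norm (U s - U t) * K) * norm (V t) * K"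
      using K by (intro mult_right_mono K(2)) auto
    finally show ?thesis by (simp add: c_def mult_ac)
  qed
  have "((\<lambda>s. c * norm (U s - U t)) \<longlongrightarrow> c * norm (U t - U t)) (at t within S)"
    by (intro tendsto_intros Ut)
  then have lim0: "((\<lambda>s. c * norm (U s - U t)) \<longlongrightarrow> 0) (at t within S)" by simp
  \<comment> \<open>Below 1/2 the unknown norm can be absorbed: \<open>norm (V s)\<close> is at most
    \<open>norm (V t) + norm (V s) / 2\<close>, hence at most twice
    \<open>norm (V t)\<close>.\<close>
  have ev: "\<forall>\<^sub>F s in at t within S. s \<in> S \<and> c * norm (U s - U t) < 1/2"
    using order_tendstoD(2)[OF lim0, of "1/2"] by (simp add: eventually_conj_iff eventually_at_filter)
  have ev2: "\<forall>\<^sub>F s in at t within S. norm (V s - V t) \<le> 2 * norm (V t) * (c * norm (U s - U t))"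
    using ev
  proof eventually_elim
    case (elim s)
    have "norm (V s) \<le> norm (V t) + norm (V s - V t)" using norm_triangle_sub[of "V s" "V t"] by simp
    also have "norm (V s - V t) \<le> norm (V s) * (1/2)"
      using VV[of s] elim by (meson less_imp_le mult_left_mono norm_ge_zero order_trans)
    finally have "norm (V s) \<le> 2 * norm (V t)" by simp
    then show ?case using VV[of s] elim c by (meson mult_nonneg_nonneg mult_right_mono norm_ge_zero order_trans)
  qed
  have "((\<lambda>s. V s - V t) \<longlongrightarrow> 0) (at t within S)"
    by (rule Lim_null_comparison[OF ev2]) (use tendsto_mult_left[OF lim0, of "2 * norm (V t)"] in simp)
  then have Vt: "(V \<longlongrightarrow> V t) (at t within S)" by (simp add: LIM_zero_iff)
  have quot: "((\<lambda>s. (1 / (s - t)) *\<^sub>R (U s - U t)) \<longlongrightarrow> U') (at t within S)"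
    using dU by (simp only: has_vector_derivative_iff_quotient)
  have "((\<lambda>s. - (V s ** ((1 / (s - t)) *\<^sub>R (U s - U t)) ** V t)) \<longlongrightarrow> - (V t ** U' ** V t)) (at t within S)"
    by (intro tendsto_minus bounded_bilinear.tendsto[OF bb] Vt quot tendsto_const)
  moreover have "\<forall>\<^sub>F s in at t within S. - (V s ** ((1 / (s - t)) *\<^sub>R (U s - U t)) ** V t) = (1 / (s - t)) *\<^sub>R (V s - V t)"
  proof -
    have "\<forall>\<^sub>F s in at t within S. s \<in> S" by (simp add: eventually_at_filter)
    then show ?thesis
    proof eventually_elim
      case (elim s)
      then show ?case
        by (simp add: resolvent bounded_bilinear.scaleR_right[OF bb] bounded_bilinear.scaleR_left[OF bb])
    qed
  qed
  ultimately have "((\<lambda>s. (1 / (s - t)) *\<^sub>R (V s - V t)) \<longlongrightarrow> - (V t ** U' ** V t)) (at t within S)"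
    by (rule Lim_transform_eventually)
  then show ?thesis by (simp only: has_vector_derivative_iff_quotient)
qed

text \<open>The solution is $W U^{-1}$ for the linear Hamiltonian system of $(U, W)$. The matrix $U(t)$ stays
  invertible because $(Ux \<bullet> Wx)' = (a \<bullet> Wx)^2 + (v \<bullet> Ux)^2 \<ge> 0$ for every vector $x$.\<close>
lemma riccati_exists:
  fixes G H :: "real \<Rightarrow> real^'n^'n" and S P0 :: "real^'n^'n" and a e :: "real^'n" and v :: "real \<Rightarrow> real^'n"
  assumes T: "0 \<le> T" and Hc: "continuous_on {0..T} H" and Gc: "continuous_on {0..T} G"
    and Gv: "\<And>t x. t \<in> {0..T} \<Longrightarrow> G t *v x = (v t \<bullet> x) *\<^sub>R v t"
    and Sa: "\<And>x. S *v x = (a \<bullet> x) *\<^sub>R a"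
    and Pe: "\<And>x. P0 *v x = (c * (e \<bullet> x)) *\<^sub>R e" and c: "0 \<le> c"
  obtains P where "P 0 = P0" "\<And>t. t \<in> {0..T} \<Longrightarrow> transpose (P t) = P t"
    "\<And>t. t \<in> {0..T} \<Longrightarrow> (P has_vector_derivative
        (G t - H t ** P t - P t ** transpose (H t) - P t ** S ** P t)) (at t within {0..T})"
proof -
  note bb = bounded_bilinear_matrix_mult
  note bbs = bounded_bilinear.add_left[OF bb] bounded_bilinear.add_right[OF bb]
    bounded_bilinear.diff_left[OF bb] bounded_bilinear.diff_right[OF bb]
    bounded_bilinear.minus_left[OF bb] bounded_bilinear.minus_right[OF bb]
  obtain K where K: "0 < K" "\<And>(A::real^'n^'n) (B::real^'n^'n). norm (A ** B) \<le> norm A * norm B * K"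
    using matrix_mult_norm_bound by blast
  \<comment> \<open>The signs are those for which W U^{-1} solves the Riccati equation:
    differentiating U^{-1} contributes - W U^{-1} H^* and - W U^{-1} S W U^{-1}.\<close>
  define f :: "real \<Rightarrow> (real^'n^'n) \<times> (real^'n^'n) \<Rightarrow> (real^'n^'n) \<times> (real^'n^'n)" where
    "f t z = (transpose (H t) ** fst z + S ** snd z, G t ** fst z - H t ** snd z)" for t z
  obtain C1 where C1: "0 < C1" "\<And>t. t \<in> {0..T} \<Longrightarrow> norm (H t) \<le> C1"
    using continuous_on_Icc_bounded[OF Hc] by blast
  obtain C2 where C2: "0 < C2" "\<And>t. t \<in> {0..T} \<Longrightarrow> norm (transpose (H t)) \<le> C2"
    using continuous_on_Icc_bounded[OF continuous_on_transpose[OF Hc]] by blast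
  obtain C3 where C3: "0 < C3" "\<And>t. t \<in> {0..T} \<Longrightarrow> norm (G t) \<le> C3"
    using continuous_on_Icc_bounded[OF Gc] by blast
  define L where "L = (C2 + norm S + C3 + C1) * K"
  obtain z where z: "z 0 = (mat 1, P0)"
    "\<And>t. t \<in> {0..T} \<Longrightarrow> (z has_vector_derivative f t (z t)) (at t within {0..T})"
  proof (rule linear_ode_exists[of T f L "(mat 1, P0)"])
    fix t and z :: "(real^'n^'n) \<times> (real^'n^'n)" assume t: "t \<in> {0..T}"
    show "linear (f t)"
      by (rule linearI)
        (simp_all add: f_def bbs bounded_bilinear.scaleR_right[OF bb] scaleR_add_right scaleR_diff_right)
    have n: "norm (M ** x) \<le> C * norm z * K" if "norm M \<le> C" "norm x \<le> norm z" for M x :: "real^'n^'n" and C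
    proof -
      have "norm (M ** x) \<le> norm M * norm x * K" by (rule K)
      also have "\<dots> \<le> C * norm z * K"
        using K that by (intro mult_right_mono mult_mono) (auto intro: order_trans[OF norm_ge_zero])
      finally show ?thesis .
    qed
    have "norm (f t z) \<le> norm (transpose (H t) ** fst z + S ** snd z) + norm (G t ** fst z - H t ** snd z)"
      unfolding f_def by (rule norm_Pair_le)
    also have "\<dots> \<le> (norm (transpose (H t) ** fst z) + norm (S ** snd z)) + (norm (G t ** fst z) + norm (H t ** snd z))"
      by (intro add_mono norm_triangle_ineq norm_triangle_ineq4)
    also have "\<dots> \<le> (C2 * norm z * K + norm S * norm z * K) + (C3 * norm z * K + C1 * norm z * K)"
      using C1(2)[OF t] C2(2)[OF t] C3(2)[OF t]
      by (intro add_mono n) (cases z; simp add: norm_fst_le norm_snd_le)+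
    also have "\<dots> = L * norm z" by (simp add: L_def algebra_simps)
    finally show "norm (f t z) \<le> L * norm z" .
  qed (use T in \<open>auto simp: f_def intro!: continuous_intros Hc Gc\<close>)
  define U where "U t = fst (z t)" for t
  define W where "W t = snd (z t)" for t
  have U0: "U 0 = mat 1" and W0: "W 0 = P0" by (simp_all add: U_def W_def z)
  have dU: "(U has_vector_derivative (transpose (H t) ** U t + S ** W t)) (at t within {0..T})" if "t \<in> {0..T}" for t
    using bounded_linear.has_vector_derivative[OF bounded_linear_fst z(2)[OF that]]
    by (simp add: U_def[abs_def] W_def[abs_def] f_def)
  have dW: "(W has_vector_derivative (G t ** U t - H t ** W t)) (at t within {0..T})" if "t \<in> {0..T}" for t
    using bounded_linear.has_vector_derivative[OF bounded_linear_snd z(2)[OF that]]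
    by (simp add: U_def[abs_def] W_def[abs_def] f_def)
  obtain K' where K': "0 < K'" "\<And>(A::real^'n^'n) (x::real^'n). norm (A *v x) \<le> norm A * norm x * K'"
    using matrix_vector_norm_bound by blast
  have inv: "invertible (U t1)" if t1: "t1 \<in> {0..T}" for t1
  proof (cases "t1 = 0")
    case True then show ?thesis by (auto simp: U0 invertible_def intro!: exI[of _ "mat 1"])
  next
    case False
    then have t1p: "0 < t1" using t1 by auto
    \<comment> \<open>For x in the kernel of U(t1), the function \<open>\<phi>\<close> vanishes at
      t1, starts at a nonnegative value and increases; hence it is constantly 0 and both squares in
      its derivative vanish. Then w starts at P0 x = 0 and solves w' = - H w, while u solves u' =
      H^* u.\<close>
    have "x = 0" if x: "U t1 *v x = 0" for x
    proof -
      define u where "u t = U t *v x" for t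
      define w where "w t = W t *v x" for t
      have sub: "{0..t1} \<subseteq> {0..T}" using t1 by auto
      have du: "(u has_vector_derivative (transpose (H t) *v u t + (a \<bullet> w t) *\<^sub>R a)) (at t within {0..t1})"
        if "t \<in> {0..t1}" for t
      proof -
        have t: "t \<in> {0..T}" using that sub by auto
        have "(U has_vector_derivative (transpose (H t) ** U t + S ** W t)) (at t within {0..t1})"
          using dU[OF t] sub by (rule has_vector_derivative_within_subset)
        from has_vector_derivative_matrix_vector[OF this has_vector_derivative_const[of x]]
        show ?thesis by (simp add: u_def[abs_def] w_def Sa matrix_vector_mult_add_rdistrib flip: matrix_vector_mul_assoc)
      qed
      have dw: "(w has_vector_derivative ((v t \<bullet> u t) *\<^sub>R v t - H t *v w t)) (at t within {0..t1})"
        if "t \<in> {0..t1}" for t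
      proof -
        have t: "t \<in> {0..T}" using that sub by auto
        have "(W has_vector_derivative (G t ** U t - H t ** W t)) (at t within {0..t1})"
          using dW[OF t] sub by (rule has_vector_derivative_within_subset)
        from has_vector_derivative_matrix_vector[OF this has_vector_derivative_const[of x]]
        show ?thesis
          by (simp add: u_def w_def[abs_def] Gv[OF t] matrix_vector_mult_diff_rdistrib flip: matrix_vector_mul_assoc)
      qed
      define \<phi> where "\<phi> t = u t \<bullet> w t" for t
      have d\<phi>: "(\<phi> has_vector_derivative ((v t \<bullet> u t)\<^sup>2 + (a \<bullet> w t)\<^sup>2)) (at t within {0..t1})"
        if "t \<in> {0..t1}" for t
        using bounded_bilinear.has_vector_derivative[OF bounded_bilinear_inner du[OF that] dw[OF that]]
        unfolding \<phi>_def[abs_def]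
        by (simp add: inner_simps power2_eq_square dot_lmul_matrix inner_commute[of "u t" "v t"])
      have mono: "\<phi> s \<le> \<phi> t" if "0 \<le> s" "s \<le> t" "t \<le> t1" for s t
      proof (rule DERIV_nonneg_imp_increasing_open[OF that(2)])
        fix r assume "s < r" "r < t"
        then have "(\<phi> has_vector_derivative ((v r \<bullet> u r)\<^sup>2 + (a \<bullet> w r)\<^sup>2)) (at r)"
          using d\<phi>[of r] that by (simp add: at_within_Icc_at)
        then show "\<exists>y. (\<phi> has_real_derivative y) (at r) \<and> 0 \<le> y"
          by (auto simp: has_real_derivative_iff_has_vector_derivative)
      next
        have "continuous_on {0..t1} \<phi>"
          using d\<phi> by (meson continuous_on_eq_continuous_within has_vector_derivative_continuous)
        then show "continuous_on {s..t} \<phi>" by (rule continuous_on_subset) (use that in auto)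
      qed
      have \<phi>t1: "\<phi> t1 = 0" by (simp add: \<phi>_def u_def x)
      have \<phi>0: "\<phi> 0 = c * (e \<bullet> x)\<^sup>2"
        by (simp add: \<phi>_def u_def w_def U0 W0 Pe power2_eq_square inner_commute)
      have c0: "0 \<le> c * (e \<bullet> x)\<^sup>2" using c by simp
      have \<phi>z: "\<phi> t = 0" if "t \<in> {0..t1}" for t
      proof -
        have "\<phi> 0 \<le> \<phi> t" "\<phi> t \<le> \<phi> t1" using that mono by auto
        then show ?thesis using \<phi>t1 \<phi>0 c0 by simp
      qed
      have "(v t \<bullet> u t)\<^sup>2 + (a \<bullet> w t)\<^sup>2 = 0" if "t \<in> {0..t1}" for t
      proof (rule vector_derivative_unique_within_closed_interval[OF t1p])
        show "t \<in> cbox 0 t1" using that by simp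
        show "(\<phi> has_vector_derivative ((v t \<bullet> u t)\<^sup>2 + (a \<bullet> w t)\<^sup>2)) (at t within cbox 0 t1)"
          using d\<phi>[OF that] by simp
        show "(\<phi> has_vector_derivative 0) (at t within cbox 0 t1)"
          using that \<phi>z by (auto intro!: has_vector_derivative_transform[OF _ _ has_vector_derivative_const[of 0]])
      qed
      then have vu: "v t \<bullet> u t = 0" and aw: "a \<bullet> w t = 0" if "t \<in> {0..t1}" for t
        using that by (simp_all add: sum_power2_eq_zero_iff)
      have "c * (e \<bullet> x) = 0" using \<phi>0 \<phi>z[of 0] t1p by auto
      then have w0: "w 0 = 0" by (simp add: w_def W0 Pe)
      have wz: "w t = 0" if "t \<in> {0..t1}" for t
      proof (rule ode_zero[where c = 0 and d = t1 and y = w and L = "C1 * K'"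
            and g = "\<lambda>t. (v t \<bullet> u t) *\<^sub>R v t - H t *v w t" and ?t0.0 = 0])
        fix t assume t: "t \<in> {0..t1}"
        have "norm (H t *v w t) \<le> norm (H t) * norm (w t) * K'" by (rule K')
        also have "\<dots> \<le> C1 * norm (w t) * K'"
          using K' C1(2)[of t] t sub by (intro mult_right_mono) auto
        finally show "norm ((v t \<bullet> u t) *\<^sub>R v t - H t *v w t) \<le> C1 * K' * norm (w t)"
          by (simp add: vu[OF t] mult_ac)
      qed (use t1p dw w0 that in auto)
      \<comment> \<open>Backwards in time: u vanishes at t1, hence also at 0, where it equals
        x.\<close>
      have "u 0 = 0"
      proof (rule ode_zero[where c = 0 and d = t1 and y = u and L = "C2 * K'"
            and g = "\<lambda>t. transpose (H t) *v u t + (a \<bullet> w t) *\<^sub>R a" and ?t0.0 = t1])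
        fix t assume t: "t \<in> {0..t1}"
        have "norm (transpose (H t) *v u t) \<le> norm (transpose (H t)) * norm (u t) * K'" by (rule K')
        also have "\<dots> \<le> C2 * norm (u t) * K'"
          using K' C2(2)[of t] t sub by (intro mult_right_mono) auto
        finally show "norm (transpose (H t) *v u t + (a \<bullet> w t) *\<^sub>R a) \<le> C2 * K' * norm (u t)"
          by (simp add: aw[OF t] mult_ac)
      qed (use t1p du in \<open>auto simp: u_def x\<close>)
      then show "x = 0" by (simp add: u_def U0)
    qed
    then show ?thesis by (simp add: invertible_left_inverse matrix_left_invertible_ker)
  qed
  define V where "V t = matrix_inv (U t)" for t
  have UV: "U t ** V t = mat 1" and VU: "V t ** U t = mat 1" if "t \<in> {0..T}" for t
    using someI_ex[OF inv[OF that, unfolded invertible_def]] unfolding V_def matrix_inv_def by auto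
  have dV: "(V has_vector_derivative - (V t ** (transpose (H t) ** U t + S ** W t) ** V t)) (at t within {0..T})"
    if "t \<in> {0..T}" for t
    by (rule matrix_inverse_has_vector_derivative[OF UV that dU[OF that]])
  have St: "transpose S = S"
  proof -
    have "(transpose S *v y) \<bullet> x = (S *v y) \<bullet> x" for x y
      by (simp only: transpose_matrix_vector dot_lmul_matrix Sa inner_scaleR_left inner_scaleR_right)
        (simp add: inner_commute)
    then have "transpose S *v y = S *v y" for y using vector_eq_rdot by blast
    then show ?thesis unfolding matrix_eq by blast
  qed
  have Gt: "transpose (G t) = G t" if "t \<in> {0..T}" for t
  proof -
    have "(transpose (G t) *v y) \<bullet> x = (G t *v y) \<bullet> x" for x y
      by (simp only: transpose_matrix_vector dot_lmul_matrix Gv[OF that] inner_scaleR_left inner_scaleR_right)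
        (simp add: inner_commute)
    then have "transpose (G t) *v y = G t *v y" for y using vector_eq_rdot by blast
    then show ?thesis unfolding matrix_eq by blast
  qed
  have P0t: "transpose P0 = P0"
  proof -
    have "(transpose P0 *v y) \<bullet> x = (P0 *v y) \<bullet> x" for x y
      by (simp only: transpose_matrix_vector dot_lmul_matrix Pe inner_scaleR_left inner_scaleR_right)
        (simp add: inner_commute)
    then have "transpose P0 *v y = P0 *v y" for y using vector_eq_rdot by blast
    then show ?thesis unfolding matrix_eq by blast
  qed
  \<comment> \<open>The symplectic form of the Hamiltonian system. It is conserved because S and
    \<open>G t\<close> are symmetric, and it starts at 0 because P0 is symmetric; this makes W
    U^{-1} symmetric.\<close>
  define Q where "Q t = transpose (U t) ** W t - transpose (W t) ** U t" for t
  have "(Q has_vector_derivative 0) (at t within {0..T})" if t: "t \<in> {0..T}" for t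
    unfolding Q_def
    by (rule has_vector_derivative_eq_rhs,
        rule has_vector_derivative_diff
          [OF has_vector_derivative_matrix_mult[OF has_vector_derivative_transpose[OF dU[OF t]] dW[OF t]]
              has_vector_derivative_matrix_mult[OF has_vector_derivative_transpose[OF dW[OF t]] dU[OF t]]])
      (simp add: bbs matrix_transpose_mul linear_add[OF bounded_linear.linear[OF bounded_linear_transpose]]
        linear_diff[OF bounded_linear.linear[OF bounded_linear_transpose]] St Gt[OF t] matrix_mul_assoc)
  then have "Q t = Q 0" if "t \<in> {0..T}" for t
    using that T by (intro constant_of_zero_derivative) auto
  then have Q: "transpose (U t) ** W t = transpose (W t) ** U t" if "t \<in> {0..T}" for t
    using that by (simp add: Q_def U0 W0 P0t matrix_mul_rid matrix_mul_lid)
  show thesis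
  proof (rule that[of "\<lambda>t. W t ** V t"])
    have "V 0 = mat 1" using UV[of 0] T by (simp add: U0)
    then show "W 0 ** V 0 = P0" by (simp add: W0)
    fix t assume t: "t \<in> {0..T}"
    have tVU: "transpose (V t) ** transpose (U t) = mat 1"
      using UV[OF t] by (metis matrix_transpose_mul transpose_mat)
    have "transpose (W t ** V t) = transpose (V t) ** transpose (W t)" by (rule matrix_transpose_mul)
    also have "\<dots> = transpose (V t) ** (transpose (W t) ** U t) ** V t"
      using UV[OF t] by (simp flip: matrix_mul_assoc)
    also have "\<dots> = (transpose (V t) ** transpose (U t)) ** W t ** V t"
      by (simp add: Q[OF t, symmetric] matrix_mul_assoc)
    finally show "transpose (W t ** V t) = W t ** V t" by (simp add: tVU)
    show "((\<lambda>t. W t ** V t) has_vector_derivative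
        (G t - H t ** (W t ** V t) - (W t ** V t) ** transpose (H t) - W t ** V t ** S ** (W t ** V t))) (at t within {0..T})"
    proof (rule has_vector_derivative_eq_rhs[OF has_vector_derivative_matrix_mult[OF dW[OF t] dV[OF t]]])
      have "W t ** (V t ** (transpose (H t) ** U t + S ** W t) ** V t)
          = W t ** V t ** transpose (H t) ** (U t ** V t) + W t ** V t ** S ** W t ** V t"
        by (simp add: bbs matrix_mul_assoc)
      moreover have "(G t ** U t - H t ** W t) ** V t = G t ** (U t ** V t) - H t ** W t ** V t"
        by (simp add: bbs matrix_mul_assoc)
      ultimately show "W t ** - (V t ** (transpose (H t) ** U t + S ** W t) ** V t) + (G t ** U t - H t ** W t) ** V t
         = G t - H t ** (W t ** V t) - (W t ** V t) ** transpose (H t) - W t ** V t ** S ** (W t ** V t)"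
        by (simp add: UV[OF t] bbs matrix_mul_assoc)
    qed
  qed
qed

section \<open>Mean-square calculus\<close>

text \<open>Functions rather than classes modulo null sets, so that sample paths keep their meaning.
  Consequently \<open>ip\<close> is only positive semidefinite and \<open>nrm\<close> only a
  seminorm.\<close>

definition L2 :: "'w measure \<Rightarrow> ('w \<Rightarrow> real) set" where
  "L2 M = {f. f \<in> borel_measurable M \<and> integrable M (\<lambda>\<omega>. (f \<omega>)\<^sup>2)}"

definition ip :: "'w measure \<Rightarrow> ('w \<Rightarrow> real) \<Rightarrow> ('w \<Rightarrow> real) \<Rightarrow> real" where
  "ip M f g = (\<integral>\<omega>. f \<omega> * g \<omega> \<partial>M)"

definition nrm :: "'w measure \<Rightarrow> ('w \<Rightarrow> real) \<Rightarrow> real" where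
  "nrm M f = sqrt (ip M f f)"

lemma L2_measurable [measurable_dest]: "f \<in> L2 M \<Longrightarrow> f \<in> borel_measurable M"
  by (simp add: L2_def)

lemma L2_mult_integrable:
  assumes "f \<in> L2 M" "g \<in> L2 M"
  shows "integrable M (\<lambda>\<omega>. f \<omega> * g \<omega>)"
proof (rule Bochner_Integration.integrable_bound)
  show "integrable M (\<lambda>\<omega>. (f \<omega>)\<^sup>2 + (g \<omega>)\<^sup>2)" using assms by (auto simp: L2_def)
  show "(\<lambda>\<omega>. f \<omega> * g \<omega>) \<in> borel_measurable M" using assms by (auto simp: L2_def)
  have "norm (x * y) \<le> norm (x\<^sup>2 + y\<^sup>2)" for x y :: real
  proof -
    have "2 * \<bar>x * y\<bar> \<le> x\<^sup>2 + y\<^sup>2"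
      using zero_le_power2[of "\<bar>x\<bar> - \<bar>y\<bar>"] by (simp add: power2_diff abs_mult)
    then show ?thesis using abs_ge_zero[of "x * y"] unfolding real_norm_def by linarith
  qed
  then show "AE \<omega> in M. norm (f \<omega> * g \<omega>) \<le> norm ((f \<omega>)\<^sup>2 + (g \<omega>)\<^sup>2)" by simp
qed

lemma L2_zero [simp]: "(\<lambda>_. 0) \<in> L2 M" by (simp add: L2_def)

lemma L2_cmult [intro]: "f \<in> L2 M \<Longrightarrow> (\<lambda>\<omega>. c * f \<omega>) \<in> L2 M"
  by (auto simp: L2_def power_mult_distrib)

lemma L2_add [intro]:
  assumes "f \<in> L2 M" "g \<in> L2 M" shows "(\<lambda>\<omega>. f \<omega> + g \<omega>) \<in> L2 M"
  using assms L2_mult_integrable[OF assms]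
  by (auto simp: L2_def power2_sum mult.assoc)

lemma L2_minus [intro]: "f \<in> L2 M \<Longrightarrow> (\<lambda>\<omega>. - f \<omega>) \<in> L2 M"
  using L2_cmult[of f M "-1"] by simp

lemma L2_diff [intro]:
  assumes "f \<in> L2 M" "g \<in> L2 M" shows "(\<lambda>\<omega>. f \<omega> - g \<omega>) \<in> L2 M"
  using L2_add[OF assms(1) L2_minus[OF assms(2)]] by simp

lemma L2_sum: "(\<And>i. i \<in> I \<Longrightarrow> f i \<in> L2 M) \<Longrightarrow> (\<lambda>\<omega>. \<Sum>i\<in>I. f i \<omega>) \<in> L2 M"
  by (induction I rule: infinite_finite_induct) auto

lemma L2_cong_AE:
  assumes "f \<in> L2 M" "g \<in> borel_measurable M" "AE \<omega> in M. f \<omega> = g \<omega>"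
  shows "g \<in> L2 M"
proof -
  have "AE \<omega> in M. (f \<omega>)\<^sup>2 = (g \<omega>)\<^sup>2" using assms(3) by eventually_elim simp
  moreover have "(\<lambda>\<omega>. (g \<omega>)\<^sup>2) \<in> borel_measurable M" using assms(2) by measurable
  moreover have "integrable M (\<lambda>\<omega>. (f \<omega>)\<^sup>2)" using assms(1) by (simp add: L2_def)
  ultimately have "integrable M (\<lambda>\<omega>. (g \<omega>)\<^sup>2)" using integrable_cong_AE_imp by blast
  then show ?thesis using assms(2) by (simp add: L2_def)
qed

lemma ip_commute: "ip M f g = ip M g f" by (simp add: ip_def mult.commute)

lemma ip_add_left: "f \<in> L2 M \<Longrightarrow> g \<in> L2 M \<Longrightarrow> h \<in> L2 M \<Longrightarrow>
    ip M (\<lambda>\<omega>. f \<omega> + g \<omega>) h = ip M f h + ip M g h"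
  by (simp add: ip_def distrib_right L2_mult_integrable)

lemma ip_add_right: "f \<in> L2 M \<Longrightarrow> g \<in> L2 M \<Longrightarrow> h \<in> L2 M \<Longrightarrow>
    ip M h (\<lambda>\<omega>. f \<omega> + g \<omega>) = ip M h f + ip M h g"
  by (simp add: ip_def distrib_left L2_mult_integrable)

lemma ip_diff_left: "f \<in> L2 M \<Longrightarrow> g \<in> L2 M \<Longrightarrow> h \<in> L2 M \<Longrightarrow>
    ip M (\<lambda>\<omega>. f \<omega> - g \<omega>) h = ip M f h - ip M g h"
  by (simp add: ip_def left_diff_distrib L2_mult_integrable)

lemma ip_diff_right: "f \<in> L2 M \<Longrightarrow> g \<in> L2 M \<Longrightarrow> h \<in> L2 M \<Longrightarrow>
    ip M h (\<lambda>\<omega>. f \<omega> - g \<omega>) = ip M h f - ip M h g"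
  by (simp add: ip_def right_diff_distrib L2_mult_integrable)

lemma ip_cmult_left [simp]: "ip M (\<lambda>\<omega>. c * f \<omega>) g = c * ip M f g"
  by (simp add: ip_def mult.assoc)

lemma ip_cmult_right [simp]: "ip M g (\<lambda>\<omega>. c * f \<omega>) = c * ip M g f"
  by (simp add: ip_def mult.left_commute)

lemma ip_zero_left [simp]: "ip M (\<lambda>_. 0) f = 0" by (simp add: ip_def)

lemma ip_zero_right [simp]: "ip M f (\<lambda>_. 0) = 0" by (simp add: ip_def)

lemma ip_sum_left: "(\<And>i. i \<in> I \<Longrightarrow> f i \<in> L2 M) \<Longrightarrow> g \<in> L2 M \<Longrightarrow>
    ip M (\<lambda>\<omega>. \<Sum>i\<in>I. f i \<omega>) g = (\<Sum>i\<in>I. ip M (f i) g)"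
  by (simp add: ip_def sum_distrib_right L2_mult_integrable)

lemma ip_sum_right: "(\<And>i. i \<in> I \<Longrightarrow> f i \<in> L2 M) \<Longrightarrow> g \<in> L2 M \<Longrightarrow>
    ip M g (\<lambda>\<omega>. \<Sum>i\<in>I. f i \<omega>) = (\<Sum>i\<in>I. ip M g (f i))"
  by (simp add: ip_def sum_distrib_left L2_mult_integrable)

lemma ip_cong_AE:
  assumes "f \<in> borel_measurable M" "g \<in> borel_measurable M" "f' \<in> borel_measurable M" "g' \<in> borel_measurable M"
    and "AE \<omega> in M. f \<omega> = f' \<omega>" "AE \<omega> in M. g \<omega> = g' \<omega>"
  shows "ip M f g = ip M f' g'"
proof -
  have "AE \<omega> in M. f \<omega> * g \<omega> = f' \<omega> * g' \<omega>" using assms(5,6) by eventually_elim simp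
  then show ?thesis unfolding ip_def using assms(1-4) by (intro integral_cong_AE) auto
qed

lemma ip_self_nonneg [simp]: "0 \<le> ip M f f" by (simp add: ip_def)

lemma nrm_nonneg [simp]: "0 \<le> nrm M f" by (simp add: nrm_def)

lemma nrm_square: "(nrm M f)\<^sup>2 = ip M f f" by (simp add: nrm_def)

lemma nrm_zero [simp]: "nrm M (\<lambda>_. 0) = 0" by (simp add: nrm_def)

lemma cauchy_schwarz_ip:
  assumes f: "f \<in> L2 M" and g: "g \<in> L2 M"
  shows "\<bar>ip M f g\<bar> \<le> nrm M f * nrm M g"
proof -
  define a b c where "a = ip M f f" and "b = ip M f g" and "c = ip M g g"
  have q: "0 \<le> a + 2 * t * b + t\<^sup>2 * c" for t
  proof -
    have "0 \<le> ip M (\<lambda>\<omega>. f \<omega> + t * g \<omega>) (\<lambda>\<omega>. f \<omega> + t * g \<omega>)" by simp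
    also have "\<dots> = a + 2 * t * b + t\<^sup>2 * c"
      using f g by (simp add: ip_add_left ip_add_right L2_cmult L2_add a_def b_def c_def
          ip_commute[of M g f] power2_eq_square algebra_simps)
    finally show ?thesis .
  qed
  have "b\<^sup>2 \<le> a * c"
  \<comment> \<open>For c = 0 the quadratic is affine in t, and if b were not 0 the chosen t would
    give it the value - 1. Otherwise t = - b / c minimizes it.\<close>
  proof (cases "c = 0")
    case True
    have "b = 0"
    proof (rule ccontr)
      assume "b \<noteq> 0"
      then show False using q[of "- (a + 1) / (2 * b)"] True by (simp add: field_simps)
    qed
    then show ?thesis using True by simp
  next
    case False
    then have "c > 0" using ip_self_nonneg[of M g] unfolding c_def by linarith
    then show ?thesis using q[of "- b / c"] by (simp add: power2_eq_square field_simps)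
  qed
  then have "sqrt (b\<^sup>2) \<le> sqrt (a * c)" by (rule real_sqrt_le_mono)
  then show ?thesis by (simp add: real_sqrt_mult nrm_def a_def b_def c_def)
qed

lemma nrm_add:
  assumes f: "f \<in> L2 M" and g: "g \<in> L2 M"
  shows "nrm M (\<lambda>\<omega>. f \<omega> + g \<omega>) \<le> nrm M f + nrm M g"
proof -
  have "ip M (\<lambda>\<omega>. f \<omega> + g \<omega>) (\<lambda>\<omega>. f \<omega> + g \<omega>) = ip M f f + 2 * ip M f g + ip M g g"
    using f g by (simp add: ip_add_left ip_add_right L2_add ip_commute[of M g f])
  also have "\<dots> \<le> (nrm M f)\<^sup>2 + 2 * (nrm M f * nrm M g) + (nrm M g)\<^sup>2"
    using cauchy_schwarz_ip[OF f g] by (simp add: nrm_square)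
  also have "\<dots> = (nrm M f + nrm M g)\<^sup>2" by (simp add: power2_sum)
  finally show ?thesis unfolding nrm_def[of M "\<lambda>\<omega>. f \<omega> + g \<omega>"] by (intro real_le_lsqrt) auto
qed

lemma nrm_cmult [simp]: "nrm M (\<lambda>\<omega>. c * f \<omega>) = \<bar>c\<bar> * nrm M f"
  by (simp add: nrm_def real_sqrt_mult flip: mult.assoc power2_eq_square)

lemma nrm_minus [simp]: "nrm M (\<lambda>\<omega>. - f \<omega>) = nrm M f"
  using nrm_cmult[of M "-1" f] by simp

lemma nrm_diff_commute: "nrm M (\<lambda>\<omega>. f \<omega> - g \<omega>) = nrm M (\<lambda>\<omega>. g \<omega> - f \<omega>)"
  using nrm_minus[of M "\<lambda>\<omega>. f \<omega> - g \<omega>"] by simp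

lemma nrm_diff_triangle:
  assumes "f \<in> L2 M" "g \<in> L2 M" "h \<in> L2 M"
  shows "nrm M (\<lambda>\<omega>. f \<omega> - h \<omega>) \<le> nrm M (\<lambda>\<omega>. f \<omega> - g \<omega>) + nrm M (\<lambda>\<omega>. g \<omega> - h \<omega>)"
  using nrm_add[OF L2_diff[OF assms(1,2)] L2_diff[OF assms(2,3)]] by simp

lemma abs_nrm_diff:
  assumes "f \<in> L2 M" "g \<in> L2 M"
  shows "\<bar>nrm M f - nrm M g\<bar> \<le> nrm M (\<lambda>\<omega>. f \<omega> - g \<omega>)"
  using nrm_diff_triangle[OF assms L2_zero] nrm_diff_triangle[OF assms(2,1) L2_zero]
  by (simp add: nrm_diff_commute[of M g f] abs_le_iff)

lemma nrm_sum:
  "(\<And>i. i \<in> I \<Longrightarrow> f i \<in> L2 M) \<Longrightarrow> nrm M (\<lambda>\<omega>. \<Sum>i\<in>I. f i \<omega>) \<le> (\<Sum>i\<in>I. nrm M (f i))"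
proof (induction I rule: infinite_finite_induct)
  case (insert i I)
  then have "nrm M (\<lambda>\<omega>. f i \<omega> + (\<Sum>i\<in>I. f i \<omega>)) \<le> nrm M (f i) + nrm M (\<lambda>\<omega>. \<Sum>i\<in>I. f i \<omega>)"
    by (intro nrm_add L2_sum) auto
  with insert show ?case by simp
qed auto

lemma nn_integral_square:
  assumes "f \<in> L2 M"
  shows "(\<integral>\<^sup>+\<omega>. ennreal ((f \<omega>)\<^sup>2) \<partial>M) = ennreal ((nrm M f)\<^sup>2)"
  using assms by (subst nn_integral_eq_integral) (auto simp: L2_def nrm_square ip_def simp flip: power2_eq_square)

text \<open>Fatou's lemma for squares. It carries mean-square bounds over to quantities that are
  given path by path, such as time integrals.\<close>

lemma nrm_limit_le:
  assumes F: "\<And>n. F n \<in> L2 M" and lim: "\<And>\<omega>. \<omega> \<in> space M \<Longrightarrow> (\<lambda>n. F n \<omega>) \<longlonglongrightarrow> f \<omega>"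
    and c: "\<And>n. nrm M (F n) \<le> c"
  shows "f \<in> L2 M" "nrm M f \<le> c"
proof -
  have c0: "0 \<le> c" using order_trans[OF nrm_nonneg c[of 0]] .
  have fm: "f \<in> borel_measurable M"
    by (rule borel_measurable_LIMSEQ_real[OF lim L2_measurable[OF F]])
  have "(\<integral>\<^sup>+\<omega>. ennreal ((f \<omega>)\<^sup>2) \<partial>M) = (\<integral>\<^sup>+\<omega>. liminf (\<lambda>n. ennreal ((F n \<omega>)\<^sup>2)) \<partial>M)"
  proof (rule nn_integral_cong)
    fix \<omega> assume "\<omega> \<in> space M"
    then have "(\<lambda>n. ennreal ((F n \<omega>)\<^sup>2)) \<longlonglongrightarrow> ennreal ((f \<omega>)\<^sup>2)"
      by (intro tendsto_ennrealI tendsto_intros lim)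
    then show "ennreal ((f \<omega>)\<^sup>2) = liminf (\<lambda>n. ennreal ((F n \<omega>)\<^sup>2))"
      by (intro lim_imp_Liminf[symmetric]) auto
  qed
  also have "\<dots> \<le> liminf (\<lambda>n. \<integral>\<^sup>+\<omega>. ennreal ((F n \<omega>)\<^sup>2) \<partial>M)"
    using L2_measurable[OF F] by (intro nn_integral_liminf) measurable
  also have "\<dots> \<le> ennreal (c\<^sup>2)"
  proof -
    have "ennreal ((nrm M (F n))\<^sup>2) \<le> ennreal (c\<^sup>2)" for n
      by (intro ennreal_leI power_mono c) auto
    then show ?thesis
      using F by (intro Liminf_le) (auto simp: nn_integral_square)
  qed
  finally have le: "(\<integral>\<^sup>+\<omega>. ennreal ((f \<omega>)\<^sup>2) \<partial>M) \<le> ennreal (c\<^sup>2)" .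
  show fL: "f \<in> L2 M"
  proof -
    have "(\<integral>\<^sup>+\<omega>. ennreal ((f \<omega>)\<^sup>2) \<partial>M) < \<infinity>"
      unfolding infinity_ennreal_def by (rule le_less_trans[OF le ennreal_less_top])
    moreover have "(\<lambda>\<omega>. (f \<omega>)\<^sup>2) \<in> borel_measurable M" using fm by measurable
    ultimately have "integrable M (\<lambda>\<omega>. (f \<omega>)\<^sup>2)" by (intro integrableI_nonneg) simp_all
    then show ?thesis using fm by (simp add: L2_def)
  qed
  have "ennreal ((nrm M f)\<^sup>2) \<le> ennreal (c\<^sup>2)" using le by (simp add: nn_integral_square[OF fL])
  then have "(nrm M f)\<^sup>2 \<le> c\<^sup>2" by simp
  then show "nrm M f \<le> c" using c0 by (rule power2_le_imp_le)
qed

section \<open>Riemann sums on equidistant grids\<close>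

definition rsum :: "(real \<Rightarrow> real) \<Rightarrow> real \<Rightarrow> real \<Rightarrow> nat \<Rightarrow> real" where
  "rsum g a b n = (b - a) / n * (\<Sum>k<n. g (a + real k * ((b - a) / n)))"

lemma grid_in:
  assumes "a \<le> b" "k \<le> (n::nat)" "0 < n" shows "a + real k * ((b - a) / n) \<in> {a..b}"
proof -
  have "k * ((b - a) / n) = (real k / n) * (b - a)" by simp
  also have "\<dots> \<le> 1 * (b - a)" using assms by (intro mult_right_mono) auto
  finally show ?thesis using assms by auto
qed

lemma rsum_error:
  assumes ab: "a \<le> b" and n: "0 < n" and g: "continuous_on {a..b} g"
    and e: "\<And>s r. s \<in> {a..b} \<Longrightarrow> r \<in> {a..b} \<Longrightarrow> \<bar>s - r\<bar> \<le> (b - a) / n \<Longrightarrow> \<bar>g s - g r\<bar> \<le> e"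
  shows "\<bar>rsum g a b n - integral {a..b} g\<bar> \<le> (b - a) * e"
proof -
  define h where "h = (b - a) / n"
  have h: "0 \<le> h" using ab by (simp add: h_def)
  have grid: "a + real k * h \<in> {a..b}" if "k \<le> n" for k
    using grid_in[OF ab that n] by (simp add: h_def)
  have "\<bar>h * (\<Sum>k<m. g (a + real k * h)) - integral {a..a + real m * h} g\<bar> \<le> real m * h * e" if "m \<le> n" for m
    using that
  proof (induction m)
    case (Suc m)
    define c d where "c = a + m * h" and "d = a + Suc m * h"
    have cd: "a \<le> c" "c \<le> d" "d \<le> b" "d - c = h" using grid[of m] grid[of "Suc m"] Suc.prems h
      by (auto simp: c_def d_def algebra_simps)
    have gi: "g integrable_on {x..y}" if "a \<le> x" "y \<le> b" for x y
      using that by (intro integrable_continuous_real continuous_on_subset[OF g]) auto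
    have "integral {a..c} g + integral {c..d} g = integral {a..d} g"
      using cd by (intro Henstock_Kurzweil_Integration.integral_combine gi) auto
    moreover have "\<bar>h * g c - integral {c..d} g\<bar> \<le> h * e"
    proof -
      have "h * g c - integral {c..d} g = integral {c..d} (\<lambda>s. g c - g s)"
        using cd by (subst integral_diff) (auto intro!: gi)
      also have "norm \<dots> \<le> integral {c..d} (\<lambda>s. e)"
      proof (rule integral_norm_bound_integral)
        fix s assume "s \<in> {c..d}"
        then show "norm (g c - g s) \<le> e"
          using cd e[of c s] by (auto simp: h_def)
      qed (use cd in \<open>auto intro!: gi integrable_diff\<close>)
      also have "\<dots> = h * e" using cd by simp
      finally show ?thesis by simp
    qed
    moreover have "\<bar>h * (\<Sum>k<m. g (a + real k * h)) - integral {a..c} g\<bar> \<le> real m * h * e"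
      using Suc unfolding c_def by simp
    ultimately have "\<bar>h * (\<Sum>k<m. g (a + real k * h)) + h * g c - integral {a..d} g\<bar> \<le> real m * h * e + h * e"
      by linarith
    then show ?case by (simp add: c_def d_def algebra_simps)
  qed simp
  from this[of n] show ?thesis using n by (simp add: rsum_def h_def)
qed

lemma rsum_tendsto:
  assumes ab: "a \<le> b" and g: "continuous_on {a..b} g"
  shows "(\<lambda>n. rsum g a b (Suc n)) \<longlonglongrightarrow> integral {a..b} g"
proof (rule LIMSEQ_I)
  fix \<epsilon> :: real assume "0 < \<epsilon>"
  \<comment> \<open>The summand 1 keeps the denominator positive when a = b.\<close>
  define e where "e = \<epsilon> / (2 * (b - a + 1))"
  have e: "0 < e" using ab \<open>0 < \<epsilon>\<close> by (simp add: e_def)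
  have "uniformly_continuous_on {a..b} g" by (intro compact_uniformly_continuous g) auto
  then obtain d where d: "0 < d" "\<And>s r. s \<in> {a..b} \<Longrightarrow> r \<in> {a..b} \<Longrightarrow> dist s r < d \<Longrightarrow> dist (g s) (g r) < e"
    using e unfolding uniformly_continuous_on_def by blast
  obtain N where N: "(b - a) / d < real N" using reals_Archimedean2 by blast
  show "\<exists>N. \<forall>n\<ge>N. norm (rsum g a b (Suc n) - integral {a..b} g) < \<epsilon>"
  proof (intro exI allI impI)
    fix n assume "N \<le> n"
    then have "(b - a) / d < Suc n" using N by linarith
    then have hd: "(b - a) / Suc n < d" using d by (simp add: field_simps)
    have "\<bar>rsum g a b (Suc n) - integral {a..b} g\<bar> \<le> (b - a) * e"
    proof (rule rsum_error[OF ab _ g])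
      fix s r assume "s \<in> {a..b}" "r \<in> {a..b}" "\<bar>s - r\<bar> \<le> (b - a) / Suc n"
      then show "\<bar>g s - g r\<bar> \<le> e" using d(2)[of s r] hd by (simp add: dist_real_def)
    qed simp
    also have "\<dots> \<le> (b - a + 1) * e" using e by simp
    also have "\<dots> = \<epsilon> / 2" using ab by (simp add: e_def field_simps)
    finally show "norm (rsum g a b (Suc n) - integral {a..b} g) < \<epsilon>" using \<open>0 < \<epsilon>\<close> by simp
  qed
qed

text \<open>The fine grid is grouped into n blocks of m points. The difference of the two sums
  becomes b - a times an average of increments of g over distances below (b - a) / n, to which a
  modulus of continuity applies.\<close>

lemma rsum_refine:
  fixes n m :: nat
  assumes "0 < n" "0 < m"
  shows "rsum g a b (n * m) - rsum g a b n =
    (b - a) / (n * m) * (\<Sum>k<n. \<Sum>j\<in>{k*m..<k*m+m}. g (a + real j * ((b - a) / (n * m))) - g (a + real k * ((b - a) / n)))"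
proof -
  have "(b - a) / n * (\<Sum>k<n. g (a + real k * ((b - a) / n))) =
      (b - a) / (n * m) * (\<Sum>k<n. \<Sum>j\<in>{k*m..<k*m+m}. g (a + real k * ((b - a) / n)))"
    using assms by (simp add: sum_distrib_left[symmetric])
  moreover have "(\<Sum>j<n * m. g (a + real j * ((b - a) / (n * m)))) =
      (\<Sum>k<n. \<Sum>j\<in>{k*m..<k*m+m}. g (a + real j * ((b - a) / (n * m))))"
    by (rule sum.nat_group[symmetric])
  ultimately show ?thesis
    by (simp add: rsum_def sum_subtractf right_diff_distrib)
qed

text \<open>Two continuities are combined. Continuity of every path makes time integrals meaningful
  as pathwise limits of Riemann sums; mean-square continuity makes the same sums converge in mean
  square, so that the integrals commute with \<open>ip\<close>. The modulus is uniform over the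
  interval, which is the form used in all estimates.\<close>

definition l2proc :: "'w measure \<Rightarrow> real \<Rightarrow> real \<Rightarrow> (real \<Rightarrow> 'w \<Rightarrow> real) \<Rightarrow> bool" where
  "l2proc M a b x \<longleftrightarrow> (\<forall>s\<in>{a..b}. x s \<in> L2 M) \<and>
    (\<forall>\<omega>\<in>space M. continuous_on {a..b} (\<lambda>s. x s \<omega>)) \<and>
    (\<forall>e>0. \<exists>d>0. \<forall>s\<in>{a..b}. \<forall>r\<in>{a..b}. \<bar>s - r\<bar> < d \<longrightarrow> nrm M (\<lambda>\<omega>. x s \<omega> - x r \<omega>) \<le> e)"

lemma l2proc_L2: "l2proc M a b x \<Longrightarrow> s \<in> {a..b} \<Longrightarrow> x s \<in> L2 M"
  by (simp add: l2proc_def)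

lemma l2proc_cont: "l2proc M a b x \<Longrightarrow> \<omega> \<in> space M \<Longrightarrow> continuous_on {a..b} (\<lambda>s. x s \<omega>)"
  by (simp add: l2proc_def)

lemma l2proc_mod:
  assumes "l2proc M a b x" "0 < e"
  obtains d where "0 < d" "\<And>s r. s \<in> {a..b} \<Longrightarrow> r \<in> {a..b} \<Longrightarrow> \<bar>s - r\<bar> < d \<Longrightarrow> nrm M (\<lambda>\<omega>. x s \<omega> - x r \<omega>) \<le> e"
  using assms unfolding l2proc_def by meson

lemma l2proc_subset:
  assumes x: "l2proc M a b x" and "a \<le> c" "d \<le> b"
  shows "l2proc M c d x"
proof -
  have sub: "{c..d} \<subseteq> {a..b}" using assms by auto
  show ?thesis
    unfolding l2proc_def
  proof (intro conjI ballI allI impI)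
    fix e :: real assume "0 < e"
    from l2proc_mod[OF x this] obtain d' where "0 < d'"
      "\<And>s r. s \<in> {a..b} \<Longrightarrow> r \<in> {a..b} \<Longrightarrow> \<bar>s - r\<bar> < d' \<Longrightarrow> nrm M (\<lambda>\<omega>. x s \<omega> - x r \<omega>) \<le> e" by blast
    then show "\<exists>d'>0. \<forall>s\<in>{c..d}. \<forall>r\<in>{c..d}. \<bar>s - r\<bar> < d' \<longrightarrow> nrm M (\<lambda>\<omega>. x s \<omega> - x r \<omega>) \<le> e"
      using sub by blast
  qed (use x sub in \<open>auto simp: l2proc_def intro: continuous_on_subset\<close>)
qed

lemma l2proc_nrm_continuous:
  assumes x: "l2proc M a b x"
  shows "continuous_on {a..b} (\<lambda>s. nrm M (x s))"
  unfolding continuous_on_iff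
proof (intro ballI allI impI)
  fix s e assume s: "s \<in> {a..b}" and e: "0 < (e::real)"
  from e have "0 < e / 2" by simp
  from l2proc_mod[OF x this] obtain d where d: "0 < d"
    "\<And>s r. s \<in> {a..b} \<Longrightarrow> r \<in> {a..b} \<Longrightarrow> \<bar>s - r\<bar> < d \<Longrightarrow> nrm M (\<lambda>\<omega>. x s \<omega> - x r \<omega>) \<le> e / 2" by blast
  show "\<exists>d>0. \<forall>r\<in>{a..b}. dist r s < d \<longrightarrow> dist (nrm M (x r)) (nrm M (x s)) < e"
  proof (intro exI conjI ballI impI)
    fix r assume r: "r \<in> {a..b}" "dist r s < d"
    have "\<bar>nrm M (x r) - nrm M (x s)\<bar> \<le> nrm M (\<lambda>\<omega>. x r \<omega> - x s \<omega>)"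
      by (intro abs_nrm_diff l2proc_L2[OF x] r s)
    also have "\<dots> \<le> e / 2" using d(2) r s by (simp add: dist_real_def)
    finally show "dist (nrm M (x r)) (nrm M (x s)) < e" using e by (simp add: dist_real_def)
  qed (fact d)
qed

lemma l2proc_bounded:
  assumes "l2proc M a b x"
  obtains C where "0 < C" "\<And>s. s \<in> {a..b} \<Longrightarrow> nrm M (x s) \<le> C"
  using continuous_on_Icc_bounded[OF l2proc_nrm_continuous[OF assms]] by auto

lemma l2proc_const: "f \<in> L2 M \<Longrightarrow> l2proc M a b (\<lambda>_. f)"
  by (auto simp: l2proc_def intro: exI[of _ 1])

lemma l2proc_add:
  assumes x: "l2proc M a b x" and y: "l2proc M a b y"
  shows "l2proc M a b (\<lambda>s \<omega>. x s \<omega> + y s \<omega>)"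
  unfolding l2proc_def
proof (intro conjI ballI allI impI)
  fix e :: real assume "0 < e"
  then have e2: "0 < e / 2" by simp
  from l2proc_mod[OF x e2] obtain d1 where d1: "0 < d1"
    "\<And>s r. s \<in> {a..b} \<Longrightarrow> r \<in> {a..b} \<Longrightarrow> \<bar>s - r\<bar> < d1 \<Longrightarrow> nrm M (\<lambda>\<omega>. x s \<omega> - x r \<omega>) \<le> e / 2" by blast
  from l2proc_mod[OF y e2] obtain d2 where d2: "0 < d2"
    "\<And>s r. s \<in> {a..b} \<Longrightarrow> r \<in> {a..b} \<Longrightarrow> \<bar>s - r\<bar> < d2 \<Longrightarrow> nrm M (\<lambda>\<omega>. y s \<omega> - y r \<omega>) \<le> e / 2" by blast
  show "\<exists>d>0. \<forall>s\<in>{a..b}. \<forall>r\<in>{a..b}. \<bar>s - r\<bar> < d \<longrightarrow>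
      nrm M (\<lambda>\<omega>. x s \<omega> + y s \<omega> - (x r \<omega> + y r \<omega>)) \<le> e"
  proof (intro exI[of _ "min d1 d2"] conjI ballI impI)
    fix s r assume sr: "s \<in> {a..b}" "r \<in> {a..b}" "\<bar>s - r\<bar> < min d1 d2"
    have "nrm M (\<lambda>\<omega>. (x s \<omega> - x r \<omega>) + (y s \<omega> - y r \<omega>)) \<le>
        nrm M (\<lambda>\<omega>. x s \<omega> - x r \<omega>) + nrm M (\<lambda>\<omega>. y s \<omega> - y r \<omega>)"
      by (intro nrm_add L2_diff l2proc_L2[OF x] l2proc_L2[OF y] sr)
    also have "\<dots> \<le> e / 2 + e / 2" using d1 d2 sr by (intro add_mono) auto
    finally show "nrm M (\<lambda>\<omega>. x s \<omega> + y s \<omega> - (x r \<omega> + y r \<omega>)) \<le> e"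
      by (simp add: algebra_simps)
  qed (use d1 d2 in auto)
qed (use x y in \<open>auto simp: l2proc_def intro!: continuous_intros\<close>)

lemma l2proc_mult:
  assumes x: "l2proc M a b x" and f: "continuous_on {a..b} f"
  shows "l2proc M a b (\<lambda>s \<omega>. f s * x s \<omega>)"
  unfolding l2proc_def
proof (intro conjI ballI allI impI)
  fix e :: real assume e: "0 < e"
  obtain C where C: "0 < C" "\<And>s. s \<in> {a..b} \<Longrightarrow> nrm M (x s) \<le> C" using l2proc_bounded[OF x] by blast
  obtain K where K: "0 < K" "\<And>s. s \<in> {a..b} \<Longrightarrow> norm (f s) \<le> K" using continuous_on_Icc_bounded[OF f] by blast
  have "uniformly_continuous_on {a..b} f" by (intro compact_uniformly_continuous f) auto
  moreover have "0 < e / (2 * C)" using e C by simp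
  ultimately obtain d1 where d1: "0 < d1"
    "\<And>s r. s \<in> {a..b} \<Longrightarrow> r \<in> {a..b} \<Longrightarrow> dist s r < d1 \<Longrightarrow> dist (f s) (f r) < e / (2 * C)"
    unfolding uniformly_continuous_on_def by blast
  have "0 < e / (2 * K)" using e K by simp
  from l2proc_mod[OF x this] obtain d2 where d2: "0 < d2"
    "\<And>s r. s \<in> {a..b} \<Longrightarrow> r \<in> {a..b} \<Longrightarrow> \<bar>s - r\<bar> < d2 \<Longrightarrow> nrm M (\<lambda>\<omega>. x s \<omega> - x r \<omega>) \<le> e / (2 * K)" by blast
  show "\<exists>d>0. \<forall>s\<in>{a..b}. \<forall>r\<in>{a..b}. \<bar>s - r\<bar> < d \<longrightarrow> nrm M (\<lambda>\<omega>. f s * x s \<omega> - f r * x r \<omega>) \<le> e"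
  proof (intro exI[of _ "min d1 d2"] conjI ballI impI)
    fix s r assume sr: "s \<in> {a..b}" "r \<in> {a..b}" "\<bar>s - r\<bar> < min d1 d2"
    have "nrm M (\<lambda>\<omega>. f s * (x s \<omega> - x r \<omega>) + (f s - f r) * x r \<omega>) \<le>
        nrm M (\<lambda>\<omega>. f s * (x s \<omega> - x r \<omega>)) + nrm M (\<lambda>\<omega>. (f s - f r) * x r \<omega>)"
      by (intro nrm_add L2_cmult L2_diff l2proc_L2[OF x] sr)
    also have "\<dots> = \<bar>f s\<bar> * nrm M (\<lambda>\<omega>. x s \<omega> - x r \<omega>) + \<bar>f s - f r\<bar> * nrm M (x r)" by simp
    also have "\<dots> \<le> K * (e / (2 * K)) + e / (2 * C) * C"
      using K C e d1(2)[OF sr(1,2)] d2 sr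
      by (intro add_mono mult_mono) (auto simp: dist_real_def)
    also have "\<dots> = e" using K C by simp
    finally show "nrm M (\<lambda>\<omega>. f s * x s \<omega> - f r * x r \<omega>) \<le> e" by (simp add: algebra_simps)
  qed (use d1 d2 in auto)
qed (use x f in \<open>auto simp: l2proc_def intro!: continuous_intros\<close>)

lemma rsum_L2:
  assumes "l2proc M a b x" "a \<le> b"
  shows "(\<lambda>\<omega>. rsum (\<lambda>s. x s \<omega>) a b n) \<in> L2 M"
proof (cases "n = 0")
  case False
  then show ?thesis unfolding rsum_def
    using assms by (intro L2_cmult L2_sum l2proc_L2[OF assms(1)] grid_in) auto
qed (simp add: rsum_def)

text \<open>Fatou's lemma along the refinements $nm$ of the grid, so that no joint measurability in time and
  \<open>\<omega>\<close> is needed.\<close>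
lemma l2_riemann:
  assumes x: "l2proc M a b x" and ab: "a \<le> b" and n: "0 < n"
    and e: "\<And>s r. s \<in> {a..b} \<Longrightarrow> r \<in> {a..b} \<Longrightarrow> \<bar>s - r\<bar> \<le> (b - a) / n \<Longrightarrow> nrm M (\<lambda>\<omega>. x s \<omega> - x r \<omega>) \<le> e"
  shows "(\<lambda>\<omega>. integral {a..b} (\<lambda>s. x s \<omega>)) \<in> L2 M"
    and "nrm M (\<lambda>\<omega>. integral {a..b} (\<lambda>s. x s \<omega>) - rsum (\<lambda>s. x s \<omega>) a b n) \<le> (b - a) * e"
proof -
  have fine: "nrm M (\<lambda>\<omega>. rsum (\<lambda>s. x s \<omega>) a b (n * m) - rsum (\<lambda>s. x s \<omega>) a b n) \<le> (b - a) * e" if m: "0 < m" for m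
  proof -
    define h where "h = (b - a) / (n * m)"
    have h: "0 \<le> h" using ab by (simp add: h_def)
    have hn: "(b - a) / n = m * h"
      unfolding h_def of_nat_mult using n m by simp
    have grid: "a + real j * h \<in> {a..b}" if "j \<le> n * m" for j :: nat
      using grid_in[OF ab that] n m by (simp add: h_def)
    have j_le: "j < n * m" if "k < n" "j \<in> {k*m..<k*m+m}" for k j
    proof -
      have "k * m + m \<le> n * m" using that(1) by (metis Suc_leI add.commute mult_Suc mult_le_mono1)
      then show ?thesis using that(2) by auto
    qed
    have xm: "x (a + real j * h) \<in> L2 M" "x (a + real k * ((b - a) / n)) \<in> L2 M"
      "nrm M (\<lambda>\<omega>. x (a + real j * h) \<omega> - x (a + real k * ((b - a) / n)) \<omega>) \<le> e"
      if kj: "k < n" "j \<in> {k*m..<k*m+m}" for k j :: nat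
    proof -
      have 1: "a + real j * h \<in> {a..b}" using j_le[OF kj] by (intro grid) auto
      have 2: "a + real k * ((b - a) / n) \<in> {a..b}" using kj n by (intro grid_in ab) auto
      show "x (a + real j * h) \<in> L2 M" "x (a + real k * ((b - a) / n)) \<in> L2 M"
        using 1 2 by (auto intro: l2proc_L2[OF x])
      have "real (k * m) * h \<le> j * h" "j * h \<le> real (k * m + m) * h"
        using kj by (intro mult_right_mono h of_nat_mono; simp)+
      then have "\<bar>(a + real j * h) - (a + real k * ((b - a) / n))\<bar> \<le> (b - a) / n"
        unfolding hn by (simp add: algebra_simps)
      then show "nrm M (\<lambda>\<omega>. x (a + real j * h) \<omega> - x (a + real k * ((b - a) / n)) \<omega>) \<le> e"
        by (intro e 1 2)
    qed
    have "nrm M (\<lambda>\<omega>. rsum (\<lambda>s. x s \<omega>) a b (n * m) - rsum (\<lambda>s. x s \<omega>) a b n) =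
        nrm M (\<lambda>\<omega>. h * (\<Sum>k<n. \<Sum>j\<in>{k*m..<k*m+m}. x (a + real j * h) \<omega> - x (a + real k * ((b - a) / n)) \<omega>))"
      using n m by (subst rsum_refine) (auto simp: h_def)
    also have "\<dots> \<le> h * (\<Sum>k<n. \<Sum>j\<in>{k*m..<k*m+m}. e)"
      unfolding nrm_cmult abs_of_nonneg[OF h]
    proof (intro mult_left_mono h)
      have L: "(\<lambda>\<omega>. \<Sum>j\<in>{k*m..<k*m+m}. x (a + real j * h) \<omega> - x (a + real k * ((b - a) / n)) \<omega>) \<in> L2 M"
        and N: "nrm M (\<lambda>\<omega>. \<Sum>j\<in>{k*m..<k*m+m}. x (a + real j * h) \<omega> - x (a + real k * ((b - a) / n)) \<omega>)
          \<le> (\<Sum>j\<in>{k*m..<k*m+m}. e)" if k: "k < n" for k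
      proof -
        show "(\<lambda>\<omega>. \<Sum>j\<in>{k*m..<k*m+m}. x (a + real j * h) \<omega> - x (a + real k * ((b - a) / n)) \<omega>) \<in> L2 M"
          by (intro L2_sum L2_diff xm[OF k])
        show "nrm M (\<lambda>\<omega>. \<Sum>j\<in>{k*m..<k*m+m}. x (a + real j * h) \<omega> - x (a + real k * ((b - a) / n)) \<omega>)
          \<le> (\<Sum>j\<in>{k*m..<k*m+m}. e)"
          by (intro order_trans[OF nrm_sum] sum_mono L2_diff xm[OF k])
      qed
      show "nrm M (\<lambda>\<omega>. \<Sum>k<n. \<Sum>j\<in>{k*m..<k*m+m}. x (a + real j * h) \<omega> - x (a + real k * ((b - a) / n)) \<omega>)
          \<le> (\<Sum>k<n. \<Sum>j\<in>{k*m..<k*m+m}. e)"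
        by (rule order_trans[OF nrm_sum sum_mono]) (use L N in auto)
    qed
    also have "\<dots> = h * real (n * m) * e" by simp
    also have "h * real (n * m) = b - a"
      using n m by (simp add: h_def)
    finally show ?thesis .
  qed
  have lim: "(\<lambda>m. rsum (\<lambda>s. x s \<omega>) a b (n * Suc m)) \<longlonglongrightarrow> integral {a..b} (\<lambda>s. x s \<omega>)" if "\<omega> \<in> space M" for \<omega>
  proof -
    \<comment> \<open>\<open>rsum_tendsto\<close> is indexed by \<open>Suc\<close>, hence the shift
      by 1 in the subsequence.\<close>
    have "strict_mono (\<lambda>m. n * Suc m - 1)" using n by (auto simp: strict_mono_Suc_iff)
    from LIMSEQ_subseq_LIMSEQ[OF rsum_tendsto[OF ab l2proc_cont[OF x that]] this]
    show ?thesis using n by (simp add: o_def)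
  qed
  note R = rsum_L2[OF x ab]
  note res = nrm_limit_le[of "\<lambda>m \<omega>. rsum (\<lambda>s. x s \<omega>) a b (n * Suc m) - rsum (\<lambda>s. x s \<omega>) a b n" M
      "\<lambda>\<omega>. integral {a..b} (\<lambda>s. x s \<omega>) - rsum (\<lambda>s. x s \<omega>) a b n" "(b - a) * e",
      OF L2_diff[OF R R] tendsto_diff[OF lim tendsto_const] fine[OF zero_less_Suc]]
  show "nrm M (\<lambda>\<omega>. integral {a..b} (\<lambda>s. x s \<omega>) - rsum (\<lambda>s. x s \<omega>) a b n) \<le> (b - a) * e"
    by (rule res)
  show "(\<lambda>\<omega>. integral {a..b} (\<lambda>s. x s \<omega>)) \<in> L2 M"
    using L2_add[OF res(1) R[of n]] by simp
qed

lemma l2_integral_rsum: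
  assumes x: "l2proc M a b x" and ab: "a \<le> b"
  shows "(\<lambda>\<omega>. integral {a..b} (\<lambda>s. x s \<omega>)) \<in> L2 M"
    and "(\<lambda>n. nrm M (\<lambda>\<omega>. rsum (\<lambda>s. x s \<omega>) a b (Suc n) - integral {a..b} (\<lambda>s. x s \<omega>))) \<longlonglongrightarrow> 0"
proof -
  have *: "\<exists>N. \<forall>n\<ge>N. (\<lambda>\<omega>. integral {a..b} (\<lambda>s. x s \<omega>)) \<in> L2 M \<and>
      nrm M (\<lambda>\<omega>. rsum (\<lambda>s. x s \<omega>) a b (Suc n) - integral {a..b} (\<lambda>s. x s \<omega>)) < \<epsilon>" if \<epsilon>: "0 < \<epsilon>" for \<epsilon>
  proof -
    define e where "e = \<epsilon> / (2 * (b - a + 1))"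
    have e: "0 < e" using ab \<epsilon> by (simp add: e_def)
    from l2proc_mod[OF x e] obtain d where d: "0 < d"
      "\<And>s r. s \<in> {a..b} \<Longrightarrow> r \<in> {a..b} \<Longrightarrow> \<bar>s - r\<bar> < d \<Longrightarrow> nrm M (\<lambda>\<omega>. x s \<omega> - x r \<omega>) \<le> e" by blast
    obtain N where N: "(b - a) / d < real N" using reals_Archimedean2 by blast
    show ?thesis
    proof (intro exI allI impI)
      fix n assume "N \<le> n"
      then have "(b - a) / d < Suc n" using N by linarith
      then have hd: "(b - a) / Suc n < d" using d by (simp add: field_simps)
      have ee: "nrm M (\<lambda>\<omega>. x s \<omega> - x r \<omega>) \<le> e"
        if "s \<in> {a..b}" "r \<in> {a..b}" "\<bar>s - r\<bar> \<le> (b - a) / Suc n" for s r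
        using d(2)[of s r] hd that by simp
      have "(b - a) * e \<le> (b - a + 1) * e" using e by simp
      also have "\<dots> = \<epsilon> / 2" using ab by (simp add: e_def field_simps)
      finally have "(b - a) * e < \<epsilon>" using \<epsilon> by simp
      then show "(\<lambda>\<omega>. integral {a..b} (\<lambda>s. x s \<omega>)) \<in> L2 M \<and>
          nrm M (\<lambda>\<omega>. rsum (\<lambda>s. x s \<omega>) a b (Suc n) - integral {a..b} (\<lambda>s. x s \<omega>)) < \<epsilon>"
        using l2_riemann[OF x ab _ ee, of "Suc n"] nrm_diff_commute[of M "\<lambda>\<omega>. rsum (\<lambda>s. x s \<omega>) a b (Suc n)"]
        by fastforce
    qed
  qed
  show "(\<lambda>\<omega>. integral {a..b} (\<lambda>s. x s \<omega>)) \<in> L2 M" using *[of 1] by auto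
  show "(\<lambda>n. nrm M (\<lambda>\<omega>. rsum (\<lambda>s. x s \<omega>) a b (Suc n) - integral {a..b} (\<lambda>s. x s \<omega>))) \<longlonglongrightarrow> 0"
    by (rule LIMSEQ_I) (use * in force)
qed

lemma ip_continuous_on:
  assumes x: "l2proc M a b x" and \<xi>: "\<xi> \<in> L2 M"
  shows "continuous_on {a..b} (\<lambda>s. ip M \<xi> (x s))"
  unfolding continuous_on_iff
proof (intro ballI allI impI)
  fix s e assume s: "s \<in> {a..b}" and e: "0 < (e::real)"
  define e' where "e' = e / (nrm M \<xi> + 1)"
  have e': "0 < e'" using e by (simp add: e'_def add_nonneg_pos)
  from l2proc_mod[OF x e'] obtain d where d: "0 < d"
    "\<And>s r. s \<in> {a..b} \<Longrightarrow> r \<in> {a..b} \<Longrightarrow> \<bar>s - r\<bar> < d \<Longrightarrow> nrm M (\<lambda>\<omega>. x s \<omega> - x r \<omega>) \<le> e'" by blast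
  show "\<exists>d>0. \<forall>r\<in>{a..b}. dist r s < d \<longrightarrow> dist (ip M \<xi> (x r)) (ip M \<xi> (x s)) < e"
  proof (intro exI conjI ballI impI)
    fix r assume r: "r \<in> {a..b}" "dist r s < d"
    have "\<bar>ip M \<xi> (x r) - ip M \<xi> (x s)\<bar> = \<bar>ip M \<xi> (\<lambda>\<omega>. x r \<omega> - x s \<omega>)\<bar>"
      by (subst ip_diff_right) (auto intro: l2proc_L2[OF x] r s \<xi>)
    also have "\<dots> \<le> nrm M \<xi> * nrm M (\<lambda>\<omega>. x r \<omega> - x s \<omega>)"
      by (intro cauchy_schwarz_ip \<xi> L2_diff l2proc_L2[OF x] r s)
    also have "\<dots> \<le> nrm M \<xi> * e'" using d(2)[of r s] r s by (intro mult_left_mono) (auto simp: dist_real_def)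
    also have "\<dots> < (nrm M \<xi> + 1) * e'" using e' by simp
    also have "\<dots> = e" using nrm_nonneg[of M \<xi>] by (simp add: e'_def add_nonneg_eq_0_iff)
    finally show "dist (ip M \<xi> (x r)) (ip M \<xi> (x s)) < e" by (simp add: dist_real_def)
  qed (fact d)
qed

lemma ip_limit:
  assumes F: "\<And>n. F n \<in> L2 M" "f \<in> L2 M" "(\<lambda>n. nrm M (\<lambda>\<omega>. F n \<omega> - f \<omega>)) \<longlonglongrightarrow> 0" and \<xi>: "\<xi> \<in> L2 M"
  shows "(\<lambda>n. ip M \<xi> (F n)) \<longlonglongrightarrow> ip M \<xi> f"
proof -
  have "(\<lambda>n. ip M \<xi> (F n) - ip M \<xi> f) \<longlonglongrightarrow> 0"
  proof (rule Lim_null_comparison)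
    show "(\<lambda>n. nrm M \<xi> * nrm M (\<lambda>\<omega>. F n \<omega> - f \<omega>)) \<longlonglongrightarrow> 0"
      using tendsto_mult_left[OF F(3), of "nrm M \<xi>"] by simp
    have "norm (ip M \<xi> (F n) - ip M \<xi> f) \<le> nrm M \<xi> * nrm M (\<lambda>\<omega>. F n \<omega> - f \<omega>)" for n
      using cauchy_schwarz_ip[OF \<xi> L2_diff[OF F(1) F(2)]] F \<xi> by (simp add: ip_diff_right)
    then show "\<forall>\<^sub>F n in sequentially. norm (ip M \<xi> (F n) - ip M \<xi> f) \<le> nrm M \<xi> * nrm M (\<lambda>\<omega>. F n \<omega> - f \<omega>)"
      by simp
  qed
  then show ?thesis by (simp add: LIM_zero_iff)
qed

text \<open>Fubini for second moments. Both sides are limits of the same Riemann sums: on the left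
  in mean square, on the right as Riemann sums of a continuous real function.\<close>

lemma ip_integral:
  assumes x: "l2proc M a b x" and ab: "a \<le> b" and \<xi>: "\<xi> \<in> L2 M"
  shows "ip M \<xi> (\<lambda>\<omega>. integral {a..b} (\<lambda>s. x s \<omega>)) = integral {a..b} (\<lambda>s. ip M \<xi> (x s))"
proof -
  have "ip M \<xi> (\<lambda>\<omega>. rsum (\<lambda>s. x s \<omega>) a b (Suc n)) = rsum (\<lambda>s. ip M \<xi> (x s)) a b (Suc n)" for n
  proof -
    have "x (a + real k * ((b - a) / Suc n)) \<in> L2 M" if "k < Suc n" for k
      using that by (intro l2proc_L2[OF x] grid_in[OF ab]) auto
    then show ?thesis unfolding rsum_def ip_cmult_right using \<xi> by (subst ip_sum_right) auto
  qed
  then have "(\<lambda>n. rsum (\<lambda>s. ip M \<xi> (x s)) a b (Suc n)) \<longlonglongrightarrow> ip M \<xi> (\<lambda>\<omega>. integral {a..b} (\<lambda>s. x s \<omega>))"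
    using ip_limit[OF rsum_L2[OF x ab] l2_integral_rsum[OF x ab] \<xi>] by simp
  with rsum_tendsto[OF ab ip_continuous_on[OF x \<xi>]] show ?thesis using LIMSEQ_unique by blast
qed

text \<open>Duality: testing the integral against itself bounds its squared norm by its norm times
  (b - a) C.\<close>

lemma nrm_integral_le:
  assumes x: "l2proc M a b x" and ab: "a \<le> b" and C: "\<And>s. s \<in> {a..b} \<Longrightarrow> nrm M (x s) \<le> C"
  shows "nrm M (\<lambda>\<omega>. integral {a..b} (\<lambda>s. x s \<omega>)) \<le> (b - a) * C"
proof -
  let ?I = "\<lambda>\<omega>. integral {a..b} (\<lambda>s. x s \<omega>)"
  have I: "?I \<in> L2 M" by (rule l2_integral_rsum(1)[OF x ab])
  have "(nrm M ?I)\<^sup>2 = integral {a..b} (\<lambda>s. ip M ?I (x s))"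
    unfolding nrm_square by (rule ip_integral[OF x ab I])
  also have "\<dots> \<le> integral {a..b} (\<lambda>s. nrm M ?I * C)"
  proof (rule integral_le)
    fix s assume s: "s \<in> {a..b}"
    have "ip M ?I (x s) \<le> nrm M ?I * nrm M (x s)"
      using cauchy_schwarz_ip[OF I l2proc_L2[OF x s]] by simp
    also have "\<dots> \<le> nrm M ?I * C" by (intro mult_left_mono C s) simp
    finally show "ip M ?I (x s) \<le> nrm M ?I * C" .
  qed (auto intro!: integrable_continuous_real ip_continuous_on[OF x I])
  also have "\<dots> = nrm M ?I * ((b - a) * C)" using ab by simp
  finally have "nrm M ?I * nrm M ?I \<le> nrm M ?I * ((b - a) * C)" by (simp add: power2_eq_square)
  moreover have "0 \<le> (b - a) * C" using C[of a] ab order_trans[OF nrm_nonneg] by (auto intro!: mult_nonneg_nonneg)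
  ultimately show ?thesis using nrm_nonneg[of M ?I] by (cases "nrm M ?I = 0") auto
qed

lemma l2proc_integral:
  assumes x: "l2proc M a b x"
  shows "l2proc M a b (\<lambda>t \<omega>. integral {a..t} (\<lambda>s. x s \<omega>))"
  unfolding l2proc_def
proof (intro conjI ballI allI impI)
  fix t assume t: "t \<in> {a..b}"
  show "(\<lambda>\<omega>. integral {a..t} (\<lambda>s. x s \<omega>)) \<in> L2 M"
    using t by (intro l2_integral_rsum(1) l2proc_subset[OF x]) auto
next
  fix \<omega> assume "\<omega> \<in> space M"
  then show "continuous_on {a..b} (\<lambda>t. integral {a..t} (\<lambda>s. x s \<omega>))"
    by (intro indefinite_integral_continuous_1 integrable_continuous_real l2proc_cont[OF x])
next
  fix e :: real assume e: "0 < e"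
  obtain C where C: "0 < C" "\<And>s. s \<in> {a..b} \<Longrightarrow> nrm M (x s) \<le> C" using l2proc_bounded[OF x] by blast
  have le: "nrm M (\<lambda>\<omega>. integral {a..t} (\<lambda>s. x s \<omega>) - integral {a..r} (\<lambda>s. x s \<omega>)) \<le> (t - r) * C"
    if "r \<in> {a..b}" "t \<in> {a..b}" "r \<le> t" for r t
  proof -
    have i: "l2proc M r t x" using that by (intro l2proc_subset[OF x]) auto
    have eq: "integral {a..t} (\<lambda>s. x s \<omega>) - integral {a..r} (\<lambda>s. x s \<omega>) = integral {r..t} (\<lambda>s. x s \<omega>)"
      if "\<omega> \<in> space M" for \<omega>
    proof -
      have "continuous_on {a..t} (\<lambda>s. x s \<omega>)"
        using \<open>t \<in> {a..b}\<close> by (intro continuous_on_subset[OF l2proc_cont[OF x that]]) auto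
      from integrable_continuous_real[OF this] show ?thesis
        using Henstock_Kurzweil_Integration.integral_combine[of a r t "\<lambda>s. x s \<omega>"] \<open>r \<in> {a..b}\<close> \<open>r \<le> t\<close>
        by simp
    qed
    have "nrm M (\<lambda>\<omega>. integral {a..t} (\<lambda>s. x s \<omega>) - integral {a..r} (\<lambda>s. x s \<omega>)) =
        nrm M (\<lambda>\<omega>. integral {r..t} (\<lambda>s. x s \<omega>))"
      unfolding nrm_def ip_def using eq by (intro arg_cong[where f = sqrt] Bochner_Integration.integral_cong) auto
    also have "\<dots> \<le> (t - r) * C" using that C by (intro nrm_integral_le[OF i]) auto
    finally show ?thesis .
  qed
  show "\<exists>d>0. \<forall>s\<in>{a..b}. \<forall>r\<in>{a..b}. \<bar>s - r\<bar> < d \<longrightarrow>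
      nrm M (\<lambda>\<omega>. integral {a..s} (\<lambda>s. x s \<omega>) - integral {a..r} (\<lambda>s. x s \<omega>)) \<le> e"
  proof (intro exI[of _ "e / C"] conjI ballI impI)
    fix s r assume sr: "s \<in> {a..b}" "r \<in> {a..b}" "\<bar>s - r\<bar> < e / C"
    have "nrm M (\<lambda>\<omega>. integral {a..s} (\<lambda>s. x s \<omega>) - integral {a..r} (\<lambda>s. x s \<omega>)) \<le> \<bar>s - r\<bar> * C"
      using le[of r s] le[of s r] sr
        nrm_diff_commute[of M "\<lambda>\<omega>. integral {a..s} (\<lambda>s. x s \<omega>)" "\<lambda>\<omega>. integral {a..r} (\<lambda>s. x s \<omega>)"]
      by (cases "r \<le> s") auto
    also have "\<dots> \<le> (e / C) * C" using sr C by (intro mult_right_mono) auto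
    also have "\<dots> = e" using C by simp
    finally show "nrm M (\<lambda>\<omega>. integral {a..s} (\<lambda>s. x s \<omega>) - integral {a..r} (\<lambda>s. x s \<omega>)) \<le> e" .
  qed (use e C in auto)
qed

text \<open>Adaptedness and Gaussianity will both be closed linear conditions; in this form they are
  inherited by time integrals, which are mean-square limits of Riemann sums. Closure also absorbs
  square-integrable modifications on null sets, through constant sequences.\<close>

definition closed_subspace :: "'w measure \<Rightarrow> ('w \<Rightarrow> real) set \<Rightarrow> bool" where
  "closed_subspace M S \<longleftrightarrow> S \<subseteq> L2 M \<and> (\<lambda>_. 0) \<in> S \<and>
    (\<forall>f\<in>S. \<forall>g\<in>S. (\<lambda>\<omega>. f \<omega> + g \<omega>) \<in> S) \<and> (\<forall>c. \<forall>f\<in>S. (\<lambda>\<omega>. c * f \<omega>) \<in> S) \<and>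
    (\<forall>F f. (\<forall>n. F n \<in> S) \<and> f \<in> L2 M \<and> (\<lambda>n. nrm M (\<lambda>\<omega>. F n \<omega> - f \<omega>)) \<longlonglongrightarrow> 0 \<longrightarrow> f \<in> S)"

lemma closed_subspace_sum:
  "closed_subspace M S \<Longrightarrow> (\<And>i. i \<in> I \<Longrightarrow> f i \<in> S) \<Longrightarrow> (\<lambda>\<omega>. \<Sum>i\<in>I. f i \<omega>) \<in> S"
  by (induction I rule: infinite_finite_induct) (auto simp: closed_subspace_def)

lemma closed_subspace_limit:
  assumes "closed_subspace M S" "\<And>n. F n \<in> S" "f \<in> L2 M" "(\<lambda>n. nrm M (\<lambda>\<omega>. F n \<omega> - f \<omega>)) \<longlonglongrightarrow> 0"
  shows "f \<in> S"
proof -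
  have "\<forall>F f. (\<forall>n. F n \<in> S) \<and> f \<in> L2 M \<and> (\<lambda>n. nrm M (\<lambda>\<omega>. F n \<omega> - f \<omega>)) \<longlonglongrightarrow> 0 \<longrightarrow> f \<in> S"
    using assms(1) unfolding closed_subspace_def by (elim conjE)
  from this[THEN spec, of F, THEN spec, of f] show ?thesis using assms(2-4) by simp
qed

lemma closed_subspace_integral:
  assumes S: "closed_subspace M S" and x: "l2proc M a b x" and ab: "a \<le> b"
    and xS: "\<And>s. s \<in> {a..b} \<Longrightarrow> x s \<in> S"
  shows "(\<lambda>\<omega>. integral {a..b} (\<lambda>s. x s \<omega>)) \<in> S"
proof -
  have "(\<lambda>\<omega>. rsum (\<lambda>s. x s \<omega>) a b (Suc n)) \<in> S" for n
  proof -
    have "(\<lambda>\<omega>. \<Sum>k<Suc n. x (a + real k * ((b - a) / Suc n)) \<omega>) \<in> S"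
      by (intro closed_subspace_sum[OF S] xS grid_in ab) auto
    moreover have cm: "(\<lambda>\<omega>. c * f \<omega>) \<in> S" if "f \<in> S" for c f
      using S that by (simp add: closed_subspace_def)
    ultimately show ?thesis unfolding rsum_def by (intro cm)
  qed
  from closed_subspace_limit[OF S this l2_integral_rsum[OF x ab]] show ?thesis .
qed

section \<open>Gaussian processes adapted to two Brownian motions\<close>

lemma cmod_iexp_diff_le: "cmod (iexp x - iexp y) \<le> \<bar>x - y\<bar>"
proof -
  have "iexp x - iexp y = iexp y * (iexp (x - y) - 1)"
    by (simp add: right_diff_distrib algebra_simps flip: exp_add)
  then have "cmod (iexp x - iexp y) = cmod (iexp (x - y) - 1)" by (simp add: norm_mult)
  also have "\<dots> \<le> \<bar>x - y\<bar>" using iexp_approx1[of "x - y" 0] by simp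
  finally show ?thesis .
qed

text \<open>Centered Gaussian laws through the characteristic function: variance 0 is included, and
  the property passes directly to mean-square limits and to sums of independent variables.\<close>

definition gaussian :: "'w measure \<Rightarrow> ('w \<Rightarrow> real) \<Rightarrow> bool" where
  "gaussian M \<xi> \<longleftrightarrow> \<xi> \<in> L2 M \<and> (\<integral>\<omega>. \<xi> \<omega> \<partial>M) = 0 \<and>
    (\<forall>u. char (distr M borel \<xi>) u = exp (- (u\<^sup>2 * ip M \<xi> \<xi>) / 2))"

lemma gaussian_char:
  assumes "gaussian M \<xi>"
  shows "(CLINT \<omega>|M. iexp (u * \<xi> \<omega>)) = exp (- (u\<^sup>2 * ip M \<xi> \<xi>) / 2)"
proof -
  have [measurable]: "\<xi> \<in> borel_measurable M" using assms by (simp add: gaussian_def L2_def)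
  have "char (distr M borel \<xi>) u = (CLINT \<omega>|M. iexp (u * \<xi> \<omega>))"
    unfolding char_def by (subst integral_distr) auto
  then show ?thesis using assms by (simp add: gaussian_def)
qed

context prob_space begin

lemma L2_const: "(\<lambda>_. c) \<in> L2 M" by (simp add: L2_def)

lemma L2_integrable: "f \<in> L2 M \<Longrightarrow> integrable M f"
  using L2_mult_integrable[OF L2_const[of 1]] by simp

lemma integral_abs_le_nrm: "f \<in> L2 M \<Longrightarrow> (\<integral>\<omega>. \<bar>f \<omega>\<bar> \<partial>M) \<le> nrm M f"
proof -
  assume f: "f \<in> L2 M"
  then have af: "(\<lambda>\<omega>. \<bar>f \<omega>\<bar>) \<in> L2 M" by (auto simp: L2_def)
  have "ip M (\<lambda>_. 1) (\<lambda>\<omega>. \<bar>f \<omega>\<bar>) \<le> nrm M (\<lambda>_. 1) * nrm M (\<lambda>\<omega>. \<bar>f \<omega>\<bar>)"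
    using cauchy_schwarz_ip[OF L2_const af, of 1] by simp
  then show ?thesis by (simp add: ip_def nrm_def prob_space)
qed

text \<open>The function \<open>iexp (u * x)\<close> of x is Lipschitz with constant
  \<open>\<bar>u\<bar>\<close>, so characteristic functions converge when the variables converge in
  mean square; the variances converge with the norms.\<close>

lemma gaussian_limit:
  assumes F: "\<And>n. gaussian M (F n)" and f: "f \<in> L2 M"
    and lim: "(\<lambda>n. nrm M (\<lambda>\<omega>. F n \<omega> - f \<omega>)) \<longlonglongrightarrow> 0"
  shows "gaussian M f"
  unfolding gaussian_def
proof (intro conjI allI f)
  have FL: "F n \<in> L2 M" for n using F by (simp add: gaussian_def)
  have "(\<lambda>n. ip M (\<lambda>_. 1) (F n)) \<longlonglongrightarrow> ip M (\<lambda>_. 1) f"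
    by (rule ip_limit[OF FL f lim L2_const])
  moreover have "ip M (\<lambda>_. 1) (F n) = 0" for n using F by (simp add: gaussian_def ip_def)
  ultimately show "(\<integral>\<omega>. f \<omega> \<partial>M) = 0"
    by (simp add: ip_def) (use LIMSEQ_unique tendsto_const in blast)
  fix u
  have "(\<lambda>n. nrm M (F n) - nrm M f) \<longlonglongrightarrow> 0"
    by (rule Lim_null_comparison[OF _ lim]) (simp add: abs_nrm_diff[OF FL f])
  then have "(\<lambda>n. nrm M (F n)) \<longlonglongrightarrow> nrm M f" by (simp add: LIM_zero_iff)
  then have "(\<lambda>n. (nrm M (F n))\<^sup>2) \<longlonglongrightarrow> (nrm M f)\<^sup>2" by (intro tendsto_intros)
  then have 1: "(\<lambda>n. complex_of_real (exp (- (u\<^sup>2 * ip M (F n) (F n)) / 2))) \<longlonglongrightarrow> exp (- (u\<^sup>2 * ip M f f) / 2)"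
    unfolding nrm_square by (intro tendsto_intros) simp_all
  have mf [measurable]: "f \<in> borel_measurable M" "F n \<in> borel_measurable M" for n
    using f FL by (simp_all add: L2_def)
  have int: "complex_integrable M (\<lambda>\<omega>. iexp (u * g \<omega>))" if [measurable]: "g \<in> borel_measurable M" for g
    by (rule integrable_const_bound[where B = 1]) auto
  have "cmod ((CLINT \<omega>|M. iexp (u * F n \<omega>)) - (CLINT \<omega>|M. iexp (u * f \<omega>))) \<le> \<bar>u\<bar> * nrm M (\<lambda>\<omega>. F n \<omega> - f \<omega>)" for n
  proof -
    have "cmod ((CLINT \<omega>|M. iexp (u * F n \<omega>)) - (CLINT \<omega>|M. iexp (u * f \<omega>))) =
        cmod (CLINT \<omega>|M. iexp (u * F n \<omega>) - iexp (u * f \<omega>))"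
      by (simp only: Bochner_Integration.integral_diff[OF int[OF mf(2)] int[OF mf(1)]])
    also have "\<dots> \<le> (\<integral>\<omega>. cmod (iexp (u * F n \<omega>) - iexp (u * f \<omega>)) \<partial>M)" by (rule integral_norm_bound)
    also have "\<dots> \<le> (\<integral>\<omega>. \<bar>u\<bar> * \<bar>F n \<omega> - f \<omega>\<bar> \<partial>M)"
    proof (rule integral_mono)
      show "integrable M (\<lambda>\<omega>. cmod (iexp (u * F n \<omega>) - iexp (u * f \<omega>)))"
        by (intro integrable_norm Bochner_Integration.integrable_diff int mf)
      show "integrable M (\<lambda>\<omega>. \<bar>u\<bar> * \<bar>F n \<omega> - f \<omega>\<bar>)"
        using L2_integrable[OF L2_diff[OF FL f]] by (intro integrable_mult_right integrable_abs)
      fix \<omega>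
      show "cmod (iexp (u * F n \<omega>) - iexp (u * f \<omega>)) \<le> \<bar>u\<bar> * \<bar>F n \<omega> - f \<omega>\<bar>"
        using cmod_iexp_diff_le[of "u * F n \<omega>" "u * f \<omega>"] by (simp add: abs_mult flip: right_diff_distrib)
    qed
    also have "\<dots> \<le> \<bar>u\<bar> * nrm M (\<lambda>\<omega>. F n \<omega> - f \<omega>)"
      using integral_abs_le_nrm[OF L2_diff[OF FL f]] by (simp add: mult_left_mono)
    finally show ?thesis .
  qed
  then have "(\<lambda>n. (CLINT \<omega>|M. iexp (u * F n \<omega>)) - (CLINT \<omega>|M. iexp (u * f \<omega>))) \<longlonglongrightarrow> 0"
    by (intro Lim_null_comparison[OF always_eventually tendsto_mult_right_zero[OF lim, of "\<bar>u\<bar>"]] allI)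
  then have "(\<lambda>n. CLINT \<omega>|M. iexp (u * F n \<omega>)) \<longlonglongrightarrow> (CLINT \<omega>|M. iexp (u * f \<omega>))"
    by (simp add: LIM_zero_iff)
  then have "(CLINT \<omega>|M. iexp (u * f \<omega>)) = exp (- (u\<^sup>2 * ip M f f) / 2)"
    using 1 unfolding gaussian_char[OF F] by (rule LIMSEQ_unique)
  moreover have "char (distr M borel f) u = (CLINT \<omega>|M. iexp (u * f \<omega>))"
    unfolding char_def by (subst integral_distr) auto
  ultimately show "char (distr M borel f) u = exp (- (u\<^sup>2 * ip M f f) / 2)" by simp
qed

end

section \<open>Time derivatives of second moments\<close>

lemma nrm_cong: "(\<And>\<omega>. \<omega> \<in> space M \<Longrightarrow> f \<omega> = g \<omega>) \<Longrightarrow> nrm M f = nrm M g"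
  unfolding nrm_def ip_def by (intro arg_cong[where f = sqrt] Bochner_Integration.integral_cong) auto

lemma ip_cong: "(\<And>\<omega>. \<omega> \<in> space M \<Longrightarrow> f \<omega> = f' \<omega>) \<Longrightarrow> (\<And>\<omega>. \<omega> \<in> space M \<Longrightarrow> g \<omega> = g' \<omega>) \<Longrightarrow>
    ip M f g = ip M f' g'"
  unfolding ip_def by (intro Bochner_Integration.integral_cong) auto

lemma L2_cong:
  assumes "f \<in> L2 M" "\<And>\<omega>. \<omega> \<in> space M \<Longrightarrow> f \<omega> = g \<omega>" shows "g \<in> L2 M"
proof -
  have "f \<in> borel_measurable M \<longleftrightarrow> g \<in> borel_measurable M" using assms(2) by (rule measurable_cong)
  moreover have "integrable M (\<lambda>\<omega>. (f \<omega>)\<^sup>2) \<longleftrightarrow> integrable M (\<lambda>\<omega>. (g \<omega>)\<^sup>2)"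
    using assms(2) by (intro Bochner_Integration.integrable_cong) auto
  ultimately show ?thesis using assms(1) by (simp add: L2_def)
qed

lemma closed_subspace_L2: "closed_subspace M S \<Longrightarrow> f \<in> S \<Longrightarrow> f \<in> L2 M"
  by (auto simp: closed_subspace_def)

lemma closed_subspace_cong:
  assumes S: "closed_subspace M S" and f: "f \<in> S" and eq: "\<And>\<omega>. \<omega> \<in> space M \<Longrightarrow> f \<omega> = g \<omega>"
  shows "g \<in> S"
proof (rule closed_subspace_limit[OF S, of "\<lambda>_. f"])
  show "g \<in> L2 M" by (rule L2_cong[OF closed_subspace_L2[OF S f] eq])
  have "nrm M (\<lambda>\<omega>. f \<omega> - g \<omega>) = nrm M (\<lambda>_. 0)" by (rule nrm_cong) (simp add: eq)
  then show "(\<lambda>_. nrm M (\<lambda>\<omega>. f \<omega> - g \<omega>)) \<longlonglongrightarrow> 0" by simp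
qed (rule f)

lemma closed_subspace_add: "closed_subspace M S \<Longrightarrow> f \<in> S \<Longrightarrow> g \<in> S \<Longrightarrow> (\<lambda>\<omega>. f \<omega> + g \<omega>) \<in> S"
  by (auto simp: closed_subspace_def)

lemma closed_subspace_cmult: "closed_subspace M S \<Longrightarrow> f \<in> S \<Longrightarrow> (\<lambda>\<omega>. c * f \<omega>) \<in> S"
  by (auto simp: closed_subspace_def)

lemma ip_joint_continuous:
  assumes x: "l2proc M a b x" and y: "l2proc M a b y" and e: "0 < (e::real)"
  obtains d where "0 < d" "\<And>r s r' s'. r \<in> {a..b} \<Longrightarrow> r' \<in> {a..b} \<Longrightarrow> s \<in> {a..b} \<Longrightarrow> s' \<in> {a..b} \<Longrightarrow>
      \<bar>r - r'\<bar> < d \<Longrightarrow> \<bar>s - s'\<bar> < d \<Longrightarrow> \<bar>ip M (x r) (y s) - ip M (x r') (y s')\<bar> \<le> e"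
proof -
  obtain C where C: "0 < C" "\<And>s. s \<in> {a..b} \<Longrightarrow> nrm M (x s) \<le> C" using l2proc_bounded[OF x] by blast
  obtain K where K: "0 < K" "\<And>s. s \<in> {a..b} \<Longrightarrow> nrm M (y s) \<le> K" using l2proc_bounded[OF y] by blast
  have "0 < e / (2 * K)" using e K by simp
  from l2proc_mod[OF x this] obtain d1 where d1: "0 < d1"
    "\<And>s r. s \<in> {a..b} \<Longrightarrow> r \<in> {a..b} \<Longrightarrow> \<bar>s - r\<bar> < d1 \<Longrightarrow> nrm M (\<lambda>\<omega>. x s \<omega> - x r \<omega>) \<le> e / (2 * K)" by blast
  have "0 < e / (2 * C)" using e C by simp
  from l2proc_mod[OF y this] obtain d2 where d2: "0 < d2"
    "\<And>s r. s \<in> {a..b} \<Longrightarrow> r \<in> {a..b} \<Longrightarrow> \<bar>s - r\<bar> < d2 \<Longrightarrow> nrm M (\<lambda>\<omega>. y s \<omega> - y r \<omega>) \<le> e / (2 * C)" by blast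
  show thesis
  proof (rule that[of "min d1 d2"])
    fix r s r' s' assume *: "r \<in> {a..b}" "r' \<in> {a..b}" "s \<in> {a..b}" "s' \<in> {a..b}"
      "\<bar>r - r'\<bar> < min d1 d2" "\<bar>s - s'\<bar> < min d1 d2"
    note L = l2proc_L2[OF x] l2proc_L2[OF y]
    have "\<bar>ip M (x r) (y s) - ip M (x r') (y s')\<bar> =
        \<bar>ip M (\<lambda>\<omega>. x r \<omega> - x r' \<omega>) (y s) + ip M (x r') (\<lambda>\<omega>. y s \<omega> - y s' \<omega>)\<bar>"
      using * L by (simp add: ip_diff_left ip_diff_right)
    also have "\<dots> \<le> nrm M (\<lambda>\<omega>. x r \<omega> - x r' \<omega>) * nrm M (y s) + nrm M (x r') * nrm M (\<lambda>\<omega>. y s \<omega> - y s' \<omega>)"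
      using * L by (intro order_trans[OF abs_triangle_ineq] add_mono cauchy_schwarz_ip L2_diff)
    also have "\<dots> \<le> e / (2 * K) * K + C * (e / (2 * C))"
      using * d1 d2 C K e by (intro add_mono mult_mono) auto
    also have "\<dots> = e" using C K by simp
    finally show "\<bar>ip M (x r) (y s) - ip M (x r') (y s')\<bar> \<le> e" .
  qed (use d1 d2 in auto)
qed

lemma integral_approx_const:
  fixes g :: "real \<Rightarrow> real"
  assumes "s \<le> t" "continuous_on {s..t} g" "\<And>r. r \<in> {s..t} \<Longrightarrow> \<bar>g r - c\<bar> \<le> e"
  shows "\<bar>integral {s..t} g - (t - s) * c\<bar> \<le> (t - s) * e"
proof -
  have gi: "g integrable_on {s..t}" by (intro integrable_continuous_real assms)
  have "integral {s..t} g - (t - s) * c = integral {s..t} (\<lambda>r. g r - c)"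
    using assms(1) by (subst integral_diff[OF gi]) auto
  also have "norm \<dots> \<le> integral {s..t} (\<lambda>r. e)"
    using assms(3) by (intro integral_norm_bound_integral integrable_diff gi) auto
  also have "\<dots> = (t - s) * e" using assms(1) by simp
  finally show ?thesis by simp
qed

text \<open>The increment of \<open>ip M (x t) (y t)\<close> from s to t is y(t) against the
  increment of x plus x(s) against the increment of y. Hence the asymmetry of the two drift
  hypotheses: the drift of x is tested with the later y(t), as suits a process of finite variation,
  that of y only with the earlier x(s), so that y may carry noise orthogonal to the past.\<close>

lemma ip_product_rule:
  assumes x: "l2proc M a b x" and u: "l2proc M a b u" and y: "l2proc M a b y" and v: "l2proc M a b v"
    and x_drift: "\<And>s t. a \<le> s \<Longrightarrow> s \<le> t \<Longrightarrow> t \<le> b \<Longrightarrow>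
        ip M (y t) (x t) - ip M (y t) (x s) = integral {s..t} (\<lambda>r. ip M (y t) (u r))"
    and y_drift: "\<And>s t. a \<le> s \<Longrightarrow> s \<le> t \<Longrightarrow> t \<le> b \<Longrightarrow>
        ip M (x s) (y t) - ip M (x s) (y s) = integral {s..t} (\<lambda>r. ip M (x s) (v r))"
    and t0: "t0 \<in> {a..b}"
  shows "((\<lambda>t. ip M (x t) (y t)) has_real_derivative ip M (u t0) (y t0) + ip M (x t0) (v t0)) (at t0 within {a..b})"
proof -
  define \<phi> where "\<phi> t = ip M (x t) (y t)" for t
  define A B where "A = ip M (u t0) (y t0)" and "B = ip M (x t0) (v t0)"
  have incr: "\<phi> t - \<phi> s = integral {s..t} (\<lambda>r. ip M (y t) (u r)) + integral {s..t} (\<lambda>r. ip M (x s) (v r))"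
    if "a \<le> s" "s \<le> t" "t \<le> b" for s t
    using x_drift[OF that] y_drift[OF that] by (simp add: \<phi>_def ip_commute)
  show ?thesis
    unfolding has_field_derivative_iff \<phi>_def[symmetric] A_def[symmetric] B_def[symmetric]
  proof (rule tendstoI)
    fix e :: real assume "0 < e"
    then have e3: "0 < e / 3" by simp
    from ip_joint_continuous[OF u y e3] obtain d1 where d1: "0 < d1"
      "\<And>r s r' s'. r \<in> {a..b} \<Longrightarrow> r' \<in> {a..b} \<Longrightarrow> s \<in> {a..b} \<Longrightarrow> s' \<in> {a..b} \<Longrightarrow>
      \<bar>r - r'\<bar> < d1 \<Longrightarrow> \<bar>s - s'\<bar> < d1 \<Longrightarrow> \<bar>ip M (u r) (y s) - ip M (u r') (y s')\<bar> \<le> e / 3" by blast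
    from ip_joint_continuous[OF x v e3] obtain d2 where d2: "0 < d2"
      "\<And>r s r' s'. r \<in> {a..b} \<Longrightarrow> r' \<in> {a..b} \<Longrightarrow> s \<in> {a..b} \<Longrightarrow> s' \<in> {a..b} \<Longrightarrow>
      \<bar>r - r'\<bar> < d2 \<Longrightarrow> \<bar>s - s'\<bar> < d2 \<Longrightarrow> \<bar>ip M (x r) (v s) - ip M (x r') (v s')\<bar> \<le> e / 3" by blast
    \<comment> \<open>With s and t on either side of \<open>t0\<close>, a single estimate serves
      both one-sided difference quotients.\<close>
    have near: "\<bar>(\<phi> t - \<phi> s) - (t - s) * (A + B)\<bar> \<le> (t - s) * (2 * e / 3)"
      if st: "a \<le> s" "s \<le> t0" "t0 \<le> t" "t \<le> b" "t - s < min d1 d2" for s t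
    proof -
      have ab: "s \<in> {a..b}" "t \<in> {a..b}" "s \<le> t" using st by auto
      have "\<bar>integral {s..t} (\<lambda>r. ip M (y t) (u r)) - (t - s) * A\<bar> \<le> (t - s) * (e / 3)"
      proof (rule integral_approx_const[OF ab(3)])
        show "continuous_on {s..t} (\<lambda>r. ip M (y t) (u r))"
          using st by (intro continuous_on_subset[OF ip_continuous_on[OF u l2proc_L2[OF y ab(2)]]]) auto
        fix r assume "r \<in> {s..t}"
        then show "\<bar>ip M (y t) (u r) - A\<bar> \<le> e / 3"
          unfolding A_def ip_commute[of M "y t"] using st t0 by (intro d1) auto
      qed
      moreover have "\<bar>integral {s..t} (\<lambda>r. ip M (x s) (v r)) - (t - s) * B\<bar> \<le> (t - s) * (e / 3)"
      proof (rule integral_approx_const[OF ab(3)])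
        show "continuous_on {s..t} (\<lambda>r. ip M (x s) (v r))"
          using st by (intro continuous_on_subset[OF ip_continuous_on[OF v l2proc_L2[OF x ab(1)]]]) auto
        fix r assume "r \<in> {s..t}"
        then show "\<bar>ip M (x s) (v r) - B\<bar> \<le> e / 3"
          unfolding B_def using st t0 by (intro d2) auto
      qed
      moreover have "(t - s) * (A + B) = (t - s) * A + (t - s) * B"
        "(t - s) * (2 * e / 3) = (t - s) * (e / 3) + (t - s) * (e / 3)"
        by (simp_all add: algebra_simps)
      ultimately show ?thesis using incr[OF st(1) ab(3) st(4)] by linarith
    qed
    have "dist ((\<phi> t - \<phi> t0) / (t - t0)) (A + B) < e"
      if t: "t \<in> {a..b}" "t \<noteq> t0" "\<bar>t - t0\<bar> < min d1 d2" for t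
    proof -
      have *: "\<bar>(\<phi> t - \<phi> t0) - (t - t0) * (A + B)\<bar> \<le> \<bar>t - t0\<bar> * (2 * e / 3)"
      proof (cases "t0 \<le> t")
        case True
        then show ?thesis using near[of t0 t] t t0 by auto
      next
        case False
        then have "\<bar>(\<phi> t0 - \<phi> t) - (t0 - t) * (A + B)\<bar> \<le> (t0 - t) * (2 * e / 3)"
          using near[of t t0] t t0 by auto
        moreover have "(\<phi> t0 - \<phi> t) - (t0 - t) * (A + B) = - ((\<phi> t - \<phi> t0) - (t - t0) * (A + B))"
          by (simp add: algebra_simps)
        moreover have "\<bar>t - t0\<bar> = t0 - t" using False by simp
        ultimately show ?thesis by (simp only: abs_minus_cancel)
      qed
      have "(\<phi> t - \<phi> t0) / (t - t0) - (A + B) = ((\<phi> t - \<phi> t0) - (t - t0) * (A + B)) / (t - t0)"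
        using t by (simp add: field_simps)
      then have "dist ((\<phi> t - \<phi> t0) / (t - t0)) (A + B) = \<bar>(\<phi> t - \<phi> t0) - (t - t0) * (A + B)\<bar> / \<bar>t - t0\<bar>"
        by (simp add: dist_real_def)
      also have "\<dots> \<le> 2 * e / 3" using * t by (simp add: pos_divide_le_eq mult.commute)
      also have "\<dots> < e" using \<open>0 < e\<close> by simp
      finally show ?thesis .
    qed
    then show "\<forall>\<^sub>F t in at t0 within {a..b}. dist ((\<phi> t - \<phi> t0) / (t - t0)) (A + B) < e"
      unfolding eventually_at using d1 d2 by (intro exI[of _ "min d1 d2"]) (auto simp: dist_real_def)
  qed
qed

lemma has_real_derivative_transform:
  assumes "(f has_real_derivative D) (at t within S)" "t \<in> S" "\<And>s. s \<in> S \<Longrightarrow> g s = f s" "D = D'"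
  shows "(g has_real_derivative D') (at t within S)"
  using has_derivative_transform[of t S g f "(*) D"] assms by (simp add: has_field_derivative_def)

lemma closed_subspace_Int:
  assumes S: "closed_subspace M S" and S': "closed_subspace M S'"
  shows "closed_subspace M (S \<inter> S')"
  unfolding closed_subspace_def
proof (intro conjI ballI allI impI)
  fix F f assume *: "(\<forall>n. F n \<in> S \<inter> S') \<and> f \<in> L2 M \<and> (\<lambda>n. nrm M (\<lambda>\<omega>. F n \<omega> - f \<omega>)) \<longlonglongrightarrow> 0"
  then show "f \<in> S \<inter> S'"
    using closed_subspace_limit[OF S, of F f] closed_subspace_limit[OF S', of F f] by simp
next
  fix f g assume "f \<in> S \<inter> S'" "g \<in> S \<inter> S'"
  then show "(\<lambda>\<omega>. f \<omega> + g \<omega>) \<in> S \<inter> S'"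
    using closed_subspace_add[OF S, of f g] closed_subspace_add[OF S', of f g] by simp
next
  fix c f assume "f \<in> S \<inter> S'"
  then show "(\<lambda>\<omega>. c * f \<omega>) \<in> S \<inter> S'"
    using closed_subspace_cmult[OF S, of f c] closed_subspace_cmult[OF S', of f c] by simp
next
  show "S \<inter> S' \<subseteq> L2 M" using S by (auto simp: closed_subspace_def)
  show "(\<lambda>_. 0) \<in> S \<inter> S'" using S S' by (simp add: closed_subspace_def)
qed

text \<open>The second-order content of a Gaussian initial value and two independent Brownian
  motions: covariances, and joint Gaussianity of the increments on grids. In the filtering model
  \<open>False\<close> indexes the noise of the observation. Path properties are asked at every
  sample point. Grid points have the literal shape used in \<open>grid_in\<close> and
  \<open>rsum\<close>.\<close>

locale gauss_base = prob_space M for M :: "'w measure" +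
  fixes T :: real and X0 :: "'w \<Rightarrow> real" and B :: "bool \<Rightarrow> real \<Rightarrow> 'w \<Rightarrow> real"
  assumes T: "0 < T"
    and X0_L2: "X0 \<in> L2 M"
    and B_L2: "\<And>j t. t \<in> {0..T} \<Longrightarrow> B j t \<in> L2 M"
    and B_cont: "\<And>j \<omega>. \<omega> \<in> space M \<Longrightarrow> continuous_on {0..T} (\<lambda>t. B j t \<omega>)"
    and B_zero: "\<And>j \<omega>. \<omega> \<in> space M \<Longrightarrow> B j 0 \<omega> = 0"
    and B_cov: "\<And>i j s t. s \<in> {0..T} \<Longrightarrow> t \<in> {0..T} \<Longrightarrow> ip M (B i s) (B j t) = (if i = j then min s t else 0)"
    and X0_B: "\<And>j t. t \<in> {0..T} \<Longrightarrow> ip M X0 (B j t) = 0"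
    and elementary_gaussian: "\<And>n c d. gaussian M (\<lambda>\<omega>. c * X0 \<omega> + (\<Sum>j\<in>UNIV. \<Sum>k<Suc n. d j k *
          (B j (0 + real (Suc k) * ((T - 0) / Suc n)) \<omega> - B j (0 + real k * ((T - 0) / Suc n)) \<omega>)))"
begin

definition grid :: "nat \<Rightarrow> ('w \<Rightarrow> real) set" where
  "grid n = {(\<lambda>\<omega>. c * X0 \<omega> + (\<Sum>j\<in>UNIV. \<Sum>k<Suc n. d j k *
      (B j (0 + real (Suc k) * ((T - 0) / Suc n)) \<omega> - B j (0 + real k * ((T - 0) / Suc n)) \<omega>))) | c d. True}"

text \<open>The Gaussian space of the noise, as the closure of the combinations on grids. Grids of
  different n are not nested, so approximation is asked for all n from some N on; two elements then
  have approximants on a common grid, and sums stay in the span.\<close>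

definition gspan :: "('w \<Rightarrow> real) set" where
  "gspan = {\<xi> \<in> L2 M. \<forall>e>0. \<exists>N. \<forall>n\<ge>N. \<exists>\<zeta>\<in>grid n. nrm M (\<lambda>\<omega>. \<xi> \<omega> - \<zeta> \<omega>) \<le> e}"

text \<open>Orthogonality to the increments of both motions after s: the linear counterpart of
  measurability with respect to the past of s, and evidently a closed condition.\<close>

definition past :: "real \<Rightarrow> ('w \<Rightarrow> real) set" where
  "past s = {\<xi> \<in> L2 M. \<forall>j. \<forall>t\<in>{s..T}. ip M \<xi> (B j t) = ip M \<xi> (B j s)}"

definition hist :: "real \<Rightarrow> ('w \<Rightarrow> real) set" where
  "hist s = gspan \<inter> past s"

lemma T0: "0 \<le> T" using T by simp

lemma past_L2: "\<xi> \<in> past s \<Longrightarrow> \<xi> \<in> L2 M" by (simp add: past_def)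

lemma pastD: "\<xi> \<in> past s \<Longrightarrow> t \<in> {s..T} \<Longrightarrow> ip M \<xi> (B j t) = ip M \<xi> (B j s)"
  unfolding past_def by blast

lemma pastI: "\<xi> \<in> L2 M \<Longrightarrow> (\<And>j t. t \<in> {s..T} \<Longrightarrow> ip M \<xi> (B j t) = ip M \<xi> (B j s)) \<Longrightarrow> \<xi> \<in> past s"
  unfolding past_def by blast

lemma grid_point: "k \<le> Suc n \<Longrightarrow> 0 + real k * ((T - 0) / Suc n) \<in> {0..T}"
  by (intro grid_in T0) auto

lemma grid_gaussian: "\<zeta> \<in> grid n \<Longrightarrow> gaussian M \<zeta>"
  unfolding grid_def using elementary_gaussian by blast

lemma grid_L2: "\<zeta> \<in> grid n \<Longrightarrow> \<zeta> \<in> L2 M"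
  using grid_gaussian by (auto simp: gaussian_def)

lemma grid_add:
  assumes "\<zeta> \<in> grid n" "\<eta> \<in> grid n" shows "(\<lambda>\<omega>. \<zeta> \<omega> + \<eta> \<omega>) \<in> grid n"
proof -
  from assms obtain c d c' d' where
    "\<zeta> = (\<lambda>\<omega>. c * X0 \<omega> + (\<Sum>j\<in>UNIV. \<Sum>k<Suc n. d j k *
      (B j (0 + real (Suc k) * ((T - 0) / Suc n)) \<omega> - B j (0 + real k * ((T - 0) / Suc n)) \<omega>)))"
    "\<eta> = (\<lambda>\<omega>. c' * X0 \<omega> + (\<Sum>j\<in>UNIV. \<Sum>k<Suc n. d' j k *
      (B j (0 + real (Suc k) * ((T - 0) / Suc n)) \<omega> - B j (0 + real k * ((T - 0) / Suc n)) \<omega>)))"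
    unfolding grid_def by blast
  then have "(\<lambda>\<omega>. \<zeta> \<omega> + \<eta> \<omega>) = (\<lambda>\<omega>. (c + c') * X0 \<omega> + (\<Sum>j\<in>UNIV. \<Sum>k<Suc n. (d j k + d' j k) *
      (B j (0 + real (Suc k) * ((T - 0) / Suc n)) \<omega> - B j (0 + real k * ((T - 0) / Suc n)) \<omega>)))"
    by (simp only: distrib_right sum.distrib add_ac)
  then show ?thesis unfolding grid_def by (intro CollectI exI[of _ "c + c'"] exI[of _ "\<lambda>j k. d j k + d' j k"] conjI TrueI)
qed

lemma grid_cmult:
  assumes "\<zeta> \<in> grid n" shows "(\<lambda>\<omega>. a * \<zeta> \<omega>) \<in> grid n"
proof -
  from assms obtain c d where
    "\<zeta> = (\<lambda>\<omega>. c * X0 \<omega> + (\<Sum>j\<in>UNIV. \<Sum>k<Suc n. d j k *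
      (B j (0 + real (Suc k) * ((T - 0) / Suc n)) \<omega> - B j (0 + real k * ((T - 0) / Suc n)) \<omega>)))"
    unfolding grid_def by blast
  then have "(\<lambda>\<omega>. a * \<zeta> \<omega>) = (\<lambda>\<omega>. (a * c) * X0 \<omega> + (\<Sum>j\<in>UNIV. \<Sum>k<Suc n. (a * d j k) *
      (B j (0 + real (Suc k) * ((T - 0) / Suc n)) \<omega> - B j (0 + real k * ((T - 0) / Suc n)) \<omega>)))"
    by (simp only: distrib_left sum_distrib_left mult.assoc)
  then show ?thesis unfolding grid_def by (intro CollectI exI[of _ "a * c"] exI[of _ "\<lambda>j k. a * d j k"] conjI TrueI)
qed

lemma X0_grid: "X0 \<in> grid n"
  unfolding grid_def by (intro CollectI exI[of _ 1] exI[of _ "\<lambda>_ _. 0"]) simp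

lemma gspanI:
  assumes "\<xi> \<in> L2 M" "\<And>e. 0 < e \<Longrightarrow> \<exists>N. \<forall>n\<ge>N. \<exists>\<zeta>\<in>grid n. nrm M (\<lambda>\<omega>. \<xi> \<omega> - \<zeta> \<omega>) \<le> e"
  shows "\<xi> \<in> gspan"
  using assms by (simp add: gspan_def)

lemma gspanD:
  assumes "\<xi> \<in> gspan" "0 < e"
  obtains N where "\<And>n. N \<le> n \<Longrightarrow> \<exists>\<zeta>\<in>grid n. nrm M (\<lambda>\<omega>. \<xi> \<omega> - \<zeta> \<omega>) \<le> e"
  using assms unfolding gspan_def by blast

lemma gspan_L2: "\<xi> \<in> gspan \<Longrightarrow> \<xi> \<in> L2 M" by (simp add: gspan_def)

lemma grid_subset_gspan:
  assumes "\<And>n. \<xi> \<in> grid n" shows "\<xi> \<in> gspan"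
proof (rule gspanI)
  show "\<xi> \<in> L2 M" using grid_L2[OF assms[of 0]] .
  fix e :: real assume "0 < e"
  then show "\<exists>N. \<forall>n\<ge>N. \<exists>\<zeta>\<in>grid n. nrm M (\<lambda>\<omega>. \<xi> \<omega> - \<zeta> \<omega>) \<le> e"
    using assms by (intro exI[of _ 0] allI impI bexI[of _ \<xi>]) auto
qed

lemma closed_subspace_gspan: "closed_subspace M gspan"
  unfolding closed_subspace_def
proof (intro conjI ballI allI impI)
  show "gspan \<subseteq> L2 M" by (auto simp: gspan_def)
  show "(\<lambda>_. 0) \<in> gspan"
    using grid_cmult[OF X0_grid, of 0] by (intro grid_subset_gspan) simp
next
  fix f g assume f: "f \<in> gspan" and g: "g \<in> gspan"
  show "(\<lambda>\<omega>. f \<omega> + g \<omega>) \<in> gspan"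
  proof (rule gspanI)
    show "(\<lambda>\<omega>. f \<omega> + g \<omega>) \<in> L2 M" using f g by (intro L2_add gspan_L2)
    fix e :: real assume "0 < e"
    then have e2: "0 < e / 2" by simp
    from gspanD[OF f e2] obtain N1 where N1: "\<And>n. N1 \<le> n \<Longrightarrow> \<exists>\<zeta>\<in>grid n. nrm M (\<lambda>\<omega>. f \<omega> - \<zeta> \<omega>) \<le> e / 2" by blast
    from gspanD[OF g e2] obtain N2 where N2: "\<And>n. N2 \<le> n \<Longrightarrow> \<exists>\<zeta>\<in>grid n. nrm M (\<lambda>\<omega>. g \<omega> - \<zeta> \<omega>) \<le> e / 2" by blast
    show "\<exists>N. \<forall>n\<ge>N. \<exists>\<zeta>\<in>grid n. nrm M (\<lambda>\<omega>. f \<omega> + g \<omega> - \<zeta> \<omega>) \<le> e"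
    proof (intro exI allI impI)
      fix n assume "max N1 N2 \<le> n"
      then obtain \<zeta> \<eta> where z: "\<zeta> \<in> grid n" "nrm M (\<lambda>\<omega>. f \<omega> - \<zeta> \<omega>) \<le> e / 2"
        "\<eta> \<in> grid n" "nrm M (\<lambda>\<omega>. g \<omega> - \<eta> \<omega>) \<le> e / 2" using N1[of n] N2[of n] by auto
      have "nrm M (\<lambda>\<omega>. (f \<omega> - \<zeta> \<omega>) + (g \<omega> - \<eta> \<omega>)) \<le> e / 2 + e / 2"
        using z f g by (intro order_trans[OF nrm_add] add_mono L2_diff gspan_L2 grid_L2)
      then have "nrm M (\<lambda>\<omega>. f \<omega> + g \<omega> - (\<zeta> \<omega> + \<eta> \<omega>)) \<le> e" by (simp add: algebra_simps)
      then show "\<exists>\<zeta>\<in>grid n. nrm M (\<lambda>\<omega>. f \<omega> + g \<omega> - \<zeta> \<omega>) \<le> e"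
        by (rule bexI[of _ "\<lambda>\<omega>. \<zeta> \<omega> + \<eta> \<omega>"]) (intro grid_add z)
    qed
  qed
next
  fix c f assume f: "f \<in> gspan"
  show "(\<lambda>\<omega>. c * f \<omega>) \<in> gspan"
  proof (rule gspanI)
    show "(\<lambda>\<omega>. c * f \<omega>) \<in> L2 M" using f by (intro L2_cmult gspan_L2)
    fix e :: real assume e: "0 < e"
    then have "0 < e / (\<bar>c\<bar> + 1)" by simp
    from gspanD[OF f this] obtain N where N: "\<And>n. N \<le> n \<Longrightarrow> \<exists>\<zeta>\<in>grid n. nrm M (\<lambda>\<omega>. f \<omega> - \<zeta> \<omega>) \<le> e / (\<bar>c\<bar> + 1)" by blast
    show "\<exists>N. \<forall>n\<ge>N. \<exists>\<zeta>\<in>grid n. nrm M (\<lambda>\<omega>. c * f \<omega> - \<zeta> \<omega>) \<le> e"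
    proof (intro exI allI impI)
      fix n assume "N \<le> n"
      then obtain \<zeta> where z: "\<zeta> \<in> grid n" "nrm M (\<lambda>\<omega>. f \<omega> - \<zeta> \<omega>) \<le> e / (\<bar>c\<bar> + 1)" using N[of n] by auto
      have "nrm M (\<lambda>\<omega>. c * (f \<omega> - \<zeta> \<omega>)) \<le> \<bar>c\<bar> * (e / (\<bar>c\<bar> + 1))"
        unfolding nrm_cmult by (intro mult_left_mono z) simp
      also have "\<dots> \<le> e" using e by (simp add: field_simps)
      finally have "nrm M (\<lambda>\<omega>. c * f \<omega> - c * \<zeta> \<omega>) \<le> e" by (simp add: right_diff_distrib)
      then show "\<exists>\<zeta>\<in>grid n. nrm M (\<lambda>\<omega>. c * f \<omega> - \<zeta> \<omega>) \<le> e"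
        by (rule bexI[of _ "\<lambda>\<omega>. c * \<zeta> \<omega>"]) (intro grid_cmult z)
    qed
  qed
next
  fix F f assume *: "(\<forall>n. F n \<in> gspan) \<and> f \<in> L2 M \<and> (\<lambda>n. nrm M (\<lambda>\<omega>. F n \<omega> - f \<omega>)) \<longlonglongrightarrow> 0"
  show "f \<in> gspan"
  proof (rule gspanI)
    show fL: "f \<in> L2 M" using * by simp
    fix e :: real assume e: "0 < e"
    then have e2: "0 < e / 2" by simp
    from * e2 have "\<forall>\<^sub>F n in sequentially. nrm M (\<lambda>\<omega>. F n \<omega> - f \<omega>) < e / 2"
      using order_tendstoD(2) by blast
    then obtain m where m: "nrm M (\<lambda>\<omega>. F m \<omega> - f \<omega>) < e / 2"
      using eventually_happens'[OF sequentially_bot] by blast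
    have Fm: "F m \<in> gspan" using * by simp
    from gspanD[OF this e2] obtain N where N: "\<And>n. N \<le> n \<Longrightarrow> \<exists>\<zeta>\<in>grid n. nrm M (\<lambda>\<omega>. F m \<omega> - \<zeta> \<omega>) \<le> e / 2" by blast
    show "\<exists>N. \<forall>n\<ge>N. \<exists>\<zeta>\<in>grid n. nrm M (\<lambda>\<omega>. f \<omega> - \<zeta> \<omega>) \<le> e"
    proof (intro exI allI impI)
      fix n assume "N \<le> n"
      then obtain \<zeta> where z: "\<zeta> \<in> grid n" "nrm M (\<lambda>\<omega>. F m \<omega> - \<zeta> \<omega>) \<le> e / 2" using N[of n] by auto
      have "nrm M (\<lambda>\<omega>. f \<omega> - \<zeta> \<omega>) \<le> nrm M (\<lambda>\<omega>. f \<omega> - F m \<omega>) + nrm M (\<lambda>\<omega>. F m \<omega> - \<zeta> \<omega>)"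
        by (intro nrm_diff_triangle fL gspan_L2 Fm grid_L2[OF z(1)])
      also have "\<dots> \<le> e" using m z(2) nrm_diff_commute[of M f "F m"] by simp
      finally show "\<exists>\<zeta>\<in>grid n. nrm M (\<lambda>\<omega>. f \<omega> - \<zeta> \<omega>) \<le> e" using z(1) by blast
    qed
  qed
qed

lemma gspan_gaussian:
  assumes "\<xi> \<in> gspan" shows "gaussian M \<xi>"
proof -
  have "\<exists>\<zeta>. gaussian M \<zeta> \<and> nrm M (\<lambda>\<omega>. \<zeta> \<omega> - \<xi> \<omega>) \<le> inverse (real (Suc m))" for m
  proof -
    have "0 < inverse (real (Suc m))" by simp
    from gspanD[OF assms this] obtain N where
      "\<And>n. N \<le> n \<Longrightarrow> \<exists>\<zeta>\<in>grid n. nrm M (\<lambda>\<omega>. \<xi> \<omega> - \<zeta> \<omega>) \<le> inverse (real (Suc m))" by blast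
    from this[of N] obtain \<zeta> where "\<zeta> \<in> grid N" "nrm M (\<lambda>\<omega>. \<xi> \<omega> - \<zeta> \<omega>) \<le> inverse (real (Suc m))" by auto
    then show ?thesis using grid_gaussian nrm_diff_commute[of M \<xi> \<zeta>] by auto
  qed
  then obtain F where F: "\<And>m. gaussian M (F m)" "\<And>m. nrm M (\<lambda>\<omega>. F m \<omega> - \<xi> \<omega>) \<le> inverse (real (Suc m))"
    by metis
  have "(\<lambda>m. nrm M (\<lambda>\<omega>. F m \<omega> - \<xi> \<omega>)) \<longlonglongrightarrow> 0"
    by (rule Lim_null_comparison[OF always_eventually LIMSEQ_inverse_real_of_nat]) (use F(2) in simp)
  then show ?thesis by (rule gaussian_limit[OF F(1) gspan_L2[OF assms]])
qed

lemma nrm_B_diff: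
  assumes "s \<in> {0..T}" "t \<in> {0..T}"
  shows "nrm M (\<lambda>\<omega>. B j t \<omega> - B j s \<omega>) = sqrt \<bar>t - s\<bar>"
proof -
  have "ip M (\<lambda>\<omega>. B j t \<omega> - B j s \<omega>) (\<lambda>\<omega>. B j t \<omega> - B j s \<omega>) = \<bar>t - s\<bar>"
    using assms by (simp add: ip_diff_left ip_diff_right B_L2 L2_diff B_cov min_def)
  then show ?thesis by (simp add: nrm_def)
qed

lemma l2proc_B: "l2proc M 0 T (B j)"
  unfolding l2proc_def
proof (intro conjI ballI allI impI)
  fix e :: real assume e: "0 < e"
  show "\<exists>d>0. \<forall>s\<in>{0..T}. \<forall>r\<in>{0..T}. \<bar>s - r\<bar> < d \<longrightarrow> nrm M (\<lambda>\<omega>. B j s \<omega> - B j r \<omega>) \<le> e"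
    using e by (intro exI[of _ "e\<^sup>2"]) (auto simp: nrm_B_diff intro!: real_le_lsqrt)
qed (auto intro: B_L2 B_cont)

lemma B_gspan:
  assumes t: "t \<in> {0..T}" shows "B j t \<in> gspan"
proof (rule gspanI[OF B_L2[OF t]])
  fix e :: real assume e: "0 < e"
  \<comment> \<open>The grid width has to be at most \<open>e\<^sup>2\<close>, because B at two
    times differs in norm by the square root of their distance.\<close>
  obtain N where N: "T / e\<^sup>2 < real N" using reals_Archimedean2 by blast
  show "\<exists>N. \<forall>n\<ge>N. \<exists>\<zeta>\<in>grid n. nrm M (\<lambda>\<omega>. B j t \<omega> - \<zeta> \<omega>) \<le> e"
  proof (intro exI allI impI)
    fix n assume "N \<le> n"
    then have Tn: "T / e\<^sup>2 < Suc n" using N by linarith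
    define h where "h = (T - 0) / Suc n"
    have h: "0 < h" "h \<le> e\<^sup>2" using T e Tn by (simp_all add: h_def field_simps)
    define k0 where "k0 = nat \<lfloor>t / h\<rfloor>"
    have th: "0 \<le> t / h" using t h by simp
    have k0: "real k0 \<le> t / h" "t / h < real k0 + 1"
      using th unfolding k0_def by (simp_all add: of_nat_nat)
    have "t / h \<le> T / h" using t h by (intro divide_right_mono) auto
    also have "T / h = Suc n" using T by (simp add: h_def)
    finally have k0n: "k0 \<le> Suc n" using k0(1) by linarith
    have tk: "real k0 * h \<le> t" "t - real k0 * h \<le> h" using k0 h by (simp_all add: field_simps)
    define p where "p k = 0 + real k * ((T - 0) / Suc n)" for k
    \<comment> \<open>With these coefficients the increments telescope to B at the last grid point
      before t.\<close>
    define d :: "bool \<Rightarrow> nat \<Rightarrow> real" where "d i k = (if i = j \<and> k < k0 then 1 else 0)" for i k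
    define \<zeta> where "\<zeta> = (\<lambda>\<omega>. 0 * X0 \<omega> + (\<Sum>i\<in>UNIV. \<Sum>k<Suc n. d i k * (B i (p (Suc k)) \<omega> - B i (p k) \<omega>)))"
    have zg: "\<zeta> \<in> grid n" unfolding grid_def \<zeta>_def p_def by blast
    have zB: "\<zeta> \<omega> = B j (p k0) \<omega>" if "\<omega> \<in> space M" for \<omega>
    proof -
      have "(\<Sum>k<Suc n. d i k * (B i (p (Suc k)) \<omega> - B i (p k) \<omega>)) = (if i = j then B j (p k0) \<omega> else 0)" for i
      proof (cases "i = j")
        case True
        have "(\<Sum>k<Suc n. d i k * (B i (p (Suc k)) \<omega> - B i (p k) \<omega>)) =
            (\<Sum>k\<in>{..<Suc n} \<inter> {k. k < k0}. B i (p (Suc k)) \<omega> - B i (p k) \<omega>)"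
          using True by (subst sum.inter_restrict) (auto simp: d_def intro!: sum.cong)
        also have "{..<Suc n} \<inter> {k. k < k0} = {..<k0}" using k0n by auto
        also have "(\<Sum>k<k0. B i (p (Suc k)) \<omega> - B i (p k) \<omega>) = B i (p k0) \<omega> - B i (p 0) \<omega>"
          by (rule sum_lessThan_telescope)
        finally show ?thesis using True B_zero[OF that] by (simp add: p_def)
      qed (simp add: d_def)
      then show ?thesis unfolding \<zeta>_def by simp
    qed
    have pk: "p k0 = real k0 * h" "p k0 \<in> {0..T}"
      using grid_point[OF k0n] by (simp_all add: p_def h_def)
    have "nrm M (\<lambda>\<omega>. B j t \<omega> - \<zeta> \<omega>) = nrm M (\<lambda>\<omega>. B j t \<omega> - B j (p k0) \<omega>)"
      by (rule nrm_cong) (simp add: zB)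
    also have "\<dots> = sqrt \<bar>t - p k0\<bar>" by (rule nrm_B_diff[OF pk(2) t])
    also have "\<dots> \<le> e" using tk h e pk(1) by (intro real_le_lsqrt) auto
    finally show "\<exists>\<zeta>\<in>grid n. nrm M (\<lambda>\<omega>. B j t \<omega> - \<zeta> \<omega>) \<le> e" using zg by blast
  qed
qed

lemma closed_subspace_past:
  assumes s: "s \<in> {0..T}" shows "closed_subspace M (past s)"
  unfolding closed_subspace_def
proof (intro conjI ballI allI impI)
  show "past s \<subseteq> L2 M" using past_L2 by blast
  show "(\<lambda>_. 0) \<in> past s" by (simp add: past_def)
  have B: "B j t \<in> L2 M" if "t \<in> {s..T}" for j t using that s by (intro B_L2) auto
  have ss: "s \<in> {s..T}" using s by simp
  fix f g assume f: "f \<in> past s" and g: "g \<in> past s"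
  show "(\<lambda>\<omega>. f \<omega> + g \<omega>) \<in> past s"
  proof (rule pastI)
    show "(\<lambda>\<omega>. f \<omega> + g \<omega>) \<in> L2 M" by (intro L2_add past_L2[OF f] past_L2[OF g])
    fix j t assume t: "t \<in> {s..T}"
    show "ip M (\<lambda>\<omega>. f \<omega> + g \<omega>) (B j t) = ip M (\<lambda>\<omega>. f \<omega> + g \<omega>) (B j s)"
      unfolding ip_add_left[OF past_L2[OF f] past_L2[OF g] B[OF t]]
        ip_add_left[OF past_L2[OF f] past_L2[OF g] B[OF ss]] pastD[OF f t] pastD[OF g t] ..
  qed
next
  fix c f assume f: "f \<in> past s"
  show "(\<lambda>\<omega>. c * f \<omega>) \<in> past s"
  proof (rule pastI)
    fix j t assume t: "t \<in> {s..T}"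
    show "ip M (\<lambda>\<omega>. c * f \<omega>) (B j t) = ip M (\<lambda>\<omega>. c * f \<omega>) (B j s)"
      unfolding ip_cmult_left pastD[OF f t] ..
  qed (intro L2_cmult past_L2[OF f])
next
  fix F f assume *: "(\<forall>n. F n \<in> past s) \<and> f \<in> L2 M \<and> (\<lambda>n. nrm M (\<lambda>\<omega>. F n \<omega> - f \<omega>)) \<longlonglongrightarrow> 0"
  then have fL: "f \<in> L2 M" and lim: "(\<lambda>n. nrm M (\<lambda>\<omega>. F n \<omega> - f \<omega>)) \<longlonglongrightarrow> 0" by auto
  have Fp: "F n \<in> past s" for n using * by blast
  have F: "F n \<in> L2 M" for n by (rule past_L2[OF Fp])
  show "f \<in> past s"
  proof (rule pastI[OF fL])
    fix j t assume t: "t \<in> {s..T}"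
    have tT: "t \<in> {0..T}" using t s by auto
    have 1: "(\<lambda>n. ip M (B j t) (F n)) \<longlonglongrightarrow> ip M (B j t) f"
      by (rule ip_limit[OF F fL lim B_L2[OF tT]])
    have 2: "(\<lambda>n. ip M (B j s) (F n)) \<longlonglongrightarrow> ip M (B j s) f"
      by (rule ip_limit[OF F fL lim B_L2[OF s]])
    have "(\<lambda>n. ip M (B j t) (F n)) = (\<lambda>n. ip M (B j s) (F n))"
      unfolding ip_commute[of M "B j _"] by (rule ext) (rule pastD[OF Fp t])
    with 1 have "(\<lambda>n. ip M (B j s) (F n)) \<longlonglongrightarrow> ip M (B j t) f" by simp
    then show "ip M f (B j t) = ip M f (B j s)"
      using LIMSEQ_unique[OF _ 2] unfolding ip_commute[of M f] by blast
  qed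
qed

lemma closed_subspace_hist:
  assumes "s \<in> {0..T}" shows "closed_subspace M (hist s)"
  unfolding hist_def by (rule closed_subspace_Int[OF closed_subspace_gspan closed_subspace_past[OF assms]])

lemma hist_mono:
  assumes "s \<le> t" "t \<le> T" shows "hist s \<subseteq> hist t"
proof
  fix \<xi> assume \<xi>: "\<xi> \<in> hist s"
  have p: "\<xi> \<in> past s" using \<xi> by (simp add: hist_def)
  have "\<xi> \<in> past t"
  proof (rule pastI[OF past_L2[OF p]])
    fix j r assume "r \<in> {t..T}"
    then have "r \<in> {s..T}" "t \<in> {s..T}" using assms by auto
    then show "ip M \<xi> (B j r) = ip M \<xi> (B j t)" using pastD[OF p] by metis
  qed
  then show "\<xi> \<in> hist t" using \<xi> by (simp add: hist_def)
qed

lemma hist_B: "\<xi> \<in> hist s \<Longrightarrow> s \<le> t \<Longrightarrow> t \<le> T \<Longrightarrow> ip M \<xi> (B j t) = ip M \<xi> (B j s)"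
  unfolding hist_def by (rule pastD) auto

lemma hist_L2: "\<xi> \<in> hist s \<Longrightarrow> \<xi> \<in> L2 M"
  using past_L2 by (auto simp: hist_def)

lemma B_hist: "t \<in> {0..T} \<Longrightarrow> B j t \<in> hist t"
  unfolding hist_def by (intro IntI B_gspan pastI B_L2) (auto simp: B_cov)

lemma X0_hist: "t \<in> {0..T} \<Longrightarrow> X0 \<in> hist t"
  unfolding hist_def by (intro IntI grid_subset_gspan X0_grid pastI X0_L2) (auto simp: X0_B)

section \<open>Adapted, mean-square continuous Gaussian processes\<close>

definition proc :: "(real \<Rightarrow> 'w \<Rightarrow> real) \<Rightarrow> bool" where
  "proc x \<longleftrightarrow> l2proc M 0 T x \<and> (\<forall>t\<in>{0..T}. x t \<in> hist t)"

lemma proc_l2proc: "proc x \<Longrightarrow> l2proc M 0 T x" by (simp add: proc_def)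

lemma proc_hist: "proc x \<Longrightarrow> t \<in> {0..T} \<Longrightarrow> x t \<in> hist t" by (simp add: proc_def)

lemma proc_L2: "proc x \<Longrightarrow> t \<in> {0..T} \<Longrightarrow> x t \<in> L2 M" by (rule l2proc_L2[OF proc_l2proc])

lemma proc_cont: "proc x \<Longrightarrow> \<omega> \<in> space M \<Longrightarrow> continuous_on {0..T} (\<lambda>t. x t \<omega>)"
  by (rule l2proc_cont[OF proc_l2proc])

lemma proc_B: "proc (B j)" by (simp add: proc_def l2proc_B B_hist)

lemma proc_X0: "proc (\<lambda>_. X0)" by (simp add: proc_def l2proc_const X0_L2 X0_hist)

lemma proc_add: "proc x \<Longrightarrow> proc y \<Longrightarrow> proc (\<lambda>t \<omega>. x t \<omega> + y t \<omega>)"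
  unfolding proc_def by (auto intro!: l2proc_add closed_subspace_add[OF closed_subspace_hist])

lemma proc_mult: "proc x \<Longrightarrow> continuous_on {0..T} f \<Longrightarrow> proc (\<lambda>t \<omega>. f t * x t \<omega>)"
  unfolding proc_def by (auto intro!: l2proc_mult closed_subspace_cmult[OF closed_subspace_hist])

lemma proc_minus: "proc x \<Longrightarrow> proc (\<lambda>t \<omega>. - x t \<omega>)"
  using proc_mult[of x "\<lambda>_. -1"] by simp

lemma proc_diff: "proc x \<Longrightarrow> proc y \<Longrightarrow> proc (\<lambda>t \<omega>. x t \<omega> - y t \<omega>)"
  using proc_add[OF _ proc_minus, of x y] by simp

lemma proc_zero: "proc (\<lambda>_ _. 0)"
  using proc_mult[OF proc_X0, of "\<lambda>_. 0"] by simp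

lemma proc_sum: "(\<And>i. i \<in> I \<Longrightarrow> proc (x i)) \<Longrightarrow> proc (\<lambda>t \<omega>. \<Sum>i\<in>I. x i t \<omega>)"
  by (induction I rule: infinite_finite_induct) (auto intro: proc_add proc_zero)

lemma proc_integral:
  assumes x: "proc x" shows "proc (\<lambda>t \<omega>. integral {0..t} (\<lambda>s. x s \<omega>))"
  unfolding proc_def
proof (intro conjI ballI)
  show "l2proc M 0 T (\<lambda>t \<omega>. integral {0..t} (\<lambda>s. x s \<omega>))" by (intro l2proc_integral proc_l2proc x)
  fix t assume t: "t \<in> {0..T}"
  show "(\<lambda>\<omega>. integral {0..t} (\<lambda>s. x s \<omega>)) \<in> hist t"
  proof (rule closed_subspace_integral[OF closed_subspace_hist[OF t]])
    show "l2proc M 0 t x" using t by (intro l2proc_subset[OF proc_l2proc[OF x]]) auto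
    show "0 \<le> t" using t by simp
    fix s assume s: "s \<in> {0..t}"
    then have "x s \<in> hist s" using t by (intro proc_hist[OF x]) auto
    then show "x s \<in> hist t" using hist_mono[of s t] s t by auto
  qed
qed

lemma l2proc_cong:
  assumes "l2proc M a b x" "\<And>t \<omega>. t \<in> {a..b} \<Longrightarrow> \<omega> \<in> space M \<Longrightarrow> x t \<omega> = y t \<omega>"
  shows "l2proc M a b y"
  unfolding l2proc_def
proof (intro conjI ballI allI impI)
  fix s assume s: "s \<in> {a..b}"
  show "y s \<in> L2 M" by (rule L2_cong[OF l2proc_L2[OF assms(1) s] assms(2)[OF s]])
next
  fix \<omega> assume "\<omega> \<in> space M"
  then show "continuous_on {a..b} (\<lambda>s. y s \<omega>)"
    using l2proc_cont[OF assms(1)] assms(2) continuous_on_cong by (metis (mono_tags, lifting))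
next
  fix e :: real assume "0 < e"
  from l2proc_mod[OF assms(1) this] obtain d where d: "0 < d"
    "\<And>s r. s \<in> {a..b} \<Longrightarrow> r \<in> {a..b} \<Longrightarrow> \<bar>s - r\<bar> < d \<Longrightarrow> nrm M (\<lambda>\<omega>. x s \<omega> - x r \<omega>) \<le> e" by blast
  moreover have "nrm M (\<lambda>\<omega>. y s \<omega> - y r \<omega>) = nrm M (\<lambda>\<omega>. x s \<omega> - x r \<omega>)" if "s \<in> {a..b}" "r \<in> {a..b}" for s r
    using that by (intro nrm_cong) (simp add: assms(2))
  ultimately show "\<exists>d>0. \<forall>s\<in>{a..b}. \<forall>r\<in>{a..b}. \<bar>s - r\<bar> < d \<longrightarrow> nrm M (\<lambda>\<omega>. y s \<omega> - y r \<omega>) \<le> e" by auto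
qed

lemma proc_cong:
  assumes "proc x" "\<And>t \<omega>. t \<in> {0..T} \<Longrightarrow> \<omega> \<in> space M \<Longrightarrow> x t \<omega> = y t \<omega>"
  shows "proc y"
  unfolding proc_def
proof (intro conjI ballI)
  show "l2proc M 0 T y" by (rule l2proc_cong[OF proc_l2proc[OF assms(1)] assms(2)])
  fix t assume "t \<in> {0..T}"
  then show "y t \<in> hist t"
    using closed_subspace_cong[OF closed_subspace_hist proc_hist[OF assms(1)] assms(2)] by blast
qed

lemma path_drift:
  assumes u: "proc u" and x: "\<And>t. t \<in> {0..T} \<Longrightarrow> x t \<in> L2 M"
    and eq: "\<And>\<omega> t. \<omega> \<in> space M \<Longrightarrow> t \<in> {0..T} \<Longrightarrow> x t \<omega> = x0 \<omega> + integral {0..t} (\<lambda>s. u s \<omega>)"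
    and st: "0 \<le> s" "s \<le> t" "t \<le> T" and \<xi>: "\<xi> \<in> L2 M"
  shows "ip M \<xi> (x t) - ip M \<xi> (x s) = integral {s..t} (\<lambda>r. ip M \<xi> (u r))"
proof -
  have ust: "l2proc M s t u" using st by (intro l2proc_subset[OF proc_l2proc[OF u]]) auto
  have "ip M \<xi> (x t) - ip M \<xi> (x s) = ip M \<xi> (\<lambda>\<omega>. x t \<omega> - x s \<omega>)"
    using st \<xi> x by (simp add: ip_diff_right)
  also have "\<dots> = ip M \<xi> (\<lambda>\<omega>. integral {s..t} (\<lambda>r. u r \<omega>))"
  proof (rule ip_cong)
    fix \<omega> assume w: "\<omega> \<in> space M"
    have "(\<lambda>r. u r \<omega>) integrable_on {0..t}"
      using st by (intro integrable_continuous_real continuous_on_subset[OF proc_cont[OF u w]]) auto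
    from Henstock_Kurzweil_Integration.integral_combine[OF st(1,2) this]
    show "x t \<omega> - x s \<omega> = integral {s..t} (\<lambda>r. u r \<omega>)" using eq[OF w] st by simp
  qed simp
  also have "\<dots> = integral {s..t} (\<lambda>r. ip M \<xi> (u r))" by (rule ip_integral[OF ust st(2) \<xi>])
  finally show ?thesis .
qed

text \<open>The equation dx = u dt + sum of f_j dB_j with its stochastic integrals integrated by
  parts, which is possible since the f_j are deterministic and continuously differentiable. Only
  path integrals remain.\<close>

definition semimart :: "(real \<Rightarrow> 'w \<Rightarrow> real) \<Rightarrow> (real \<Rightarrow> 'w \<Rightarrow> real) \<Rightarrow> (bool \<Rightarrow> real \<Rightarrow> real) \<Rightarrow> (bool \<Rightarrow> real \<Rightarrow> real) \<Rightarrow> bool" where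
  "semimart x u f f' \<longleftrightarrow> proc x \<and> proc u \<and> (\<forall>j. continuous_on {0..T} (f' j)) \<and>
    (\<forall>j. \<forall>t\<in>{0..T}. (f j has_real_derivative f' j t) (at t within {0..T})) \<and>
    (\<forall>\<omega>\<in>space M. \<forall>t\<in>{0..T}. x t \<omega> = x 0 \<omega> + (\<Sum>j\<in>UNIV. f j t * B j t \<omega>)
        + integral {0..t} (\<lambda>s. u s \<omega> - (\<Sum>j\<in>UNIV. f' j s * B j s \<omega>)))"

context
  fixes x u f f' assumes sm: "semimart x u f f'"
begin

lemma semimart_proc: "proc x" "proc u" using sm by (simp_all add: semimart_def)

lemma semimart_deriv: "t \<in> {0..T} \<Longrightarrow> (f j has_real_derivative f' j t) (at t within {0..T})"
  "continuous_on {0..T} (f' j)" using sm by (simp_all add: semimart_def)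

definition fv_drift :: "real \<Rightarrow> 'w \<Rightarrow> real" where
  "fv_drift s \<omega> = u s \<omega> - (\<Sum>j\<in>UNIV. f' j s * B j s \<omega>)"

text \<open>What is left of x after removing the f_j B_j. Its paths are differentiable with
  derivative \<open>fv_drift\<close>, so it qualifies as the first factor in
  \<open>ip_product_rule\<close>.\<close>

definition fv_part :: "real \<Rightarrow> 'w \<Rightarrow> real" where
  "fv_part t \<omega> = x 0 \<omega> + integral {0..t} (\<lambda>s. fv_drift s \<omega>)"

lemma proc_x0: "proc (\<lambda>_. x 0)"
proof -
  have "x 0 \<in> hist 0" using proc_hist[OF semimart_proc(1)] T0 by simp
  then have "x 0 \<in> hist t" if "t \<in> {0..T}" for t using hist_mono[of 0 t] that by auto
  then show ?thesis unfolding proc_def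
    using proc_L2[OF semimart_proc(1)] T0 by (auto intro!: l2proc_const)
qed

lemma proc_fv_drift: "proc fv_drift"
  unfolding fv_drift_def
  by (intro proc_diff semimart_proc proc_sum proc_mult proc_B semimart_deriv)

lemma proc_fv_part: "proc fv_part"
  unfolding fv_part_def by (intro proc_add proc_x0 proc_integral proc_fv_drift)

lemma semimart_eq:
  assumes "\<omega> \<in> space M" "t \<in> {0..T}"
  shows "x t \<omega> = (\<Sum>j\<in>UNIV. f j t * B j t \<omega>) + fv_part t \<omega>"
proof -
  have "x t \<omega> = x 0 \<omega> + (\<Sum>j\<in>UNIV. f j t * B j t \<omega>)
      + integral {0..t} (\<lambda>s. u s \<omega> - (\<Sum>j\<in>UNIV. f' j s * B j s \<omega>))"
    using sm assms unfolding semimart_def by blast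
  then show ?thesis unfolding fv_part_def fv_drift_def by linarith
qed

lemma ip_fv_drift:
  assumes "t \<in> {0..T}" "\<xi> \<in> L2 M"
  shows "ip M \<xi> (fv_drift t) = ip M \<xi> (u t) - (\<Sum>j\<in>UNIV. f' j t * ip M \<xi> (B j t))"
proof -
  have "ip M \<xi> (fv_drift t) = ip M \<xi> (u t) - ip M \<xi> (\<lambda>\<omega>. \<Sum>j\<in>UNIV. f' j t * B j t \<omega>)"
    unfolding fv_drift_def using assms
    by (intro ip_diff_right proc_L2[OF semimart_proc(2)] L2_sum L2_cmult B_L2)
  also have "ip M \<xi> (\<lambda>\<omega>. \<Sum>j\<in>UNIV. f' j t * B j t \<omega>) = (\<Sum>j\<in>UNIV. f' j t * ip M \<xi> (B j t))"
    using assms by (subst ip_sum_right) (simp_all add: L2_cmult B_L2)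
  finally show ?thesis .
qed

lemma ip_semimart:
  assumes "t \<in> {0..T}" "\<xi> \<in> L2 M"
  shows "ip M \<xi> (x t) = (\<Sum>j\<in>UNIV. f j t * ip M \<xi> (B j t)) + ip M \<xi> (fv_part t)"
proof -
  have "ip M \<xi> (x t) = ip M \<xi> (\<lambda>\<omega>. (\<Sum>j\<in>UNIV. f j t * B j t \<omega>) + fv_part t \<omega>)"
    by (rule ip_cong) (simp_all add: semimart_eq[OF _ assms(1)])
  also have "\<dots> = ip M \<xi> (\<lambda>\<omega>. \<Sum>j\<in>UNIV. f j t * B j t \<omega>) + ip M \<xi> (fv_part t)"
    using assms by (intro ip_add_right proc_L2[OF proc_fv_part] L2_sum L2_cmult B_L2)
  also have "ip M \<xi> (\<lambda>\<omega>. \<Sum>j\<in>UNIV. f j t * B j t \<omega>) = (\<Sum>j\<in>UNIV. f j t * ip M \<xi> (B j t))"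
    using assms by (subst ip_sum_right) (simp_all add: L2_cmult B_L2)
  finally show ?thesis .
qed

lemma fv_part_drift:
  assumes "0 \<le> s" "s \<le> t" "t \<le> T" "\<xi> \<in> L2 M"
  shows "ip M \<xi> (fv_part t) - ip M \<xi> (fv_part s) = integral {s..t} (\<lambda>r. ip M \<xi> (fv_drift r))"
  by (rule path_drift[OF proc_fv_drift proc_L2[OF proc_fv_part] _ assms]) (simp_all add: fv_part_def)

text \<open>The past of s does not see later noise: \<open>ip M \<xi> (B j r)\<close> is constant
  for r after s. The boundary terms with f_j and the integrals of f_j' therefore cancel, and the
  drift u alone is left.\<close>

lemma semimart_drift:
  assumes st: "0 \<le> s" "s \<le> t" "t \<le> T" and \<xi>: "\<xi> \<in> hist s"
  shows "ip M \<xi> (x t) - ip M \<xi> (x s) = integral {s..t} (\<lambda>r. ip M \<xi> (u r))"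
proof -
  have L: "\<xi> \<in> L2 M" using \<xi> by (rule hist_L2)
  define \<beta> where "\<beta> j = ip M \<xi> (B j s)" for j
  have \<beta>: "ip M \<xi> (B j r) = \<beta> j" if "s \<le> r" "r \<le> T" for j r
    unfolding \<beta>_def using hist_B[OF \<xi> that] .
  have i1: "(\<lambda>r. ip M \<xi> (u r)) integrable_on {s..t}"
    using st by (intro integrable_continuous_real continuous_on_subset[OF ip_continuous_on[OF proc_l2proc[OF semimart_proc(2)] L]]) auto
  have i2: "((\<lambda>r. f' j r * \<beta> j) has_integral (f j t * \<beta> j - f j s * \<beta> j)) {s..t}" for j
  proof (rule fundamental_theorem_of_calculus[OF st(2)])
    fix r assume "r \<in> {s..t}"
    then have "(f j has_real_derivative f' j r) (at r within {s..t})"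
      using st by (intro DERIV_subset[OF semimart_deriv(1)]) auto
    then show "((\<lambda>r. f j r * \<beta> j) has_vector_derivative f' j r * \<beta> j) (at r within {s..t})"
      by (auto intro!: derivative_eq_intros simp flip: has_real_derivative_iff_has_vector_derivative)
  qed
  have i3: "((\<lambda>r. \<Sum>j\<in>UNIV. f' j r * \<beta> j) has_integral (\<Sum>j\<in>UNIV. f j t * \<beta> j - f j s * \<beta> j)) {s..t}"
    by (intro has_integral_sum i2) simp
  have "ip M \<xi> (x t) - ip M \<xi> (x s) = (\<Sum>j\<in>UNIV. f j t * \<beta> j - f j s * \<beta> j) + (ip M \<xi> (fv_part t) - ip M \<xi> (fv_part s))"
    using st L by (simp add: ip_semimart \<beta> sum_subtractf)
  also have "ip M \<xi> (fv_part t) - ip M \<xi> (fv_part s) = integral {s..t} (\<lambda>r. ip M \<xi> (fv_drift r))"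
    by (rule fv_part_drift[OF st L])
  also have "\<dots> = integral {s..t} (\<lambda>r. ip M \<xi> (u r) - (\<Sum>j\<in>UNIV. f' j r * \<beta> j))"
    using st L by (intro integral_cong) (simp add: ip_fv_drift \<beta>)
  also have "\<dots> = integral {s..t} (\<lambda>r. ip M \<xi> (u r)) - (\<Sum>j\<in>UNIV. f j t * \<beta> j - f j s * \<beta> j)"
    using i3 i1 by (subst integral_diff) (auto simp: integral_unique)
  finally show ?thesis by simp
qed

text \<open>The summand \<open>f j t\<close> is the covariation rate of B_j and x. It appears when
  f_j(t) t is differentiated, where t is the variance of B_j(t); the other term f_j'(t) t is
  cancelled by the corresponding part of \<open>fv_drift\<close>. Seen from the past, B_j has drift
  0.\<close>

lemma semimart_B_derivative:
  assumes t: "t \<in> {0..T}"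
  shows "((\<lambda>t. ip M (B j t) (x t)) has_real_derivative ip M (B j t) (u t) + f j t) (at t within {0..T})"
proof -
  have d: "((\<lambda>t. ip M (fv_part t) (B j t)) has_real_derivative
      ip M (fv_drift t) (B j t) + ip M (fv_part t) (\<lambda>_. 0)) (at t within {0..T})"
  proof (rule ip_product_rule[OF proc_l2proc[OF proc_fv_part] proc_l2proc[OF proc_fv_drift] l2proc_B l2proc_const[OF L2_zero] _ _ t])
    fix s t assume st: "0 \<le> s" "s \<le> t" "t \<le> T"
    show "ip M (B j t) (fv_part t) - ip M (B j t) (fv_part s) = integral {s..t} (\<lambda>r. ip M (B j t) (fv_drift r))"
      using st by (intro fv_part_drift B_L2) auto
    show "ip M (fv_part s) (B j t) - ip M (fv_part s) (B j s) = integral {s..t} (\<lambda>r. ip M (fv_part s) (\<lambda>_. 0))"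
      using hist_B[OF proc_hist[OF proc_fv_part], of s t j] st by simp
  qed
  have 1: "ip M (B j t) (x t) = f j t * t + ip M (fv_part t) (B j t)" if "t \<in> {0..T}" for t
    using that by (simp add: ip_semimart B_L2 B_cov if_distrib cong: if_cong) (simp add: ip_commute UNIV_bool)
  have 2: "((\<lambda>t. f j t * t + ip M (fv_part t) (B j t)) has_real_derivative
      (f' j t * t + f j t) + (ip M (fv_drift t) (B j t) + ip M (fv_part t) (\<lambda>_. 0))) (at t within {0..T})"
    by (intro DERIV_add d) (auto intro!: derivative_eq_intros semimart_deriv t)
  have 3: "ip M (fv_drift t) (B j t) = ip M (B j t) (u t) - f' j t * t"
    using t by (subst ip_commute) (auto simp: ip_fv_drift B_L2 B_cov if_distrib UNIV_bool cong: if_cong)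
  show ?thesis
    by (rule has_real_derivative_transform[OF 2 t 1]) (simp_all add: 3)
qed

end

text \<open>Ito's product rule in expectation, the final sum being the bracket term. Writing x as
  the f_j B_j plus \<open>fv_part\<close> reduces it to \<open>semimart_B_derivative\<close> for the
  noise and to \<open>ip_product_rule\<close> for the rest, in which only y is rough.\<close>

lemma semimart_product_derivative:
  assumes x: "semimart x u f f'" and y: "semimart y v g g'" and t: "t \<in> {0..T}"
  shows "((\<lambda>t. ip M (x t) (y t)) has_real_derivative
      ip M (u t) (y t) + ip M (x t) (v t) + (\<Sum>j\<in>UNIV. f j t * g j t)) (at t within {0..T})"
proof -
  let ?n = "fv_part x u f'" and ?d = "fv_drift u f'"
  note pn = proc_fv_part[OF x] and pd = proc_fv_drift[OF x] and py = semimart_proc(1)[OF y] and pv = semimart_proc(2)[OF y]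
  have 1: "((\<lambda>t. ip M (?n t) (y t)) has_real_derivative ip M (?d t) (y t) + ip M (?n t) (v t)) (at t within {0..T})"
  proof (rule ip_product_rule[OF proc_l2proc[OF pn] proc_l2proc[OF pd] proc_l2proc[OF py] proc_l2proc[OF pv] _ _ t])
    fix s t assume st: "0 \<le> s" "s \<le> t" "t \<le> T"
    show "ip M (y t) (?n t) - ip M (y t) (?n s) = integral {s..t} (\<lambda>r. ip M (y t) (?d r))"
      using st by (intro fv_part_drift[OF x] proc_L2[OF py]) auto
    show "ip M (?n s) (y t) - ip M (?n s) (y s) = integral {s..t} (\<lambda>r. ip M (?n s) (v r))"
      using st by (intro semimart_drift[OF y] proc_hist[OF pn]) auto
  qed
  have 2: "((\<lambda>t. f j t * ip M (B j t) (y t)) has_real_derivative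
      f' j t * ip M (B j t) (y t) + f j t * (ip M (B j t) (v t) + g j t)) (at t within {0..T})" for j
    by (rule derivative_eq_intros semimart_deriv(1)[OF x t] semimart_B_derivative[OF y t])+ (simp add: mult.commute)
  have 3: "((\<lambda>t. (\<Sum>j\<in>UNIV. f j t * ip M (B j t) (y t)) + ip M (?n t) (y t)) has_real_derivative
      (\<Sum>j\<in>UNIV. f' j t * ip M (B j t) (y t) + f j t * (ip M (B j t) (v t) + g j t)) +
      (ip M (?d t) (y t) + ip M (?n t) (v t))) (at t within {0..T})"
    by (intro DERIV_add DERIV_sum 1 2)
  have 4: "ip M (x t) (y t) = (\<Sum>j\<in>UNIV. f j t * ip M (B j t) (y t)) + ip M (?n t) (y t)" if "t \<in> {0..T}" for t
    using ip_semimart[OF x that proc_L2[OF py that]] by (simp only: ip_commute[of M "y t"])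
  have 5: "ip M (x t) (v t) = (\<Sum>j\<in>UNIV. f j t * ip M (B j t) (v t)) + ip M (?n t) (v t)"
    using ip_semimart[OF x t proc_L2[OF pv t]] by (simp only: ip_commute[of M "v t"])
  have 6: "ip M (?d t) (y t) = ip M (u t) (y t) - (\<Sum>j\<in>UNIV. f' j t * ip M (B j t) (y t))"
    using ip_fv_drift[OF x t proc_L2[OF py t]] by (simp add: ip_commute[of M "y t"])
  show ?thesis
    by (rule has_real_derivative_transform[OF 3 t 4]) (simp_all add: 5 6 sum.distrib distrib_left)
qed

end

section \<open>The linear filter\<close>

definition outer :: "real^'n \<Rightarrow> real^'m \<Rightarrow> real^'m^'n" where
  "outer v w = (\<chi> i j. v $ i * w $ j)"

lemma outer_nth [simp]: "outer v w $ i $ j = v $ i * w $ j"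
  by (simp add: outer_def)

lemma outer_vector: "outer v w *v x = (w \<bullet> x) *\<^sub>R v"
  by (simp add: vec_eq_iff matrix_vector_mult_def inner_vec_def sum_distrib_right sum_distrib_left mult_ac)

lemma matrix_outer: "A ** outer v w = outer (A *v v) w"
  by (simp add: vec_eq_iff matrix_matrix_mult_def matrix_vector_mult_def sum_distrib_right sum_distrib_left mult_ac)

lemma outer_matrix: "outer v w ** A = outer v (transpose A *v w)"
  by (simp add: vec_eq_iff matrix_matrix_mult_def vector_matrix_mult_def sum_distrib_left mult_ac)

lemma transpose_outer: "transpose (outer v w) = outer w v"
  by (simp add: vec_eq_iff transpose_def mult.commute)

lemma bounded_bilinear_outer: "bounded_bilinear (outer :: real^'n \<Rightarrow> real^'m \<Rightarrow> real^'m^'n)"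
  unfolding bilinear_conv_bounded_bilinear[symmetric] bilinear_def
  by (auto intro!: linearI simp: vec_eq_iff algebra_simps)

lemmas continuous_on_outer [continuous_intros] = bounded_bilinear.continuous_on[OF bounded_bilinear_outer]

lemma has_vector_derivative_vecI:
  fixes f :: "real \<Rightarrow> 'a::real_normed_vector ^ 'n"
  assumes "\<And>i. ((\<lambda>t. f t $ i) has_vector_derivative f' $ i) (at t within S)"
  shows "(f has_vector_derivative f') (at t within S)"
  using assms unfolding has_vector_derivative_iff_quotient
  by (intro vec_tendstoI) simp

lemma has_vector_derivative_nth:
  assumes "(f has_vector_derivative f') F"
  shows "((\<lambda>t. f t $ i) has_vector_derivative f' $ i) F"
  using bounded_linear.has_vector_derivative[OF bounded_linear_vec_nth assms] .

lemma continuous_on_vecI: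
  fixes f :: "'b::topological_space \<Rightarrow> 'a::topological_space ^ 'n"
  assumes "\<And>i. continuous_on S (\<lambda>t. f t $ i)"
  shows "continuous_on S f"
  using continuous_on_vec_lambda[of S "\<lambda>i t. f t $ i"] assms by simp

lemma variation_of_constants:
  fixes A \<Phi> \<Psi> :: "real \<Rightarrow> real^'n^'n"
  assumes \<Phi>: "(\<Phi> has_vector_derivative A t ** \<Phi> t) (at t within {0..T})"
    and inv: "\<Phi> t ** \<Psi> t = mat 1" and \<Psi>: "continuous_on {0..T} \<Psi>"
    and h: "continuous_on {0..T} h" and t: "t \<in> {0..T}"
  shows "((\<lambda>t. \<Phi> t *v (n0 + integral {0..t} (\<lambda>s. \<Psi> s *v h s))) has_vector_derivative
      A t *v (\<Phi> t *v (n0 + integral {0..t} (\<lambda>s. \<Psi> s *v h s))) + h t) (at t within {0..T})"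
proof -
  have "continuous_on {0..T} (\<lambda>s. \<Psi> s *v h s)" by (intro continuous_intros \<Psi> h)
  then have "((\<lambda>t. n0 + integral {0..t} (\<lambda>s. \<Psi> s *v h s)) has_vector_derivative 0 + \<Psi> t *v h t) (at t within {0..T})"
    by (intro has_vector_derivative_add has_vector_derivative_const integral_has_vector_derivative t)
  from has_vector_derivative_matrix_vector[OF \<Phi> this] show ?thesis
    by (simp add: matrix_vector_mul_assoc inv)
      (simp add: add.commute flip: matrix_vector_mul_assoc)
qed

lemma linear_ode_unique:
  fixes n m :: "real \<Rightarrow> real^'n"
  assumes A: "continuous_on {c..d} A"
    and n: "\<And>t. t \<in> {c..d} \<Longrightarrow> (n has_vector_derivative A t *v n t + h t) (at t within {c..d})"
    and m: "\<And>t. t \<in> {c..d} \<Longrightarrow> (m has_vector_derivative A t *v m t + h t) (at t within {c..d})"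
    and eq: "n c = m c" and t: "t \<in> {c..d}"
  shows "n t = m t"
proof -
  obtain K where K: "0 < K" "\<And>(A::real^'n^'n) (x::real^'n). norm (A *v x) \<le> norm A * norm x * K"
    using matrix_vector_norm_bound by blast
  obtain C where C: "0 < C" "\<And>t. t \<in> {c..d} \<Longrightarrow> norm (A t) \<le> C"
    using continuous_on_Icc_bounded[OF A] by blast
  have "n t - m t = 0"
  proof (rule ode_zero[where c = c and d = d and y = "\<lambda>t. n t - m t" and g = "\<lambda>t. A t *v (n t - m t)" and ?t0.0 = c and L = "C * K"])
    fix t assume t: "t \<in> {c..d}"
    show "((\<lambda>t. n t - m t) has_vector_derivative A t *v (n t - m t)) (at t within {c..d})"
      using has_vector_derivative_diff[OF n[OF t] m[OF t]] by (simp add: matrix_vector_mult_diff_distrib)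
    have "norm (A t *v (n t - m t)) \<le> norm (A t) * norm (n t - m t) * K" by (rule K)
    also have "\<dots> \<le> C * norm (n t - m t) * K" using K C(2)[OF t] by (intro mult_right_mono) auto
    finally show "norm (A t *v (n t - m t)) \<le> C * K * norm (n t - m t)" by (simp add: mult_ac)
  qed (use t eq in auto)
  then show ?thesis by simp
qed

lemma integral_equation_derivative:
  fixes n :: "real \<Rightarrow> 'a::euclidean_space"
  assumes "continuous_on {c..d} g" "\<And>t. t \<in> {c..d} \<Longrightarrow> n t = n0 + integral {c..t} g" "t \<in> {c..d}"
  shows "(n has_vector_derivative g t) (at t within {c..d})"
proof -
  have "((\<lambda>t. n0 + integral {c..t} g) has_vector_derivative 0 + g t) (at t within {c..d})"
    by (intro has_vector_derivative_add has_vector_derivative_const integral_has_vector_derivative assms)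
  then show ?thesis
    using has_vector_derivative_transform[OF assms(3) assms(2), of "\<lambda>t. t"] assms
    by (metis (no_types, lifting) add_0 has_vector_derivative_transform)
qed

lemma derivative_integral_equation:
  fixes n :: "real \<Rightarrow> 'a::euclidean_space"
  assumes "\<And>t. t \<in> {c..d} \<Longrightarrow> (n has_vector_derivative g t) (at t within {c..d})" "t \<in> {c..d}"
  shows "n t = n c + integral {c..t} g"
proof -
  have "(g has_integral (n t - n c)) {c..t}"
  proof (rule fundamental_theorem_of_calculus)
    show "c \<le> t" using assms(2) by simp
    fix s assume "s \<in> {c..t}"
    then show "(n has_vector_derivative g s) (at s within {c..t})"
      using assms(2) by (intro has_vector_derivative_within_subset[OF assms(1)]) auto
  qed
  then show ?thesis by (simp add: integral_unique)
qed

section \<open>Vector-valued adapted processes\<close>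

context gauss_base begin

definition vproc :: "(real \<Rightarrow> 'w \<Rightarrow> real^'n) \<Rightarrow> bool" where
  "vproc x \<longleftrightarrow> (\<forall>i. proc (\<lambda>t \<omega>. x t \<omega> $ i))"

lemma vproc_nth: "vproc x \<Longrightarrow> proc (\<lambda>t \<omega>. x t \<omega> $ i)" by (simp add: vproc_def)

lemma vproc_cont: "vproc x \<Longrightarrow> \<omega> \<in> space M \<Longrightarrow> continuous_on {0..T} (\<lambda>t. x t \<omega>)"
  by (intro continuous_on_vecI proc_cont vproc_nth)

lemma vproc_add: "vproc x \<Longrightarrow> vproc y \<Longrightarrow> vproc (\<lambda>t \<omega>. x t \<omega> + y t \<omega>)"
  by (simp add: vproc_def proc_add)

lemma vproc_diff: "vproc x \<Longrightarrow> vproc y \<Longrightarrow> vproc (\<lambda>t \<omega>. x t \<omega> - y t \<omega>)"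
  by (simp add: vproc_def proc_diff)

lemma vproc_sum: "(\<And>j. j \<in> J \<Longrightarrow> vproc (x j)) \<Longrightarrow> vproc (\<lambda>t \<omega>. \<Sum>j\<in>J. x j t \<omega>)"
  unfolding vproc_def sum_component by (intro allI proc_sum) auto

lemma vproc_matrix:
  assumes x: "vproc x" and A: "continuous_on {0..T} A"
  shows "vproc (\<lambda>t \<omega>. A t *v x t \<omega>)"
  unfolding vproc_def matrix_vector_mult_def vec_lambda_beta
  by (intro allI proc_sum proc_mult vproc_nth x continuous_intros A)

lemma vproc_scale:
  assumes x: "proc x" and c: "continuous_on {0..T} c"
  shows "vproc (\<lambda>t \<omega>. x t \<omega> *\<^sub>R c t)"
  unfolding vproc_def vector_scaleR_component real_scaleR_def mult.commute[of "x _ _"]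
  by (intro allI proc_mult x continuous_intros c)

lemma vproc_inner: assumes x: "vproc x" shows "proc (\<lambda>t \<omega>. a \<bullet> x t \<omega>)"
  unfolding inner_vec_def inner_real_def
  by (intro proc_sum proc_mult vproc_nth x continuous_intros)

lemma vproc_cong:
  assumes "vproc x" "\<And>t \<omega>. t \<in> {0..T} \<Longrightarrow> \<omega> \<in> space M \<Longrightarrow> x t \<omega> = y t \<omega>"
  shows "vproc y"
  unfolding vproc_def
proof
  fix i show "proc (\<lambda>t \<omega>. y t \<omega> $ i)"
    by (rule proc_cong[OF vproc_nth[OF assms(1), of i]]) (simp add: assms(2))
qed

lemma vproc_integral:
  assumes x: "vproc x" shows "vproc (\<lambda>t \<omega>. integral {0..t} (\<lambda>s. x s \<omega>))"
  unfolding vproc_def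
proof
  fix i
  show "proc (\<lambda>t \<omega>. integral {0..t} (\<lambda>s. x s \<omega>) $ i)"
  proof (rule proc_cong[OF proc_integral[OF vproc_nth[OF x, of i]]])
    fix t \<omega> assume t: "t \<in> {0..T}" and w: "\<omega> \<in> space M"
    have "(\<lambda>s. x s \<omega>) integrable_on {0..t}"
      using t by (intro integrable_continuous_real continuous_on_subset[OF vproc_cont[OF x w]]) auto
    then show "integral {0..t} (\<lambda>s. x s \<omega> $ i) = integral {0..t} (\<lambda>s. x s \<omega>) $ i"
      by (rule integral_component_eq_cart)
  qed
qed

end

text \<open>The linear system in integrated form, in any finite dimension; \<open>e0\<close> is the
  direction in which the initial value enters. \<open>B False\<close> drives the observation and,
  through \<open>b False\<close>, also the signal, so that the two noises are correlated.\<close>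

locale kalman = gauss_base M T X0 B for M :: "'w measure" and T X0 B +
  fixes Z :: "real \<Rightarrow> 'w \<Rightarrow> real^'n" and Y :: "real \<Rightarrow> 'w \<Rightarrow> real"
    and F :: "real^'n^'n" and a e0 :: "real^'n" and b b' :: "bool \<Rightarrow> real \<Rightarrow> real^'n"
  assumes Z_cont: "\<And>\<omega>. \<omega> \<in> space M \<Longrightarrow> continuous_on {0..T} (\<lambda>t. Z t \<omega>)"
    and Z_eq: "\<And>\<omega> t. \<omega> \<in> space M \<Longrightarrow> t \<in> {0..T} \<Longrightarrow> Z t \<omega> = X0 \<omega> *\<^sub>R e0 + (\<Sum>j\<in>UNIV. B j t \<omega> *\<^sub>R b j t)
        + integral {0..t} (\<lambda>s. - (F *v Z s \<omega>) - (\<Sum>j\<in>UNIV. B j s \<omega> *\<^sub>R b' j s))"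
    and Y_eq: "\<And>\<omega> t. \<omega> \<in> space M \<Longrightarrow> t \<in> {0..T} \<Longrightarrow>
        Y t \<omega> = B False t \<omega> + integral {0..t} (\<lambda>s. a \<bullet> Z s \<omega>)"
    and b_deriv: "\<And>j t. t \<in> {0..T} \<Longrightarrow> (b j has_vector_derivative b' j t) (at t within {0..T})"
    and b'_cont: "\<And>j. continuous_on {0..T} (b' j)"
begin

lemma b_cont: "continuous_on {0..T} (b j)"
  using b_deriv by (meson continuous_on_eq_continuous_within has_vector_derivative_continuous)

lemma Z_0: "\<omega> \<in> space M \<Longrightarrow> Z 0 \<omega> = X0 \<omega> *\<^sub>R e0"
  using Z_eq[of \<omega> 0] T0 by (simp add: B_zero)

lemma Y_0: "\<omega> \<in> space M \<Longrightarrow> Y 0 \<omega> = 0"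
  using Y_eq[of \<omega> 0] T0 by (simp add: B_zero)

text \<open>The equation of Z is only pathwise, so square integrability and membership in the
  Gaussian space have to be read off from a formula. Subtracting the B_j b_j leaves a linear
  ordinary differential equation with forcing \<open>h\<close>, and variation of constants writes
  its solution with operations that preserve \<open>vproc\<close>.\<close>

lemma vproc_Z: "vproc Z"
proof -
  have "continuous_on {0..T} (\<lambda>_. - F)" by (intro continuous_intros)
  from fundamental_solution[OF T0 this] obtain \<Phi> \<Psi> :: "real \<Rightarrow> real^'n^'n" where
    \<Phi>0: "\<Phi> 0 = mat 1" and
    \<Phi>: "\<And>t. t \<in> {0..T} \<Longrightarrow> (\<Phi> has_vector_derivative - F ** \<Phi> t) (at t within {0..T})" and
    \<Psi>: "\<And>t. t \<in> {0..T} \<Longrightarrow> (\<Psi> has_vector_derivative - (\<Psi> t ** - F)) (at t within {0..T})" and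
    inv: "\<And>t. t \<in> {0..T} \<Longrightarrow> \<Phi> t ** \<Psi> t = mat 1" by metis
  have \<Phi>c: "continuous_on {0..T} \<Phi>"
    using \<Phi> by (meson continuous_on_eq_continuous_within has_vector_derivative_continuous)
  have \<Psi>c: "continuous_on {0..T} \<Psi>"
    using \<Psi> by (meson continuous_on_eq_continuous_within has_vector_derivative_continuous)
  define h where "h s \<omega> = (\<Sum>j\<in>UNIV. B j s \<omega> *\<^sub>R (- (F *v b j s) - b' j s))" for s \<omega>
  have hp: "vproc h" unfolding h_def
    by (intro vproc_sum vproc_scale proc_B continuous_intros b_cont b'_cont)
  define m where "m t \<omega> = \<Phi> t *v (X0 \<omega> *\<^sub>R e0 + integral {0..t} (\<lambda>s. \<Psi> s *v h s \<omega>))" for t \<omega>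
  have mp: "vproc m" unfolding m_def
    by (intro vproc_matrix vproc_add vproc_scale proc_X0 vproc_integral hp \<Phi>c \<Psi>c continuous_intros)
  have eq: "(\<Sum>j\<in>UNIV. B j t \<omega> *\<^sub>R b j t) + m t \<omega> = Z t \<omega>" if t: "t \<in> {0..T}" and w: "\<omega> \<in> space M" for t \<omega>
  proof -
    define n where "n t = Z t \<omega> - (\<Sum>j\<in>UNIV. B j t \<omega> *\<^sub>R b j t)" for t
    have "n t = m t \<omega>"
    proof (rule linear_ode_unique[where c = 0 and d = T and A = "\<lambda>_. - F" and h = "\<lambda>s. h s \<omega>"])
      fix t assume t: "t \<in> {0..T}"
      have "(n has_vector_derivative - (F *v Z t \<omega>) - (\<Sum>j\<in>UNIV. B j t \<omega> *\<^sub>R b' j t)) (at t within {0..T})"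
      proof (rule integral_equation_derivative[OF _ _ t, where ?n0.0 = "X0 \<omega> *\<^sub>R e0"])
        show "continuous_on {0..T} (\<lambda>t. - (F *v Z t \<omega>) - (\<Sum>j\<in>UNIV. B j t \<omega> *\<^sub>R b' j t))"
          by (intro continuous_intros Z_cont w B_cont b'_cont)
      qed (simp add: n_def Z_eq w)
      moreover have "- (F *v Z t \<omega>) - (\<Sum>j\<in>UNIV. B j t \<omega> *\<^sub>R b' j t) = - F *v n t + h t \<omega>"
        by (simp add: n_def h_def matrix_vector_mult_diff_distrib UNIV_bool matrix_vector_mult_scaleR
            matrix_vector_right_distrib scaleR_diff_right bounded_bilinear.minus_left[OF bounded_bilinear_matrix_vector])
      ultimately show "(n has_vector_derivative - F *v n t + h t \<omega>) (at t within {0..T})" by simp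
      show "((\<lambda>t. m t \<omega>) has_vector_derivative - F *v m t \<omega> + h t \<omega>) (at t within {0..T})"
        unfolding m_def by (rule variation_of_constants[OF \<Phi>[OF t] inv[OF t] \<Psi>c vproc_cont[OF hp w] t])
    next
      show "n 0 = m 0 \<omega>" by (simp add: n_def m_def Z_0[OF w] B_zero[OF w] \<Phi>0)
    qed (use t in \<open>auto intro!: continuous_intros\<close>)
    then show ?thesis unfolding n_def by (simp add: diff_eq_eq add.commute)
  qed
  show ?thesis
    by (rule vproc_cong[OF vproc_add[OF vproc_sum mp] eq])
      (intro vproc_scale proc_B b_cont)
qed

lemma proc_Y: "proc Y"
proof (rule proc_cong)
  show "proc (\<lambda>t \<omega>. B False t \<omega> + integral {0..t} (\<lambda>s. a \<bullet> Z s \<omega>))"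
    by (intro proc_add proc_B proc_integral vproc_inner vproc_Z)
qed (simp add: Y_eq)

lemma semimart_Z: "semimart (\<lambda>t \<omega>. Z t \<omega> $ i) (\<lambda>t \<omega>. (- F *v Z t \<omega>) $ i) (\<lambda>j t. b j t $ i) (\<lambda>j t. b' j t $ i)"
  unfolding semimart_def
proof (intro conjI allI ballI)
  show "proc (\<lambda>t \<omega>. Z t \<omega> $ i)" by (rule vproc_nth[OF vproc_Z])
  show "proc (\<lambda>t \<omega>. (- F *v Z t \<omega>) $ i)" by (intro vproc_nth vproc_matrix vproc_Z continuous_intros)
  fix j show "continuous_on {0..T} (\<lambda>t. b' j t $ i)" by (intro continuous_intros b'_cont)
  fix t assume "t \<in> {0..T}"
  then show "((\<lambda>t. b j t $ i) has_real_derivative b' j t $ i) (at t within {0..T})"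
    unfolding has_real_derivative_iff_has_vector_derivative by (intro has_vector_derivative_nth b_deriv)
next
  fix \<omega> t assume w: "\<omega> \<in> space M" and t: "t \<in> {0..T}"
  let ?g = "\<lambda>s. - (F *v Z s \<omega>) - (\<Sum>j\<in>UNIV. B j s \<omega> *\<^sub>R b' j s)"
  have "continuous_on {0..T} ?g" by (intro continuous_intros Z_cont w B_cont b'_cont)
  then have "?g integrable_on {0..t}"
    using t by (intro integrable_continuous_real) (auto intro: continuous_on_subset)
  then have "integral {0..t} ?g $ i = integral {0..t} (\<lambda>s. ?g s $ i)"
    by (rule integral_component_eq_cart[symmetric])
  also have "\<dots> = integral {0..t} (\<lambda>s. (- F *v Z s \<omega>) $ i - (\<Sum>j\<in>UNIV. b' j s $ i * B j s \<omega>))"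
    by (simp add: sum_component mult.commute bounded_bilinear.minus_left[OF bounded_bilinear_matrix_vector])
  finally have "integral {0..t} ?g $ i = integral {0..t} (\<lambda>s. (- F *v Z s \<omega>) $ i - (\<Sum>j\<in>UNIV. b' j s $ i * B j s \<omega>))" .
  moreover have "Z t \<omega> $ i = (X0 \<omega> *\<^sub>R e0) $ i + (\<Sum>j\<in>UNIV. b j t $ i * B j t \<omega>) + integral {0..t} ?g $ i"
    by (subst Z_eq[OF w t]) (simp add: sum_component mult.commute)
  ultimately show "Z t \<omega> $ i = Z 0 \<omega> $ i + (\<Sum>j\<in>UNIV. b j t $ i * B j t \<omega>)
      + integral {0..t} (\<lambda>s. (- F *v Z s \<omega>) $ i - (\<Sum>j\<in>UNIV. b' j s $ i * B j s \<omega>))"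
    by (simp only: Z_0[OF w])
qed

lemma semimart_Y: "semimart Y (\<lambda>t \<omega>. a \<bullet> Z t \<omega>) (\<lambda>j t. if j then 0 else 1) (\<lambda>j t. 0)"
  unfolding semimart_def
proof (intro conjI allI ballI)
  fix \<omega> t assume w: "\<omega> \<in> space M" and t: "t \<in> {0..T}"
  have "Y t \<omega> = B False t \<omega> + integral {0..t} (\<lambda>s. a \<bullet> Z s \<omega>)" by (rule Y_eq[OF w t])
  then show "Y t \<omega> = Y 0 \<omega> + (\<Sum>j\<in>UNIV. (if j then 0 else 1) * B j t \<omega>)
      + integral {0..t} (\<lambda>s. a \<bullet> Z s \<omega> - (\<Sum>j\<in>UNIV. 0 * B j s \<omega>))"
    by (simp add: Y_0[OF w] UNIV_bool)
qed (auto intro: proc_Y vproc_inner vproc_Z)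

text \<open>Origin of \<open>Gm\<close> and \<open>Hm\<close>: the signal noise contributes b_1
  b_1^* + b_2 b_2^* and the observation takes away k k^* with k = P a + b_2. After expansion b_2
  b_2^* cancels and the mixed terms turn F into F + b_2 a^*, which leaves only b_1 b_1^* as
  source.\<close>

definition Gm :: "real \<Rightarrow> real^'n^'n" where "Gm t = outer (b True t) (b True t)"

definition Hm :: "real \<Rightarrow> real^'n^'n" where "Hm t = F + outer (b False t) a"

definition riccati_rhs :: "real \<Rightarrow> real^'n^'n \<Rightarrow> real^'n^'n" where
  "riccati_rhs t P = Gm t - Hm t ** P - P ** transpose (Hm t) - P ** outer a a ** P"

lemma riccati_solution:
  obtains P where "P 0 = ip M X0 X0 *\<^sub>R outer e0 e0" "\<And>t. t \<in> {0..T} \<Longrightarrow> transpose (P t) = P t"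
    "\<And>t. t \<in> {0..T} \<Longrightarrow> (P has_vector_derivative riccati_rhs t (P t)) (at t within {0..T})"
proof (rule riccati_exists[of T Hm Gm "b True" "outer a a" a "ip M X0 X0 *\<^sub>R outer e0 e0" "ip M X0 X0" e0])
  show "continuous_on {0..T} Hm" unfolding Hm_def by (intro continuous_intros b_cont)
  show "continuous_on {0..T} Gm" unfolding Gm_def by (intro continuous_intros b_cont)
  show "(ip M X0 X0 *\<^sub>R outer e0 e0) *v x = (ip M X0 X0 * (e0 \<bullet> x)) *\<^sub>R e0" for x
    by (simp add: outer_vector flip: scaleR_matrix_vector_assoc)
qed (use that in \<open>auto simp: T0 Gm_def outer_vector riccati_rhs_def\<close>)

end

text \<open>\<open>\<Phi>\<close> is a fundamental matrix of the error dynamics and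
  \<open>\<Psi>\<close> its inverse; with both fixed, the filter can be written as an explicit
  functional of the observation.\<close>

locale kalman_gain = kalman M T X0 B Z Y F a e0 b b'
  for M :: "'w measure" and T X0 B and Z :: "real \<Rightarrow> 'w \<Rightarrow> real^'n" and Y F a e0 b b' +
  fixes P \<Phi> \<Psi> :: "real \<Rightarrow> real^'n^'n"
  assumes P_0: "P 0 = ip M X0 X0 *\<^sub>R outer e0 e0"
    and P_sym: "\<And>t. t \<in> {0..T} \<Longrightarrow> transpose (P t) = P t"
    and P_deriv: "\<And>t. t \<in> {0..T} \<Longrightarrow> (P has_vector_derivative riccati_rhs t (P t)) (at t within {0..T})"
    and \<Phi>_deriv: "\<And>t. t \<in> {0..T} \<Longrightarrow>
        (\<Phi> has_vector_derivative - (F + outer (P t *v a + b False t) a) ** \<Phi> t) (at t within {0..T})"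
    and \<Psi>_cont: "continuous_on {0..T} \<Psi>"
    and \<Phi>\<Psi>: "\<And>t. t \<in> {0..T} \<Longrightarrow> \<Phi> t ** \<Psi> t = mat 1"
begin

definition gain :: "real \<Rightarrow> real^'n" where "gain t = P t *v a + b False t"

definition gain' :: "real \<Rightarrow> real^'n" where "gain' t = riccati_rhs t (P t) *v a + b' False t"

definition A :: "real \<Rightarrow> real^'n^'n" where "A t = - (F + outer (gain t) a)"

lemma P_cont: "continuous_on {0..T} P"
  using P_deriv by (meson continuous_on_eq_continuous_within has_vector_derivative_continuous)

lemma gain_deriv: "t \<in> {0..T} \<Longrightarrow> (gain has_vector_derivative gain' t) (at t within {0..T})"
  using has_vector_derivative_add[OF has_vector_derivative_matrix_vector[OF P_deriv has_vector_derivative_const[of a]] b_deriv]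
  unfolding gain_def[abs_def] gain'_def by simp

lemma gain_cont: "continuous_on {0..T} gain"
  unfolding gain_def[abs_def] by (intro continuous_intros P_cont b_cont)

lemma gain'_cont: "continuous_on {0..T} gain'"
  unfolding gain'_def[abs_def] riccati_rhs_def Hm_def Gm_def
  by (intro continuous_intros P_cont b_cont b'_cont)

lemma A_cont: "continuous_on {0..T} A"
  unfolding A_def[abs_def] by (intro continuous_intros gain_cont)

lemma \<Phi>_cont: "continuous_on {0..T} \<Phi>"
  using \<Phi>_deriv by (meson continuous_on_eq_continuous_within has_vector_derivative_continuous)

text \<open>The forcing that remains when the rough part is split off the filter: filter minus Y
  times gain is differentiable, and its derivative is A applied to itself plus Y times this vector,
  as integration by parts of the integral of the gain against Y shows. \<open>filt\<close> solves
  that equation by variation of constants.\<close>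

definition weight :: "real \<Rightarrow> real^'n" where "weight s = A s *v gain s - gain' s"

lemma weight_cont: "continuous_on {0..T} weight"
  unfolding weight_def[abs_def] by (intro continuous_intros A_cont gain_cont gain'_cont)

definition filt :: "real \<Rightarrow> 'w \<Rightarrow> real^'n" where
  "filt t \<omega> = Y t \<omega> *\<^sub>R gain t + \<Phi> t *v (0 + integral {0..t} (\<lambda>s. \<Psi> s *v (Y s \<omega> *\<^sub>R weight s)))"

lemma vproc_filt: "vproc filt"
proof -
  have "vproc (\<lambda>t \<omega>. integral {0..t} (\<lambda>s. \<Psi> s *v (Y s \<omega> *\<^sub>R weight s)))"
    by (intro vproc_matrix vproc_scale vproc_integral proc_Y \<Psi>_cont weight_cont)
  then show ?thesis unfolding filt_def[abs_def] add_0
    by (intro vproc_matrix vproc_add vproc_scale proc_Y gain_cont \<Phi>_cont)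
qed

lemma filt_0: "\<omega> \<in> space M \<Longrightarrow> filt 0 \<omega> = 0"
  by (simp add: filt_def Y_0)

lemma filt_eq:
  assumes w: "\<omega> \<in> space M" and t: "t \<in> {0..T}"
  shows "filt t \<omega> = Y t \<omega> *\<^sub>R gain t + integral {0..t} (\<lambda>s. A s *v filt s \<omega> - Y s \<omega> *\<^sub>R gain' s)"
proof -
  define \<eta> where "\<eta> t = \<Phi> t *v (0 + integral {0..t} (\<lambda>s. \<Psi> s *v (Y s \<omega> *\<^sub>R weight s)))" for t
  have f: "filt t \<omega> = Y t \<omega> *\<^sub>R gain t + \<eta> t" for t by (simp add: filt_def \<eta>_def)
  have "(\<eta> has_vector_derivative A t *v filt t \<omega> - Y t \<omega> *\<^sub>R gain' t) (at t within {0..T})" if t: "t \<in> {0..T}" for t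
  proof -
    have "(\<eta> has_vector_derivative A t *v \<eta> t + Y t \<omega> *\<^sub>R weight t) (at t within {0..T})"
      unfolding \<eta>_def A_def gain_def
      by (rule variation_of_constants[where A = "\<lambda>t. - (F + outer (P t *v a + b False t) a)"])
        (intro \<Phi>_deriv \<Phi>\<Psi> \<Psi>_cont t continuous_intros proc_cont[OF proc_Y w] weight_cont)+
    moreover have "A t *v \<eta> t + Y t \<omega> *\<^sub>R weight t = A t *v filt t \<omega> - Y t \<omega> *\<^sub>R gain' t"
      by (simp add: f weight_def matrix_vector_right_distrib matrix_vector_mult_scaleR scaleR_diff_right)
    ultimately show ?thesis by simp
  qed
  from derivative_integral_equation[OF this t] show ?thesis by (simp add: f \<eta>_def)
qed

definition err :: "real \<Rightarrow> 'w \<Rightarrow> real^'n" where "err t \<omega> = Z t \<omega> - filt t \<omega>"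

definition be :: "bool \<Rightarrow> real \<Rightarrow> real^'n" where "be j t = (if j then b True t else b False t - gain t)"

definition be' :: "bool \<Rightarrow> real \<Rightarrow> real^'n" where "be' j t = (if j then b' True t else b' False t - gain' t)"

lemma vproc_err: "vproc err"
  unfolding err_def[abs_def] by (intro vproc_diff vproc_Z vproc_filt)

lemma err_0: "\<omega> \<in> space M \<Longrightarrow> err 0 \<omega> = X0 \<omega> *\<^sub>R e0"
  by (simp add: err_def Z_0 filt_0)

lemma err_eq:
  assumes w: "\<omega> \<in> space M" and t: "t \<in> {0..T}"
  shows "err t \<omega> = X0 \<omega> *\<^sub>R e0 + (\<Sum>j\<in>UNIV. B j t \<omega> *\<^sub>R be j t)
      + integral {0..t} (\<lambda>s. A s *v err s \<omega> - (\<Sum>j\<in>UNIV. B j s \<omega> *\<^sub>R be' j s))"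
proof -
  \<comment> \<open>\<open>y\<close> is the differentiable part of Y. For its product with the gain
    the ordinary product rule holds, so the only noise contributed by Y times gain is
    \<open>B False\<close> times gain; this is how \<open>be False\<close> arises as
    \<open>b False\<close> minus gain.\<close>
  define y where "y t = integral {0..t} (\<lambda>s. a \<bullet> Z s \<omega>)" for t
  have Zc: "continuous_on {0..T} (\<lambda>s. Z s \<omega>)" by (rule Z_cont[OF w])
  have yd: "(y has_vector_derivative a \<bullet> Z t \<omega>) (at t within {0..T})" if "t \<in> {0..T}" for t
    unfolding y_def by (intro integral_has_vector_derivative that continuous_intros Zc)
  have yc: "continuous_on {0..T} y"
    using yd by (meson continuous_on_eq_continuous_within has_vector_derivative_continuous)
  have "((\<lambda>t. y t *\<^sub>R gain t) has_vector_derivative y t *\<^sub>R gain' t + (a \<bullet> Z t \<omega>) *\<^sub>R gain t) (at t within {0..T})"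
    if "t \<in> {0..T}" for t
    by (rule bounded_bilinear.has_vector_derivative[OF bounded_bilinear_scaleR yd[OF that] gain_deriv[OF that]])
  from derivative_integral_equation[OF this t]
  have yk: "y t *\<^sub>R gain t = integral {0..t} (\<lambda>s. y s *\<^sub>R gain' s + (a \<bullet> Z s \<omega>) *\<^sub>R gain s)"
    by (simp add: y_def)
  have int: "g integrable_on {0..t}" if "continuous_on {0..T} g" for g :: "real \<Rightarrow> real^'n"
    using t by (intro integrable_continuous_real continuous_on_subset[OF that]) auto
  let ?g1 = "\<lambda>s. - (F *v Z s \<omega>) - (\<Sum>j\<in>UNIV. B j s \<omega> *\<^sub>R b' j s)"
  let ?g2 = "\<lambda>s. A s *v filt s \<omega> - Y s \<omega> *\<^sub>R gain' s"
  let ?g3 = "\<lambda>s. y s *\<^sub>R gain' s + (a \<bullet> Z s \<omega>) *\<^sub>R gain s"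
  have c1: "continuous_on {0..T} ?g1" by (intro continuous_intros Zc B_cont w b'_cont)
  have c2: "continuous_on {0..T} ?g2"
    by (intro continuous_intros A_cont vproc_cont[OF vproc_filt w] proc_cont[OF proc_Y w] gain'_cont)
  have c3: "continuous_on {0..T} ?g3" by (intro continuous_intros yc gain'_cont gain_cont Zc)
  have "err t \<omega> = X0 \<omega> *\<^sub>R e0 + (\<Sum>j\<in>UNIV. B j t \<omega> *\<^sub>R b j t) - B False t \<omega> *\<^sub>R gain t
      + (integral {0..t} ?g1 - integral {0..t} ?g2 - integral {0..t} ?g3)"
    unfolding err_def filt_eq[OF w t] yk[symmetric]
    by (subst Z_eq[OF w t], subst Y_eq[OF w t]) (simp add: y_def scaleR_left_distrib)
  also have "integral {0..t} ?g1 - integral {0..t} ?g2 - integral {0..t} ?g3 = integral {0..t} (\<lambda>s. ?g1 s - ?g2 s - ?g3 s)"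
    using int[OF c1] int[OF c2] int[OF c3] by (simp add: integral_diff integrable_diff)
  also have "\<dots> = integral {0..t} (\<lambda>s. A s *v err s \<omega> - (\<Sum>j\<in>UNIV. B j s \<omega> *\<^sub>R be' j s))"
  proof (rule integral_cong)
    fix s assume "s \<in> {0..t}"
    then have s: "s \<in> {0..T}" using t by auto
    have Ys: "Y s \<omega> = B False s \<omega> + y s" using Y_eq[OF w s] by (simp add: y_def)
    have AZ: "A s *v Z s \<omega> = - (F *v Z s \<omega>) - (a \<bullet> Z s \<omega>) *\<^sub>R gain s"
      unfolding A_def by (simp add: bounded_bilinear.minus_left[OF bounded_bilinear_matrix_vector]
          matrix_vector_mult_diff_rdistrib outer_vector)
    show "?g1 s - ?g2 s - ?g3 s = A s *v err s \<omega> - (\<Sum>j\<in>UNIV. B j s \<omega> *\<^sub>R be' j s)"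
      unfolding err_def matrix_vector_mult_diff_distrib AZ Ys
      by (simp add: UNIV_bool be'_def scaleR_left_distrib scaleR_diff_right)
  qed
  also have "X0 \<omega> *\<^sub>R e0 + (\<Sum>j\<in>UNIV. B j t \<omega> *\<^sub>R b j t) - B False t \<omega> *\<^sub>R gain t
      = X0 \<omega> *\<^sub>R e0 + (\<Sum>j\<in>UNIV. B j t \<omega> *\<^sub>R be j t)"
    by (simp add: UNIV_bool be_def scaleR_diff_right)
  finally show ?thesis .
qed

lemma semimart_err:
  "semimart (\<lambda>t \<omega>. err t \<omega> $ i) (\<lambda>t \<omega>. (A t *v err t \<omega>) $ i) (\<lambda>j t. be j t $ i) (\<lambda>j t. be' j t $ i)"
  unfolding semimart_def
proof (intro conjI allI ballI)
  show "proc (\<lambda>t \<omega>. err t \<omega> $ i)" by (rule vproc_nth[OF vproc_err])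
  show "proc (\<lambda>t \<omega>. (A t *v err t \<omega>) $ i)" by (intro vproc_nth vproc_matrix vproc_err A_cont)
  fix j
  have bc: "continuous_on {0..T} (be' j)"
    unfolding be'_def by (cases j) (simp_all add: b'_cont gain'_cont continuous_on_diff)
  show "continuous_on {0..T} (\<lambda>t. be' j t $ i)" by (intro continuous_intros bc)
  fix t assume "t \<in> {0..T}"
  then have "(be j has_vector_derivative be' j t) (at t within {0..T})"
    unfolding be_def be'_def by (cases j) (auto intro!: b_deriv has_vector_derivative_diff gain_deriv)
  then show "((\<lambda>t. be j t $ i) has_real_derivative be' j t $ i) (at t within {0..T})"
    unfolding has_real_derivative_iff_has_vector_derivative by (intro has_vector_derivative_nth)
next
  fix \<omega> t assume w: "\<omega> \<in> space M" and t: "t \<in> {0..T}"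
  let ?g = "\<lambda>s. A s *v err s \<omega> - (\<Sum>j\<in>UNIV. B j s \<omega> *\<^sub>R be' j s)"
  have bc: "continuous_on {0..T} (be' j)" for j
    unfolding be'_def by (cases j) (simp_all add: b'_cont gain'_cont continuous_on_diff)
  have "continuous_on {0..T} ?g" by (intro continuous_intros A_cont vproc_cont[OF vproc_err w] w B_cont bc)
  then have "?g integrable_on {0..t}"
    using t by (intro integrable_continuous_real) (auto intro: continuous_on_subset)
  then have "integral {0..t} ?g $ i = integral {0..t} (\<lambda>s. ?g s $ i)"
    by (rule integral_component_eq_cart[symmetric])
  also have "\<dots> = integral {0..t} (\<lambda>s. (A s *v err s \<omega>) $ i - (\<Sum>j\<in>UNIV. be' j s $ i * B j s \<omega>))"
    by (simp add: sum_component mult.commute)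
  finally have "integral {0..t} ?g $ i = integral {0..t} (\<lambda>s. (A s *v err s \<omega>) $ i - (\<Sum>j\<in>UNIV. be' j s $ i * B j s \<omega>))" .
  moreover have "err t \<omega> $ i = (X0 \<omega> *\<^sub>R e0) $ i + (\<Sum>j\<in>UNIV. be j t $ i * B j t \<omega>) + integral {0..t} ?g $ i"
    by (subst err_eq[OF w t]) (simp add: sum_component mult.commute)
  ultimately show "err t \<omega> $ i = err 0 \<omega> $ i + (\<Sum>j\<in>UNIV. be j t $ i * B j t \<omega>)
      + integral {0..t} (\<lambda>s. (A s *v err s \<omega>) $ i - (\<Sum>j\<in>UNIV. be' j s $ i * B j s \<omega>))"
    by (simp only: err_0[OF w])
qed

section \<open>Covariances of the filtering error\<close>

lemma ip_matrix_left:
  assumes "\<And>k. x k \<in> L2 M" "y \<in> L2 M"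
  shows "ip M (\<lambda>\<omega>. ((C :: real^'n^'n) *v (\<chi> k. x k \<omega>)) $ i) y = (\<Sum>k\<in>UNIV. C $ i $ k * ip M (x k) y)"
proof -
  have "ip M (\<lambda>\<omega>. \<Sum>k\<in>UNIV. C $ i $ k * x k \<omega>) y = (\<Sum>k\<in>UNIV. ip M (\<lambda>\<omega>. C $ i $ k * x k \<omega>) y)"
    using assms by (intro ip_sum_left L2_cmult)
  then show ?thesis by (simp add: matrix_vector_mult_def)
qed

text \<open>The shape in which the right-hand side arises from differentiating E[e Z^*]. The
  quadratic term is hidden in \<open>A\<close>, and \<open>be False\<close> is - P a; the symmetry
  of P moves a to the right of P where needed.\<close>

lemma riccati_rhs_eq:
  assumes t: "t \<in> {0..T}"
  shows "riccati_rhs t (P t) = A t ** P t - P t ** transpose F + Gm t + outer (be False t) (b False t)"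
proof -
  note bb = bounded_bilinear_matrix_mult
  note bbs = bounded_bilinear.add_left[OF bb] bounded_bilinear.add_right[OF bb]
    bounded_bilinear.diff_left[OF bb] bounded_bilinear.diff_right[OF bb]
    bounded_bilinear.minus_left[OF bb] bounded_bilinear.minus_right[OF bb]
  note bo = bounded_bilinear_outer
  have 1: "outer v a ** P t = outer v (P t *v a)" for v :: "real^'n"
    unfolding outer_matrix P_sym[OF t] ..
  have 2: "P t ** outer a a ** P t = outer (P t *v a) (P t *v a)"
    unfolding matrix_outer 1 ..
  have 3: "P t ** transpose (Hm t) = P t ** transpose F + outer (P t *v a) (b False t)"
    unfolding Hm_def linear_add[OF bounded_linear.linear[OF bounded_linear_transpose]] transpose_outer
      bbs matrix_outer ..
  have 4: "Hm t ** P t = F ** P t + outer (b False t) (P t *v a)"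
    unfolding Hm_def bbs 1 ..
  have 5: "A t ** P t = - (F ** P t) - outer (P t *v a) (P t *v a) - outer (b False t) (P t *v a)"
    unfolding A_def bbs 1 gain_def bounded_bilinear.add_left[OF bo] by simp
  have 6: "outer (be False t) (b False t) = - outer (P t *v a) (b False t)"
    by (simp add: be_def gain_def bounded_bilinear.diff_left[OF bo] bounded_bilinear.add_left[OF bo]
        bounded_bilinear.minus_left[OF bo])
  show ?thesis unfolding riccati_rhs_def 2 3 4 5 6 by simp
qed

text \<open>Since \<open>A\<close> and \<open>be\<close> are built from P and not from the
  covariance C, the equation of C is linear. By \<open>riccati_rhs_eq\<close>, C - P solves a
  homogeneous linear equation with initial value 0.\<close>

lemma cross_covariance:
  assumes t: "t \<in> {0..T}"
  shows "ip M (\<lambda>\<omega>. err t \<omega> $ i) (\<lambda>\<omega>. Z t \<omega> $ j) = P t $ i $ j"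
proof -
  define C where "C t = (\<chi> i j. ip M (\<lambda>\<omega>. err t \<omega> $ i) (\<lambda>\<omega>. Z t \<omega> $ j))" for t
  have eL: "(\<lambda>\<omega>. err t \<omega> $ i) \<in> L2 M" and ZL: "(\<lambda>\<omega>. Z t \<omega> $ i) \<in> L2 M" if "t \<in> {0..T}" for t i
    using proc_L2[OF vproc_nth[OF vproc_err]] proc_L2[OF vproc_nth[OF vproc_Z]] that by auto
  have dC: "(C has_vector_derivative A t ** C t - C t ** transpose F + Gm t + outer (be False t) (b False t)) (at t within {0..T})"
    if t: "t \<in> {0..T}" for t
  proof (intro has_vector_derivative_vecI)
    fix i j
    have l: "ip M (\<lambda>\<omega>. (A t *v err t \<omega>) $ i) (\<lambda>\<omega>. Z t \<omega> $ j) = (A t ** C t) $ i $ j"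
      using ip_matrix_left[of "\<lambda>k \<omega>. err t \<omega> $ k" "\<lambda>\<omega>. Z t \<omega> $ j" "A t" i] eL[OF t] ZL[OF t]
      by (simp add: matrix_matrix_mult_def C_def)
    have "ip M (\<lambda>\<omega>. (- F *v Z t \<omega>) $ j) (\<lambda>\<omega>. err t \<omega> $ i) = (\<Sum>k\<in>UNIV. - F $ j $ k * ip M (\<lambda>\<omega>. Z t \<omega> $ k) (\<lambda>\<omega>. err t \<omega> $ i))"
      using ip_matrix_left[of "\<lambda>k \<omega>. Z t \<omega> $ k" "\<lambda>\<omega>. err t \<omega> $ i" "- F" j] eL[OF t] ZL[OF t] by simp
    also have "\<dots> = - (C t ** transpose F) $ i $ j"
      by (simp add: matrix_matrix_mult_def C_def transpose_def sum_negf mult.commute ip_commute[of M "\<lambda>\<omega>. Z t \<omega> $ _"])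
    finally have r: "ip M (\<lambda>\<omega>. err t \<omega> $ i) (\<lambda>\<omega>. (- F *v Z t \<omega>) $ j) = - (C t ** transpose F) $ i $ j"
      by (simp add: ip_commute)
    show "((\<lambda>t. C t $ i $ j) has_vector_derivative
        (A t ** C t - C t ** transpose F + Gm t + outer (be False t) (b False t)) $ i $ j) (at t within {0..T})"
      using semimart_product_derivative[OF semimart_err[of i] semimart_Z[of j] t]
      unfolding has_real_derivative_iff_has_vector_derivative l r
      by (simp add: C_def UNIV_bool Gm_def be_def add_ac)
  qed
  obtain K where K: "0 < K" "\<And>(A::real^'n^'n) (B::real^'n^'n). norm (A ** B) \<le> norm A * norm B * K"
    using matrix_mult_norm_bound by blast
  obtain c where c: "0 < c" "\<And>t. t \<in> {0..T} \<Longrightarrow> norm (A t) \<le> c"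
    using continuous_on_Icc_bounded[OF A_cont] by blast
  have "C t - P t = 0"
  proof (rule ode_zero[where c = 0 and d = T and y = "\<lambda>t. C t - P t" and ?t0.0 = 0
        and g = "\<lambda>t. A t ** (C t - P t) - (C t - P t) ** transpose F" and L = "c * K + norm (transpose F) * K"])
    fix t assume t: "t \<in> {0..T}"
    show "((\<lambda>t. C t - P t) has_vector_derivative A t ** (C t - P t) - (C t - P t) ** transpose F) (at t within {0..T})"
      using has_vector_derivative_diff[OF dC[OF t] P_deriv[OF t]] unfolding riccati_rhs_eq[OF t]
      by (simp add: bounded_bilinear.diff_left[OF bounded_bilinear_matrix_mult]
          bounded_bilinear.diff_right[OF bounded_bilinear_matrix_mult] algebra_simps)
    have "norm (A t ** (C t - P t)) \<le> norm (A t) * norm (C t - P t) * K" by (rule K)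
    also have "\<dots> \<le> c * norm (C t - P t) * K" using K c(2)[OF t] by (intro mult_right_mono) auto
    finally have "norm (A t ** (C t - P t)) \<le> c * norm (C t - P t) * K" .
    moreover have "norm ((C t - P t) ** transpose F) \<le> norm (C t - P t) * norm (transpose F) * K" by (rule K)
    ultimately have "norm (A t ** (C t - P t) - (C t - P t) ** transpose F) \<le>
        c * norm (C t - P t) * K + norm (C t - P t) * norm (transpose F) * K"
      by (intro order_trans[OF norm_triangle_ineq4] add_mono)
    then show "norm (A t ** (C t - P t) - (C t - P t) ** transpose F) \<le> (c * K + norm (transpose F) * K) * norm (C t - P t)"
      by (simp add: algebra_simps)
  next
    have "ip M (\<lambda>\<omega>. err 0 \<omega> $ i) (\<lambda>\<omega>. Z 0 \<omega> $ j) = ip M (\<lambda>\<omega>. e0 $ i * X0 \<omega>) (\<lambda>\<omega>. e0 $ j * X0 \<omega>)" for i j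
      by (rule ip_cong) (simp_all add: err_0 Z_0 mult.commute)
    then show "C 0 - P 0 = 0" by (simp add: C_def P_0 vec_eq_iff)
  qed (use t T0 in auto)
  then show ?thesis by (simp add: C_def vec_eq_iff)
qed

text \<open>Here the choice of the gain takes effect. Differentiating E[e Y] produces P a from the
  drift of Y, by \<open>cross_covariance\<close>, and \<open>be False\<close> = - P a from the
  common noise; they cancel and a homogeneous equation remains.\<close>

lemma err_orthogonal_now:
  assumes t: "t \<in> {0..T}"
  shows "ip M (\<lambda>\<omega>. err t \<omega> $ i) (Y t) = 0"
proof -
  define c where "c t = (\<chi> i. ip M (\<lambda>\<omega>. err t \<omega> $ i) (Y t))" for t
  have eL: "(\<lambda>\<omega>. err t \<omega> $ i) \<in> L2 M" and ZL: "(\<lambda>\<omega>. Z t \<omega> $ i) \<in> L2 M" and YL: "Y t \<in> L2 M" if "t \<in> {0..T}" for t i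
    using proc_L2[OF vproc_nth[OF vproc_err]] proc_L2[OF vproc_nth[OF vproc_Z]] proc_L2[OF proc_Y] that by auto
  have "c t = (\<lambda>_. 0) t"
  proof (rule linear_ode_unique[OF A_cont _ _ _ t, where h = "\<lambda>_. 0"])
    fix t assume t: "t \<in> {0..T}"
    show "(c has_vector_derivative A t *v c t + 0) (at t within {0..T})"
    proof (rule has_vector_derivative_vecI)
      fix i
      have l: "ip M (\<lambda>\<omega>. (A t *v err t \<omega>) $ i) (Y t) = (A t *v c t) $ i"
        using ip_matrix_left[of "\<lambda>k \<omega>. err t \<omega> $ k" "Y t" "A t" i] eL[OF t] YL[OF t]
        by (simp add: matrix_vector_mult_def c_def)
      have "ip M (\<lambda>\<omega>. err t \<omega> $ i) (\<lambda>\<omega>. a \<bullet> Z t \<omega>) = ip M (\<lambda>\<omega>. err t \<omega> $ i) (\<lambda>\<omega>. \<Sum>k\<in>UNIV. a $ k * Z t \<omega> $ k)"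
        by (simp add: inner_vec_def)
      also have "\<dots> = (\<Sum>k\<in>UNIV. ip M (\<lambda>\<omega>. err t \<omega> $ i) (\<lambda>\<omega>. a $ k * Z t \<omega> $ k))"
        by (intro ip_sum_right L2_cmult eL ZL t)
      also have "\<dots> = (P t *v a) $ i"
        by (simp add: cross_covariance[OF t] matrix_vector_mult_def mult.commute)
      finally have r: "ip M (\<lambda>\<omega>. err t \<omega> $ i) (\<lambda>\<omega>. a \<bullet> Z t \<omega>) = (P t *v a) $ i" .
      show "((\<lambda>t. c t $ i) has_vector_derivative (A t *v c t + 0) $ i) (at t within {0..T})"
        using semimart_product_derivative[OF semimart_err[of i] semimart_Y t]
        unfolding has_real_derivative_iff_has_vector_derivative l r
        by (simp add: c_def UNIV_bool be_def gain_def)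
    qed
  next
    have "ip M (\<lambda>\<omega>. err 0 \<omega> $ i) (Y 0) = ip M (\<lambda>\<omega>. err 0 \<omega> $ i) (\<lambda>_. 0)" for i
      by (rule ip_cong) (simp_all add: Y_0)
    then show "c 0 = 0" by (simp add: c_def vec_eq_iff)
  qed simp
  then show ?thesis by (simp add: c_def vec_eq_iff)
qed

text \<open>With s fixed and t moving on, Y(s) belongs to the past, so the noise of the error drops
  out by \<open>semimart_drift\<close>; the covariance solves a homogeneous equation starting from 0
  at t = s.\<close>

lemma err_orthogonal:
  assumes st: "0 \<le> s" "s \<le> t" "t \<le> T"
  shows "ip M (Y s) (\<lambda>\<omega>. err t \<omega> $ i) = 0"
proof -
  define q where "q t = (\<chi> i. ip M (Y s) (\<lambda>\<omega>. err t \<omega> $ i))" for t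
  have s: "s \<in> {0..T}" using st by simp
  have Yh: "Y s \<in> hist s" by (rule proc_hist[OF proc_Y s])
  have YL: "Y s \<in> L2 M" by (rule hist_L2[OF Yh])
  have eL: "(\<lambda>\<omega>. err t \<omega> $ i) \<in> L2 M" if "t \<in> {0..T}" for t i
    using proc_L2[OF vproc_nth[OF vproc_err]] that by auto
  have Ac: "continuous_on {s..T} A" using s by (intro continuous_on_subset[OF A_cont]) auto
  have qc: "continuous_on {0..T} (\<lambda>r. ip M (Y s) (\<lambda>\<omega>. err r \<omega> $ k))" for k
    by (rule ip_continuous_on[OF proc_l2proc[OF vproc_nth[OF vproc_err]] YL])
  have "q t = (\<lambda>_. 0) t"
  proof (rule linear_ode_unique[OF Ac, where h = "\<lambda>_. 0"])
    fix r assume r: "r \<in> {s..T}"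
    show "(q has_vector_derivative A r *v q r + 0) (at r within {s..T})"
    proof (rule has_vector_derivative_vecI)
      fix i
      have Aq: "ip M (Y s) (\<lambda>\<omega>. (A r *v err r \<omega>) $ i) = (A r *v q r) $ i" if "r \<in> {s..T}" for r
        using ip_matrix_left[of "\<lambda>k \<omega>. err r \<omega> $ k" "Y s" "A r" i] eL[of r] YL that s
        by (simp add: matrix_vector_mult_def q_def ip_commute[of M "Y s"])
      have ieq: "q r $ i = q s $ i + integral {s..r} (\<lambda>r. (A r *v q r) $ i)" if r: "r \<in> {s..T}" for r
      proof -
        have "ip M (Y s) (\<lambda>\<omega>. err r \<omega> $ i) - ip M (Y s) (\<lambda>\<omega>. err s \<omega> $ i) =
            integral {s..r} (\<lambda>r. ip M (Y s) (\<lambda>\<omega>. (A r *v err r \<omega>) $ i))"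
          using r st by (intro semimart_drift[OF semimart_err _ _ _ Yh]) auto
        also have "\<dots> = integral {s..r} (\<lambda>r. (A r *v q r) $ i)"
          using r by (intro integral_cong Aq) auto
        finally show ?thesis by (simp add: q_def)
      qed
      have "continuous_on {s..T} q" unfolding q_def
        using s by (intro continuous_on_vec_lambda continuous_on_subset[OF qc]) auto
      then have cc: "continuous_on {s..T} (\<lambda>r. (A r *v q r) $ i)" by (intro continuous_intros Ac)
      show "((\<lambda>t. q t $ i) has_vector_derivative (A r *v q r + 0) $ i) (at r within {s..T})"
        unfolding add_0_right by (rule integral_equation_derivative[OF cc ieq r])
    qed
  next
    show "q s = 0"
      using err_orthogonal_now[OF s] by (simp add: q_def vec_eq_iff ip_commute[of M "Y s"])
  qed (use st in auto)
  then show ?thesis by (simp add: q_def vec_eq_iff)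
qed

end

section \<open>Conditional expectation of Gaussian families\<close>

context prob_space begin

lemma complex_integrable_mult_iexp:
  fixes g :: "'a \<Rightarrow> real"
  assumes g: "integrable M g" and [measurable]: "\<eta> \<in> borel_measurable M"
  shows "complex_integrable M (\<lambda>\<omega>. complex_of_real (g \<omega>) * iexp (\<eta> \<omega>))"
proof (rule Bochner_Integration.integrable_bound)
  show "integrable M (\<lambda>\<omega>. complex_of_real (g \<omega>))" using g by simp
  have [measurable]: "g \<in> borel_measurable M" using g by (rule borel_measurable_integrable)
  show "(\<lambda>\<omega>. complex_of_real (g \<omega>) * iexp (\<eta> \<omega>)) \<in> borel_measurable M" by measurable
qed (simp add: norm_mult)

lemma integrable_mult_cos_sin:
  fixes g :: "'a \<Rightarrow> real"
  assumes g: "integrable M g" and [measurable]: "\<eta> \<in> borel_measurable M"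
  shows "integrable M (\<lambda>\<omega>. g \<omega> * cos (\<eta> \<omega>))" "integrable M (\<lambda>\<omega>. g \<omega> * sin (\<eta> \<omega>))"
proof -
  have [measurable]: "g \<in> borel_measurable M" using g by (rule borel_measurable_integrable)
  have "\<bar>x * c\<bar> \<le> \<bar>x\<bar>" if "\<bar>c\<bar> \<le> 1" for x c :: real
    using that by (simp add: abs_mult mult_left_le)
  then show "integrable M (\<lambda>\<omega>. g \<omega> * cos (\<eta> \<omega>))" "integrable M (\<lambda>\<omega>. g \<omega> * sin (\<eta> \<omega>))"
    by (intro Bochner_Integration.integrable_bound[OF g]; simp add: abs_cos_le_one abs_sin_le_one)+
qed

lemma integral_mult_iexp:
  fixes g :: "'a \<Rightarrow> real"
  assumes g: "integrable M g" and m: "\<eta> \<in> borel_measurable M"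
  shows "(CLINT \<omega>|M. complex_of_real (g \<omega>) * iexp (\<eta> \<omega>)) =
    Complex (\<integral>\<omega>. g \<omega> * cos (\<eta> \<omega>) \<partial>M) (\<integral>\<omega>. g \<omega> * sin (\<eta> \<omega>) \<partial>M)"
proof (rule complex_eqI)
  note I = complex_integrable_mult_iexp[OF g m]
  show "Re (CLINT \<omega>|M. complex_of_real (g \<omega>) * iexp (\<eta> \<omega>)) = Re (Complex (\<integral>\<omega>. g \<omega> * cos (\<eta> \<omega>) \<partial>M) (\<integral>\<omega>. g \<omega> * sin (\<eta> \<omega>) \<partial>M))"
    unfolding integral_Re[OF I, symmetric] by (simp add: Re_exp)
  show "Im (CLINT \<omega>|M. complex_of_real (g \<omega>) * iexp (\<eta> \<omega>)) = Im (Complex (\<integral>\<omega>. g \<omega> * cos (\<eta> \<omega>) \<partial>M) (\<integral>\<omega>. g \<omega> * sin (\<eta> \<omega>) \<partial>M))"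
    unfolding integral_Im[OF I, symmetric] by (simp add: Im_exp)
qed

text \<open>The integral is, up to the factor i, the derivative at 0 of the characteristic function
  of \<open>\<epsilon> * \<xi> + \<eta>\<close>. Without correlation that function depends on
  \<open>\<epsilon>\<close> only through its square, so the derivative is 0. Quantitatively, the
  Taylor remainder and the change of the characteristic function are each at most
  \<open>\<epsilon>\<^sup>2 * a / 2\<close>; dividing by \<open>\<epsilon>\<close> leaves
  \<open>\<epsilon> * a\<close>.\<close>

lemma gaussian_iexp_orthogonal:
  assumes \<xi>: "\<xi> \<in> L2 M" and \<eta>: "\<eta> \<in> L2 M" and G: "\<And>\<epsilon>. gaussian M (\<lambda>\<omega>. \<epsilon> * \<xi> \<omega> + \<eta> \<omega>)"
    and orth: "ip M \<xi> \<eta> = 0"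
  shows "(CLINT \<omega>|M. complex_of_real (\<xi> \<omega>) * iexp (\<eta> \<omega>)) = 0"
proof -
  define a b where "a = ip M \<xi> \<xi>" and "b = ip M \<eta> \<eta>"
  define I where "I = (CLINT \<omega>|M. complex_of_real (\<xi> \<omega>) * iexp (\<eta> \<omega>))"
  have ab: "0 \<le> a" "0 \<le> b" by (simp_all add: a_def b_def)
  have [measurable]: "\<xi> \<in> borel_measurable M" "\<eta> \<in> borel_measurable M" using \<xi> \<eta> by (auto simp: L2_def)
  have int: "complex_integrable M (\<lambda>\<omega>. iexp (g \<omega>))" if [measurable]: "g \<in> borel_measurable M" for g
    by (rule integrable_const_bound[where B = 1]) auto
  have char: "(CLINT \<omega>|M. iexp (\<epsilon> * \<xi> \<omega> + \<eta> \<omega>)) = exp (- (\<epsilon>\<^sup>2 * a + b) / 2)" for \<epsilon>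
  proof -
    have "ip M (\<lambda>\<omega>. \<epsilon> * \<xi> \<omega> + \<eta> \<omega>) (\<lambda>\<omega>. \<epsilon> * \<xi> \<omega> + \<eta> \<omega>) = \<epsilon>\<^sup>2 * a + b"
      using \<xi> \<eta> orth by (simp add: ip_add_left ip_add_right L2_cmult L2_add a_def b_def ip_commute[of M \<eta> \<xi>] power2_eq_square)
    then show ?thesis using gaussian_char[OF G, of 1 \<epsilon>] by simp
  qed
  have bound: "cmod I \<le> \<epsilon> * a" if e: "0 < \<epsilon>" for \<epsilon>
  proof -
    let ?d = "\<lambda>\<omega>. iexp (\<epsilon> * \<xi> \<omega> + \<eta> \<omega>) - iexp (\<eta> \<omega>) - \<i> * \<epsilon> * (complex_of_real (\<xi> \<omega>) * iexp (\<eta> \<omega>))"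
    have ci: "complex_integrable M (\<lambda>\<omega>. complex_of_real (\<xi> \<omega>) * iexp (\<eta> \<omega>))"
      by (intro complex_integrable_mult_iexp L2_integrable \<xi>) measurable
    have i1: "complex_integrable M (\<lambda>\<omega>. iexp (\<epsilon> * \<xi> \<omega> + \<eta> \<omega>))" "complex_integrable M (\<lambda>\<omega>. iexp (\<eta> \<omega>))"
      by (rule int, measurable)+
    have d1: "(CLINT \<omega>|M. ?d \<omega>) = exp (- (\<epsilon>\<^sup>2 * a + b) / 2) - exp (- (0\<^sup>2 * a + b) / 2) - \<i> * \<epsilon> * I"
    proof -
      have "(CLINT \<omega>|M. ?d \<omega>) = (CLINT \<omega>|M. iexp (\<epsilon> * \<xi> \<omega> + \<eta> \<omega>)) - (CLINT \<omega>|M. iexp (\<eta> \<omega>))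
          - (CLINT \<omega>|M. \<i> * \<epsilon> * (complex_of_real (\<xi> \<omega>) * iexp (\<eta> \<omega>)))"
        using i1 ci by (simp only: Bochner_Integration.integral_diff Bochner_Integration.integrable_diff integrable_mult_right)
      also have "(CLINT \<omega>|M. iexp (\<eta> \<omega>)) = exp (- (0\<^sup>2 * a + b) / 2)" using char[of 0] by simp
      finally show ?thesis unfolding char I_def by simp
    qed
    have d2: "cmod (CLINT \<omega>|M. ?d \<omega>) \<le> \<epsilon>\<^sup>2 * a / 2"
    proof -
      have pt: "cmod (?d \<omega>) \<le> \<epsilon>\<^sup>2 / 2 * (\<xi> \<omega> * \<xi> \<omega>)" for \<omega>
      proof -
        have "iexp (\<epsilon> * \<xi> \<omega> + \<eta> \<omega>) = iexp (\<epsilon> * \<xi> \<omega>) * iexp (\<eta> \<omega>)"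
          by (simp add: distrib_left exp_add)
        then have "?d \<omega> = (iexp (\<epsilon> * \<xi> \<omega>) - (\<Sum>k\<le>1. (\<i> * (\<epsilon> * \<xi> \<omega>))^k / fact k)) * iexp (\<eta> \<omega>)"
          by (simp add: algebra_simps)
        then have "cmod (?d \<omega>) = cmod (iexp (\<epsilon> * \<xi> \<omega>) - (\<Sum>k\<le>1. (\<i> * (\<epsilon> * \<xi> \<omega>))^k / fact k))"
          by (simp add: norm_mult)
        also have "\<dots> \<le> \<bar>\<epsilon> * \<xi> \<omega>\<bar> ^ Suc 1 / fact (Suc 1)" by (rule iexp_approx1)
        also have "\<dots> = \<epsilon>\<^sup>2 / 2 * (\<xi> \<omega> * \<xi> \<omega>)"
          by (simp add: power2_eq_square abs_mult fact_numeral mult_ac flip: abs_mult)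
        finally show ?thesis .
      qed
      have "cmod (CLINT \<omega>|M. ?d \<omega>) \<le> (\<integral>\<omega>. cmod (?d \<omega>) \<partial>M)" by (rule integral_norm_bound)
      also have "\<dots> \<le> (\<integral>\<omega>. \<epsilon>\<^sup>2 / 2 * (\<xi> \<omega> * \<xi> \<omega>) \<partial>M)"
        by (intro integral_mono integrable_norm Bochner_Integration.integrable_diff i1 integrable_mult_right ci
            L2_mult_integrable \<xi> pt)
      also have "\<dots> = \<epsilon>\<^sup>2 * a / 2" by (simp add: a_def ip_def)
      finally show ?thesis .
    qed
    have d3: "cmod (complex_of_real (exp (- (\<epsilon>\<^sup>2 * a + b) / 2)) - complex_of_real (exp (- (0\<^sup>2 * a + b) / 2))) \<le> \<epsilon>\<^sup>2 * a / 2"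
    proof -
      have "exp (- (\<epsilon>\<^sup>2 * a + b) / 2) = exp (- (b / 2)) * exp (- (\<epsilon>\<^sup>2 * a / 2))"
        by (simp add: add_divide_distrib flip: exp_add)
      then have "exp (- (\<epsilon>\<^sup>2 * a + b) / 2) - exp (- (b / 2)) = - (exp (- (b / 2)) * (1 - exp (- (\<epsilon>\<^sup>2 * a / 2))))"
        by (simp add: right_diff_distrib)
      then have "\<bar>exp (- (\<epsilon>\<^sup>2 * a + b) / 2) - exp (- (b / 2))\<bar> = exp (- (b / 2)) * \<bar>1 - exp (- (\<epsilon>\<^sup>2 * a / 2))\<bar>"
        by (simp only: abs_minus_cancel abs_mult abs_exp_cancel)
      also have "\<dots> \<le> 1 * (\<epsilon>\<^sup>2 * a / 2)"
      proof (rule mult_mono)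
        have "1 - \<epsilon>\<^sup>2 * a / 2 \<le> exp (- (\<epsilon>\<^sup>2 * a / 2))" using exp_ge_add_one_self[of "- (\<epsilon>\<^sup>2 * a / 2)"] by simp
        moreover have "exp (- (\<epsilon>\<^sup>2 * a / 2)) \<le> 1" using ab by simp
        ultimately show "\<bar>1 - exp (- (\<epsilon>\<^sup>2 * a / 2))\<bar> \<le> \<epsilon>\<^sup>2 * a / 2" by simp
      qed (use ab in auto)
      finally show ?thesis by (simp flip: of_real_diff)
    qed
    have "\<i> * \<epsilon> * I = complex_of_real (exp (- (\<epsilon>\<^sup>2 * a + b) / 2)) - complex_of_real (exp (- (0\<^sup>2 * a + b) / 2)) - (CLINT \<omega>|M. ?d \<omega>)"
      unfolding d1 by simp
    then have "cmod (\<i> * \<epsilon> * I) \<le> \<epsilon>\<^sup>2 * a / 2 + \<epsilon>\<^sup>2 * a / 2"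
      by (metis (no_types) order_trans[OF norm_triangle_ineq4 add_mono[OF d3 d2]])
    then have "\<epsilon> * cmod I \<le> \<epsilon> * (\<epsilon> * a)" using e by (simp add: norm_mult power2_eq_square)
    then show ?thesis using e by simp
  qed
  have "cmod I \<le> 0"
  proof (rule field_le_epsilon)
    fix e :: real assume e: "0 < e"
    have "cmod I \<le> e / (a + 1) * a" using e ab by (intro bound) auto
    also have "\<dots> \<le> e" using e ab by (simp add: field_simps)
    finally show "cmod I \<le> 0 + e" by simp
  qed
  then show ?thesis by (simp add: I_def)
qed

text \<open>Positive and negative part of g have the same mass m, by frequency 0. Normalized by m
  they are densities of two probability measures under which Y has the same characteristic function,
  so Levy's uniqueness theorem applies. The case m = 0, where nothing can be normalized, makes g
  vanish almost everywhere.\<close>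

lemma fourier_unique:
  fixes g :: "'a \<Rightarrow> real"
  assumes g: "integrable M g" and [measurable]: "Y \<in> borel_measurable M"
    and c: "\<And>l. (\<integral>\<omega>. g \<omega> * cos (l * Y \<omega>) \<partial>M) = 0" and s: "\<And>l. (\<integral>\<omega>. g \<omega> * sin (l * Y \<omega>) \<partial>M) = 0"
    and A [measurable]: "A \<in> sets borel"
  shows "(\<integral>\<omega>. g \<omega> * indicator A (Y \<omega>) \<partial>M) = 0"
proof -
  have gm [measurable]: "g \<in> borel_measurable M" using g by (rule borel_measurable_integrable)
  define gp where "gp \<omega> = max 0 (g \<omega>)" for \<omega>
  define gn where "gn \<omega> = max 0 (- g \<omega>)" for \<omega>
  have gpi: "integrable M gp" and gni: "integrable M gn"
    unfolding gp_def gn_def using g by auto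
  have [measurable]: "gp \<in> borel_measurable M" "gn \<in> borel_measurable M" using gpi gni by auto
  have pos: "0 \<le> gp \<omega>" "0 \<le> gn \<omega>" for \<omega> by (simp_all add: gp_def gn_def)
  have gd: "g \<omega> = gp \<omega> - gn \<omega>" for \<omega> by (simp add: gp_def gn_def)
  define m where "m = (\<integral>\<omega>. gp \<omega> \<partial>M)"
  have mn: "(\<integral>\<omega>. gn \<omega> \<partial>M) = m"
    using c[of 0] gpi gni by (simp add: gd m_def)
  have m0: "0 \<le> m" unfolding m_def by (intro integral_nonneg_AE) (simp add: pos)
  show ?thesis
  proof (cases "m = 0")
    case True
    then have "AE \<omega> in M. gp \<omega> = 0" "AE \<omega> in M. gn \<omega> = 0"
      using integral_nonneg_eq_0_iff_AE[OF gpi] integral_nonneg_eq_0_iff_AE[OF gni] mn by (simp_all add: pos m_def)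
    then have "AE \<omega> in M. g \<omega> * indicator A (Y \<omega>) = 0" by eventually_elim (simp add: gd)
    then show ?thesis by (rule integral_eq_zero_AE)
  next
    case False
    with m0 have mp: "0 < m" by simp
    define N where "N h = distr (density M (\<lambda>\<omega>. ennreal (h \<omega> / m))) borel Y" for h
    have int: "(LINT x|N h. f x) = (\<integral>\<omega>. (h \<omega> / m) *\<^sub>R f (Y \<omega>) \<partial>M)"
      if h [measurable]: "h \<in> borel_measurable M" and "\<And>\<omega>. 0 \<le> h \<omega>" and [measurable]: "f \<in> borel_measurable borel"
      for h and f :: "real \<Rightarrow> 'c::{banach, second_countable_topology}"
      unfolding N_def using that mp by (subst integral_distr) (auto simp: integral_density)
    have rd: "real_distribution (N h)"
      if hi: "integrable M h" and h0: "\<And>\<omega>. 0 \<le> h \<omega>" and hm: "(\<integral>\<omega>. h \<omega> \<partial>M) = m" for h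
    proof -
      have [measurable]: "h \<in> borel_measurable M" using hi by auto
      have "(\<integral>\<^sup>+\<omega>. ennreal (h \<omega> / m) \<partial>M) = ennreal (\<integral>\<omega>. h \<omega> / m \<partial>M)"
        using hi h0 mp by (intro nn_integral_eq_integral) auto
      also have "\<dots> = 1" using hm mp by simp
      finally have "prob_space (density M (\<lambda>\<omega>. ennreal (h \<omega> / m)))"
        by (intro prob_spaceI) (simp add: emeasure_density cong: nn_integral_cong)
      then interpret D: prob_space "density M (\<lambda>\<omega>. ennreal (h \<omega> / m))" .
      show ?thesis unfolding N_def by (intro D.real_distribution_distr) simp
    qed
    have "char (N gp) = char (N gn)"
    proof
      fix u
      have cc: "char (N h) u = (CLINT \<omega>|M. complex_of_real (h \<omega>) * iexp (u * Y \<omega>)) / m"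
        if [measurable]: "h \<in> borel_measurable M" and "\<And>\<omega>. 0 \<le> h \<omega>" for h
        unfolding char_def using that by (subst int) (auto simp: scaleR_conv_of_real)
      have "(CLINT \<omega>|M. complex_of_real (gp \<omega>) * iexp (u * Y \<omega>)) - (CLINT \<omega>|M. complex_of_real (gn \<omega>) * iexp (u * Y \<omega>)) =
          (CLINT \<omega>|M. complex_of_real (g \<omega>) * iexp (u * Y \<omega>))"
      proof -
        have um: "(\<lambda>\<omega>. u * Y \<omega>) \<in> borel_measurable M" by measurable
        have "(CLINT \<omega>|M. complex_of_real (g \<omega>) * iexp (u * Y \<omega>)) =
            (CLINT \<omega>|M. complex_of_real (gp \<omega>) * iexp (u * Y \<omega>) - complex_of_real (gn \<omega>) * iexp (u * Y \<omega>))"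
          by (simp add: gd left_diff_distrib)
        also have "\<dots> = (CLINT \<omega>|M. complex_of_real (gp \<omega>) * iexp (u * Y \<omega>)) - (CLINT \<omega>|M. complex_of_real (gn \<omega>) * iexp (u * Y \<omega>))"
          by (rule Bochner_Integration.integral_diff[OF complex_integrable_mult_iexp[OF gpi um] complex_integrable_mult_iexp[OF gni um]])
        finally show ?thesis by simp
      qed
      also have "\<dots> = 0"
        by (subst integral_mult_iexp[OF g]) (simp_all add: c s complex_eq_iff)
      finally have "(CLINT \<omega>|M. complex_of_real (gp \<omega>) * iexp (u * Y \<omega>)) = (CLINT \<omega>|M. complex_of_real (gn \<omega>) * iexp (u * Y \<omega>))"
        by simp
      then show "char (N gp) u = char (N gn) u" by (simp add: cc pos)
    qed
    then have NN: "N gp = N gn"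
      by (intro Levy_uniqueness rd gpi gni pos mn) (simp_all add: m_def)
    have ind: "(LINT x|N h. indicator A x :: real) = (\<integral>\<omega>. h \<omega> * indicator A (Y \<omega>) \<partial>M) / m"
      if "h \<in> borel_measurable M" "\<And>\<omega>. 0 \<le> h \<omega>" for h
      by (subst int[OF that]) simp_all
    have "(\<integral>\<omega>. gp \<omega> * indicator A (Y \<omega>) \<partial>M) / m = (\<integral>\<omega>. gn \<omega> * indicator A (Y \<omega>) \<partial>M) / m"
      using NN ind[of gp] ind[of gn] pos by simp
    then have "(\<integral>\<omega>. gp \<omega> * indicator A (Y \<omega>) \<partial>M) = (\<integral>\<omega>. gn \<omega> * indicator A (Y \<omega>) \<partial>M)"
      using mp by simp
    moreover have "integrable M (\<lambda>\<omega>. h \<omega> * indicator A (Y \<omega>))" if "integrable M h" for h :: "'a \<Rightarrow> real"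
      using that by (rule Bochner_Integration.integrable_bound) (use that in \<open>auto split: split_indicator\<close>)
    ultimately show ?thesis using gpi gni by (simp add: gd left_diff_distrib)
  qed
qed

text \<open>Induction over the coordinates with g arbitrary: one coordinate at a time is turned from
  a frequency into an indicator, which is then absorbed into g. For this the one-dimensional lemma
  is applied to g times the cosine and g times the sine of the remaining linear combination.\<close>

lemma fourier_unique_finite:
  fixes g :: "'a \<Rightarrow> real"
  assumes "finite K" "\<And>k. k \<in> K \<Longrightarrow> Y k \<in> borel_measurable M" "integrable M g"
    and "\<And>l. (\<integral>\<omega>. g \<omega> * cos (\<Sum>k\<in>K. l k * Y k \<omega>) \<partial>M) = 0"
    and "\<And>l. (\<integral>\<omega>. g \<omega> * sin (\<Sum>k\<in>K. l k * Y k \<omega>) \<partial>M) = 0"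
    and "\<And>k. k \<in> K \<Longrightarrow> A k \<in> sets borel"
  shows "(\<integral>\<omega>. g \<omega> * (\<Prod>k\<in>K. indicator (A k) (Y k \<omega>)) \<partial>M) = 0"
  using assms
proof (induction K arbitrary: g rule: finite_induct)
  case empty
  then show ?case by simp
next
  case (insert i K)
  note gi = insert.prems(2)
  have Yi [measurable]: "Y i \<in> borel_measurable M" and Ai [measurable]: "A i \<in> sets borel" using insert by auto
  have gm [measurable]: "g \<in> borel_measurable M" using gi by auto
  define \<psi> where "\<psi> l \<omega> = (\<Sum>k\<in>K. l k * Y k \<omega>)" for l \<omega>
  have \<psi>m [measurable]: "\<psi> l \<in> borel_measurable M" for l
    unfolding \<psi>_def using insert.prems(1) by (intro borel_measurable_sum borel_measurable_times) auto
  have upd: "(\<Sum>k\<in>insert i K. (l(i := x)) k * Y k \<omega>) = \<psi> l \<omega> + x * Y i \<omega>" for l x \<omega>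
  proof -
    have "(\<Sum>k\<in>K. (l(i := x)) k * Y k \<omega>) = \<psi> l \<omega>"
      unfolding \<psi>_def using insert.hyps by (intro sum.cong) auto
    then show ?thesis using insert.hyps by simp
  qed
  have c0: "(\<integral>\<omega>. g \<omega> * cos (\<psi> l \<omega> + x * Y i \<omega>) \<partial>M) = 0" for l x
    using insert.prems(3)[of "l(i := x)"] unfolding upd .
  have s0: "(\<integral>\<omega>. g \<omega> * sin (\<psi> l \<omega> + x * Y i \<omega>) \<partial>M) = 0" for l x
    using insert.prems(4)[of "l(i := x)"] unfolding upd .
  have ci: "integrable M (\<lambda>\<omega>. g \<omega> * cos (\<psi> l \<omega> + x * Y i \<omega>))"
    and si: "integrable M (\<lambda>\<omega>. g \<omega> * sin (\<psi> l \<omega> + x * Y i \<omega>))" for l x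
    by (intro integrable_mult_cos_sin gi, measurable)+
  \<comment> \<open>Product-to-sum formulas: the hypothesis at the frequencies x and - x of the new
    coordinate separates the product into its factors, here and in the three companions.\<close>
  have cc: "(\<integral>\<omega>. (g \<omega> * cos (\<psi> l \<omega>)) * cos (x * Y i \<omega>) \<partial>M) = 0" for l x
  proof -
    have "(\<integral>\<omega>. (g \<omega> * cos (\<psi> l \<omega>)) * cos (x * Y i \<omega>) \<partial>M) =
        (\<integral>\<omega>. (g \<omega> * cos (\<psi> l \<omega> + (- x) * Y i \<omega>) + g \<omega> * cos (\<psi> l \<omega> + x * Y i \<omega>)) / 2 \<partial>M)"
      by (intro Bochner_Integration.integral_cong refl) (simp add: cos_add cos_diff algebra_simps)
    also have "\<dots> = 0" using Bochner_Integration.integral_add[OF ci[of l "- x"] ci[of l x]] c0[of l "- x"] c0[of l x] by simp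
    finally show ?thesis .
  qed
  have cs: "(\<integral>\<omega>. (g \<omega> * cos (\<psi> l \<omega>)) * sin (x * Y i \<omega>) \<partial>M) = 0" for l x
  proof -
    have "(\<integral>\<omega>. (g \<omega> * cos (\<psi> l \<omega>)) * sin (x * Y i \<omega>) \<partial>M) =
        (\<integral>\<omega>. (g \<omega> * sin (\<psi> l \<omega> + x * Y i \<omega>) - g \<omega> * sin (\<psi> l \<omega> + (- x) * Y i \<omega>)) / 2 \<partial>M)"
      by (intro Bochner_Integration.integral_cong refl) (simp add: sin_add sin_diff algebra_simps)
    also have "\<dots> = 0" using Bochner_Integration.integral_diff[OF si[of l x] si[of l "- x"]] s0[of l "- x"] s0[of l x] by simp
    finally show ?thesis .
  qed
  have sc: "(\<integral>\<omega>. (g \<omega> * sin (\<psi> l \<omega>)) * cos (x * Y i \<omega>) \<partial>M) = 0" for l x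
  proof -
    have "(\<integral>\<omega>. (g \<omega> * sin (\<psi> l \<omega>)) * cos (x * Y i \<omega>) \<partial>M) =
        (\<integral>\<omega>. (g \<omega> * sin (\<psi> l \<omega> + x * Y i \<omega>) + g \<omega> * sin (\<psi> l \<omega> + (- x) * Y i \<omega>)) / 2 \<partial>M)"
      by (intro Bochner_Integration.integral_cong refl) (simp add: sin_add sin_diff algebra_simps)
    also have "\<dots> = 0" using Bochner_Integration.integral_add[OF si[of l x] si[of l "- x"]] s0[of l "- x"] s0[of l x] by simp
    finally show ?thesis .
  qed
  have ss: "(\<integral>\<omega>. (g \<omega> * sin (\<psi> l \<omega>)) * sin (x * Y i \<omega>) \<partial>M) = 0" for l x
  proof -
    have "(\<integral>\<omega>. (g \<omega> * sin (\<psi> l \<omega>)) * sin (x * Y i \<omega>) \<partial>M) =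
        (\<integral>\<omega>. (g \<omega> * cos (\<psi> l \<omega> + (- x) * Y i \<omega>) - g \<omega> * cos (\<psi> l \<omega> + x * Y i \<omega>)) / 2 \<partial>M)"
      by (intro Bochner_Integration.integral_cong refl) (simp add: cos_add cos_diff algebra_simps)
    also have "\<dots> = 0" using Bochner_Integration.integral_diff[OF ci[of l "- x"] ci[of l x]] c0[of l "- x"] c0[of l x] by simp
    finally show ?thesis .
  qed
  have c1: "(\<integral>\<omega>. (g \<omega> * indicator (A i) (Y i \<omega>)) * cos (\<Sum>k\<in>K. l k * Y k \<omega>) \<partial>M) = 0" for l
    using fourier_unique[OF integrable_mult_cos_sin(1)[OF gi \<psi>m[of l]] Yi cc[of l] cs[of l] Ai] by (simp add: \<psi>_def mult_ac)
  have s1: "(\<integral>\<omega>. (g \<omega> * indicator (A i) (Y i \<omega>)) * sin (\<Sum>k\<in>K. l k * Y k \<omega>) \<partial>M) = 0" for l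
    using fourier_unique[OF integrable_mult_cos_sin(2)[OF gi \<psi>m[of l]] Yi sc[of l] ss[of l] Ai] by (simp add: \<psi>_def mult_ac)
  have "integrable M (\<lambda>\<omega>. g \<omega> * indicator (A i) (Y i \<omega>))"
    by (rule Bochner_Integration.integrable_bound[OF gi]) (auto split: split_indicator)
  from insert.IH[OF _ this c1 s1] insert.prems(1,5) insert.hyps
  show ?case by (simp add: mult.assoc)
qed

text \<open>A pi-lambda argument. The generator of the augmented sigma-algebra is not closed under
  intersection; finite-dimensional cylinders together with the null sets are.\<close>

lemma integral_zero_on_generated:
  fixes g :: "'a \<Rightarrow> real" and Y :: "'i \<Rightarrow> 'a \<Rightarrow> real"
  assumes g: "integrable M g" and Y: "\<And>s. s \<in> S \<Longrightarrow> Y s \<in> borel_measurable M"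
    and z: "\<And>K A. finite K \<Longrightarrow> K \<subseteq> S \<Longrightarrow> (\<And>k. k \<in> K \<Longrightarrow> A k \<in> sets borel) \<Longrightarrow>
        (\<integral>\<omega>. g \<omega> * (\<Prod>k\<in>K. indicator (A k) (Y k \<omega>)) \<partial>M) = 0"
    and E: "E \<in> sigma_sets (space M) ({Y s -` E \<inter> space M | s E. s \<in> S \<and> E \<in> sets borel} \<union> null_sets M)"
  shows "(LINT \<omega>:E|M. g \<omega>) = 0"
proof -
  define cyl where "cyl K A = {\<omega> \<in> space M. \<forall>k\<in>K. Y k \<omega> \<in> A k}" for K and A :: "'i \<Rightarrow> real set"
  define G where "G = {cyl K A | K A. finite K \<and> K \<subseteq> S \<and> (\<forall>k\<in>K. A k \<in> sets borel)} \<union> null_sets M"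
  have cylM: "cyl K A \<in> sets M" if "finite K" "K \<subseteq> S" "\<forall>k\<in>K. A k \<in> sets borel" for K A
    unfolding cyl_def using that
    by (intro sets.sets_Collect_finite_All) (auto intro!: measurable_sets_Collect[OF Y, where P = "\<lambda>x. x \<in> A _"] simp: subset_iff)
  have GM: "G \<subseteq> sets M" unfolding G_def using cylM by auto
  have st: "Int_stable G"
  proof (rule Int_stableI)
    fix a b assume a: "a \<in> G" and b: "b \<in> G"
    show "a \<inter> b \<in> G"
    proof (cases "a \<in> null_sets M \<or> b \<in> null_sets M")
      case True
      then have "a \<inter> b \<in> null_sets M"
        using a b GM by (metis Int_commute null_set_Int1 null_set_Int2 subset_iff)
      then show ?thesis by (simp add: G_def)
    next
      case False
      then obtain K A K' A' where a': "a = cyl K A" "finite K" "K \<subseteq> S" "\<forall>k\<in>K. A k \<in> sets borel"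
        and b': "b = cyl K' A'" "finite K'" "K' \<subseteq> S" "\<forall>k\<in>K'. A' k \<in> sets borel"
        using a b unfolding G_def by blast
      \<comment> \<open>Coordinates missing from one of the two cylinders are unconstrained there,
        hence \<open>UNIV\<close>.\<close>
      define A'' where "A'' k = (if k \<in> K then A k else UNIV) \<inter> (if k \<in> K' then A' k else UNIV)" for k
      have "a \<inter> b = cyl (K \<union> K') A''" unfolding a' b' cyl_def A''_def by auto
      moreover have "\<forall>k\<in>K \<union> K'. A'' k \<in> sets borel" unfolding A''_def using a' b' by auto
      ultimately show ?thesis unfolding G_def using a' b' by blast
    qed
  qed
  have "{Y s -` E \<inter> space M | s E. s \<in> S \<and> E \<in> sets borel} \<union> null_sets M \<subseteq> G"
  proof -
    have "Y s -` E \<inter> space M = cyl {s} (\<lambda>_. E)" for s E by (auto simp: cyl_def)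
    moreover have "cyl {s} (\<lambda>_. E) \<in> G" if "s \<in> S" "E \<in> sets borel" for s E
      unfolding G_def using that by (intro UnI1 CollectI exI[of _ "{s}"] exI[of _ "\<lambda>_. E"]) auto
    ultimately show ?thesis unfolding G_def by auto
  qed
  then have EG: "E \<in> sigma_sets (space M) G" using E by (meson sigma_sets_mono' subsetD)
  have Gsp: "G \<subseteq> Pow (space M)" using GM sets.sets_into_space by blast
  have "E \<in> sets M \<and> (LINT \<omega>:E|M. g \<omega>) = 0"
    using st Gsp EG
  proof (induction rule: sigma_sets_induct_disjoint)
    case (basic a)
    show ?case
    proof (cases "a \<in> null_sets M")
      case True
      have "AE \<omega> in M. indicator a \<omega> *\<^sub>R g \<omega> = 0"
        by (rule eventually_mono[OF AE_not_in[OF True]]) simp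
      then have "(LINT \<omega>:a|M. g \<omega>) = 0" unfolding set_lebesgue_integral_def by (rule integral_eq_zero_AE)
      then show ?thesis using True by auto
    next
      case False
      then obtain K A where a: "a = cyl K A" "finite K" "K \<subseteq> S" "\<forall>k\<in>K. A k \<in> sets borel"
        using basic unfolding G_def by blast
      have "(LINT \<omega>:a|M. g \<omega>) = (\<integral>\<omega>. g \<omega> * (\<Prod>k\<in>K. indicator (A k) (Y k \<omega>)) \<partial>M)"
        unfolding set_lebesgue_integral_def
      proof (intro Bochner_Integration.integral_cong refl)
        fix \<omega> assume "\<omega> \<in> space M"
        then have "indicator a \<omega> = (\<Prod>k\<in>K. indicator (A k) (Y k \<omega>) :: real)"
          using a(2) unfolding a(1) cyl_def by (auto simp: indicator_def prod_zero_iff)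
        then show "indicator a \<omega> *\<^sub>R g \<omega> = g \<omega> * (\<Prod>k\<in>K. indicator (A k) (Y k \<omega>))" by simp
      qed
      also have "\<dots> = 0" using a by (intro z) auto
      finally show ?thesis using cylM a by simp
    qed
  next
    case empty
    show ?case by (simp add: set_lebesgue_integral_def)
  next
    case (compl a)
    have gs: "set_integrable M E g" if "E \<in> sets M" for E
      using integrable_mult_indicator[OF that g] by (simp add: set_integrable_def)
    \<comment> \<open>The cylinder over no coordinates is the whole space; complements are handled
      by subtracting from this zero integral.\<close>
    have "(LINT \<omega>:space M|M. g \<omega>) = 0"
      using z[of "{}"] by (simp add: set_lebesgue_integral_def indicator_def cong: Bochner_Integration.integral_cong)
    moreover have "(LINT \<omega>:(space M - a) \<union> a|M. g \<omega>) = (LINT \<omega>:space M - a|M. g \<omega>) + (LINT \<omega>:a|M. g \<omega>)"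
      using compl by (intro set_integral_Un gs) auto
    moreover have "(space M - a) \<union> a = space M" using compl sets.sets_into_space by auto
    ultimately show ?case using compl by auto
  next
    case (union A)
    have "(LINT \<omega>:(\<Union>i. A i)|M. g \<omega>) = (\<Sum>i. LINT \<omega>:A i|M. g \<omega>)"
    proof (rule lebesgue_integral_countable_add)
      show "A i \<in> sets M" for i using union by auto
      show "A i \<inter> A j = {}" if "i \<noteq> j" for i j using union that by (auto simp: disjoint_family_on_def)
      have "(\<Union>i. A i) \<in> sets M" using union by auto
      then show "set_integrable M (\<Union>i. A i) g"
        using integrable_mult_indicator[OF _ g] by (simp add: set_integrable_def)
    qed
    then show ?case using union by auto
  qed
  then show ?thesis by simp
qed

section \<open>Augmented filtrations\<close>

lemma space_aug_filtration [simp]: "space (aug_filtration M Y t) = space M"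
  by (simp add: aug_filtration_def space_measure_of_conv)

lemma sets_aug_filtration:
  "sets (aug_filtration M Y t) = sigma_sets (space M)
     ({Y s -` E \<inter> space M | s E. s \<in> {0..t} \<and> E \<in> sets borel} \<union> null_sets M)"
proof -
  have "{Y s -` E \<inter> space M | s E. s \<in> {0..t} \<and> E \<in> sets borel} \<union> null_sets M \<subseteq> Pow (space M)"
    using sets.sets_into_space by blast
  then show ?thesis unfolding aug_filtration_def by (simp add: sets_measure_of)
qed

lemma subalgebra_aug_filtration:
  fixes Y :: "real \<Rightarrow> 'a \<Rightarrow> real"
  assumes "\<And>s. s \<in> {0..t} \<Longrightarrow> Y s \<in> borel_measurable M"
  shows "subalgebra M (aug_filtration M Y t)"
proof -
  have "sigma_sets (space M) ({Y s -` E \<inter> space M | s E. s \<in> {0..t} \<and> E \<in> sets borel} \<union> null_sets M) \<subseteq> sets M"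
    using assms by (intro sets.sigma_sets_subset) (auto intro: measurable_sets)
  then show ?thesis unfolding subalgebra_def sets_aug_filtration by simp
qed

lemma aug_filtration_measurable:
  fixes Y :: "real \<Rightarrow> 'a \<Rightarrow> real"
  assumes "s \<in> {0..t}" shows "Y s \<in> borel_measurable (aug_filtration M Y t)"
proof (rule measurableI)
  fix E :: "real set" assume "E \<in> sets borel"
  then show "Y s -` E \<inter> space (aug_filtration M Y t) \<in> sets (aug_filtration M Y t)"
    unfolding sets_aug_filtration using assms by (auto intro!: sigma_sets.Basic)
qed simp

end

text \<open>Through Riemann sums, measurability holds for every sigma-algebra that carries all x(s);
  it is applied to the augmented filtration of Y at time t.\<close>

lemma borel_measurable_integral_Icc:
  fixes x :: "real \<Rightarrow> 'w \<Rightarrow> real"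
  assumes "0 \<le> t" "\<And>s. s \<in> {0..t} \<Longrightarrow> x s \<in> borel_measurable N"
    and "\<And>\<omega>. \<omega> \<in> space N \<Longrightarrow> continuous_on {0..t} (\<lambda>s. x s \<omega>)"
  shows "(\<lambda>\<omega>. integral {0..t} (\<lambda>s. x s \<omega>)) \<in> borel_measurable N"
proof (rule borel_measurable_LIMSEQ_real)
  show "(\<lambda>n. rsum (\<lambda>s. x s \<omega>) 0 t (Suc n)) \<longlonglongrightarrow> integral {0..t} (\<lambda>s. x s \<omega>)" if "\<omega> \<in> space N" for \<omega>
    by (rule rsum_tendsto[OF assms(1) assms(3)[OF that]])
  show "(\<lambda>\<omega>. rsum (\<lambda>s. x s \<omega>) 0 t (Suc n)) \<in> borel_measurable N" for n
  proof -
    have "x (0 + real k * ((t - 0) / Suc n)) \<in> borel_measurable N" if "k \<in> {..<Suc n}" for k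
      using that by (intro assms(2) grid_in assms(1)) auto
    then show ?thesis unfolding rsum_def by (intro borel_measurable_times borel_measurable_sum borel_measurable_const)
  qed
qed

lemma borel_measurable_vecI:
  fixes f :: "'w \<Rightarrow> real^'n"
  assumes "\<And>i. (\<lambda>\<omega>. f \<omega> $ i) \<in> borel_measurable N"
  shows "f \<in> borel_measurable N"
  unfolding borel_measurable_euclidean_space[where 'c = "real^'n"]
  using assms by (auto simp: Basis_vec_def inner_axis)

section \<open>Identification of the conditional expectation\<close>

context kalman_gain begin

lemma Y_measurable: "s \<in> {0..T} \<Longrightarrow> Y s \<in> borel_measurable M"
  using proc_L2[OF proc_Y] by (auto simp: L2_def)

lemma filt_measurable:
  assumes t: "t \<in> {0..T}" shows "filt t \<in> borel_measurable (aug_filtration M Y t)"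
proof (rule borel_measurable_vecI)
  fix i
  let ?N = "aug_filtration M Y t"
  let ?c = "\<lambda>s. \<Psi> s *v weight s"
  have Yt: "Y s \<in> borel_measurable ?N" if "s \<in> {0..t}" for s by (rule aug_filtration_measurable[OF that])
  have cc: "continuous_on {0..t} ?c"
    using t by (intro continuous_on_subset[OF continuous_on_matrix_vector[OF \<Psi>_cont weight_cont]]) auto
  have Yc: "continuous_on {0..t} (\<lambda>s. Y s \<omega>)" if "\<omega> \<in> space M" for \<omega>
    using t by (intro continuous_on_subset[OF proc_cont[OF proc_Y that]]) auto
  have I: "(\<lambda>\<omega>. integral {0..t} (\<lambda>s. Y s \<omega> * ?c s $ k)) \<in> borel_measurable ?N" for k
    using t Yt by (intro borel_measurable_integral_Icc borel_measurable_times borel_measurable_const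
        continuous_intros Yc cc) auto
  have "filt t \<omega> $ i = Y t \<omega> * gain t $ i + (\<Sum>k\<in>UNIV. \<Phi> t $ i $ k * integral {0..t} (\<lambda>s. Y s \<omega> * ?c s $ k))"
    if w: "\<omega> \<in> space M" for \<omega>
  proof -
    have "(\<lambda>s. \<Psi> s *v (Y s \<omega> *\<^sub>R weight s)) = (\<lambda>s. Y s \<omega> *\<^sub>R ?c s)"
      by (simp add: matrix_vector_mult_scaleR)
    moreover have "(\<lambda>s. Y s \<omega> *\<^sub>R ?c s) integrable_on {0..t}"
      by (intro integrable_continuous_real continuous_intros Yc w cc)
    then have "integral {0..t} (\<lambda>s. Y s \<omega> *\<^sub>R ?c s) $ k = integral {0..t} (\<lambda>s. Y s \<omega> * ?c s $ k)" for k
      by (subst integral_component_eq_cart[symmetric]) simp_all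
    ultimately show ?thesis unfolding filt_def by (simp add: matrix_vector_mult_def)
  qed
  moreover have "(\<lambda>\<omega>. Y t \<omega> * gain t $ i + (\<Sum>k\<in>UNIV. \<Phi> t $ i $ k * integral {0..t} (\<lambda>s. Y s \<omega> * ?c s $ k))) \<in> borel_measurable ?N"
    using t by (intro borel_measurable_add borel_measurable_times borel_measurable_sum borel_measurable_const I Yt) auto
  ultimately show "(\<lambda>\<omega>. filt t \<omega> $ i) \<in> borel_measurable ?N"
    by (subst measurable_cong) auto
qed

lemma filt_cond_exp:
  assumes t: "t \<in> {0..T}"
  shows "AE \<omega> in M. real_cond_exp M (aug_filtration M Y t) (\<lambda>\<omega>. Z t \<omega> $ i) \<omega> = filt t \<omega> $ i"
proof -
  have Ym: "Y s \<in> borel_measurable M" if "s \<in> {0..t}" for s using that t by (intro Y_measurable) auto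
  interpret finite_measure_subalgebra M "aug_filtration M Y t"
    by unfold_locales (rule subalgebra_aug_filtration[OF Ym])
  have eL: "(\<lambda>\<omega>. err t \<omega> $ i) \<in> L2 M" and ZL: "(\<lambda>\<omega>. Z t \<omega> $ i) \<in> L2 M" and fL: "(\<lambda>\<omega>. filt t \<omega> $ i) \<in> L2 M"
    using proc_L2[OF vproc_nth[OF vproc_err] t] proc_L2[OF vproc_nth[OF vproc_Z] t]
      proc_L2[OF vproc_nth[OF vproc_filt] t] by auto
  have eg: "(\<lambda>\<omega>. err t \<omega> $ i) \<in> gspan" using proc_hist[OF vproc_nth[OF vproc_err] t] by (simp add: hist_def)
  have Yg: "Y s \<in> gspan" if "s \<in> {0..T}" for s using proc_hist[OF proc_Y that] by (simp add: hist_def)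
  have zero: "(LINT \<omega>:E|M. err t \<omega> $ i) = 0" if E: "E \<in> sets (aug_filtration M Y t)" for E
  proof (rule integral_zero_on_generated[OF L2_integrable[OF eL], of "{0..t}" Y])
    show "E \<in> sigma_sets (space M) ({Y s -` E \<inter> space M | s E. s \<in> {0..t} \<and> E \<in> sets borel} \<union> null_sets M)"
      using E unfolding sets_aug_filtration .
    fix K and A :: "real \<Rightarrow> real set"
    assume K: "finite K" "K \<subseteq> {0..t}" "\<And>k. k \<in> K \<Longrightarrow> A k \<in> sets borel"
    have KT: "k \<in> {0..T}" if "k \<in> K" for k using that K t by auto
    \<comment> \<open>The error and all linear combinations of observations lie in the same Gaussian
      space, so the pair is jointly Gaussian and being uncorrelated makes the Fourier integral
      vanish.\<close>
    have I: "(CLINT \<omega>|M. complex_of_real (err t \<omega> $ i) * iexp (\<Sum>k\<in>K. l k * Y k \<omega>)) = 0" for l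
    proof (rule gaussian_iexp_orthogonal[OF eL])
      have g: "(\<lambda>\<omega>. \<Sum>k\<in>K. l k * Y k \<omega>) \<in> gspan"
        by (intro closed_subspace_sum[OF closed_subspace_gspan] closed_subspace_cmult[OF closed_subspace_gspan] Yg KT)
      show "(\<lambda>\<omega>. \<Sum>k\<in>K. l k * Y k \<omega>) \<in> L2 M" by (rule gspan_L2[OF g])
      show "gaussian M (\<lambda>\<omega>. \<epsilon> * err t \<omega> $ i + (\<Sum>k\<in>K. l k * Y k \<omega>))" for \<epsilon>
        by (intro gspan_gaussian closed_subspace_add[OF closed_subspace_gspan] closed_subspace_cmult[OF closed_subspace_gspan] eg g)
      have "ip M (\<lambda>\<omega>. err t \<omega> $ i) (\<lambda>\<omega>. \<Sum>k\<in>K. l k * Y k \<omega>) = (\<Sum>k\<in>K. ip M (\<lambda>\<omega>. err t \<omega> $ i) (\<lambda>\<omega>. l k * Y k \<omega>))"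
        by (intro ip_sum_right L2_cmult gspan_L2 Yg KT eL)
      also have "\<dots> = 0"
      proof (rule sum.neutral, rule ballI)
        fix k assume "k \<in> K"
        then have "0 \<le> k" "k \<le> t" "t \<le> T" using K t by auto
        from err_orthogonal[OF this, of i]
        show "ip M (\<lambda>\<omega>. err t \<omega> $ i) (\<lambda>\<omega>. l k * Y k \<omega>) = 0" by (simp add: ip_commute)
      qed
      finally show "ip M (\<lambda>\<omega>. err t \<omega> $ i) (\<lambda>\<omega>. \<Sum>k\<in>K. l k * Y k \<omega>) = 0" .
    qed
    have Sm: "(\<lambda>\<omega>. \<Sum>k\<in>K. l k * Y k \<omega>) \<in> borel_measurable M" for l
      by (intro borel_measurable_sum borel_measurable_times borel_measurable_const Y_measurable KT)
    have cs: "(\<integral>\<omega>. err t \<omega> $ i * cos (\<Sum>k\<in>K. l k * Y k \<omega>) \<partial>M) = 0"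
      "(\<integral>\<omega>. err t \<omega> $ i * sin (\<Sum>k\<in>K. l k * Y k \<omega>) \<partial>M) = 0" for l
      using I[of l] unfolding integral_mult_iexp[OF L2_integrable[OF eL] Sm] by (simp_all add: complex_eq_iff)
    show "(\<integral>\<omega>. err t \<omega> $ i * (\<Prod>k\<in>K. indicator (A k) (Y k \<omega>)) \<partial>M) = 0"
      by (rule fourier_unique_finite[OF K(1) Y_measurable[OF KT] L2_integrable[OF eL] cs K(3)])
  qed (rule Ym)
  show ?thesis
  proof (rule real_cond_exp_charact)
    fix E assume E: "E \<in> sets (aug_filtration M Y t)"
    have EM: "E \<in> sets M" using E subalg by (auto simp: subalgebra_def)
    have si: "set_integrable M E f" if "f \<in> L2 M" for f
      using integrable_mult_indicator[OF EM L2_integrable[OF that]] by (simp add: set_integrable_def)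
    have "(LINT \<omega>:E|M. Z t \<omega> $ i) - (LINT \<omega>:E|M. filt t \<omega> $ i) = (LINT \<omega>:E|M. err t \<omega> $ i)"
      using set_integral_diff(2)[OF si[OF ZL] si[OF fL]] by (simp add: err_def)
    then show "(LINT \<omega>:E|M. Z t \<omega> $ i) = (LINT \<omega>:E|M. filt t \<omega> $ i)" using zero[OF E] by simp
  next
    have "(\<lambda>x::real^'n. x $ i) \<in> borel_measurable borel"
      by (intro borel_measurable_continuous_onI continuous_intros)
    from measurable_compose[OF filt_measurable[OF t] this]
    show "(\<lambda>\<omega>. filt t \<omega> $ i) \<in> borel_measurable (aug_filtration M Y t)" .
  qed (intro L2_integrable ZL fL)+
qed

end

section \<open>Brownian motion\<close>

context prob_space begin

lemma char_distr_eq: "\<xi> \<in> borel_measurable M \<Longrightarrow> char (distr M borel \<xi>) u = (CLINT \<omega>|M. iexp (u * \<xi> \<omega>))"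
  unfolding char_def by (subst integral_distr) auto

lemma distributed_normal_gaussian:
  assumes D: "distributed M lborel \<xi> (normal_density 0 s)" and s: "0 < s"
  shows "gaussian M \<xi>" "ip M \<xi> \<xi> = s\<^sup>2"
proof -
  have \<xi>m [measurable]: "\<xi> \<in> borel_measurable M" using distributed_measurable[OF D] by simp
  have exp0: "expectation \<xi> = 0" by (rule normal_distributed_expectation[OF s D])
  have "integrable M (\<lambda>\<omega>. (\<xi> \<omega>)\<^sup>2)"
    using integrable_normal_moment[OF s, of 0 2] distributed_integrable[OF D, of "\<lambda>x. x\<^sup>2"] by simp
  then have L: "\<xi> \<in> L2 M" by (simp add: L2_def)
  show v: "ip M \<xi> \<xi> = s\<^sup>2"
    using normal_distributed_variance[OF s D] by (simp add: exp0 ip_def power2_eq_square)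
  have D1: "distributed M lborel (\<lambda>x. \<xi> x / s) std_normal_density"
    using D normal_standard_normal_convert[OF s, of \<xi> 0] by simp
  then have "distr M borel (\<lambda>x. \<xi> x / s) = std_normal_distribution"
    using distributed_distr_eq_density[OF D1] by (simp cong: distr_cong)
  then have "char (distr M borel (\<lambda>x. \<xi> x / s)) (u * s) = exp (- ((u * s)\<^sup>2) / 2)" for u
    by (simp add: char_std_normal_distribution)
  then have "(CLINT \<omega>|M. iexp ((u * s) * (\<xi> \<omega> / s))) = exp (- ((u * s)\<^sup>2) / 2)" for u
    by (subst (asm) char_distr_eq) auto
  then have "char (distr M borel \<xi>) u = exp (- (u\<^sup>2 * ip M \<xi> \<xi>) / 2)" for u
    unfolding v char_distr_eq[OF \<xi>m] using s by (simp add: power_mult_distrib)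
  then show "gaussian M \<xi>" using L exp0 by (simp add: gaussian_def)
qed

lemma gaussian_L2: "gaussian M \<xi> \<Longrightarrow> \<xi> \<in> L2 M" by (simp add: gaussian_def)

lemma gaussian_cong_AE:
  assumes "gaussian M \<xi>" "\<eta> \<in> borel_measurable M" "AE \<omega> in M. \<xi> \<omega> = \<eta> \<omega>"
  shows "gaussian M \<eta>"
proof -
  have \<xi>m: "\<xi> \<in> borel_measurable M" using gaussian_L2[OF assms(1)] by (simp add: L2_def)
  have "\<eta> \<in> L2 M" by (rule L2_cong_AE[OF gaussian_L2[OF assms(1)] assms(2,3)])
  moreover have "expectation \<eta> = expectation \<xi>"
    using assms(2,3) \<xi>m by (intro integral_cong_AE) (auto elim: eventually_mono)
  moreover have "ip M \<eta> \<eta> = ip M \<xi> \<xi>" by (rule ip_cong_AE[symmetric]) (fact \<xi>m assms)+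
  moreover have "distr M borel \<eta> = distr M borel \<xi>"
    by (rule distr_cong_AE) (use assms(2,3) \<xi>m in \<open>auto elim: eventually_mono\<close>)
  ultimately show ?thesis using assms(1) by (simp add: gaussian_def)
qed

lemma gaussian_zero: "gaussian M (\<lambda>_. 0)"
proof -
  have "char (distr M borel (\<lambda>_. 0)) u = 1" for u
    by (subst char_distr_eq) (auto simp: prob_space)
  then show ?thesis by (simp add: gaussian_def del: distr_const)
qed

lemma gaussian_cmult:
  assumes "gaussian M \<xi>" shows "gaussian M (\<lambda>\<omega>. c * \<xi> \<omega>)"
proof -
  have L: "\<xi> \<in> L2 M" by (rule gaussian_L2[OF assms])
  then have m: "(\<lambda>\<omega>. c * \<xi> \<omega>) \<in> borel_measurable M" using L2_cmult[OF L, of c] by (auto simp: L2_def)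
  have "char (distr M borel (\<lambda>\<omega>. c * \<xi> \<omega>)) u = exp (- (u\<^sup>2 * (c * (c * ip M \<xi> \<xi>))) / 2)" for u
    using gaussian_char[OF assms, of "u * c"] unfolding char_distr_eq[OF m]
    by (simp add: mult.assoc power_mult_distrib power2_eq_square mult_ac)
  then show ?thesis using L assms by (auto simp: gaussian_def)
qed

lemma indep_var_ip_zero:
  assumes "indep_var borel \<xi> borel \<eta>" "\<xi> \<in> L2 M" "\<eta> \<in> L2 M" "expectation \<xi> = 0 \<or> expectation \<eta> = 0"
  shows "ip M \<xi> \<eta> = 0"
  using indep_var_lebesgue_integral[OF assms(1) L2_integrable[OF assms(2)] L2_integrable[OF assms(3)]] assms(4)
  by (auto simp: ip_def)

lemma gaussian_indep_add:
  assumes i: "indep_var borel \<xi> borel \<eta>" and \<xi>: "gaussian M \<xi>" and \<eta>: "gaussian M \<eta>"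
  shows "gaussian M (\<lambda>\<omega>. \<xi> \<omega> + \<eta> \<omega>)"
proof -
  note L = gaussian_L2[OF \<xi>] gaussian_L2[OF \<eta>]
  have z: "ip M \<xi> \<eta> = 0" using \<xi> by (intro indep_var_ip_zero i L) (simp add: gaussian_def)
  have v: "ip M (\<lambda>\<omega>. \<xi> \<omega> + \<eta> \<omega>) (\<lambda>\<omega>. \<xi> \<omega> + \<eta> \<omega>) = ip M \<xi> \<xi> + ip M \<eta> \<eta>"
    using L z by (simp add: ip_add_left ip_add_right L2_add ip_commute[of M \<eta> \<xi>])
  have "char (distr M borel (\<lambda>\<omega>. \<xi> \<omega> + \<eta> \<omega>)) u = exp (- (u\<^sup>2 * ip M (\<lambda>\<omega>. \<xi> \<omega> + \<eta> \<omega>) (\<lambda>\<omega>. \<xi> \<omega> + \<eta> \<omega>)) / 2)" for u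
  proof -
    have "char (distr M borel \<xi>) u = exp (- (u\<^sup>2 * ip M \<xi> \<xi>) / 2)" "char (distr M borel \<eta>) u = exp (- (u\<^sup>2 * ip M \<eta> \<eta>) / 2)"
      using \<xi> \<eta> by (simp_all add: gaussian_def)
    then show ?thesis unfolding char_distr_add[OF i] v
      by (simp add: distrib_left diff_divide_distrib add_divide_distrib flip: of_real_mult exp_add)
  qed
  then show ?thesis
    using L \<xi> \<eta> L2_integrable[OF L(1)] L2_integrable[OF L(2)] by (simp add: gaussian_def L2_add)
qed

lemma gaussian_indep_sum:
  assumes "finite I" "indep_vars (\<lambda>_. borel) \<xi> I" "\<And>i. i \<in> I \<Longrightarrow> gaussian M (\<xi> i)"
  shows "gaussian M (\<lambda>\<omega>. \<Sum>i\<in>I. \<xi> i \<omega>)"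
  using assms
proof (induction I rule: finite_induct)
  case empty
  then show ?case by (simp add: gaussian_zero)
next
  case (insert i I)
  have "indep_var borel (\<xi> i) borel (\<lambda>\<omega>. \<Sum>i\<in>I. \<xi> i \<omega>)"
    by (rule indep_vars_sum[OF insert.hyps insert.prems(1)])
  moreover have "gaussian M (\<lambda>\<omega>. \<Sum>i\<in>I. \<xi> i \<omega>)"
    using insert by (intro insert.IH indep_vars_subset[OF insert.prems(1)]) auto
  ultimately have "gaussian M (\<lambda>\<omega>. \<xi> i \<omega> + (\<Sum>i\<in>I. \<xi> i \<omega>))"
    using insert.prems by (intro gaussian_indep_add) auto
  then show ?case using insert.hyps by simp
qed

lemma brownian_measurable: "brownian_motion_on M I W \<Longrightarrow> t \<in> I \<Longrightarrow> W t \<in> borel_measurable M"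
  by (simp add: brownian_motion_on_def)

lemma brownian_increment:
  assumes W: "brownian_motion_on M I W" and st: "s \<in> I" "t \<in> I" "s < t"
  shows "gaussian M (\<lambda>\<omega>. W t \<omega> - W s \<omega>)" "ip M (\<lambda>\<omega>. W t \<omega> - W s \<omega>) (\<lambda>\<omega>. W t \<omega> - W s \<omega>) = t - s"
proof -
  have D: "distributed M lborel (\<lambda>\<omega>. W t \<omega> - W s \<omega>) (normal_density 0 (sqrt (t - s)))"
    using W st by (simp add: brownian_motion_on_def)
  have p: "0 < sqrt (t - s)" using st by simp
  show "gaussian M (\<lambda>\<omega>. W t \<omega> - W s \<omega>)" "ip M (\<lambda>\<omega>. W t \<omega> - W s \<omega>) (\<lambda>\<omega>. W t \<omega> - W s \<omega>) = t - s"
    using distributed_normal_gaussian[OF D p] st by simp_all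
qed

lemma brownian_gaussian:
  assumes W: "brownian_motion_on M {0..T} W" and t: "t \<in> {0..T}"
  shows "gaussian M (W t)" "ip M (W t) (W t) = t"
proof -
  have z: "AE \<omega> in M. W 0 \<omega> = 0" using W by (simp add: brownian_motion_on_def)
  have m: "W t \<in> borel_measurable M" "W 0 \<in> borel_measurable M" using W t by (auto intro!: brownian_measurable)
  have "gaussian M (W t) \<and> ip M (W t) (W t) = t"
  \<comment> \<open>At time 0 there is no increment to use; W(0) vanishes almost surely and counts
    as Gaussian with variance 0.\<close>
  proof (cases "t = 0")
    case True
    have 0: "AE \<omega> in M. (\<lambda>_. 0) \<omega> = W 0 \<omega>" using z by eventually_elim simp
    have "gaussian M (W 0)" by (rule gaussian_cong_AE[OF gaussian_zero m(2) 0])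
    moreover have "ip M (\<lambda>_. 0) (\<lambda>_. 0) = ip M (W 0) (W 0)" by (rule ip_cong_AE) (use m 0 in auto)
    ultimately show ?thesis using True by simp
  next
    case False
    then have st: "0 \<in> {0..T}" "t \<in> {0..T}" "0 < t" using t by auto
    have e: "AE \<omega> in M. W t \<omega> - W 0 \<omega> = W t \<omega>" using z by eventually_elim simp
    have "gaussian M (W t)" by (rule gaussian_cong_AE[OF brownian_increment(1)[OF W st] m(1) e])
    moreover have "ip M (\<lambda>\<omega>. W t \<omega> - W 0 \<omega>) (\<lambda>\<omega>. W t \<omega> - W 0 \<omega>) = ip M (W t) (W t)"
      by (rule ip_cong_AE) (use m e in auto)
    ultimately show ?thesis using brownian_increment(2)[OF W st] by simp
  qed
  then show "gaussian M (W t)" "ip M (W t) (W t) = t" by simp_all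
qed

text \<open>Polarization: the variances s, t and t - s of W(s), W(t) and their difference determine
  the covariance.\<close>

lemma brownian_cov:
  assumes W: "brownian_motion_on M {0..T} W" and s: "s \<in> {0..T}" and t: "t \<in> {0..T}"
  shows "ip M (W s) (W t) = min s t"
proof -
  have *: "ip M (W s) (W t) = s" if s: "s \<in> {0..T}" and t: "t \<in> {0..T}" and st: "s < t" for s t
  proof -
    note L = gaussian_L2[OF brownian_gaussian(1)[OF W s]] gaussian_L2[OF brownian_gaussian(1)[OF W t]]
    have "ip M (\<lambda>\<omega>. W t \<omega> - W s \<omega>) (\<lambda>\<omega>. W t \<omega> - W s \<omega>) = ip M (W t) (W t) - 2 * ip M (W s) (W t) + ip M (W s) (W s)"
      using L by (simp add: ip_diff_left ip_diff_right L2_diff ip_commute[of M "W t" "W s"])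
    then show ?thesis
      using brownian_increment(2)[OF W s t st] brownian_gaussian(2)[OF W s] brownian_gaussian(2)[OF W t] by simp
  qed
  consider "s < t" | "s = t" | "t < s" by linarith
  then show ?thesis
  proof cases
    case 1 then show ?thesis using *[OF s t] by simp
  next
    case 2 then show ?thesis using brownian_gaussian(2)[OF W t] by simp
  next
    case 3 then show ?thesis using *[OF t s] ip_commute[of M "W s"] by simp
  qed
qed

lemma brownian_grid_gaussian:
  assumes W: "brownian_motion_on M {0..T} W" and T: "0 < T"
  shows "gaussian M (\<lambda>\<omega>. \<Sum>k<Suc n. d k * (W (0 + real (Suc k) * ((T - 0) / Suc n)) \<omega> - W (0 + real k * ((T - 0) / Suc n)) \<omega>))"
proof -
  define p where "p k = 0 + real k * ((T - 0) / Suc n)" for k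
  have pT: "p k \<in> {0..T}" if "k \<le> Suc n" for k
    unfolding p_def using T that by (intro grid_in) auto
  have pm: "p k < p (Suc k)" for k using T by (simp add: p_def divide_strict_right_mono distrib_right)
  have "(\<forall>k\<le>Suc n. p k \<in> {0..T}) \<and> (\<forall>k<Suc n. p k < p (Suc k))" using pT pm by simp
  then have i: "indep_vars (\<lambda>_. borel) (\<lambda>k \<omega>. W (p (Suc k)) \<omega> - W (p k) \<omega>) {..<Suc n}"
    using W unfolding brownian_motion_on_def by blast
  have "indep_vars (\<lambda>_. borel) (\<lambda>k \<omega>. d k * (W (p (Suc k)) \<omega> - W (p k) \<omega>)) {..<Suc n}"
    by (rule indep_vars_compose2[OF i, of "\<lambda>k x. d k * x"]) simp
  then have "gaussian M (\<lambda>\<omega>. \<Sum>k<Suc n. d k * (W (p (Suc k)) \<omega> - W (p k) \<omega>))"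
    using pm pT by (intro gaussian_indep_sum gaussian_cmult brownian_increment(1)[OF W]) auto
  then show ?thesis unfolding p_def .
qed

text \<open>The Brownian motions are set to $0$ off a set of probability one, so that the locale may ask for
  path properties at every point of the space.\<close>
lemma gauss_base_of_brownian:
  fixes W :: "bool \<Rightarrow> real \<Rightarrow> 'a \<Rightarrow> real"
  assumes T: "0 < T" and W: "\<And>j. brownian_motion_on M {0..T} (W j)"
    and indep_W: "indep_var (PiM {0..T} (\<lambda>_. borel)) (\<lambda>\<omega>. \<lambda>t\<in>{0..T}. W True t \<omega>)
          (PiM {0..T} (\<lambda>_. borel)) (\<lambda>\<omega>. \<lambda>t\<in>{0..T}. W False t \<omega>)"
    and X0: "gaussian M X0"
    and X0_indep: "\<And>L. L \<in> borel_measurable N \<Longrightarrow> indep_var borel X0 borel L"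
    and WN: "\<And>j t. t \<in> {0..T} \<Longrightarrow> W j t \<in> borel_measurable N"
    and \<Omega>: "\<Omega> \<in> sets M" "AE \<omega> in M. \<omega> \<in> \<Omega>"
    and \<Omega>c: "\<And>j \<omega>. \<omega> \<in> \<Omega> \<Longrightarrow> continuous_on {0..T} (\<lambda>t. W j t \<omega>)"
    and \<Omega>0: "\<And>j \<omega>. \<omega> \<in> \<Omega> \<Longrightarrow> W j 0 \<omega> = 0"
  shows "gauss_base M T (\<lambda>\<omega>. if \<omega> \<in> \<Omega> then X0 \<omega> else 0) (\<lambda>j t \<omega>. if \<omega> \<in> \<Omega> then W j t \<omega> else 0)"
proof -
  let ?X = "\<lambda>\<omega>. if \<omega> \<in> \<Omega> then X0 \<omega> else 0" and ?B = "\<lambda>j t \<omega>. if \<omega> \<in> \<Omega> then W j t \<omega> else 0"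
  have Om [measurable]: "\<Omega> \<in> sets M" by (rule \<Omega>)
  have X0m [measurable]: "X0 \<in> borel_measurable M" using gaussian_L2[OF X0] by (simp add: L2_def)
  have Wm: "W j t \<in> borel_measurable M" if "t \<in> {0..T}" for j t by (rule brownian_measurable[OF W that])
  have Xm: "?X \<in> borel_measurable M" by measurable
  have Bm: "?B j t \<in> borel_measurable M" if "t \<in> {0..T}" for j t
    using Wm[OF that, of j] by measurable
  have Xae: "AE \<omega> in M. X0 \<omega> = ?X \<omega>" using \<Omega>(2) by eventually_elim simp
  have Bae: "AE \<omega> in M. W j t \<omega> = ?B j t \<omega>" for j t using \<Omega>(2) by eventually_elim simp
  note WL = gaussian_L2[OF brownian_gaussian(1)[OF W]]
  have WE: "expectation (W j t) = 0" if "t \<in> {0..T}" for j t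
    using brownian_gaussian(1)[OF W that] by (simp add: gaussian_def)
  have XE: "expectation X0 = 0" using X0 by (simp add: gaussian_def)
  \<comment> \<open>Independence is assumed for whole paths on [0,T]; in this form it passes to
    functionals of the paths, namely values at single times and weighted sums over a grid.\<close>
  have cross: "indep_var borel (f \<circ> (\<lambda>\<omega>. \<lambda>t\<in>{0..T}. W True t \<omega>)) borel (g \<circ> (\<lambda>\<omega>. \<lambda>t\<in>{0..T}. W False t \<omega>))"
    if "f \<in> borel_measurable (PiM {0..T} (\<lambda>_. borel))" "g \<in> borel_measurable (PiM {0..T} (\<lambda>_. borel))"
    for f g :: "(real \<Rightarrow> real) \<Rightarrow> real"
    by (rule indep_var_compose[OF indep_W that])
  have TF: "ip M (W True s) (W False t) = 0" if s: "s \<in> {0..T}" and t: "t \<in> {0..T}" for s t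
  proof -
    have "indep_var borel ((\<lambda>f. f s) \<circ> (\<lambda>\<omega>. \<lambda>t\<in>{0..T}. W True t \<omega>)) borel ((\<lambda>f. f t) \<circ> (\<lambda>\<omega>. \<lambda>t\<in>{0..T}. W False t \<omega>))"
      using s t by (intro cross measurable_component_singleton) auto
    then have "indep_var borel (W True s) borel (W False t)" using s t by (simp add: comp_def)
    then show ?thesis using WE[OF s] by (intro indep_var_ip_zero WL s t) auto
  qed
  have Wcov: "ip M (W i s) (W j t) = (if i = j then min s t else 0)" if "s \<in> {0..T}" "t \<in> {0..T}" for i j s t
  proof (cases "i = j")
    case True then show ?thesis using brownian_cov[OF W that] by simp
  next
    case False
    then show ?thesis using TF[OF that] TF[OF that(2,1)] ip_commute[of M "W i s"] by (cases i; cases j) auto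
  qed
  show ?thesis
  proof (unfold_locales)
    show "0 < T" by (rule T)
    show "?X \<in> L2 M" by (rule L2_cong_AE[OF gaussian_L2[OF X0] Xm Xae])
    show "?B j t \<in> L2 M" if "t \<in> {0..T}" for j t by (rule L2_cong_AE[OF WL[OF that] Bm[OF that] Bae])
    show "continuous_on {0..T} (\<lambda>t. ?B j t \<omega>)" if "\<omega> \<in> space M" for j \<omega>
      using \<Omega>c[of \<omega> j] by (cases "\<omega> \<in> \<Omega>") simp_all
    show "?B j 0 \<omega> = 0" if "\<omega> \<in> space M" for j \<omega> using \<Omega>0 by simp
    show "ip M (?B i s) (?B j t) = (if i = j then min s t else 0)" if st: "s \<in> {0..T}" "t \<in> {0..T}" for i j s t
      using ip_cong_AE[OF Wm[OF st(1)] Wm[OF st(2)] Bm[OF st(1)] Bm[OF st(2)] Bae Bae, of i j] Wcov[OF st] by simp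
    show "ip M ?X (?B j t) = 0" if t: "t \<in> {0..T}" for j t
    proof -
      have "ip M X0 (W j t) = 0"
        using XE by (intro indep_var_ip_zero X0_indep WN WL gaussian_L2[OF X0] t) auto
      then show ?thesis using ip_cong_AE[OF X0m Wm[OF t] Xm Bm[OF t] Xae Bae] by simp
    qed
    fix n c and d :: "bool \<Rightarrow> nat \<Rightarrow> real"
    define p where "p k = 0 + real k * ((T - 0) / Suc n)" for k
    have pT: "p k \<in> {0..T}" if "k \<le> Suc n" for k
      unfolding p_def using T that by (intro grid_in) auto
    define S where "S j \<omega> = (\<Sum>k<Suc n. d j k * (W j (p (Suc k)) \<omega> - W j (p k) \<omega>))" for j \<omega>
    have SG: "gaussian M (S j)" for j
      unfolding S_def p_def by (rule brownian_grid_gaussian[OF W T])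
    have SN: "S j \<in> borel_measurable N" for j
      unfolding S_def using pT by (intro borel_measurable_sum borel_measurable_times borel_measurable_const borel_measurable_diff WN) auto
    have "indep_var borel (S True) borel (S False)"
    proof -
      define f where "f d' g = (\<Sum>k<Suc n. d' k * (g (p (Suc k)) - g (p k)))" for d' :: "nat \<Rightarrow> real" and g :: "real \<Rightarrow> real"
      have fm: "f d' \<in> borel_measurable (PiM {0..T} (\<lambda>_. borel))" for d'
        unfolding f_def using pT
        by (intro borel_measurable_sum borel_measurable_times borel_measurable_const borel_measurable_diff measurable_component_singleton) auto
      have fS: "f (d j) \<circ> (\<lambda>\<omega>. \<lambda>t\<in>{0..T}. W j t \<omega>) = S j" for j
      proof
        fix \<omega>
        have "(\<lambda>t\<in>{0..T}. W j t \<omega>) (p k) = W j (p k) \<omega>" if "k \<le> Suc n" for k using pT[OF that] by simp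
        then show "(f (d j) \<circ> (\<lambda>\<omega>. \<lambda>t\<in>{0..T}. W j t \<omega>)) \<omega> = S j \<omega>"
          unfolding comp_def f_def S_def by (intro sum.cong refl) auto
      qed
      show ?thesis using cross[OF fm[of "d True"] fm[of "d False"]] unfolding fS .
    qed
    then have G2: "gaussian M (\<lambda>\<omega>. S True \<omega> + S False \<omega>)" by (intro gaussian_indep_add SG)
    \<comment> \<open>Independence of X0 from each motion alone would not do here: the sum of both
      weighted sums is treated as one N-measurable variable.\<close>
    have "indep_var borel (\<lambda>\<omega>. c * X0 \<omega>) borel (\<lambda>\<omega>. S True \<omega> + S False \<omega>)"
    proof -
      have "indep_var borel X0 borel (\<lambda>\<omega>. S True \<omega> + S False \<omega>)"
        by (intro X0_indep borel_measurable_add SN)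
      moreover have "(\<lambda>x. c * x) \<in> borel_measurable borel" "(\<lambda>x. x) \<in> borel_measurable (borel :: real measure)"
        by simp_all
      ultimately have "indep_var borel ((\<lambda>x. c * x) \<circ> X0) borel ((\<lambda>x. x) \<circ> (\<lambda>\<omega>. S True \<omega> + S False \<omega>))"
        by (rule indep_var_compose)
      then show ?thesis unfolding comp_def .
    qed
    then have G: "gaussian M (\<lambda>\<omega>. c * X0 \<omega> + (S True \<omega> + S False \<omega>))"
      by (rule gaussian_indep_add[OF _ gaussian_cmult[OF X0] G2])
    show "gaussian M (\<lambda>\<omega>. c * ?X \<omega> + (\<Sum>j\<in>UNIV. \<Sum>k<Suc n. d j k *
          (?B j (0 + real (Suc k) * ((T - 0) / Suc n)) \<omega> - ?B j (0 + real k * ((T - 0) / Suc n)) \<omega>)))"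
    proof (rule gaussian_cong_AE[OF G])
      show "AE \<omega> in M. c * X0 \<omega> + (S True \<omega> + S False \<omega>) = c * ?X \<omega> + (\<Sum>j\<in>UNIV. \<Sum>k<Suc n. d j k *
          (?B j (0 + real (Suc k) * ((T - 0) / Suc n)) \<omega> - ?B j (0 + real k * ((T - 0) / Suc n)) \<omega>))"
        using \<Omega>(2) by eventually_elim (simp add: S_def p_def UNIV_bool)
      have "?B j (p k) \<in> borel_measurable M" if "k \<le> Suc n" for j k by (rule Bm[OF pT[OF that]])
      then show "(\<lambda>\<omega>. c * ?X \<omega> + (\<Sum>j\<in>UNIV. \<Sum>k<Suc n. d j k *
          (?B j (0 + real (Suc k) * ((T - 0) / Suc n)) \<omega> - ?B j (0 + real k * ((T - 0) / Suc n)) \<omega>))) \<in> borel_measurable M"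
        unfolding p_def
        by (intro borel_measurable_add borel_measurable_sum borel_measurable_times borel_measurable_const
            borel_measurable_diff Xm) auto
    qed
  qed
qed

text \<open>Adding null sets changes a set of V only by a null set, and independence depends only on
  probabilities. This bridges the gap between the noise V_j, of which X0 is independent, and the
  innovation B_j, which is measurable only for the augmented sigma-algebra.\<close>

lemma indep_set_mod_null:
  assumes AB: "indep_set \<A> (sets V)" and sp: "space V = space M" and VM: "sets V \<subseteq> sets M"
    and X: "X \<in> borel_measurable M" "\<And>E. E \<in> sets borel \<Longrightarrow> X -` E \<inter> space M \<in> \<A>"
    and L: "L \<in> borel_measurable (sigma (space M) (sets V \<union> null_sets M))"
  shows "indep_var borel X borel L"
proof -
  have sub: "sets V \<union> null_sets M \<subseteq> Pow (space M)"
    by (auto dest!: subsetD[OF VM] null_setsD2 dest: sets.sets_into_space)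
  have S: "sets (sigma (space M) (sets V \<union> null_sets M)) = sigma_sets (space M) (sets V \<union> null_sets M)"
    using sub by (simp add: sets_measure_of)
  have mod: "E \<in> sets M \<and> (\<exists>E'\<in>sets V. AE \<omega> in M. \<omega> \<in> E \<longleftrightarrow> \<omega> \<in> E')"
    if "E \<in> sigma_sets (space M) (sets V \<union> null_sets M)" for E
    using that
  proof (induction rule: sigma_sets.induct)
    case (Basic a)
    then show ?case
    proof
      assume "a \<in> sets V" then show ?thesis using VM by (auto intro!: bexI[of _ a])
    next
      assume a: "a \<in> null_sets M"
      have "AE \<omega> in M. \<omega> \<in> a \<longleftrightarrow> \<omega> \<in> {}" by (rule eventually_mono[OF AE_not_in[OF a]]) simp
      then show ?thesis using a by blast
    qed
  next
    case Empty then show ?case by (auto intro!: bexI[of _ "{}"])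
  next
    case (Compl a)
    then obtain E' where E': "E' \<in> sets V" "AE \<omega> in M. \<omega> \<in> a \<longleftrightarrow> \<omega> \<in> E'" by blast
    have "AE \<omega> in M. \<omega> \<in> space M - a \<longleftrightarrow> \<omega> \<in> space M - E'" using E'(2) by eventually_elim simp
    moreover have "space M - E' \<in> sets V" using E'(1) sp by (metis sets.compl_sets)
    ultimately show ?case using Compl by blast
  next
    case (Union a)
    then have "\<forall>i. \<exists>E'. E' \<in> sets V \<and> (AE \<omega> in M. \<omega> \<in> a i \<longleftrightarrow> \<omega> \<in> E')" by blast
    then obtain E' where E': "\<And>i. E' i \<in> sets V" "\<And>i. AE \<omega> in M. \<omega> \<in> a i \<longleftrightarrow> \<omega> \<in> E' i" by metis
    have "AE \<omega> in M. \<forall>i. \<omega> \<in> a i \<longleftrightarrow> \<omega> \<in> E' i" using E'(2) by (simp add: AE_all_countable)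
    then have "AE \<omega> in M. \<omega> \<in> (\<Union>i. a i) \<longleftrightarrow> \<omega> \<in> (\<Union>i. E' i)" by eventually_elim simp
    moreover have "(\<Union>i. E' i) \<in> sets V" using E'(1) by auto
    moreover have "(\<Union>i. a i) \<in> sets M" using Union by auto
    ultimately show ?case by blast
  qed
  have Lpre: "L -` E \<inter> space M \<in> sigma_sets (space M) (sets V \<union> null_sets M)" if "E \<in> sets borel" for E
    using measurable_sets[OF L that] unfolding S by (simp add: space_measure_of_conv)
  have Lm: "L \<in> borel_measurable M"
    by (rule measurableI) (use mod[OF Lpre] in auto)
  have ind: "prob (a \<inter> E) = prob a * prob E"
    if a: "a \<in> \<A>" and E: "E \<in> sigma_sets (space M) (sets V \<union> null_sets M)" for a E
  proof -
    from mod[OF E] obtain E' where E': "E' \<in> sets V" "AE \<omega> in M. \<omega> \<in> E \<longleftrightarrow> \<omega> \<in> E'" and EM: "E \<in> sets M" by blast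
    have aM: "a \<in> sets M" using AB a by (auto simp: indep_sets2_eq)
    have E'M: "E' \<in> sets M" using E'(1) VM by auto
    have "prob (a \<inter> E) = prob (a \<inter> E')"
      using E'(2) aM EM E'M by (intro finite_measure_eq_AE) (auto elim: eventually_mono)
    also have "\<dots> = prob a * prob E'" by (rule indep_setD[OF AB a E'(1)])
    also have "prob E' = prob E" using E'(2) EM E'M by (intro finite_measure_eq_AE) (auto elim: eventually_mono)
    finally show ?thesis .
  qed
  have s1: "sigma_sets (space M) {X -` E \<inter> space M | E. E \<in> sets borel} = {X -` E \<inter> space M | E. E \<in> sets borel}"
    using sets_vimage_algebra[of "space M" X borel] sets_vimage_algebra2[of X "space M" borel] by simp
  have s2: "sigma_sets (space M) {L -` E \<inter> space M | E. E \<in> sets borel} = {L -` E \<inter> space M | E. E \<in> sets borel}"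
    using sets_vimage_algebra[of "space M" L borel] sets_vimage_algebra2[of L "space M" borel] by simp
  show ?thesis
    unfolding indep_var_eq s1 s2 indep_sets2_eq
    using X Lm Lpre ind by (auto intro: measurable_sets)
qed

end

section \<open>Wiener integrals and integration by parts\<close>

lemma step_fun_simps [simp]:
  "step_fun [] u = 0" "step_fun ((c, a, b) # xs) u = c * indicator {a<..b} u + step_fun xs u"
  by (simp_all add: step_fun_def)

lemma step_integral_simps [simp]:
  "step_integral S [] \<omega> = 0" "step_integral S ((c, a, b) # xs) \<omega> = c * (S b \<omega> - S a \<omega>) + step_integral S xs \<omega>"
  by (simp_all add: step_integral_def)

definition steps_within :: "real \<Rightarrow> (real \<times> real \<times> real) list \<Rightarrow> bool" where
  "steps_within t xs \<longleftrightarrow> (\<forall>(c, a, b)\<in>set xs. a < b \<and> {a<..b} \<subseteq> {0<..t})"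

lemma steps_within_Nil [simp]: "steps_within t []" by (simp add: steps_within_def)

lemma Ioc_subset_iff: "a < b \<Longrightarrow> {a<..b} \<subseteq> {0<..t} \<longleftrightarrow> 0 \<le> a \<and> b \<le> (t::real)"
proof
  assume ab: "a < b" and s: "{a<..b} \<subseteq> {0<..t}"
  have "b \<in> {0<..t}" using ab s by auto
  moreover have "0 \<le> a"
  proof (rule ccontr)
    assume "\<not> 0 \<le> a"
    \<comment> \<open>A point of the interval that is not positive, contradicting the
      inclusion.\<close>
    then have "min b 0 \<in> {a<..b}" using ab by auto
    with s have "min b 0 \<in> {0<..t}" by blast
    then show False by simp
  qed
  ultimately show "0 \<le> a \<and> b \<le> t" by simp
qed auto

lemma steps_within_Cons [simp]:
  "steps_within t ((c, a, b) # xs) \<longleftrightarrow> 0 \<le> a \<and> a < b \<and> b \<le> t \<and> steps_within t xs"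
  using Ioc_subset_iff[of a b t] by (auto simp: steps_within_def)

lemma l2proc_diff:
  assumes "l2proc M a b x" "l2proc M a b y" shows "l2proc M a b (\<lambda>s \<omega>. x s \<omega> - y s \<omega>)"
  using l2proc_add[OF assms(1) l2proc_mult[OF assms(2), of "\<lambda>_. -1"]] by simp

lemma integral_grid_sum:
  fixes g :: "real \<Rightarrow> real"
  assumes "\<And>k. k < m \<Longrightarrow> p k \<le> p (Suc k)" "continuous_on {p 0..p m} g"
  shows "integral {p 0..p m} g = (\<Sum>k<m. integral {p k..p (Suc k)} g)"
  using assms
proof (induction m)
  case (Suc m)
  have mono: "p 0 \<le> p m"
    using Suc.prems(1) by (induction m) (auto intro: order_trans less_SucI)
  have "g integrable_on {p 0..p (Suc m)}" by (intro integrable_continuous_real Suc.prems)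
  from Henstock_Kurzweil_Integration.integral_combine[OF mono Suc.prems(1)[OF lessI] this]
  have "integral {p 0..p (Suc m)} g = integral {p 0..p m} g + integral {p m..p (Suc m)} g" by simp
  moreover have "continuous_on {p 0..p m} g"
    using Suc.prems(1)[OF lessI] by (intro continuous_on_subset[OF Suc.prems(2)]) auto
  ultimately show ?case using Suc by simp
qed simp

text \<open>For smooth f the integral exists explicitly against any mean-square continuous y.
  Summation by parts shows that the step integral misses the claimed value by the sum over the cells
  of the integrals of f'(s) (y(s) - y(p_k)), p_k being the left endpoint of the cell, and this is
  controlled by the modulus of y.\<close>

lemma has_wiener_integral_by_parts:
  assumes y: "l2proc M 0 T y" and y0: "\<And>\<omega>. \<omega> \<in> space M \<Longrightarrow> y 0 \<omega> = 0"
    and f: "\<And>t. t \<in> {0..T} \<Longrightarrow> (f has_real_derivative f' t) (at t within {0..T})"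
    and f'c: "continuous_on {0..T} f'" and t: "t \<in> {0..T}"
  shows "has_wiener_integral M y {0<..t} f (\<lambda>\<omega>. f t * y t \<omega> - integral {0..t} (\<lambda>s. f' s * y s \<omega>))"
    (is "has_wiener_integral M y _ f ?I")
proof -
  have yt: "l2proc M 0 t y" using t by (intro l2proc_subset[OF y]) auto
  have f'ct: "continuous_on {0..t} f'" using t by (intro continuous_on_subset[OF f'c]) auto
  have fc: "continuous_on {0..T} f"
    using f by (meson DERIV_continuous continuous_on_eq_continuous_within)
  have fct: "continuous_on {0..t} f" using t by (intro continuous_on_subset[OF fc]) auto
  have IL: "?I \<in> L2 M"
    using t by (intro L2_diff L2_cmult l2proc_L2[OF y] l2_integral_rsum(1) l2proc_mult yt f'ct) auto
  have Im: "?I \<in> borel_measurable M" using IL by (simp add: L2_def)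
  have "continuous_on {0<..t} f" by (rule continuous_on_subset[OF fct]) auto
  then have fm: "set_borel_measurable lborel {0<..t} f"
    unfolding set_borel_measurable_def
    using borel_measurable_continuous_on_indicator[of "{0<..t}" f] by simp
  obtain K where K: "0 < K" "\<And>s. s \<in> {0..t} \<Longrightarrow> norm (f' s) \<le> K" using continuous_on_Icc_bounded[OF f'ct] by blast
  have lip: "\<bar>f s - f r\<bar> \<le> K * \<bar>s - r\<bar>" if "s \<in> {0..t}" "r \<in> {0..t}" for s r
  proof -
    have "norm (f s - f r) \<le> K * norm (s - r)"
    proof (rule field_differentiable_bound[of "{0..t}" f f'])
      fix z assume z: "z \<in> {0..t}"
      then show "(f has_field_derivative f' z) (at z within {0..t})"
        using t by (intro DERIV_subset[OF f]) auto
      show "norm (f' z) \<le> K" by (rule K(2)[OF z])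
    qed (use that in auto)
    then show ?thesis by simp
  qed
  show ?thesis
  \<comment> \<open>For t = 0 the interval is empty and admits no step, so the empty list
    approximates.\<close>
  proof (cases "t = 0")
    case True
    have "?I \<omega> = 0" if "\<omega> \<in> space M" for \<omega> using y0[OF that] True by simp
    then have "(\<integral>\<^sup>+\<omega>. ennreal ((step_integral y [] \<omega> - ?I \<omega>)\<^sup>2) \<partial>M) = 0"
      by (simp cong: nn_integral_cong)
    then show ?thesis
      unfolding has_wiener_integral_def using Im fm True by (intro conjI exI[of _ "\<lambda>_. []"]) auto
  next
    case False
    then have tp: "0 < t" using t by simp
    define p where "p n k = real k * (t / Suc n)" for n k :: nat
    \<comment> \<open>The value of f is taken at the right end of each cell; summation by parts then
      leaves y at the left end, multiplied by the increment of f over the cell.\<close>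
    define \<xi> where "\<xi> n = map (\<lambda>k. (f (p n (Suc k)), p n k, p n (Suc k))) [0..<Suc n]" for n
    have p0: "p n 0 = 0" and pN: "p n (Suc n) = t" for n by (simp_all add: p_def)
    have pd: "p n (Suc k) - p n k = t / Suc n" for n k by (simp add: p_def algebra_simps add_divide_distrib)
    have tn: "0 < t / Suc n" for n using tp by simp
    have plt: "p n k < p n (Suc k)" for n k using pd[of n k] tn[of n] by linarith
    have pin: "p n k \<in> {0..t}" if "k \<le> Suc n" for n k
    proof -
      have "real k * (t / Suc n) \<le> real (Suc n) * (t / Suc n)" using that tn[of n] by (intro mult_right_mono) auto
      then show ?thesis using tp by (simp add: p_def)
    qed
    have sf: "step_fun (\<xi> n) u = (\<Sum>k<Suc n. f (p n (Suc k)) * indicator {p n k<..p n (Suc k)} u)" for n u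
      unfolding step_fun_def \<xi>_def
      by (simp add: interv_sum_list_conv_sum_set_nat o_def lessThan_atLeast0 del: upt_Suc sum.lessThan_Suc sum.op_ivl_Suc)
    have si: "step_integral y (\<xi> n) \<omega> = (\<Sum>k<Suc n. f (p n (Suc k)) * (y (p n (Suc k)) \<omega> - y (p n k) \<omega>))" for n \<omega>
      unfolding step_integral_def \<xi>_def
      by (simp add: interv_sum_list_conv_sum_set_nat o_def lessThan_atLeast0 del: upt_Suc sum.lessThan_Suc sum.op_ivl_Suc)
    have within: "\<forall>(c, a, b)\<in>set (\<xi> n). a < b \<and> {a<..b} \<subseteq> {0<..t}" for n
    proof -
      have "0 \<le> p n k" "p n (Suc k) \<le> t" if "k < Suc n" for k using pin[of k n] pin[of "Suc k" n] that by auto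
      then show ?thesis unfolding \<xi>_def using plt[of n] by (auto simp: Ioc_subset_iff simp del: upt_Suc)
    qed
    have conv_f: "(\<lambda>n. \<integral>\<^sup>+u\<in>{0<..t}. ennreal ((step_fun (\<xi> n) u - f u)\<^sup>2) \<partial>lborel) \<longlonglongrightarrow> 0"
    proof -
      have le: "(\<integral>\<^sup>+u\<in>{0<..t}. ennreal ((step_fun (\<xi> n) u - f u)\<^sup>2) \<partial>lborel) \<le> ennreal ((K * (t / Suc n))\<^sup>2 * t)" for n
      proof -
        have "(step_fun (\<xi> n) u - f u)\<^sup>2 \<le> (K * (t / Suc n))\<^sup>2" if u: "u \<in> {0<..t}" for u
        proof -
          \<comment> \<open>The cells partition (0,t]; as differences of indicators of half-lines
            their indicators telescope. Multiplying f(u) by this 1 compares it with the step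
            function cell by cell.\<close>
          have ind: "(\<Sum>k<Suc n. indicator {p n k<..p n (Suc k)} u :: real) = 1"
          proof -
            have "indicator {p n k<..p n (Suc k)} u = (indicator {..p n (Suc k)} u - indicator {..p n k} u :: real)" for k
              using plt[of n k] by (auto simp: indicator_def)
            then have "(\<Sum>k<Suc n. indicator {p n k<..p n (Suc k)} u :: real) = indicator {..p n (Suc n)} u - indicator {..p n 0} u"
              using sum_lessThan_telescope[of "\<lambda>k. indicator {..p n k} u :: real" "Suc n"] by simp
            then show ?thesis using u by (simp add: p0 pN)
          qed
          have "step_fun (\<xi> n) u - f u = (\<Sum>k<Suc n. f (p n (Suc k)) * indicator {p n k<..p n (Suc k)} u)
              - f u * (\<Sum>k<Suc n. indicator {p n k<..p n (Suc k)} u)"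
            unfolding ind sf by simp
          also have "\<dots> = (\<Sum>k<Suc n. (f (p n (Suc k)) - f u) * indicator {p n k<..p n (Suc k)} u)"
            by (simp only: sum_distrib_left sum_subtractf[symmetric] left_diff_distrib)
          also have "\<bar>\<dots>\<bar> \<le> (\<Sum>k<Suc n. \<bar>(f (p n (Suc k)) - f u) * indicator {p n k<..p n (Suc k)} u\<bar>)"
            by (rule sum_abs)
          also have "\<dots> \<le> (\<Sum>k<Suc n. K * (t / Suc n) * indicator {p n k<..p n (Suc k)} u)"
          proof (rule sum_mono)
            fix k assume k: "k \<in> {..<Suc n}"
            show "\<bar>(f (p n (Suc k)) - f u) * indicator {p n k<..p n (Suc k)} u\<bar> \<le> K * (t / Suc n) * indicator {p n k<..p n (Suc k)} u"
            proof (cases "u \<in> {p n k<..p n (Suc k)}")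
              case True
              have "\<bar>f (p n (Suc k)) - f u\<bar> \<le> K * \<bar>p n (Suc k) - u\<bar>"
                using k u by (intro lip pin) auto
              also have "\<dots> \<le> K * (t / Suc n)"
              proof (rule mult_left_mono)
                show "\<bar>p n (Suc k) - u\<bar> \<le> t / Suc n" using True pd[of n k] by auto
              qed (use K in simp)
              finally show ?thesis using True by simp
            qed simp
          qed
          also have "\<dots> = K * (t / Suc n)" unfolding sum_distrib_left[symmetric] ind by simp
          finally show ?thesis by (simp add: abs_le_square_iff[symmetric] K tp less_imp_le abs_mult)
        qed
        then have "(\<integral>\<^sup>+u\<in>{0<..t}. ennreal ((step_fun (\<xi> n) u - f u)\<^sup>2) \<partial>lborel) \<le> (\<integral>\<^sup>+u\<in>{0<..t}. ennreal ((K * (t / Suc n))\<^sup>2) \<partial>lborel)"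
          by (intro nn_integral_mono) (auto simp: indicator_def intro!: ennreal_leI)
        also have "\<dots> = ennreal ((K * (t / Suc n))\<^sup>2) * ennreal t"
          using tp by (subst nn_integral_cmult_indicator) (auto simp: emeasure_lborel_Ioc)
        finally show ?thesis using tp by (simp add: ennreal_mult)
      qed
      have "(\<lambda>n. (K * (t / Suc n))\<^sup>2 * t) \<longlonglongrightarrow> (K * 0)\<^sup>2 * t"
        by (intro tendsto_intros LIMSEQ_Suc[OF lim_const_over_n])
      then have "(\<lambda>n. ennreal ((K * (t / Suc n))\<^sup>2 * t)) \<longlonglongrightarrow> 0"
        using tendsto_ennrealI by fastforce
      then show ?thesis by (rule tendsto_sandwich[OF _ _ tendsto_const, rotated 2]) (use le in auto)
    qed
    have conv_I: "(\<lambda>n. nrm M (\<lambda>\<omega>. step_integral y (\<xi> n) \<omega> - ?I \<omega>)) \<longlonglongrightarrow> 0"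
    proof (rule LIMSEQ_I)
      fix \<epsilon> :: real assume \<epsilon>: "0 < \<epsilon>"
      define e where "e = \<epsilon> / (2 * t * K)"
      have e: "0 < e" using \<epsilon> tp K by (simp add: e_def)
      from l2proc_mod[OF yt e] obtain d where d: "0 < d"
        "\<And>s r. s \<in> {0..t} \<Longrightarrow> r \<in> {0..t} \<Longrightarrow> \<bar>s - r\<bar> < d \<Longrightarrow> nrm M (\<lambda>\<omega>. y s \<omega> - y r \<omega>) \<le> e" by blast
      obtain N where N: "t / d < real N" using reals_Archimedean2 by blast
      show "\<exists>N. \<forall>n\<ge>N. norm (nrm M (\<lambda>\<omega>. step_integral y (\<xi> n) \<omega> - ?I \<omega>) - 0) < \<epsilon>"
      proof (intro exI allI impI)
        fix n assume "N \<le> n"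
        then have "t / d < Suc n" using N by linarith
        then have hd: "t / Suc n < d" using d by (simp add: field_simps)
        let ?D = "\<lambda>k \<omega>. integral {p n k..p n (Suc k)} (\<lambda>s. f' s * (y s \<omega> - y (p n k) \<omega>))"
        have Dp: "l2proc M (p n k) (p n (Suc k)) (\<lambda>s \<omega>. f' s * (y s \<omega> - y (p n k) \<omega>))" if k: "k < Suc n" for k
        proof (intro l2proc_mult l2proc_diff l2proc_const)
          have pk: "p n k \<in> {0..t}" "p n (Suc k) \<in> {0..t}" by (rule pin, use k in simp)+
          then show "l2proc M (p n k) (p n (Suc k)) y" by (intro l2proc_subset[OF yt]) auto
          show "y (p n k) \<in> L2 M" by (rule l2proc_L2[OF yt pk(1)])
          show "continuous_on {p n k..p n (Suc k)} f'" using pk by (intro continuous_on_subset[OF f'ct]) auto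
        qed
        have DL: "?D k \<in> L2 M" if "k < Suc n" for k
          by (rule l2_integral_rsum(1)[OF Dp[OF that] less_imp_le[OF plt]])
        have Dn: "nrm M (?D k) \<le> (p n (Suc k) - p n k) * (K * e)" if k: "k < Suc n" for k
        proof (rule nrm_integral_le[OF Dp[OF k] less_imp_le[OF plt]])
          fix s assume s: "s \<in> {p n k..p n (Suc k)}"
          have pk: "p n k \<in> {0..t}" "p n (Suc k) \<in> {0..t}" by (rule pin, use k in simp)+
          have st: "s \<in> {0..t}" using s pk by auto
          have "\<bar>s - p n k\<bar> < d" using s pd[of n k] hd by auto
          then have "nrm M (\<lambda>\<omega>. y s \<omega> - y (p n k) \<omega>) \<le> e" by (intro d st pk)
          then show "nrm M (\<lambda>\<omega>. f' s * (y s \<omega> - y (p n k) \<omega>)) \<le> K * e"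
            using K(2)[OF st] K(1) by (simp add: mult_mono)
        qed
        have eq: "step_integral y (\<xi> n) \<omega> - ?I \<omega> = (\<Sum>k<Suc n. ?D k \<omega>)" if w: "\<omega> \<in> space M" for \<omega>
        proof -
          have yc: "continuous_on {0..t} (\<lambda>s. y s \<omega>)" by (rule l2proc_cont[OF yt w])
          have c1: "continuous_on {0..t} (\<lambda>s. f' s * y s \<omega>)" by (intro continuous_intros f'ct yc)
          have sub: "{p n k..p n (Suc k)} \<subseteq> {0..t}" if "k < Suc n" for k
            using pin[of k n] pin[of "Suc k" n] that by auto
          have D: "?D k \<omega> = integral {p n k..p n (Suc k)} (\<lambda>s. f' s * y s \<omega>) - (f (p n (Suc k)) - f (p n k)) * y (p n k) \<omega>"
            if k: "k < Suc n" for k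
          proof -
            have i1: "(\<lambda>s. f' s * y s \<omega>) integrable_on {p n k..p n (Suc k)}"
              by (intro integrable_continuous_real continuous_on_subset[OF c1] sub k)
            have i2: "(f' has_integral (f (p n (Suc k)) - f (p n k))) {p n k..p n (Suc k)}"
            proof (rule fundamental_theorem_of_calculus[OF less_imp_le[OF plt]])
              fix s assume "s \<in> {p n k..p n (Suc k)}"
              then have "s \<in> {0..T}" "{p n k..p n (Suc k)} \<subseteq> {0..T}" using sub[OF k] t by auto
              then show "(f has_vector_derivative f' s) (at s within {p n k..p n (Suc k)})"
                using DERIV_subset[OF f] by (simp add: has_real_derivative_iff_has_vector_derivative)
            qed
            have "?D k \<omega> = integral {p n k..p n (Suc k)} (\<lambda>s. f' s * y s \<omega> - f' s * y (p n k) \<omega>)"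
              by (simp add: right_diff_distrib)
            also have "\<dots> = integral {p n k..p n (Suc k)} (\<lambda>s. f' s * y s \<omega>) - integral {p n k..p n (Suc k)} (\<lambda>s. f' s * y (p n k) \<omega>)"
              by (rule integral_diff[OF i1 integrable_on_mult_left]) (use i2 in blast)
            also have "integral {p n k..p n (Suc k)} (\<lambda>s. f' s * y (p n k) \<omega>) = (f (p n (Suc k)) - f (p n k)) * y (p n k) \<omega>"
              by (rule integral_unique[OF has_integral_mult_left[OF i2]])
            finally show ?thesis .
          qed
          have "(\<Sum>k<Suc n. ?D k \<omega>) = (\<Sum>k<Suc n. integral {p n k..p n (Suc k)} (\<lambda>s. f' s * y s \<omega>))
              - (\<Sum>k<Suc n. (f (p n (Suc k)) - f (p n k)) * y (p n k) \<omega>)"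
            unfolding sum_subtractf[symmetric] by (intro sum.cong refl D) simp
          also have "(\<Sum>k<Suc n. integral {p n k..p n (Suc k)} (\<lambda>s. f' s * y s \<omega>)) = integral {0..t} (\<lambda>s. f' s * y s \<omega>)"
            using integral_grid_sum[of "Suc n" "p n" "\<lambda>s. f' s * y s \<omega>"] plt c1 unfolding p0 pN by (simp add: less_imp_le)
          also have "(\<Sum>k<Suc n. (f (p n (Suc k)) - f (p n k)) * y (p n k) \<omega>) =
              (\<Sum>k<Suc n. (f (p n (Suc k)) * y (p n (Suc k)) \<omega> - f (p n k) * y (p n k) \<omega>) - f (p n (Suc k)) * (y (p n (Suc k)) \<omega> - y (p n k) \<omega>))"
            by (intro sum.cong refl) (simp add: algebra_simps)
          also have "\<dots> = (f t * y t \<omega> - f 0 * y 0 \<omega>) - step_integral y (\<xi> n) \<omega>"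
            unfolding sum_subtractf si using sum_lessThan_telescope[of "\<lambda>k. f (p n k) * y (p n k) \<omega>" "Suc n"]
            unfolding p0 pN sum_subtractf by simp
          finally show ?thesis using y0[OF w] by simp
        qed
        have "nrm M (\<lambda>\<omega>. step_integral y (\<xi> n) \<omega> - ?I \<omega>) = nrm M (\<lambda>\<omega>. \<Sum>k<Suc n. ?D k \<omega>)"
          by (rule nrm_cong[OF eq])
        also have "\<dots> \<le> (\<Sum>k<Suc n. nrm M (?D k))" by (rule nrm_sum) (simp add: DL)
        also have "\<dots> \<le> (\<Sum>k<Suc n. (p n (Suc k) - p n k) * (K * e))" by (rule sum_mono) (simp add: Dn)
        also have "\<dots> = t * (K * e)"
          unfolding sum_distrib_right[symmetric] sum_lessThan_telescope p0 pN by simp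
        also have "\<dots> = \<epsilon> / 2" using tp K by (simp add: e_def)
        finally show "norm (nrm M (\<lambda>\<omega>. step_integral y (\<xi> n) \<omega> - ?I \<omega>) - 0) < \<epsilon>" using \<epsilon> by simp
      qed
    qed
    have SL: "(\<lambda>\<omega>. step_integral y (\<xi> n) \<omega> - ?I \<omega>) \<in> L2 M" for n
      unfolding si by (intro L2_diff[OF _ IL] L2_sum L2_cmult L2_diff l2proc_L2[OF yt] pin) auto
    have "(\<lambda>n. ennreal ((nrm M (\<lambda>\<omega>. step_integral y (\<xi> n) \<omega> - ?I \<omega>))\<^sup>2)) \<longlonglongrightarrow> ennreal (0\<^sup>2)"
      by (intro tendsto_ennrealI tendsto_intros conv_I)
    then have "(\<lambda>n. \<integral>\<^sup>+\<omega>. ennreal ((step_integral y (\<xi> n) \<omega> - ?I \<omega>)\<^sup>2) \<partial>M) \<longlonglongrightarrow> 0"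
      unfolding nn_integral_square[OF SL] by simp
    then show ?thesis
      unfolding has_wiener_integral_def using Im fm within conv_f by (intro conjI exI[of _ \<xi>]) auto
  qed
qed

text \<open>Moves an integral between a process and its version that is set to 0 off the good
  set.\<close>

lemma has_wiener_integral_cong_AE:
  assumes W: "has_wiener_integral M S {0<..t} f I"
    and S: "\<And>s. s \<in> {0..t} \<Longrightarrow> AE \<omega> in M. S s \<omega> = S' s \<omega>"
    and f: "\<And>u. u \<in> {0<..t} \<Longrightarrow> f u = f' u"
  shows "has_wiener_integral M S' {0<..t} f' I"
proof -
  from W obtain \<xi> where Im: "I \<in> borel_measurable M" and fm: "set_borel_measurable lborel {0<..t} f"
    and \<xi>: "\<And>n. steps_within t (\<xi> n)"
    and c1: "(\<lambda>n. \<integral>\<^sup>+u\<in>{0<..t}. ennreal ((step_fun (\<xi> n) u - f u)\<^sup>2) \<partial>lborel) \<longlonglongrightarrow> 0"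
    and c2: "(\<lambda>n. \<integral>\<^sup>+\<omega>. ennreal ((step_integral S (\<xi> n) \<omega> - I \<omega>)\<^sup>2) \<partial>M) \<longlonglongrightarrow> 0"
    unfolding has_wiener_integral_def steps_within_def by blast
  have "(\<lambda>u. indicat_real {0<..t} u *\<^sub>R f u) = (\<lambda>u. indicator {0<..t} u *\<^sub>R f' u)"
    using f by (auto simp: indicator_def)
  then have fm': "set_borel_measurable lborel {0<..t} f'" using fm by (simp add: set_borel_measurable_def)
  have "(\<integral>\<^sup>+u\<in>{0<..t}. ennreal ((step_fun (\<xi> n) u - f u)\<^sup>2) \<partial>lborel) =
      (\<integral>\<^sup>+u\<in>{0<..t}. ennreal ((step_fun (\<xi> n) u - f' u)\<^sup>2) \<partial>lborel)" for n
    using f by (intro nn_integral_cong) (auto simp: indicator_def)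
  with c1 have c1': "(\<lambda>n. \<integral>\<^sup>+u\<in>{0<..t}. ennreal ((step_fun (\<xi> n) u - f' u)\<^sup>2) \<partial>lborel) \<longlonglongrightarrow> 0" by simp
  have SS: "AE \<omega> in M. step_integral S xs \<omega> = step_integral S' xs \<omega>" if "steps_within t xs" for xs
    using that
  proof (induction xs)
    case (Cons x xs)
    obtain c a b where x: "x = (c, a, b)" by (cases x)
    have "AE \<omega> in M. S a \<omega> = S' a \<omega>" "AE \<omega> in M. S b \<omega> = S' b \<omega>" using Cons.prems by (auto intro!: S simp: x)
    moreover have "AE \<omega> in M. step_integral S xs \<omega> = step_integral S' xs \<omega>" using Cons by (simp add: x)
    ultimately show ?case by eventually_elim (simp add: x)
  qed simp
  have "(\<integral>\<^sup>+\<omega>. ennreal ((step_integral S (\<xi> n) \<omega> - I \<omega>)\<^sup>2) \<partial>M) =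
      (\<integral>\<^sup>+\<omega>. ennreal ((step_integral S' (\<xi> n) \<omega> - I \<omega>)\<^sup>2) \<partial>M)" for n
    using SS[OF \<xi>[of n]] by (intro nn_integral_cong_AE) (auto elim: eventually_mono)
  with c2 have c2': "(\<lambda>n. \<integral>\<^sup>+\<omega>. ennreal ((step_integral S' (\<xi> n) \<omega> - I \<omega>)\<^sup>2) \<partial>M) \<longlonglongrightarrow> 0" by simp
  show ?thesis unfolding has_wiener_integral_def
    using Im fm' \<xi> c1' c2' by (intro conjI exI[of _ \<xi>]) (auto simp: steps_within_def)
qed

section \<open>Ito isometry for step functions and uniqueness of Wiener integrals\<close>

context gauss_base begin

lemma step_integral_L2: "t \<le> T \<Longrightarrow> steps_within t xs \<Longrightarrow> step_integral (B j) xs \<in> L2 M"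
proof (induction xs)
  case Nil
  then show ?case by (simp add: step_integral_def)
next
  case (Cons x xs)
  obtain c a b where x: "x = (c, a, b)" by (cases x)
  have "B j a \<in> L2 M" "B j b \<in> L2 M" using Cons.prems by (auto intro!: B_L2 simp: x)
  then have "(\<lambda>\<omega>. c * (B j b \<omega> - B j a \<omega>) + step_integral (B j) xs \<omega>) \<in> L2 M"
    using Cons by (intro L2_add L2_cmult L2_diff) (auto simp: x)
  moreover have "step_integral (B j) (x # xs) = (\<lambda>\<omega>. c * (B j b \<omega> - B j a \<omega>) + step_integral (B j) xs \<omega>)"
    by (simp add: x fun_eq_iff)
  ultimately show ?case by simp
qed

text \<open>The intervals in a list may overlap, so the isometry is obtained by bilinearity, one
  interval against another. There it says that two increments have the length of the intersection as
  covariance, an identity between minima of endpoints.\<close>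

lemma step_integral_isometry_aux:
  assumes t: "t \<le> T" and x: "0 \<le> a" "a < b" "b \<le> t" and ys: "steps_within t ys"
  shows "integrable lborel (\<lambda>u. indicator {a<..b} u * step_fun ys u) \<and>
    ip M (\<lambda>\<omega>. B j b \<omega> - B j a \<omega>) (step_integral (B j) ys) = (\<integral>u. indicator {a<..b} u * step_fun ys u \<partial>lborel)"
  using ys
proof (induction ys)
  case Nil
  have "step_integral (B j) [] = (\<lambda>_. 0)" by (simp add: fun_eq_iff)
  then show ?case by simp
next
  case (Cons y ys)
  obtain c a' b' where y: "y = (c, a', b')" by (cases y)
  have y': "0 \<le> a'" "a' < b'" "b' \<le> t" and ys: "steps_within t ys" using Cons.prems by (simp_all add: y)
  have BL: "B j a \<in> L2 M" "B j b \<in> L2 M" "B j a' \<in> L2 M" "B j b' \<in> L2 M"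
    using x y' t by (auto intro!: B_L2)
  have ab: "a \<in> {0..T}" "b \<in> {0..T}" "a' \<in> {0..T}" "b' \<in> {0..T}" using x y' t by auto
  have I: "(\<lambda>u. indicator {a<..b} u * (indicator {a'<..b'} u :: real)) = indicator {max a a'<..min b b'}"
    by (auto simp: indicator_def)
  have i1: "integrable lborel (\<lambda>u. indicator {a<..b} u * (indicator {a'<..b'} u :: real))"
    unfolding I by (intro integrable_real_indicator; cases "max a a' \<le> min b b'") auto
  have v1: "(\<integral>u. indicator {a<..b} u * (indicator {a'<..b'} u :: real) \<partial>lborel) =
      ip M (\<lambda>\<omega>. B j b \<omega> - B j a \<omega>) (\<lambda>\<omega>. B j b' \<omega> - B j a' \<omega>)"
  proof -
    have "ip M (\<lambda>\<omega>. B j b \<omega> - B j a \<omega>) (\<lambda>\<omega>. B j b' \<omega> - B j a' \<omega>) = min b b' - min b a' - (min a b' - min a a')"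
      using BL ab by (simp add: ip_diff_left ip_diff_right L2_diff B_cov)
    moreover have "measure lborel {max a a'<..min b b'} = min b b' - min b a' - (min a b' - min a a')"
    proof (cases "max a a' \<le> min b b'")
      case True
      then have "measure lborel {max a a'<..min b b'} = min b b' - max a a'" by simp
      then show ?thesis using True x(2) y'(2) by arith
    next
      case False
      then have "{max a a'<..min b b'} = {}" by auto
      then have "measure lborel {max a a'<..min b b'} = 0" by (simp only: measure_empty)
      then show ?thesis using False x(2) y'(2) by arith
    qed
    ultimately show ?thesis unfolding I by simp
  qed
  note IH = Cons.IH[OF ys]
  have e: "(\<lambda>u. indicator {a<..b} u * step_fun (y # ys) u) =
      (\<lambda>u. c * (indicator {a<..b} u * indicator {a'<..b'} u) + indicator {a<..b} u * step_fun ys u)"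
    by (simp add: y distrib_left mult.left_commute)
  have "step_integral (B j) (y # ys) = (\<lambda>\<omega>. c * (B j b' \<omega> - B j a' \<omega>) + step_integral (B j) ys \<omega>)"
    by (simp add: y fun_eq_iff)
  then have "ip M (\<lambda>\<omega>. B j b \<omega> - B j a \<omega>) (step_integral (B j) (y # ys)) =
      c * ip M (\<lambda>\<omega>. B j b \<omega> - B j a \<omega>) (\<lambda>\<omega>. B j b' \<omega> - B j a' \<omega>) + ip M (\<lambda>\<omega>. B j b \<omega> - B j a \<omega>) (step_integral (B j) ys)"
    using ip_add_right[OF L2_cmult[OF L2_diff[OF BL(4,3)]] step_integral_L2[OF t ys] L2_diff[OF BL(2,1)], of c j]
    by simp
  then show ?case unfolding e using i1 IH by (simp add: v1)
qed

lemma step_integral_isometry: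
  assumes t: "t \<le> T" and xs: "steps_within t xs" and ys: "steps_within t ys"
  shows "integrable lborel (\<lambda>u. step_fun xs u * step_fun ys u) \<and>
    ip M (step_integral (B j) xs) (step_integral (B j) ys) = (\<integral>u. step_fun xs u * step_fun ys u \<partial>lborel)"
  using xs
proof (induction xs)
  case Nil
  have "step_integral (B j) [] = (\<lambda>_. 0)" by (simp add: fun_eq_iff)
  then show ?case by simp
next
  case (Cons x xs)
  obtain c a b where x: "x = (c, a, b)" by (cases x)
  have x': "0 \<le> a" "a < b" "b \<le> t" and xs: "steps_within t xs" using Cons.prems by (simp_all add: x)
  have BL: "B j a \<in> L2 M" "B j b \<in> L2 M" using x' t by (auto intro!: B_L2)
  note IH = Cons.IH[OF xs] and aux = step_integral_isometry_aux[OF t x' ys, of j]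
  have e: "(\<lambda>u. step_fun (x # xs) u * step_fun ys u) =
      (\<lambda>u. c * (indicator {a<..b} u * step_fun ys u) + step_fun xs u * step_fun ys u)"
    by (simp add: x distrib_right mult.assoc)
  have "step_integral (B j) (x # xs) = (\<lambda>\<omega>. c * (B j b \<omega> - B j a \<omega>) + step_integral (B j) xs \<omega>)"
    by (simp add: x fun_eq_iff)
  then have "ip M (step_integral (B j) (x # xs)) (step_integral (B j) ys) =
      c * ip M (\<lambda>\<omega>. B j b \<omega> - B j a \<omega>) (step_integral (B j) ys) + ip M (step_integral (B j) xs) (step_integral (B j) ys)"
    using ip_add_left[OF L2_cmult[OF L2_diff[OF BL(2,1)]] step_integral_L2[OF t xs] step_integral_L2[OF t ys], of c j j]
    by simp
  then show ?case unfolding e using aux IH by simp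
qed

lemma step_fun_outside: "steps_within t xs \<Longrightarrow> u \<notin> {0<..t} \<Longrightarrow> step_fun xs u = 0"
proof (induction xs)
  case (Cons x xs)
  obtain c a b where x: "x = (c, a, b)" by (cases x)
  show ?case using Cons by (auto simp: x indicator_def)
qed simp

lemma step_fun_measurable [measurable]: "step_fun xs \<in> borel_measurable borel"
proof (induction xs)
  case Nil
  have "step_fun [] = (\<lambda>_. 0)" by (simp add: fun_eq_iff)
  then show ?case by simp
next
  case (Cons x xs)
  obtain c a b where x: "x = (c, a, b)" by (cases x)
  have "step_fun (x # xs) = (\<lambda>u. c * indicator {a<..b} u + step_fun xs u)" by (simp add: x fun_eq_iff)
  then show ?case using Cons by simp
qed

text \<open>Two approximating sequences of steps are close in mean square by the isometry, because
  both converge to f, so their limits agree. The estimates are made with nonnegative integrals,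
  where the distances to f and to I need not be known to be finite.\<close>

lemma wiener_integral_unique:
  assumes t: "t \<le> T" and W: "has_wiener_integral M (B j) {0<..t} f I" and W': "has_wiener_integral M (B j) {0<..t} f I'"
  shows "AE \<omega> in M. I \<omega> = I' \<omega>"
proof -
  let ?A = "{0<..t}"
  from W obtain \<xi> where Im: "I \<in> borel_measurable M" and fm: "set_borel_measurable lborel ?A f"
    and \<xi>: "\<And>n. steps_within t (\<xi> n)"
    and c1: "(\<lambda>n. \<integral>\<^sup>+u\<in>?A. ennreal ((step_fun (\<xi> n) u - f u)\<^sup>2) \<partial>lborel) \<longlonglongrightarrow> 0"
    and c2: "(\<lambda>n. \<integral>\<^sup>+\<omega>. ennreal ((step_integral (B j) (\<xi> n) \<omega> - I \<omega>)\<^sup>2) \<partial>M) \<longlonglongrightarrow> 0"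
    unfolding has_wiener_integral_def steps_within_def by blast
  from W' obtain \<eta> where Im': "I' \<in> borel_measurable M"
    and \<eta>: "\<And>n. steps_within t (\<eta> n)"
    and d1: "(\<lambda>n. \<integral>\<^sup>+u\<in>?A. ennreal ((step_fun (\<eta> n) u - f u)\<^sup>2) \<partial>lborel) \<longlonglongrightarrow> 0"
    and d2: "(\<lambda>n. \<integral>\<^sup>+\<omega>. ennreal ((step_integral (B j) (\<eta> n) \<omega> - I' \<omega>)\<^sup>2) \<partial>M) \<longlonglongrightarrow> 0"
    unfolding has_wiener_integral_def steps_within_def by blast
  define S where "S n = step_integral (B j) (\<xi> n)" for n
  define S' where "S' n = step_integral (B j) (\<eta> n)" for n
  have SL: "S n \<in> L2 M" "S' n \<in> L2 M" for n unfolding S_def S'_def by (intro step_integral_L2[OF t] \<xi> \<eta>)+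
  have [measurable]: "S n \<in> borel_measurable M" "S' n \<in> borel_measurable M" for n using SL by (auto simp: L2_def)
  note [measurable] = Im Im'
  have fm' [measurable]: "(\<lambda>u. indicator ?A u * f u) \<in> borel_measurable borel"
    using fm by (simp add: set_borel_measurable_def)
  have gm: "(\<lambda>u. ennreal ((step_fun xs u - f u)\<^sup>2) * indicator ?A u) \<in> borel_measurable lborel" for xs
  proof -
    have "(\<lambda>u. ennreal ((step_fun xs u - f u)\<^sup>2) * indicator ?A u) =
        (\<lambda>u. ennreal ((step_fun xs u - indicator ?A u * f u)\<^sup>2) * indicator ?A u)"
      by (auto simp: indicator_def)
    also have "\<dots> \<in> borel_measurable lborel" by measurable
    finally show ?thesis .
  qed
  have mid: "(\<integral>\<^sup>+\<omega>. ennreal ((S n \<omega> - S' n \<omega>)\<^sup>2) \<partial>M) \<le>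
      2 * (\<integral>\<^sup>+u\<in>?A. ennreal ((step_fun (\<xi> n) u - f u)\<^sup>2) \<partial>lborel) + 2 * (\<integral>\<^sup>+u\<in>?A. ennreal ((step_fun (\<eta> n) u - f u)\<^sup>2) \<partial>lborel)" for n
  proof -
    let ?x = "step_fun (\<xi> n)" and ?y = "step_fun (\<eta> n)"
    have "ip M (\<lambda>\<omega>. S n \<omega> - S' n \<omega>) (\<lambda>\<omega>. S n \<omega> - S' n \<omega>) = ip M (S n) (S n) - ip M (S n) (S' n) - (ip M (S' n) (S n) - ip M (S' n) (S' n))"
      using SL by (simp add: ip_diff_left ip_diff_right L2_diff)
    also have "\<dots> = (\<integral>u. ?x u * ?x u \<partial>lborel) - (\<integral>u. ?x u * ?y u \<partial>lborel) - ((\<integral>u. ?y u * ?x u \<partial>lborel) - (\<integral>u. ?y u * ?y u \<partial>lborel))"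
      unfolding S_def S'_def using step_integral_isometry[OF t \<xi>[of n] \<xi>[of n]] step_integral_isometry[OF t \<xi>[of n] \<eta>[of n]]
        step_integral_isometry[OF t \<eta>[of n] \<xi>[of n]] step_integral_isometry[OF t \<eta>[of n] \<eta>[of n]] by simp
    also have "\<dots> = (\<integral>u. ?x u * ?x u - ?x u * ?y u - (?y u * ?x u - ?y u * ?y u) \<partial>lborel)"
      using step_integral_isometry[OF t \<xi>[of n] \<xi>[of n]] step_integral_isometry[OF t \<xi>[of n] \<eta>[of n]]
        step_integral_isometry[OF t \<eta>[of n] \<xi>[of n]] step_integral_isometry[OF t \<eta>[of n] \<eta>[of n]]
      by (simp add: mult.commute)
    also have "\<dots> = (\<integral>u. (?x u - ?y u)\<^sup>2 \<partial>lborel)"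
      by (intro Bochner_Integration.integral_cong refl) (simp add: power2_eq_square algebra_simps)
    finally have ipe: "ip M (\<lambda>\<omega>. S n \<omega> - S' n \<omega>) (\<lambda>\<omega>. S n \<omega> - S' n \<omega>) = (\<integral>u. (?x u - ?y u)\<^sup>2 \<partial>lborel)" .
    have "integrable lborel (\<lambda>u. ?x u * ?x u - ?x u * ?y u - (?y u * ?x u - ?y u * ?y u))"
      using step_integral_isometry[OF t \<xi>[of n] \<xi>[of n]] step_integral_isometry[OF t \<xi>[of n] \<eta>[of n]]
        step_integral_isometry[OF t \<eta>[of n] \<xi>[of n]] step_integral_isometry[OF t \<eta>[of n] \<eta>[of n]] by simp
    moreover have "(\<lambda>u. ?x u * ?x u - ?x u * ?y u - (?y u * ?x u - ?y u * ?y u)) = (\<lambda>u. (?x u - ?y u)\<^sup>2)"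
      by (simp add: fun_eq_iff power2_eq_square algebra_simps)
    ultimately have int: "integrable lborel (\<lambda>u. (?x u - ?y u)\<^sup>2)" by simp
    have "(\<integral>\<^sup>+\<omega>. ennreal ((S n \<omega> - S' n \<omega>)\<^sup>2) \<partial>M) = ennreal (\<integral>u. (?x u - ?y u)\<^sup>2 \<partial>lborel)"
      unfolding nn_integral_square[OF L2_diff[OF SL]] nrm_square ipe ..
    also have "\<dots> = (\<integral>\<^sup>+u. ennreal ((?x u - ?y u)\<^sup>2) \<partial>lborel)"
      using int by (intro nn_integral_eq_integral[symmetric]) auto
    also have "\<dots> \<le> (\<integral>\<^sup>+u. 2 * (ennreal ((?x u - f u)\<^sup>2) * indicator ?A u) + 2 * (ennreal ((?y u - f u)\<^sup>2) * indicator ?A u) \<partial>lborel)"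
    proof (rule nn_integral_mono)
      fix u :: real
      show "ennreal ((?x u - ?y u)\<^sup>2) \<le> 2 * (ennreal ((?x u - f u)\<^sup>2) * indicator ?A u) + 2 * (ennreal ((?y u - f u)\<^sup>2) * indicator ?A u)"
      proof (cases "u \<in> ?A")
        case True
        have "(?x u - ?y u)\<^sup>2 \<le> 2 * (?x u - f u)\<^sup>2 + 2 * (?y u - f u)\<^sup>2"
          using zero_le_power2[of "(?x u - f u) + (?y u - f u)"] by (simp add: power2_eq_square algebra_simps)
        then have "ennreal ((?x u - ?y u)\<^sup>2) \<le> ennreal (2 * (?x u - f u)\<^sup>2 + 2 * (?y u - f u)\<^sup>2)" by (rule ennreal_leI)
        also have "\<dots> = 2 * ennreal ((?x u - f u)\<^sup>2) + 2 * ennreal ((?y u - f u)\<^sup>2)" by (simp add: ennreal_mult)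
        finally show ?thesis using True by simp
      next
        case False
        then show ?thesis using step_fun_outside[OF \<xi>] step_fun_outside[OF \<eta>] by simp
      qed
    qed
    also have "\<dots> = 2 * (\<integral>\<^sup>+u\<in>?A. ennreal ((?x u - f u)\<^sup>2) \<partial>lborel) + 2 * (\<integral>\<^sup>+u\<in>?A. ennreal ((?y u - f u)\<^sup>2) \<partial>lborel)"
      using gm by (simp add: nn_integral_add nn_integral_cmult)
    finally show ?thesis .
  qed
  \<comment> \<open>The factors 3 and 2 come from splitting squares of sums of three and of two
    terms: I to S to S' to I', and inside the middle term the first step function to f to the
    second.\<close>
  define R where "R n = 3 * (\<integral>\<^sup>+\<omega>. ennreal ((S n \<omega> - I \<omega>)\<^sup>2) \<partial>M) +
    3 * (2 * (\<integral>\<^sup>+u\<in>?A. ennreal ((step_fun (\<xi> n) u - f u)\<^sup>2) \<partial>lborel) + 2 * (\<integral>\<^sup>+u\<in>?A. ennreal ((step_fun (\<eta> n) u - f u)\<^sup>2) \<partial>lborel)) +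
    3 * (\<integral>\<^sup>+\<omega>. ennreal ((S' n \<omega> - I' \<omega>)\<^sup>2) \<partial>M)" for n
  have "(\<integral>\<^sup>+\<omega>. ennreal ((I \<omega> - I' \<omega>)\<^sup>2) \<partial>M) \<le> R n" for n
  proof -
    have "(\<integral>\<^sup>+\<omega>. ennreal ((I \<omega> - I' \<omega>)\<^sup>2) \<partial>M) \<le>
        (\<integral>\<^sup>+\<omega>. 3 * ennreal ((S n \<omega> - I \<omega>)\<^sup>2) + 3 * ennreal ((S n \<omega> - S' n \<omega>)\<^sup>2) + 3 * ennreal ((S' n \<omega> - I' \<omega>)\<^sup>2) \<partial>M)"
    proof (rule nn_integral_mono)
      fix \<omega>
      have "(x - y)\<^sup>2 \<le> 3 * (s - x)\<^sup>2 + 3 * (s - s')\<^sup>2 + 3 * (s' - y)\<^sup>2" for x y s s' :: real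
      proof -
        have "(a + b + c)\<^sup>2 \<le> 3 * a\<^sup>2 + 3 * b\<^sup>2 + 3 * c\<^sup>2" for a b c :: real
          using zero_le_power2[of "a - b"] zero_le_power2[of "b - c"] zero_le_power2[of "a - c"]
          by (simp add: power2_eq_square algebra_simps)
        from this[of "x - s" "s - s'" "s' - y"] show ?thesis by (simp add: power2_commute[of x s])
      qed
      then have "ennreal ((I \<omega> - I' \<omega>)\<^sup>2) \<le> ennreal (3 * (S n \<omega> - I \<omega>)\<^sup>2 + 3 * (S n \<omega> - S' n \<omega>)\<^sup>2 + 3 * (S' n \<omega> - I' \<omega>)\<^sup>2)"
        by (intro ennreal_leI)
      then show "ennreal ((I \<omega> - I' \<omega>)\<^sup>2) \<le> 3 * ennreal ((S n \<omega> - I \<omega>)\<^sup>2) + 3 * ennreal ((S n \<omega> - S' n \<omega>)\<^sup>2) + 3 * ennreal ((S' n \<omega> - I' \<omega>)\<^sup>2)"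
        by (simp add: ennreal_mult)
    qed
    also have "\<dots> = 3 * (\<integral>\<^sup>+\<omega>. ennreal ((S n \<omega> - I \<omega>)\<^sup>2) \<partial>M) + 3 * (\<integral>\<^sup>+\<omega>. ennreal ((S n \<omega> - S' n \<omega>)\<^sup>2) \<partial>M)
        + 3 * (\<integral>\<^sup>+\<omega>. ennreal ((S' n \<omega> - I' \<omega>)\<^sup>2) \<partial>M)"
      by (simp add: nn_integral_add nn_integral_cmult)
    also have "\<dots> \<le> R n" unfolding R_def by (intro add_mono mult_left_mono mid order_refl) auto
    finally show ?thesis .
  qed
  moreover have "R \<longlonglongrightarrow> 3 * 0 + 3 * (2 * 0 + 2 * 0) + 3 * 0"
    unfolding R_def by (intro tendsto_add ennreal_tendsto_cmult c1 d1 c2[folded S_def] d2[folded S'_def]) auto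
  ultimately have "(\<integral>\<^sup>+\<omega>. ennreal ((I \<omega> - I' \<omega>)\<^sup>2) \<partial>M) \<le> 0"
    by (intro LIMSEQ_le_const[of R]) auto
  then have "AE \<omega> in M. ennreal ((I \<omega> - I' \<omega>)\<^sup>2) = 0"
    by (subst nn_integral_0_iff_AE[symmetric]) auto
  then show ?thesis by eventually_elim simp
qed

end

text \<open>The exceptional set depends on t; restricting to a countable dense set of times merges
  them into one null set, and continuity recovers the other times.\<close>

lemma AE_eq_of_continuous:
  fixes x y :: "real \<Rightarrow> 'w \<Rightarrow> 'a::real_normed_vector"
  assumes eq: "\<And>t. t \<in> {0..T} \<Longrightarrow> AE \<omega> in M. x t \<omega> = y t \<omega>"
    and x: "AE \<omega> in M. continuous_on {0..T} (\<lambda>t. x t \<omega>)" and y: "AE \<omega> in M. continuous_on {0..T} (\<lambda>t. y t \<omega>)"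
  shows "AE \<omega> in M. \<forall>t\<in>{0..T}. x t \<omega> = y t \<omega>"
proof -
  obtain D where D: "countable D" "D \<subseteq> {0..T}" "{0..T} \<subseteq> closure D" using separable[of "{0..T::real}"] by blast
  have "AE \<omega> in M. \<forall>t\<in>D. x t \<omega> = y t \<omega>" using D eq by (auto simp: AE_ball_countable)
  with x y show ?thesis
  proof eventually_elim
    case (elim \<omega>)
    have "closed {t \<in> {0..T}. x t \<omega> - y t \<omega> = 0}"
      using elim by (intro continuous_closed_preimage_constant continuous_intros) auto
    moreover have "D \<subseteq> {t \<in> {0..T}. x t \<omega> - y t \<omega> = 0}" using D elim by auto
    ultimately have "closure D \<subseteq> {t \<in> {0..T}. x t \<omega> - y t \<omega> = 0}" by (rule closure_minimal[rotated])
    then show ?case using D(3) by auto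
  qed
qed

section \<open>The kernel l and the equation of \<alpha>\<close>

definition lfun' :: "real \<Rightarrow> real \<Rightarrow> real \<Rightarrow> real" where
  "lfun' p q s = p * (2 * p * q * ((2 * q + p)\<^sup>2 * (2 * q * exp (2 * q * s))) / ((2 * q + p)\<^sup>2 * exp (2 * q * s) - p\<^sup>2)\<^sup>2)"

lemma lfun_denominator_pos:
  assumes "0 < q" "- q < p" "0 \<le> (s::real)"
  shows "0 < (2 * q + p)\<^sup>2 * exp (2 * q * s) - p\<^sup>2"
proof -
  have "0 < 4 * q * (q + p)" using assms by simp
  also have "\<dots> = (2 * q + p)\<^sup>2 * 1 - p\<^sup>2" by (simp add: power2_eq_square algebra_simps)
  also have "\<dots> \<le> (2 * q + p)\<^sup>2 * exp (2 * q * s) - p\<^sup>2"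
    using assms by (intro diff_right_mono mult_left_mono) auto
  finally show ?thesis .
qed

lemma lfun_deriv:
  assumes "0 < q" "- q < p" "0 \<le> s"
  shows "(lfun p q has_real_derivative lfun' p q s) (at s within S)"
  unfolding lfun_def[abs_def] lfun'_def
  using lfun_denominator_pos[OF assms]
  by (auto intro!: derivative_eq_intros simp: power2_eq_square)

lemma lfun'_cont: "0 < q \<Longrightarrow> - q < p \<Longrightarrow> continuous_on {0..T} (lfun' p q)"
  unfolding lfun'_def[abs_def]
  by (intro continuous_intros) (use lfun_denominator_pos[of q p] in force)

lemma lfun_cont: "0 < q \<Longrightarrow> - q < p \<Longrightarrow> continuous_on {0..T} (lfun p q)"
  unfolding continuous_on_eq_continuous_within using lfun_deriv DERIV_continuous by fastforce

context gauss_base begin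

text \<open>The kernel is exponential in t - s times l(s), so \<alpha> is of Ornstein-Uhlenbeck type
  and solves d\<alpha> = - (p + q) \<alpha> dt + l dB. The statement is this equation with the noise
  term integrated by parts, as \<open>semimart\<close> wants it.\<close>

lemma innovation_drift_equation:
  assumes pq: "0 < q" "- q < p"
    and W: "\<And>t. t \<in> {0..T} \<Longrightarrow> has_wiener_integral M (B j) {0<..t} (lker p q t) (\<alpha> t)"
    and c: "AE \<omega> in M. continuous_on {0..T} (\<lambda>t. \<alpha> t \<omega>)"
  shows "AE \<omega> in M. \<forall>t\<in>{0..T}. \<alpha> t \<omega> = lfun p q t * B j t \<omega> +
      integral {0..t} (\<lambda>s. - (p + q) * \<alpha> s \<omega> - lfun' p q s * B j s \<omega>)"
proof -
  define r where "r = p + q"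
  \<comment> \<open>The derivative of exp(r s) l(s), which is what remains of the kernel after
    factoring out exp(- r t); the boundary term of the integration by parts is then l(t)
    B(t).\<close>
  define w where "w s = exp (r * s) * (r * lfun p q s + lfun' p q s)" for s
  define m where "m t \<omega> = exp (- r * t) * integral {0..t} (\<lambda>s. w s * B j s \<omega>)" for t \<omega>
  have wc: "continuous_on {0..T} w"
    unfolding w_def by (intro continuous_intros lfun_cont lfun'_cont pq)
  have wBc: "continuous_on {0..T} (\<lambda>s. w s * B j s \<omega>)" if "\<omega> \<in> space M" for \<omega>
    by (intro continuous_intros wc B_cont that)
  have md: "((\<lambda>t. m t \<omega>) has_real_derivative - r * m t \<omega> + (r * lfun p q t + lfun' p q t) * B j t \<omega>) (at t within {0..T})"
    if w: "\<omega> \<in> space M" and t: "t \<in> {0..T}" for t \<omega>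
  proof -
    have "((\<lambda>t. integral {0..t} (\<lambda>s. w s * B j s \<omega>)) has_real_derivative w t * B j t \<omega>) (at t within {0..T})"
      unfolding has_real_derivative_iff_has_vector_derivative
      by (rule integral_has_vector_derivative[OF wBc[OF w] t])
    then have "((\<lambda>t. m t \<omega>) has_real_derivative
        (- r * exp (- r * t)) * integral {0..t} (\<lambda>s. w s * B j s \<omega>) + exp (- r * t) * (w t * B j t \<omega>)) (at t within {0..T})"
      unfolding m_def by (auto intro!: derivative_eq_intros)
    moreover have "exp (- r * t) * w t = r * lfun p q t + lfun' p q t"
      by (simp add: w_def flip: mult.assoc exp_add)
    ultimately show ?thesis by (simp add: m_def mult.assoc[symmetric])
  qed
  have mc: "continuous_on {0..T} (\<lambda>t. m t \<omega>)" if "\<omega> \<in> space M" for \<omega>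
    using md[OF that] by (meson DERIV_continuous continuous_on_eq_continuous_within)
  \<comment> \<open>For each t by uniqueness of the Wiener integral; continuity of both sides later
    makes it hold for all t at once.\<close>
  have "AE \<omega> in M. \<alpha> t \<omega> = lfun p q t * B j t \<omega> - m t \<omega>" if t: "t \<in> {0..T}" for t
  proof -
    define f' where "f' s = exp (- r * (t - s)) * (r * lfun p q s + lfun' p q s)" for s
    have kd: "(lker p q t has_real_derivative f' s) (at s within {0..T})" if "s \<in> {0..T}" for s
      unfolding lker_def[abs_def] f'_def r_def using that
      by (auto intro!: derivative_eq_intros lfun_deriv pq simp: algebra_simps)
    have f'c: "continuous_on {0..T} f'"
      unfolding f'_def by (intro continuous_intros lfun_cont lfun'_cont pq)
    have "has_wiener_integral M (B j) {0<..t} (lker p q t)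
        (\<lambda>\<omega>. lker p q t t * B j t \<omega> - integral {0..t} (\<lambda>s. f' s * B j s \<omega>))"
      by (rule has_wiener_integral_by_parts[OF l2proc_B B_zero kd f'c t])
    moreover have "lker p q t t = lfun p q t" by (simp add: lker_def)
    moreover have "integral {0..t} (\<lambda>s. f' s * B j s \<omega>) = m t \<omega>" for \<omega>
    proof -
      have "f' s * B j s \<omega> = exp (- r * t) * (w s * B j s \<omega>)" for s
        by (simp add: f'_def w_def algebra_simps flip: exp_add)
      then have "integral {0..t} (\<lambda>s. f' s * B j s \<omega>) = integral {0..t} (\<lambda>s. exp (- r * t) * (w s * B j s \<omega>))"
        by (intro integral_cong)
      also have "\<dots> = m t \<omega>" unfolding m_def by (rule integral_mult_right)
      finally show ?thesis .
    qed
    ultimately have "has_wiener_integral M (B j) {0<..t} (lker p q t) (\<lambda>\<omega>. lfun p q t * B j t \<omega> - m t \<omega>)" by simp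
    then show ?thesis using wiener_integral_unique[OF _ W[OF t]] t by simp
  qed
  moreover have "AE \<omega> in M. continuous_on {0..T} (\<lambda>t. lfun p q t * B j t \<omega> - m t \<omega>)"
    by (intro AE_I2 continuous_intros lfun_cont pq B_cont mc)
  ultimately have "AE \<omega> in M. \<forall>t\<in>{0..T}. \<alpha> t \<omega> = lfun p q t * B j t \<omega> - m t \<omega>"
    by (intro AE_eq_of_continuous c)
  with AE_space show ?thesis
  proof eventually_elim
    case (elim \<omega>)
    show ?case
    proof
      fix t assume t: "t \<in> {0..T}"
      have "((\<lambda>t. m t \<omega>) has_vector_derivative r * \<alpha> t \<omega> + lfun' p q t * B j t \<omega>) (at t within {0..T})"
        if t: "t \<in> {0..T}" for t
      proof -
        have a: "\<alpha> t \<omega> = lfun p q t * B j t \<omega> - m t \<omega>" using elim(2) t by blast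
        have "- r * m t \<omega> + (r * lfun p q t + lfun' p q t) * B j t \<omega> = r * \<alpha> t \<omega> + lfun' p q t * B j t \<omega>"
          unfolding a by (simp add: algebra_simps)
        with md[OF elim(1) t] show ?thesis
          by (simp add: has_real_derivative_iff_has_vector_derivative)
      qed
      from derivative_integral_equation[OF this t]
      have "m t \<omega> = integral {0..t} (\<lambda>s. r * \<alpha> s \<omega> + lfun' p q s * B j s \<omega>)" by (simp add: m_def)
      moreover have "integral {0..t} (\<lambda>s. - (p + q) * \<alpha> s \<omega> - lfun' p q s * B j s \<omega>) =
          - integral {0..t} (\<lambda>s. r * \<alpha> s \<omega> + lfun' p q s * B j s \<omega>)"
        unfolding integral_neg[symmetric] by (intro integral_cong) (simp add: r_def algebra_simps)
      ultimately show "\<alpha> t \<omega> = lfun p q t * B j t \<omega> + integral {0..t} (\<lambda>s. - (p + q) * \<alpha> s \<omega> - lfun' p q s * B j s \<omega>)"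
        using elim(2) t by simp
    qed
  qed
qed

end

section \<open>The filtering theorem\<close>

lemma LBINT_eq_integral:
  fixes g :: "real \<Rightarrow> 'a::euclidean_space"
  assumes "0 \<le> t" "continuous_on {0..t} g"
  shows "interval_lebesgue_integrable lborel 0 (ereal t) g" "(LBINT s=0..t. g s) = integral {0..t} g"
proof -
  have si: "set_integrable lborel {0..t} g"
    unfolding set_integrable_def by (rule borel_integrable_atLeastAtMost'[OF assms(2), unfolded set_integrable_def])
  then show "(LBINT s=0..t. g s) = integral {0..t} g"
    using interval_integral_eq_integral[of 0 t g] assms by (simp add: zero_ereal_def)
  have "set_integrable lborel (einterval 0 (ereal t)) g"
    by (rule set_integrable_subset[OF si]) (auto simp: einterval_def)
  then show "interval_lebesgue_integrable lborel 0 (ereal t) g"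
    using assms by (simp add: interval_lebesgue_integrable_def)
qed

lemma AE_obtain_set:
  assumes "AE \<omega> in M. P \<omega>"
  obtains \<Omega> where "\<Omega> \<in> sets M" "AE \<omega> in M. \<omega> \<in> \<Omega>" "\<And>\<omega>. \<omega> \<in> \<Omega> \<Longrightarrow> \<omega> \<in> space M \<and> P \<omega>"
proof -
  obtain N where N: "N \<in> null_sets M" "{\<omega> \<in> space M. \<not> P \<omega>} \<subseteq> N"
    using assms by (auto simp: eventually_ae_filter)
  show thesis
  proof (rule that[of "space M - N"])
    show "space M - N \<in> sets M" using N by auto
    show "AE \<omega> in M. \<omega> \<in> space M - N" using AE_not_in[OF N(1)] AE_space by eventually_elim simp
    show "\<omega> \<in> space M \<and> P \<omega>" if "\<omega> \<in> space M - N" for \<omega> using that N by auto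
  qed
qed

section \<open>Modifications of filtrations and independence of the initial value\<close>

context prob_space begin

text \<open>The augmented filtration contains all null sets, so it does not notice a change of Y(s)
  on a null set, even one that depends on s.\<close>

lemma sets_aug_filtration_mono:
  fixes Y Y' :: "real \<Rightarrow> 'a \<Rightarrow> real"
  assumes m: "\<And>s. s \<in> {0..t} \<Longrightarrow> Y s \<in> borel_measurable M" "\<And>s. s \<in> {0..t} \<Longrightarrow> Y' s \<in> borel_measurable M"
    and eq: "\<And>s. s \<in> {0..t} \<Longrightarrow> AE \<omega> in M. Y s \<omega> = Y' s \<omega>"
  shows "sets (aug_filtration M Y t) \<subseteq> sets (aug_filtration M Y' t)"
proof -
  let ?F = "aug_filtration M Y' t"
  have nul: "null_sets M \<subseteq> sets ?F" unfolding sets_aug_filtration by (auto intro: sigma_sets.Basic)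
  have "Y s -` E \<inter> space M \<in> sets ?F" if s: "s \<in> {0..t}" and E: "E \<in> sets borel" for s E
  proof -
    define N where "N = {\<omega> \<in> space M. Y s \<omega> \<noteq> Y' s \<omega>}"
    have NM: "N \<in> sets M" unfolding N_def using m[OF s] by measurable
    have N0: "N \<in> null_sets M"
      using eq[OF s] NM AE_iff_null[of M "\<lambda>\<omega>. Y s \<omega> = Y' s \<omega>"] unfolding N_def by simp
    have YE: "Y s -` E \<inter> space M \<in> sets M" using measurable_sets[OF m(1)[OF s] E] .
    have "(Y s -` E \<inter> space M) \<inter> N \<in> null_sets M" using N0 YE by (rule null_set_Int1)
    then have 1: "(Y s -` E \<inter> space M) \<inter> N \<in> sets ?F" using nul by blast
    have 2: "Y' s -` E \<inter> space M \<in> sets ?F"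
      using measurable_sets[OF aug_filtration_measurable[OF s, of Y'] E] by simp
    have "Y s -` E \<inter> space M = ((Y' s -` E \<inter> space M) - N) \<union> ((Y s -` E \<inter> space M) \<inter> N)"
      by (auto simp: N_def)
    moreover have "N \<in> sets ?F" using N0 nul by blast
    ultimately show ?thesis using 1 2 by (metis sets.Diff sets.Un)
  qed
  then have "{Y s -` E \<inter> space M | s E. s \<in> {0..t} \<and> E \<in> sets borel} \<union> null_sets M \<subseteq> sets ?F"
    using nul by auto
  then have "sigma_sets (space ?F) ({Y s -` E \<inter> space M | s E. s \<in> {0..t} \<and> E \<in> sets borel} \<union> null_sets M) \<subseteq> sets ?F"
    by (rule sets.sigma_sets_subset)
  then show ?thesis unfolding sets_aug_filtration[of Y] by simp
qed

lemma aug_filtration_cong: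
  fixes Y Y' :: "real \<Rightarrow> 'a \<Rightarrow> real"
  assumes "\<And>s. s \<in> {0..t} \<Longrightarrow> Y s \<in> borel_measurable M" "\<And>s. s \<in> {0..t} \<Longrightarrow> Y' s \<in> borel_measurable M"
    and eq: "\<And>s. s \<in> {0..t} \<Longrightarrow> AE \<omega> in M. Y s \<omega> = Y' s \<omega>"
  shows "aug_filtration M Y t = aug_filtration M Y' t"
proof (rule measure_eqI)
  have eq': "AE \<omega> in M. Y' s \<omega> = Y s \<omega>" if "s \<in> {0..t}" for s using eq[OF that] by eventually_elim simp
  show "sets (aug_filtration M Y t) = sets (aug_filtration M Y' t)"
    by (intro equalityI sets_aug_filtration_mono assms eq')
  show "emeasure (aug_filtration M Y t) A = emeasure (aug_filtration M Y' t) A" for A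
    by (simp add: aug_filtration_def emeasure_sigma)
qed

text \<open>X0 is assumed independent of V_1 and V_2, whereas the proof is driven by the
  innovations. These are measurable for the sigma-algebra N of the joint noise path and the null
  sets, because V_j and its innovation have the same augmented filtration; X0 is independent of
  N.\<close>

lemma indep_of_noise:
  fixes V W :: "bool \<Rightarrow> real \<Rightarrow> 'a \<Rightarrow> real" and X0 :: "'a \<Rightarrow> real"
  assumes Vm: "\<And>j t. t \<in> {0..T} \<Longrightarrow> V j t \<in> borel_measurable M" and T: "0 \<le> T"
    and W: "\<And>j. sets (aug_filtration M (W j) T) = sets (aug_filtration M (V j) T)"
    and X0: "X0 \<in> borel_measurable M"
    and indep: "indep_set (sets (vimage_algebra (space M) X0 borel))
          (sets (vimage_algebra (space M) (\<lambda>\<omega>. \<lambda>t\<in>{0..T}. (V True t \<omega>, V False t \<omega>))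
             (PiM {0..T} (\<lambda>_. borel \<Otimes>\<^sub>M borel))))"
  obtains N :: "'a measure" where "\<And>L :: 'a \<Rightarrow> real. L \<in> borel_measurable N \<Longrightarrow> indep_var borel X0 borel L"
    "\<And>j t. t \<in> {0..T} \<Longrightarrow> W j t \<in> borel_measurable N"
proof -
  let ?path = "\<lambda>\<omega>. \<lambda>t\<in>{0..T}. (V True t \<omega>, V False t \<omega>)"
  let ?P = "PiM {0..T} (\<lambda>_. borel \<Otimes>\<^sub>M borel) :: (real \<Rightarrow> real \<times> real) measure"
  define \<V> where "\<V> = vimage_algebra (space M) ?path ?P"
  have pm: "?path \<in> measurable M ?P" using Vm by (intro measurable_restrict measurable_Pair) auto
  then have psp: "?path \<in> space M \<rightarrow> space ?P" by (auto dest: measurable_space)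
  have spV: "space \<V> = space M" by (simp add: \<V>_def)
  have VM: "sets \<V> \<subseteq> sets M"
    unfolding \<V>_def sets_vimage_algebra2[OF psp] using pm by (auto intro: measurable_sets)
  have pV: "?path \<in> measurable \<V> ?P" unfolding \<V>_def by (rule measurable_vimage_algebra1[OF psp])
  have VV: "V j t \<in> borel_measurable \<V>" if t: "t \<in> {0..T}" for j t
  proof -
    have c: "(\<lambda>\<omega>. ?path \<omega> t) \<in> measurable \<V> (borel \<Otimes>\<^sub>M borel)"
      by (rule measurable_compose[OF pV measurable_component_singleton[OF t]])
    have "(\<lambda>\<omega>. fst (?path \<omega> t)) \<in> borel_measurable \<V>" "(\<lambda>\<omega>. snd (?path \<omega> t)) \<in> borel_measurable \<V>"
      by (rule measurable_compose[OF c measurable_fst] measurable_compose[OF c measurable_snd])+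
    then show ?thesis using t by (cases j) (simp_all add: eta_contract_eq)
  qed
  have sub: "sets \<V> \<union> null_sets M \<subseteq> Pow (space M)"
    by (auto dest!: subsetD[OF VM] null_setsD2 dest: sets.sets_into_space)
  define N where "N = sigma (space M) (sets \<V> \<union> null_sets M)"
  have spN: "space N = space M" and sN: "sets N = sigma_sets (space M) (sets \<V> \<union> null_sets M)"
    using sub by (simp_all add: N_def sets_measure_of space_measure_of_conv)
  show thesis
  proof (rule that[of N])
    fix L :: "'a \<Rightarrow> real" assume "L \<in> borel_measurable N"
    then show "indep_var borel X0 borel L"
      unfolding N_def using indep[folded \<V>_def] spV VM X0
      by (intro indep_set_mod_null[where \<A> = "sets (vimage_algebra (space M) X0 borel)" and V = \<V>])
        (auto intro: in_vimage_algebra)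
  next
    fix j t assume t: "t \<in> {0..T}"
    show "W j t \<in> borel_measurable N"
    proof (rule measurableI)
      fix E :: "real set" assume E: "E \<in> sets borel"
      have "W j t -` E \<inter> space M \<in> sets (aug_filtration M (V j) T)"
        using measurable_sets[OF aug_filtration_measurable[OF t, of "W j"] E] unfolding W[symmetric] by simp
      moreover have "sets (aug_filtration M (V j) T) \<subseteq> sets N"
        unfolding sets_aug_filtration sN
      proof (rule sigma_sets_mono'[OF Un_mono[OF _ order_refl]])
        show "{V j s -` E \<inter> space M | s E. s \<in> {0..T} \<and> E \<in> sets borel} \<subseteq> sets \<V>"
          using measurable_sets[OF VV] spV by auto
      qed
      ultimately show "W j t -` E \<inter> space N \<in> sets N" unfolding spN by blast
    qed simp
  qed
qed

lemma centered_gaussian_gaussian: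
  assumes "centered_gaussian M \<xi>" shows "gaussian M \<xi>"
proof -
  have m: "\<xi> \<in> borel_measurable M" using assms by (simp add: centered_gaussian_def)
  consider "AE \<omega> in M. \<xi> \<omega> = 0" | s where "0 < s" "distributed M lborel \<xi> (normal_density 0 s)"
    using assms unfolding centered_gaussian_def by blast
  then show ?thesis
  proof cases
    case 1
    have "AE \<omega> in M. 0 = \<xi> \<omega>" using 1 by eventually_elim simp
    then show ?thesis by (rule gaussian_cong_AE[OF gaussian_zero m])
  next
    case 2 then show ?thesis by (intro distributed_normal_gaussian)
  qed
qed

end

section \<open>The stochastic integral in the filter equation\<close>

context kalman_gain begin

text \<open>The integral of the gain against Y, integrated by parts; it will be the witness for J in
  \<open>solves_linear_sde\<close>.\<close>

definition mart :: "real \<Rightarrow> 'w \<Rightarrow> real^'n" where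
  "mart t \<omega> = Y t \<omega> *\<^sub>R gain t - integral {0..t} (\<lambda>s. Y s \<omega> *\<^sub>R gain' s)"

lemma filt_mart:
  assumes w: "\<omega> \<in> space M" and t: "t \<in> {0..T}"
  shows "filt t \<omega> = integral {0..t} (\<lambda>s. A s *v filt s \<omega>) + mart t \<omega>"
proof -
  have c: "continuous_on {0..t} (\<lambda>s. A s *v filt s \<omega>)" "continuous_on {0..t} (\<lambda>s. Y s \<omega> *\<^sub>R gain' s)"
    using t by (auto intro!: continuous_intros continuous_on_subset[OF A_cont] continuous_on_subset[OF vproc_cont[OF vproc_filt w]]
        continuous_on_subset[OF proc_cont[OF proc_Y w]] continuous_on_subset[OF gain'_cont])
  have "integral {0..t} (\<lambda>s. A s *v filt s \<omega> - Y s \<omega> *\<^sub>R gain' s) =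
      integral {0..t} (\<lambda>s. A s *v filt s \<omega>) - integral {0..t} (\<lambda>s. Y s \<omega> *\<^sub>R gain' s)"
    by (intro integral_diff integrable_continuous_real c)
  then show ?thesis by (subst filt_eq[OF w t]) (simp add: mart_def)
qed

lemma mart_wiener_integral:
  assumes t: "t \<in> {0..T}"
  shows "has_wiener_integral M Y {0<..t} (\<lambda>s. gain s $ i) (\<lambda>\<omega>. mart t \<omega> $ i)"
proof -
  have "has_wiener_integral M Y {0<..t} (\<lambda>s. gain s $ i)
      (\<lambda>\<omega>. gain t $ i * Y t \<omega> - integral {0..t} (\<lambda>s. gain' s $ i * Y s \<omega>))"
  proof (rule has_wiener_integral_by_parts[OF proc_l2proc[OF proc_Y] Y_0 _ _ t])
    show "((\<lambda>s. gain s $ i) has_real_derivative gain' t $ i) (at t within {0..T})" if "t \<in> {0..T}" for t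
      unfolding has_real_derivative_iff_has_vector_derivative by (intro has_vector_derivative_nth gain_deriv that)
    show "continuous_on {0..T} (\<lambda>s. gain' s $ i)" by (intro continuous_intros gain'_cont)
  qed
  moreover have "mart t \<omega> $ i = gain t $ i * Y t \<omega> - integral {0..t} (\<lambda>s. gain' s $ i * Y s \<omega>)" if w: "\<omega> \<in> space M" for \<omega>
  proof -
    have "continuous_on {0..t} (\<lambda>s. Y s \<omega> *\<^sub>R gain' s)"
      using t by (auto intro!: continuous_intros continuous_on_subset[OF proc_cont[OF proc_Y w]] continuous_on_subset[OF gain'_cont])
    then have "(\<lambda>s. Y s \<omega> *\<^sub>R gain' s) integrable_on {0..t}" by (rule integrable_continuous_real)
    from integral_component_eq_cart[OF this, of i] show ?thesis by (simp add: mart_def mult.commute)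
  qed
  ultimately show ?thesis unfolding has_wiener_integral_def
    by (auto cong: measurable_cong nn_integral_cong)
qed

end


theorem theorem3p4:
  fixes M :: "'w measure"
    and T \<theta> \<sigma> \<mu> p1 q1 p2 q2 r1 r2 :: real
    and W1 W2 V1 V2 B1 B2 \<alpha>1 \<alpha>2 X Y :: "real \<Rightarrow> 'w \<Rightarrow> real"
    and X0 :: "'w \<Rightarrow> real"
    and Z :: "real \<Rightarrow> 'w \<Rightarrow> real ^ 3"
    and P D G H :: "real \<Rightarrow> real ^ 3 ^ 3"
    and F aaT :: "real ^ 3 ^ 3"
    and a :: "real ^ 3"
  assumes prob: "prob_space M"
    and T: "0 < T"
    and \<mu>: "\<mu> \<noteq> 0"
    and pq1: "0 < q1" "- q1 < p1"
    and pq2: "0 < q2" "- q2 < p2"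
    and W1: "brownian_motion_on M UNIV W1"
    and W2: "brownian_motion_on M UNIV W2"
    and indep_W: "prob_space.indep_var M
          (PiM UNIV (\<lambda>_. borel)) (\<lambda>\<omega> t. W1 t \<omega>) (PiM UNIV (\<lambda>_. borel)) (\<lambda>\<omega> t. W2 t \<omega>)"
    and V1: "noise_process M p1 q1 W1 V1"
    and V2: "noise_process M p2 q2 W2 V2"
    and B1: "innovation_process M T p1 q1 V1 B1 \<alpha>1"
    and B2: "innovation_process M T p2 q2 V2 B2 \<alpha>2"
    and indep_B: "prob_space.indep_var M
          (PiM {0..T} (\<lambda>_. borel)) (\<lambda>\<omega>. \<lambda>t\<in>{0..T}. B1 t \<omega>)
          (PiM {0..T} (\<lambda>_. borel)) (\<lambda>\<omega>. \<lambda>t\<in>{0..T}. B2 t \<omega>)"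
    and X0: "centered_gaussian M X0"
    and indep_X0: "prob_space.indep_set M
          (sets (vimage_algebra (space M) X0 borel))
          (sets (vimage_algebra (space M) (\<lambda>\<omega>. \<lambda>t\<in>{0..T}. (V1 t \<omega>, V2 t \<omega>))
             (PiM {0..T} (\<lambda>_. borel \<Otimes>\<^sub>M borel))))"
    and X_meas: "\<And>t. t \<in> {0..T} \<Longrightarrow> X t \<in> borel_measurable M"
    and Y_meas: "\<And>t. t \<in> {0..T} \<Longrightarrow> Y t \<in> borel_measurable M"
    and X_cont: "AE \<omega> in M. continuous_on {0..T} (\<lambda>t. X t \<omega>)"
    and X_eq: "AE \<omega> in M. \<forall>t\<in>{0..T}.
          X t \<omega> = X0 \<omega> + (LBINT s=0..t. \<theta> * X s \<omega>) + \<sigma> * (V1 t \<omega> - V1 0 \<omega>)"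
    and Y_eq: "AE \<omega> in M. \<forall>t\<in>{0..T}.
          Y t \<omega> = (LBINT s=0..t. \<mu> * X s \<omega>) + (V2 t \<omega> - V2 0 \<omega>)"
    and Z: "Z = (\<lambda>t \<omega>. vector [X t \<omega>, \<alpha>1 t \<omega>, \<alpha>2 t \<omega>])"
    and P: "P = error_matrix M Y Z"
    and r: "r1 = p1 + q1" "r2 = p2 + q2"
    and F: "F = vector [vector [- \<theta>, \<sigma>, 0], vector [0, r1, 0], vector [0, 0, r2]]"
    and D: "D = (\<lambda>t. vector [vector [0, 0, 0], vector [0, 0, 0],
                             vector [inverse \<mu> * lfun p2 q2 t, 0, 0]])"
    and a: "a = vector [\<mu>, 0, - 1]"
    and aaT: "aaT = (columnvector a :: real ^ 1 ^ 3) ** (rowvector a :: real ^ 3 ^ 1)"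
    and G: "G = (\<lambda>t. vector [vector [\<sigma>\<^sup>2, \<sigma> * lfun p1 q1 t, 0],
                             vector [\<sigma> * lfun p1 q1 t, (lfun p1 q1 t)\<^sup>2, 0],
                             vector [0, 0, 0]])"
    and H: "H = (\<lambda>t. vector [vector [- \<theta>, \<sigma>, 0], vector [0, r1, 0],
                             vector [\<mu> * lfun p2 q2 t, 0, r2 - lfun p2 q2 t]])"
  shows "(\<exists>Zh. filter_process M T Y Z Zh) \<and>
    (\<forall>Zh. filter_process M T Y Z Zh \<longrightarrow>
       solves_linear_sde M T (\<lambda>t. - (F + (P t + D t) ** aaT)) (\<lambda>t. (P t + D t) *v a) Y Zh \<and>
       (AE \<omega> in M. Zh 0 \<omega> = vector [(\<integral>\<omega>. X0 \<omega> \<partial>M), 0, 0])) \<and>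
    (\<forall>t\<in>{0..T}. (P has_vector_derivative
        (G t - H t ** P t - P t ** transpose (H t) - P t ** aaT ** P t)) (at t within {0..T})) \<and>
    (\<forall>i j. P 0 $ i $ j = (if i = 1 \<and> j = 1 then (\<integral>\<omega>. (X0 \<omega>)\<^sup>2 \<partial>M) else 0))"
proof -
  interpret prob_space M by (rule prob)
  define W :: "bool \<Rightarrow> real \<Rightarrow> 'w \<Rightarrow> real" where "W j = (if j then B1 else B2)" for j
  define V :: "bool \<Rightarrow> real \<Rightarrow> 'w \<Rightarrow> real" where "V j = (if j then V1 else V2)" for j
  have BM: "brownian_motion_on M {0..T} (W j)" for j
    using B1 B2 by (cases j) (simp_all add: W_def innovation_process_def)
  have Vm: "V j t \<in> borel_measurable M" for j t
    using V1 V2 by (cases j) (simp_all add: V_def noise_process_def)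
  have WV: "sets (aug_filtration M (W j) T) = sets (aug_filtration M (V j) T)" for j
    using B1 B2 T by (cases j) (simp_all add: W_def V_def innovation_process_def)
  have X0G: "gaussian M X0" by (rule centered_gaussian_gaussian[OF X0])
  have X0m: "X0 \<in> borel_measurable M" using X0 by (simp add: centered_gaussian_def)
  obtain N :: "'w measure" where X0_indep: "\<And>L :: 'w \<Rightarrow> real. L \<in> borel_measurable N \<Longrightarrow> indep_var borel X0 borel L"
    and WN: "\<And>j t. t \<in> {0..T} \<Longrightarrow> W j t \<in> borel_measurable N"
    using indep_of_noise[of T V W X0] Vm WV X0m indep_X0 T by (auto simp: V_def)
  have indep_W': "indep_var (PiM {0..T} (\<lambda>_. borel)) (\<lambda>\<omega>. \<lambda>t\<in>{0..T}. W True t \<omega>)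
          (PiM {0..T} (\<lambda>_. borel)) (\<lambda>\<omega>. \<lambda>t\<in>{0..T}. W False t \<omega>)"
    using indep_B by (simp add: W_def)
  note base = gauss_base_of_brownian[OF T BM indep_W' X0G X0_indep WN]
  have W_ae: "AE \<omega> in M. \<forall>j. continuous_on {0..T} (\<lambda>t. W j t \<omega>) \<and> W j 0 \<omega> = 0"
  proof -
    have "AE \<omega> in M. continuous_on {0..T} (\<lambda>t. W j t \<omega>)" "AE \<omega> in M. W j 0 \<omega> = 0" for j
      using BM[of j] by (simp_all add: brownian_motion_on_def)
    then have "AE \<omega> in M. continuous_on {0..T} (\<lambda>t. W j t \<omega>) \<and> W j 0 \<omega> = 0" for j by simp
    from this[of True] this[of False] show ?thesis by eventually_elim (metis (full_types))
  qed
  have alpha_eq: "AE \<omega> in M. \<forall>t\<in>{0..T}. \<alpha> t \<omega> = lfun p q t * W j t \<omega> +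
      integral {0..t} (\<lambda>s. - (p + q) * \<alpha> s \<omega> - lfun' p q s * W j s \<omega>)"
    if pq: "0 < q" "- q < p" and inn: "innovation_process M T p q U (W j) \<alpha>" for p q U \<alpha> j
  proof -
    \<comment> \<open>A provisional good set. The equation of \<alpha> is proved inside the locale,
      but the final good set is to include that equation; so the locale is first used with a set on
      which only the innovations are well behaved.\<close>
    obtain \<Omega> where \<Omega>: "\<Omega> \<in> sets M" "AE \<omega> in M. \<omega> \<in> \<Omega>"
      "\<And>\<omega>. \<omega> \<in> \<Omega> \<Longrightarrow> \<omega> \<in> space M \<and> (\<forall>j. continuous_on {0..T} (\<lambda>t. W j t \<omega>) \<and> W j 0 \<omega> = 0)"
      using AE_obtain_set[OF W_ae] by blast
    interpret G0: gauss_base M T "\<lambda>\<omega>. if \<omega> \<in> \<Omega> then X0 \<omega> else 0" "\<lambda>j t \<omega>. if \<omega> \<in> \<Omega> then W j t \<omega> else 0"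
      using \<Omega> by (intro base) auto
    have "AE \<omega> in M. \<forall>t\<in>{0..T}. \<alpha> t \<omega> = lfun p q t * (if \<omega> \<in> \<Omega> then W j t \<omega> else 0) +
      integral {0..t} (\<lambda>s. - (p + q) * \<alpha> s \<omega> - lfun' p q s * (if \<omega> \<in> \<Omega> then W j s \<omega> else 0))"
    proof (rule G0.innovation_drift_equation[OF pq])
      fix t assume t: "t \<in> {0..T}"
      have "has_wiener_integral M (W j) {0<..t} (lker p q t) (\<alpha> t)"
        using inn t by (simp add: innovation_process_def)
      then show "has_wiener_integral M (\<lambda>t \<omega>. if \<omega> \<in> \<Omega> then W j t \<omega> else 0) {0<..t} (lker p q t) (\<alpha> t)"
      proof (rule has_wiener_integral_cong_AE)
        show "AE \<omega> in M. W j s \<omega> = (if \<omega> \<in> \<Omega> then W j s \<omega> else 0)" for s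
          using \<Omega>(2) by eventually_elim simp
      qed simp
    qed (use inn in \<open>simp add: innovation_process_def\<close>)
    with \<Omega>(2) show ?thesis by eventually_elim simp
  qed
  have a1: "AE \<omega> in M. \<forall>t\<in>{0..T}. \<alpha>1 t \<omega> = lfun p1 q1 t * B1 t \<omega> +
      integral {0..t} (\<lambda>s. - r1 * \<alpha>1 s \<omega> - lfun' p1 q1 s * B1 s \<omega>)"
    using alpha_eq[of q1 p1 V1 True \<alpha>1] pq1 B1 by (simp add: W_def r)
  have a2: "AE \<omega> in M. \<forall>t\<in>{0..T}. \<alpha>2 t \<omega> = lfun p2 q2 t * B2 t \<omega> +
      integral {0..t} (\<lambda>s. - r2 * \<alpha>2 s \<omega> - lfun' p2 q2 s * B2 s \<omega>)"
    using alpha_eq[of q2 p2 V2 False \<alpha>2] pq2 B2 by (simp add: W_def r)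
  have c1: "AE \<omega> in M. continuous_on {0..T} (\<lambda>t. \<alpha>1 t \<omega>)"
    and V1eq: "AE \<omega> in M. \<forall>t\<in>{0..T}. V1 t \<omega> = B1 t \<omega> - (LBINT s=0..t. \<alpha>1 s \<omega>)"
    using B1 by (simp_all add: innovation_process_def)
  have c2: "AE \<omega> in M. continuous_on {0..T} (\<lambda>t. \<alpha>2 t \<omega>)"
    and V2eq: "AE \<omega> in M. \<forall>t\<in>{0..T}. V2 t \<omega> = B2 t \<omega> - (LBINT s=0..t. \<alpha>2 s \<omega>)"
    using B2 by (simp_all add: innovation_process_def)
  \<comment> \<open>All path identities used below, with each V_j expressed by its innovation and
    with the interval integrals, over continuous integrands, turned into
    \<open>integral\<close>.\<close>
  define good where "good \<omega> \<longleftrightarrow>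
      continuous_on {0..T} (\<lambda>t. B1 t \<omega>) \<and> continuous_on {0..T} (\<lambda>t. B2 t \<omega>) \<and> B1 0 \<omega> = 0 \<and> B2 0 \<omega> = 0 \<and>
      continuous_on {0..T} (\<lambda>t. X t \<omega>) \<and> continuous_on {0..T} (\<lambda>t. \<alpha>1 t \<omega>) \<and> continuous_on {0..T} (\<lambda>t. \<alpha>2 t \<omega>) \<and>
      (\<forall>t\<in>{0..T}. X t \<omega> = X0 \<omega> + integral {0..t} (\<lambda>s. \<theta> * X s \<omega>) + \<sigma> * (B1 t \<omega> - integral {0..t} (\<lambda>s. \<alpha>1 s \<omega>))) \<and>
      (\<forall>t\<in>{0..T}. \<alpha>1 t \<omega> = lfun p1 q1 t * B1 t \<omega> + integral {0..t} (\<lambda>s. - r1 * \<alpha>1 s \<omega> - lfun' p1 q1 s * B1 s \<omega>)) \<and>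
      (\<forall>t\<in>{0..T}. \<alpha>2 t \<omega> = lfun p2 q2 t * B2 t \<omega> + integral {0..t} (\<lambda>s. - r2 * \<alpha>2 s \<omega> - lfun' p2 q2 s * B2 s \<omega>)) \<and>
      (\<forall>t\<in>{0..T}. Y t \<omega> = integral {0..t} (\<lambda>s. \<mu> * X s \<omega>) + (B2 t \<omega> - integral {0..t} (\<lambda>s. \<alpha>2 s \<omega>)))" for \<omega>
  have "AE \<omega> in M. good \<omega>"
    using W_ae a1 a2 c1 c2 V1eq V2eq X_cont X_eq Y_eq
  proof eventually_elim
    case (elim \<omega>)
    have z: "B1 0 \<omega> = 0" "B2 0 \<omega> = 0" "continuous_on {0..T} (\<lambda>t. B1 t \<omega>)" "continuous_on {0..T} (\<lambda>t. B2 t \<omega>)"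
      using elim(1)[THEN spec, of True] elim(1)[THEN spec, of False] by (simp_all add: W_def)
    have cs: "continuous_on {0..t} (\<lambda>t. X t \<omega>)" "continuous_on {0..t} (\<lambda>t. \<alpha>1 t \<omega>)" "continuous_on {0..t} (\<lambda>t. \<alpha>2 t \<omega>)"
      if "t \<in> {0..T}" for t
      using that by (auto intro: continuous_on_subset[OF elim(8)] continuous_on_subset[OF elim(4)] continuous_on_subset[OF elim(5)])
    have L: "(LBINT s=0..t. g s) = integral {0..t} g" if "t \<in> {0..T}" "continuous_on {0..t} g" for t and g :: "real \<Rightarrow> real"
      using LBINT_eq_integral(2)[of t g] that by simp
    have v1: "V1 t \<omega> - V1 0 \<omega> = B1 t \<omega> - integral {0..t} (\<lambda>s. \<alpha>1 s \<omega>)" if t: "t \<in> {0..T}" for t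
    proof -
      have "0 \<in> {0..T}" using T by simp
      then have "V1 0 \<omega> = B1 0 \<omega> - integral {0..0} (\<lambda>s. \<alpha>1 s \<omega>)" using elim(6) L[OF _ cs(2), of 0] by simp
      then show ?thesis using elim(6) t L[OF t cs(2)[OF t]] z by simp
    qed
    have v2: "V2 t \<omega> - V2 0 \<omega> = B2 t \<omega> - integral {0..t} (\<lambda>s. \<alpha>2 s \<omega>)" if t: "t \<in> {0..T}" for t
    proof -
      have "0 \<in> {0..T}" using T by simp
      then have "V2 0 \<omega> = B2 0 \<omega> - integral {0..0} (\<lambda>s. \<alpha>2 s \<omega>)" using elim(7) L[OF _ cs(3), of 0] by simp
      then show ?thesis using elim(7) t L[OF t cs(3)[OF t]] z by simp
    qed
    have "X t \<omega> = X0 \<omega> + integral {0..t} (\<lambda>s. \<theta> * X s \<omega>) + \<sigma> * (B1 t \<omega> - integral {0..t} (\<lambda>s. \<alpha>1 s \<omega>))"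
      if t: "t \<in> {0..T}" for t
    proof -
      have "X t \<omega> = X0 \<omega> + (LBINT s=0..t. \<theta> * X s \<omega>) + \<sigma> * (V1 t \<omega> - V1 0 \<omega>)" using elim(9) t by blast
      then show ?thesis unfolding v1[OF t] by (subst (asm) L[OF t]) (intro continuous_intros cs t)
    qed
    moreover have "Y t \<omega> = integral {0..t} (\<lambda>s. \<mu> * X s \<omega>) + (B2 t \<omega> - integral {0..t} (\<lambda>s. \<alpha>2 s \<omega>))"
      if t: "t \<in> {0..T}" for t
    proof -
      have "Y t \<omega> = (LBINT s=0..t. \<mu> * X s \<omega>) + (V2 t \<omega> - V2 0 \<omega>)" using elim(10) t by blast
      then show ?thesis unfolding v2[OF t] by (subst (asm) L[OF t]) (intro continuous_intros cs t)
    qed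
    ultimately show ?case unfolding good_def using z elim(2-5,8) by blast
  qed
  from AE_obtain_set[OF this] obtain \<Omega> where \<Omega>: "\<Omega> \<in> sets M" "AE \<omega> in M. \<omega> \<in> \<Omega>"
    and good: "\<And>\<omega>. \<omega> \<in> \<Omega> \<Longrightarrow> \<omega> \<in> space M \<and> good \<omega>" by blast
  define X0h where "X0h = (\<lambda>\<omega>. if \<omega> \<in> \<Omega> then X0 \<omega> else 0)"
  define Bh where "Bh = (\<lambda>j t \<omega>. if \<omega> \<in> \<Omega> then W j t \<omega> else 0)"
  \<comment> \<open>Off the good set everything is 0, which still satisfies the linear equations, so
    these versions obey them at every sample point.\<close>
  define Zs where "Zs = (\<lambda>t \<omega>. if \<omega> \<in> \<Omega> then Z t \<omega> else 0)"
  define Ys where "Ys = (\<lambda>t \<omega>. if \<omega> \<in> \<Omega> then Y t \<omega> else 0)"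
  \<comment> \<open>Inserting dV_1 = dB_1 - \<alpha>1 dt into the equation of X gives drift \<theta>
    X - \<sigma> \<alpha>1 and noise \<sigma> dB_1; each \<alpha> has noise coefficient l_j. So the
    first motion enters X and \<alpha>1, the second only \<alpha>2.\<close>
  define b :: "bool \<Rightarrow> real \<Rightarrow> real^3" where
    "b j t = (if j then vector [\<sigma>, lfun p1 q1 t, 0] else vector [0, 0, lfun p2 q2 t])" for j t
  define b' :: "bool \<Rightarrow> real \<Rightarrow> real^3" where
    "b' j t = (if j then vector [0, lfun' p1 q1 t, 0] else vector [0, 0, lfun' p2 q2 t])" for j t
  define e0 :: "real^3" where "e0 = vector [1, 0, 0]"
  have gb: "gauss_base M T X0h Bh"
    unfolding X0h_def Bh_def
  proof (rule base)
    fix j \<omega> assume "\<omega> \<in> \<Omega>"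
    from good[OF this] show "continuous_on {0..T} (\<lambda>t. W j t \<omega>)" "W j 0 \<omega> = 0"
      by (cases j; simp add: W_def good_def)+
  qed (use \<Omega> in auto)
  interpret G: gauss_base M T X0h Bh by (rule gb)
  have b'c: "continuous_on {0..T} (b' j)" for j
  proof (rule continuous_on_vecI)
    fix i :: 3
    have "\<forall>i. continuous_on {0..T} (\<lambda>t. b' j t $ i)"
      unfolding forall_3 b'_def by (cases j) (auto simp: vector_3 intro!: continuous_intros lfun'_cont pq1 pq2)
    then show "continuous_on {0..T} (\<lambda>t. b' j t $ i)" by blast
  qed
  have bd: "(b j has_vector_derivative b' j t) (at t within {0..T})" if t: "t \<in> {0..T}" for j t
  proof (rule has_vector_derivative_vecI)
    fix i :: 3
    have "\<forall>i. ((\<lambda>t. b j t $ i) has_vector_derivative b' j t $ i) (at t within {0..T})"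
      unfolding forall_3 b_def b'_def using t
      by (cases j) (auto simp: vector_3 simp flip: has_real_derivative_iff_has_vector_derivative intro!: lfun_deriv pq1 pq2)
    then show "((\<lambda>t. b j t $ i) has_vector_derivative b' j t $ i) (at t within {0..T})" by blast
  qed
  have Zcont: "continuous_on {0..T} (\<lambda>t. Zs t \<omega>)" for \<omega>
  proof (cases "\<omega> \<in> \<Omega>")
    case True
    then have g: "good \<omega>" using good by blast
    have "\<forall>i. continuous_on {0..T} (\<lambda>t. Z t \<omega> $ i)"
      unfolding forall_3 Z using g by (simp add: vector_3 good_def)
    then show ?thesis using True by (intro continuous_on_vecI) (simp add: Zs_def)
  qed (simp add: Zs_def)
  have Zeq: "Zs t \<omega> = X0h \<omega> *\<^sub>R e0 + (\<Sum>j\<in>UNIV. Bh j t \<omega> *\<^sub>R b j t)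
        + integral {0..t} (\<lambda>s. - (F *v Zs s \<omega>) - (\<Sum>j\<in>UNIV. Bh j s \<omega> *\<^sub>R b' j s))"
    if w: "\<omega> \<in> space M" and t: "t \<in> {0..T}" for \<omega> t
  proof (cases "\<omega> \<in> \<Omega>")
    case True
    then have g: "good \<omega>" using good by blast
    let ?g = "\<lambda>s. - (F *v Zs s \<omega>) - (\<Sum>j\<in>UNIV. Bh j s \<omega> *\<^sub>R b' j s)"
    have sub: "{0..t} \<subseteq> {0..T}" using t by auto
    have "continuous_on {0..T} ?g" by (intro continuous_intros Zcont G.B_cont w b'c)
    then have "?g integrable_on {0..t}" by (intro integrable_continuous_real) (rule continuous_on_subset[OF _ sub])
    then have comp: "integral {0..t} ?g $ i = integral {0..t} (\<lambda>s. ?g s $ i)" for i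
      by (rule integral_component_eq_cart[symmetric])
    have cs: "(\<lambda>s. X s \<omega>) integrable_on {0..t}" "(\<lambda>s. \<alpha>1 s \<omega>) integrable_on {0..t}"
      using g unfolding good_def by (auto intro!: integrable_continuous_real intro: continuous_on_subset[OF _ sub])
    have Zc: "Zs s \<omega> = vector [X s \<omega>, \<alpha>1 s \<omega>, \<alpha>2 s \<omega>]" for s using True by (simp add: Zs_def Z)
    have Bc: "Bh True s \<omega> = B1 s \<omega>" "Bh False s \<omega> = B2 s \<omega>" for s using True by (simp_all add: Bh_def W_def)
    have "Zs t \<omega> $ 1 = (X0h \<omega> *\<^sub>R e0 + (\<Sum>j\<in>UNIV. Bh j t \<omega> *\<^sub>R b j t) + integral {0..t} ?g) $ 1"
    proof -
      have "?g s $ 1 = \<theta> * X s \<omega> - \<sigma> * \<alpha>1 s \<omega>" for s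
        by (simp add: Zc F b'_def UNIV_bool matrix_vector_mult_def sum_3 vector_3)
      then have "integral {0..t} ?g $ 1 = integral {0..t} (\<lambda>s. \<theta> * X s \<omega>) - integral {0..t} (\<lambda>s. \<sigma> * \<alpha>1 s \<omega>)"
        unfolding comp using cs by (simp add: integral_diff integrable_on_mult_right)
      also have "integral {0..t} (\<lambda>s. \<sigma> * \<alpha>1 s \<omega>) = \<sigma> * integral {0..t} (\<lambda>s. \<alpha>1 s \<omega>)" by (rule integral_mult_right)
      moreover have "X t \<omega> = X0 \<omega> + integral {0..t} (\<lambda>s. \<theta> * X s \<omega>) + \<sigma> * (B1 t \<omega> - integral {0..t} (\<lambda>s. \<alpha>1 s \<omega>))"
        using g t unfolding good_def by blast
      ultimately show ?thesis
        using True by (simp add: Zc Bc X0h_def e0_def b_def UNIV_bool vector_3 algebra_simps)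
    qed
    moreover have "Zs t \<omega> $ 2 = (X0h \<omega> *\<^sub>R e0 + (\<Sum>j\<in>UNIV. Bh j t \<omega> *\<^sub>R b j t) + integral {0..t} ?g) $ 2"
    proof -
      have "?g s $ 2 = - r1 * \<alpha>1 s \<omega> - lfun' p1 q1 s * B1 s \<omega>" for s
        by (simp add: Zc Bc F b'_def UNIV_bool matrix_vector_mult_def sum_3 vector_3)
      then have "integral {0..t} ?g $ 2 = integral {0..t} (\<lambda>s. - r1 * \<alpha>1 s \<omega> - lfun' p1 q1 s * B1 s \<omega>)"
        unfolding comp by simp
      moreover have "\<alpha>1 t \<omega> = lfun p1 q1 t * B1 t \<omega> + integral {0..t} (\<lambda>s. - r1 * \<alpha>1 s \<omega> - lfun' p1 q1 s * B1 s \<omega>)"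
        using g t unfolding good_def by blast
      ultimately show ?thesis by (simp add: Zc Bc e0_def b_def UNIV_bool vector_3)
    qed
    moreover have "Zs t \<omega> $ 3 = (X0h \<omega> *\<^sub>R e0 + (\<Sum>j\<in>UNIV. Bh j t \<omega> *\<^sub>R b j t) + integral {0..t} ?g) $ 3"
    proof -
      have "?g s $ 3 = - r2 * \<alpha>2 s \<omega> - lfun' p2 q2 s * B2 s \<omega>" for s
        by (simp add: Zc Bc F b'_def UNIV_bool matrix_vector_mult_def sum_3 vector_3)
      then have "integral {0..t} ?g $ 3 = integral {0..t} (\<lambda>s. - r2 * \<alpha>2 s \<omega> - lfun' p2 q2 s * B2 s \<omega>)"
        unfolding comp by simp
      moreover have "\<alpha>2 t \<omega> = lfun p2 q2 t * B2 t \<omega> + integral {0..t} (\<lambda>s. - r2 * \<alpha>2 s \<omega> - lfun' p2 q2 s * B2 s \<omega>)"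
        using g t unfolding good_def by blast
      ultimately show ?thesis by (simp add: Zc Bc e0_def b_def UNIV_bool vector_3)
    qed
    ultimately show ?thesis unfolding vec_eq_iff forall_3 by blast
  qed (simp add: Zs_def X0h_def Bh_def)
  \<comment> \<open>In the same way dV_2 = dB_2 - \<alpha>2 dt explains the vector a = (\<mu>, 0,
    -1).\<close>
  have Yeq: "Ys t \<omega> = Bh False t \<omega> + integral {0..t} (\<lambda>s. a \<bullet> Zs s \<omega>)"
    if w: "\<omega> \<in> space M" and t: "t \<in> {0..T}" for \<omega> t
  proof (cases "\<omega> \<in> \<Omega>")
    case True
    then have g: "good \<omega>" using good by blast
    have sub: "{0..t} \<subseteq> {0..T}" using t by auto
    have cs: "(\<lambda>s. X s \<omega>) integrable_on {0..t}" "(\<lambda>s. \<alpha>2 s \<omega>) integrable_on {0..t}"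
      using g unfolding good_def by (auto intro!: integrable_continuous_real intro: continuous_on_subset[OF _ sub])
    have "a \<bullet> Zs s \<omega> = \<mu> * X s \<omega> - \<alpha>2 s \<omega>" for s
      using True by (simp add: Zs_def Z a inner_vec_def sum_3 vector_3)
    then have "integral {0..t} (\<lambda>s. a \<bullet> Zs s \<omega>) = integral {0..t} (\<lambda>s. \<mu> * X s \<omega>) - integral {0..t} (\<lambda>s. \<alpha>2 s \<omega>)"
      using cs by (simp add: integral_diff integrable_on_mult_right)
    moreover have "Y t \<omega> = integral {0..t} (\<lambda>s. \<mu> * X s \<omega>) + (B2 t \<omega> - integral {0..t} (\<lambda>s. \<alpha>2 s \<omega>))"
      using g t unfolding good_def by blast
    ultimately show ?thesis using True by (simp add: Ys_def Bh_def W_def)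
  qed (simp add: Ys_def Zs_def Bh_def)
  interpret K: kalman M T X0h Bh Zs Ys F a e0 b b'
    by (intro kalman.intro gb kalman_axioms.intro Zcont Zeq Yeq bd b'c)
  obtain Q where Q0: "Q 0 = ip M X0h X0h *\<^sub>R outer e0 e0"
    and Qs: "\<And>t. t \<in> {0..T} \<Longrightarrow> transpose (Q t) = Q t"
    and Qd: "\<And>t. t \<in> {0..T} \<Longrightarrow> (Q has_vector_derivative K.riccati_rhs t (Q t)) (at t within {0..T})"
    using K.riccati_solution by blast
  have Qc: "continuous_on {0..T} Q"
    using Qd by (meson continuous_on_eq_continuous_within has_vector_derivative_continuous)
  have "continuous_on {0..T} (\<lambda>t. - (F + outer (Q t *v a + b False t) a))"
    by (intro continuous_intros Qc K.b_cont)
  from fundamental_solution[OF less_imp_le[OF T] this] obtain \<Phi> \<Psi> :: "real \<Rightarrow> real^3^3" where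
    \<Phi>: "\<And>t. t \<in> {0..T} \<Longrightarrow> (\<Phi> has_vector_derivative - (F + outer (Q t *v a + b False t) a) ** \<Phi> t) (at t within {0..T})" and
    \<Psi>: "\<And>t. t \<in> {0..T} \<Longrightarrow> (\<Psi> has_vector_derivative - (\<Psi> t ** - (F + outer (Q t *v a + b False t) a))) (at t within {0..T})" and
    inv: "\<And>t. t \<in> {0..T} \<Longrightarrow> \<Phi> t ** \<Psi> t = mat 1" by metis
  have \<Psi>c: "continuous_on {0..T} \<Psi>"
    using \<Psi> by (meson continuous_on_eq_continuous_within has_vector_derivative_continuous)
  interpret KG: kalman_gain M T X0h Bh Zs Ys F a e0 b b' Q \<Phi> \<Psi>
    by (intro kalman_gain.intro K.kalman_axioms kalman_gain_axioms.intro Q0 Qs Qd \<Phi> \<Psi>c inv)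
  have Zae: "AE \<omega> in M. Z t \<omega> = Zs t \<omega>" and Yae: "AE \<omega> in M. Ys t \<omega> = Y t \<omega>" for t
    using \<Omega>(2) by (eventually_elim, simp add: Zs_def Ys_def)+
  have Zm: "(\<lambda>\<omega>. Z t \<omega> $ i) \<in> borel_measurable M" if t: "t \<in> {0..T}" for t i
  proof -
    have "\<alpha>1 t \<in> borel_measurable M" "\<alpha>2 t \<in> borel_measurable M"
      using B1 B2 t by (simp_all add: innovation_process_def has_wiener_integral_def)
    then have "\<forall>i. (\<lambda>\<omega>. Z t \<omega> $ i) \<in> borel_measurable M"
      unfolding forall_3 Z using X_meas[OF t] by (simp add: vector_3)
    then show ?thesis by blast
  qed
  have ZsL: "(\<lambda>\<omega>. Zs t \<omega> $ i) \<in> L2 M" and eL: "(\<lambda>\<omega>. KG.err t \<omega> $ i) \<in> L2 M" if "t \<in> {0..T}" for t i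
    using G.proc_L2[OF G.vproc_nth[OF K.vproc_Z]] G.proc_L2[OF G.vproc_nth[OF KG.vproc_err]] that by auto
  \<comment> \<open>Conditioning in the statement is on Y, in the locale on \<open>Ys\<close>;
    augmentation makes the two filtrations equal.\<close>
  have aug: "aug_filtration M Y t = aug_filtration M Ys t" if "t \<in> {0..T}" for t
  proof (rule aug_filtration_cong)
    fix s assume "s \<in> {0..t}"
    then have s: "s \<in> {0..T}" using that by auto
    show "Y s \<in> borel_measurable M" by (rule Y_meas[OF s])
    show "Ys s \<in> borel_measurable M" by (rule KG.Y_measurable[OF s])
    show "AE \<omega> in M. Y s \<omega> = Ys s \<omega>" using Yae[of s] by eventually_elim simp
  qed
  have cond_exp: "AE \<omega> in M. cond_exp_vec M (aug_filtration M Y t) (Z t) \<omega> = KG.filt t \<omega>" if t: "t \<in> {0..T}" for t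
  proof -
    interpret S: finite_measure_subalgebra M "aug_filtration M Ys t"
      by unfold_locales (rule subalgebra_aug_filtration, use t in \<open>auto intro: KG.Y_measurable\<close>)
    have ci: "AE \<omega> in M. cond_exp_vec M (aug_filtration M Y t) (Z t) \<omega> $ i = KG.filt t \<omega> $ i" for i
    proof -
      have "AE \<omega> in M. Z t \<omega> $ i = Zs t \<omega> $ i" using Zae[of t] by eventually_elim simp
      moreover have "(\<lambda>\<omega>. Zs t \<omega> $ i) \<in> borel_measurable M" using ZsL[OF t] by (simp add: L2_def)
      ultimately have "AE \<omega> in M. real_cond_exp M (aug_filtration M Ys t) (\<lambda>\<omega>. Z t \<omega> $ i) \<omega> =
          real_cond_exp M (aug_filtration M Ys t) (\<lambda>\<omega>. Zs t \<omega> $ i) \<omega>"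
        using Zm[OF t] by (intro S.real_cond_exp_cong)
      with KG.filt_cond_exp[OF t, of i] show ?thesis
        unfolding cond_exp_vec_def vec_lambda_beta aug[OF t] by eventually_elim simp
    qed
    from ci[of 1] ci[of 2] ci[of 3] show ?thesis by eventually_elim (simp add: vec_eq_iff forall_3)
  qed
  have PQ: "P t = Q t" if t: "t \<in> {0..T}" for t
  proof -
    \<comment> \<open>The error matrix is E[Z_i e_j], while \<open>cross_covariance\<close> gives
      E[e_i Z_j]; the symmetry of Q settles the difference.\<close>
    have "P t $ i $ j = Q t $ i $ j" for i j
    proof -
      have cm: "(\<lambda>\<omega>. cond_exp_vec M (aug_filtration M Y t) (Z t) \<omega> $ j) \<in> borel_measurable M"
        unfolding cond_exp_vec_def vec_lambda_beta by (rule borel_measurable_cond_exp2)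
      have "P t $ i $ j = (\<integral>\<omega>. Zs t \<omega> $ i * KG.err t \<omega> $ j \<partial>M)"
        unfolding P error_matrix_def vec_lambda_beta
      proof (rule integral_cong_AE)
        show "(\<lambda>\<omega>. Z t \<omega> $ i * (Z t \<omega> $ j - cond_exp_vec M (aug_filtration M Y t) (Z t) \<omega> $ j)) \<in> borel_measurable M"
          by (intro borel_measurable_times borel_measurable_diff Zm t cm)
        show "(\<lambda>\<omega>. Zs t \<omega> $ i * KG.err t \<omega> $ j) \<in> borel_measurable M"
          using L2_mult_integrable[OF ZsL[OF t] eL[OF t]] by blast
        show "AE \<omega> in M. Z t \<omega> $ i * (Z t \<omega> $ j - cond_exp_vec M (aug_filtration M Y t) (Z t) \<omega> $ j) =
            Zs t \<omega> $ i * KG.err t \<omega> $ j"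
          using Zae[of t] cond_exp[OF t] by eventually_elim (simp add: KG.err_def)
      qed
      also have "\<dots> = ip M (\<lambda>\<omega>. KG.err t \<omega> $ j) (\<lambda>\<omega>. Zs t \<omega> $ i)" by (simp add: ip_def mult.commute)
      also have "\<dots> = transpose (Q t) $ i $ j" by (simp add: KG.cross_covariance[OF t] transpose_def)
      finally show ?thesis by (simp add: Qs[OF t])
    qed
    then show ?thesis by (simp add: vec_eq_iff)
  qed
  have aa: "aaT = outer a a"
    unfolding aaT by (simp add: vec_eq_iff matrix_matrix_mult_def columnvector_def rowvector_def)
  \<comment> \<open>The role of D: its entry l_2 / \<mu> meets the component \<mu> of a, so D a is
    the coefficient \<open>b False\<close> and P + D applied to a gives the gain.\<close>
  have gain: "(P t + D t) *v a = KG.gain t" if t: "t \<in> {0..T}" for t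
  proof -
    have "D t *v a = b False t"
      using \<mu> by (simp add: D a b_def vec_eq_iff forall_3 matrix_vector_mult_def sum_3 vector_3)
    then show ?thesis by (simp add: matrix_vector_mult_add_rdistrib PQ[OF t] KG.gain_def)
  qed
  have drift: "- (F + (P t + D t) ** aaT) = KG.A t" if t: "t \<in> {0..T}" for t
    by (simp add: aa matrix_outer gain[OF t] KG.A_def)
  have E0: "expectation X0 = 0" using X0G by (simp add: gaussian_def)
  have "filter_process M T Y Z KG.filt"
    unfolding filter_process_def
  proof (intro conjI ballI)
    fix t assume t: "t \<in> {0..T}"
    show "KG.filt t \<in> borel_measurable (aug_filtration M Y t)" unfolding aug[OF t] by (rule KG.filt_measurable[OF t])
    show "AE \<omega> in M. KG.filt t \<omega> = cond_exp_vec M (aug_filtration M Y t) (Z t) \<omega>"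
      using cond_exp[OF t] by eventually_elim simp
  next
    show "AE \<omega> in M. continuous_on {0..T} (\<lambda>t. KG.filt t \<omega>)"
      by (intro AE_I2 G.vproc_cont[OF KG.vproc_filt])
  qed
  moreover have "solves_linear_sde M T (\<lambda>t. - (F + (P t + D t) ** aaT)) (\<lambda>t. (P t + D t) *v a) Y Zh \<and>
       (AE \<omega> in M. Zh 0 \<omega> = vector [expectation X0, 0, 0])" if Zh: "filter_process M T Y Z Zh" for Zh
  proof -
    have Zhc: "AE \<omega> in M. continuous_on {0..T} (\<lambda>t. Zh t \<omega>)" using Zh by (simp add: filter_process_def)
    \<comment> \<open>A filter process is prescribed only almost surely at each time; continuity
      makes any of them indistinguishable from the explicit filter.\<close>
    have Zh_filt: "AE \<omega> in M. \<forall>t\<in>{0..T}. Zh t \<omega> = KG.filt t \<omega>"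
    proof (rule AE_eq_of_continuous[OF _ Zhc])
      fix t assume t: "t \<in> {0..T}"
      have "AE \<omega> in M. Zh t \<omega> = cond_exp_vec M (aug_filtration M Y t) (Z t) \<omega>"
        using Zh t by (simp add: filter_process_def)
      with cond_exp[OF t] show "AE \<omega> in M. Zh t \<omega> = KG.filt t \<omega>" by eventually_elim simp
    qed (intro AE_I2 G.vproc_cont[OF KG.vproc_filt])
    have T0: "0 \<in> {0..T}" using T by simp
    \<comment> \<open>The explicit filter starts at 0, which is the stated value because X0 is
      centered.\<close>
    have "AE \<omega> in M. Zh 0 \<omega> = vector [expectation X0, 0, 0]"
      using Zh_filt AE_space
    proof eventually_elim
      case (elim \<omega>)
      then show ?case
        using bspec[OF elim(1) T0] KG.filt_0 by (simp add: E0 vec_eq_iff forall_3 vector_3)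
    qed
    moreover have "solves_linear_sde M T (\<lambda>t. - (F + (P t + D t) ** aaT)) (\<lambda>t. (P t + D t) *v a) Y Zh"
      unfolding solves_linear_sde_def
    \<comment> \<open>\<open>KG.mart\<close> integrates the gain against \<open>Ys\<close>; the
      integrator is exchanged for Y by almost sure equality at each time, the integrand for the
      stated coefficient by equality on (0,t].\<close>
    proof (intro conjI exI[of _ KG.mart] ballI allI Zhc)
      fix t i assume t: "t \<in> {0..T}"
      show "has_wiener_integral M Y {0<..t} (\<lambda>s. ((P s + D s) *v a) $ i) (\<lambda>\<omega>. KG.mart t \<omega> $ i)"
      proof (rule has_wiener_integral_cong_AE[OF KG.mart_wiener_integral[OF t] Yae])
        fix u assume "u \<in> {0<..t}"
        then show "KG.gain u $ i = ((P u + D u) *v a) $ i" using t by (subst gain) auto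
      qed
    next
      show "AE \<omega> in M. \<forall>t\<in>{0..T}.
             interval_lebesgue_integrable lborel 0 t (\<lambda>s. - (F + (P s + D s) ** aaT) *v Zh s \<omega>) \<and>
             Zh t \<omega> = Zh 0 \<omega> + (LBINT s=0..t. - (F + (P s + D s) ** aaT) *v Zh s \<omega>) + KG.mart t \<omega>"
        using Zh_filt AE_space
      proof eventually_elim
        case (elim \<omega>)
        show ?case
        proof
          fix t assume t: "t \<in> {0..T}"
          let ?g = "\<lambda>s. - (F + (P s + D s) ** aaT) *v Zh s \<omega>"
          have g: "?g s = KG.A s *v KG.filt s \<omega>" if "s \<in> {0..t}" for s
          proof -
            have s: "s \<in> {0..T}" using that t by auto
            show ?thesis unfolding drift[OF s] using elim(1) s by simp
          qed
          have "continuous_on {0..T} (\<lambda>s. KG.A s *v KG.filt s \<omega>)"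
            by (intro continuous_intros KG.A_cont G.vproc_cont[OF KG.vproc_filt] elim(2))
          then have "continuous_on {0..t} (\<lambda>s. KG.A s *v KG.filt s \<omega>)"
            by (rule continuous_on_subset) (use t in auto)
          then have gc: "continuous_on {0..t} ?g" using g by (subst continuous_on_cong[OF refl g]) auto
          have t0: "0 \<le> t" using t by simp
          have "(LBINT s=0..t. ?g s) = integral {0..t} (\<lambda>s. KG.A s *v KG.filt s \<omega>)"
            unfolding LBINT_eq_integral(2)[OF t0 gc] by (rule integral_cong[OF g])
          then show "interval_lebesgue_integrable lborel 0 t ?g \<and> Zh t \<omega> = Zh 0 \<omega> + (LBINT s=0..t. ?g s) + KG.mart t \<omega>"
            using LBINT_eq_integral(1)[OF t0 gc] KG.filt_mart[OF elim(2) t] bspec[OF elim(1) t] bspec[OF elim(1) T0]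
              KG.filt_0[OF elim(2)] by simp
        qed
      qed
    qed
    ultimately show ?thesis by blast
  qed
  moreover have "(P has_vector_derivative
        (G t - H t ** P t - P t ** transpose (H t) - P t ** aaT ** P t)) (at t within {0..T})" if t: "t \<in> {0..T}" for t
  proof -
    have "K.Gm t = G t"
      unfolding K.Gm_def by (simp add: G b_def vec_eq_iff forall_3 vector_3 power2_eq_square mult.commute)
    moreover have "K.Hm t = H t"
      unfolding K.Hm_def by (simp add: H F a b_def vec_eq_iff forall_3 vector_3 mult.commute)
    ultimately have "K.riccati_rhs t (Q t) = G t - H t ** P t - P t ** transpose (H t) - P t ** aaT ** P t"
      by (simp add: K.riccati_rhs_def PQ[OF t] aa)
    with has_vector_derivative_transform[OF t PQ Qd[OF t]] show ?thesis by simp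
  qed
  moreover have "P 0 $ i $ j = (if i = 1 \<and> j = 1 then (\<integral>\<omega>. (X0 \<omega>)\<^sup>2 \<partial>M) else 0)" for i j
  proof -
    have e0: "e0 $ i = (if i = 1 then 1 else 0)" for i
      using exhaust_3[of i] by (auto simp: e0_def vector_3)
    have "AE \<omega> in M. X0h \<omega> = X0 \<omega>" using \<Omega>(2) by eventually_elim (simp add: X0h_def)
    then have "ip M X0h X0h = ip M X0 X0"
      using G.X0_L2 X0m by (intro ip_cong_AE) (auto simp: L2_def)
    then show ?thesis
      using PQ[of 0] T by (simp add: Q0 e0 ip_def power2_eq_square)
  qed
  ultimately show ?thesis by blast
qed

end
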